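(* Let $n\ge 1$, and let $p,a,b$ be real numbers with $\frac12\le p\le 2$, $a\ge 0$, $b\ge 0$ and $a+b\ge 1$. Let $K$ and $L$ be two smooth uniformly h-convex bounded domains in $\mathbb{H}^{n+1}$, where each of $K$ and $L$ is allowed to degenerate to a single point, with horospherical support functions $u_K,u_L:\mathbb{S}^n\to\mathbb{R}$. Then there exists a unique h-convex bounded domain (possibly degenerate, i.e. a single point) whose horospherical support function is $$u(z)=\frac1p\log\left(a e^{p u_K(z)}+b e^{p u_L(z)}\right),\qquad z\in\mathbb{S}^n .$$ Consequently, the hyperbolic $p$-sum $a\cdot K+_p b\cdot L$, defined as the h-convex bounded domain with this horospherical support function, is well-defined. Let $\Omega=a\cdot K+_p b\cdot L$ and put $\varphi(z)=e^{u(z)}=\left(a e^{pu_K(z)}+b e^{pu_L(z)}\right)^{1/p}$. Then for every $X\in\partial\Omega$ there exists $z_X\in\mathbb{S}^n$ such that $$X=\frac12\varphi\,(-z_X,1)+\frac12\left(\frac{|D\varphi|^2}{\varphi}+\frac1\varphi\right)(z_X,1)-(D\varphi,0),$$ where $\varphi$ and $D\varphi$ are evaluated at $z_X$. Moreover, except in the following special cases: 1. $\frac12\le p\le 2$, $a=1$, $b=0$ and $K$ is a point; 2. $\frac12\le p\le 2$, $a=0$, $b=1$ and $L$ is a point; 3. $p\in\{\frac12,2\}$, $a>0$, $b>0$, $a+b=1$, and both $K$ and $L$ are points, $\Omega$ is a smooth, non-degenerate, uniformly h-convex bounded domain.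
   Context: Minkowski space $\mathbb{R}^{n+1,1}$ is $\mathbb{R}^{n+2}$ with $\langle X,Y\rangle=\sum_{i=0}^n x_iy_i-x_{n+1}y_{n+1}$; write $X=(x,x_{n+1})$ with $x\in\mathbb{R}^{n+1}$. Hyperbolic space is $\mathbb{H}^{n+1}=\{X\in\mathbb{R}^{n+1,1}:\langle X,X\rangle=-1,\ x_{n+1}>0\}$, and $\mathbb{S}^n\subset\mathbb{R}^{n+1}$ is the unit sphere with its standard metric and Levi-Civita connection $D$; the gradient $D\varphi(z)\in T_z\mathbb{S}^n$ is regarded as a vector of $\mathbb{R}^{n+1}$. For $z\in\mathbb{S}^n$, $s\in\mathbb{R}$ the closed horo-ball is $\overline{B}_z(s)=\{X\in\mathbb{H}^{n+1}:\log(-\langle X,(z,1)\rangle)\le s\}$. An h-convex (horospherically convex) bounded domain is a nonempty bounded set that is an intersection of closed horo-balls; a single point is regarded as a degenerate h-convex bounded domain. A smooth bounded domain (compact, connected, nonempty interior, smooth boundary) is uniformly h-convex if for some $\delta>0$ all principal curvatures of its boundary (with respect to the outward unit normal, geodesic spheres having positive curvatures) are greater than $1+\delta$. The horospherical support function of $\Omega$ is $u_\Omega(z)=\sup_{X\in\Omega}\log(-\langle X,(z,1)\rangle)$, $z\in\mathbb{S}^n$.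
   Formalization: The final claim (smooth, non-degenerate, uniformly h-convex) also excludes the case a>0, b>0, a+b=1 with K and L the same single point: there u=u_K, so Ω is that point and the claim as listed fails for 1/2<p<2. *)

theory Defs
  imports "HOL-Analysis.Analysis"
begin

section \<open>Minkowski space and hyperbolic space\<close>

text \<open>
  The finite index type \<open>'m\<close> plays the role of \<open>{0, ..., n}\<close>; thus \<open>n = CARD('m) - 1\<close>.
  A vector is \<open>X = (x, x\<^sub>n\<^sub>+\<^sub>1)\<close> with \<open>x = fst X\<close> and \<open>x\<^sub>n\<^sub>+\<^sub>1 = snd X\<close>.
\<close>

type_synonym 'm minkowski = "(real ^ 'm) \<times> real"

definition mink :: "'m::finite minkowski \<Rightarrow> 'm minkowski \<Rightarrow> real" where
  "mink X Y = (\<Sum>i\<in>UNIV. fst X $ i * fst Y $ i) - snd X * snd Y"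

definition hyp_space :: "'m::finite minkowski set" where
  "hyp_space = {X. mink X X = -1 \<and> snd X > 0}"

text \<open>The geodesic distance of the hyperboloid model.\<close>

definition hyp_dist :: "'m::finite minkowski \<Rightarrow> 'm minkowski \<Rightarrow> real" where
  "hyp_dist X Y = arcosh (- mink X Y)"

definition hyp_bounded :: "'m::finite minkowski set \<Rightarrow> bool" where
  "hyp_bounded S \<longleftrightarrow> (\<exists>C. \<forall>X\<in>S. \<forall>Y\<in>S. hyp_dist X Y \<le> C)"

text \<open>Interior and boundary are relative to hyperbolic space, not to the ambient space.\<close>

definition hyp_interior :: "'m::finite minkowski set \<Rightarrow> 'm minkowski set" where
  "hyp_interior S = top_of_set hyp_space interior_of S"

definition hyp_boundary :: "'m::finite minkowski set \<Rightarrow> 'm minkowski set" where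
  "hyp_boundary S = top_of_set hyp_space frontier_of S"

definition is_point :: "'m::finite minkowski set \<Rightarrow> bool" where
  "is_point S \<longleftrightarrow> (\<exists>X\<in>hyp_space. S = {X})"


section \<open>Horo-balls, h-convexity and the horospherical support function\<close>

definition horoball :: "real ^ 'm::finite \<Rightarrow> real \<Rightarrow> 'm minkowski set" where
  "horoball z s = {X \<in> hyp_space. ln (- mink X (z, 1)) \<le> s}"

text \<open>
  The intersection over the empty family is the whole (unbounded) hyperbolic space, hence it
  does not produce an h-convex bounded domain. Single points are included.
\<close>

definition hconvex_bounded_domain :: "'m::finite minkowski set \<Rightarrow> bool" where
  "hconvex_bounded_domain \<Omega> \<longleftrightarrow>
     \<Omega> \<noteq> {} \<and> hyp_bounded \<Omega> \<and>
     (\<exists>F \<subseteq> sphere 0 1 \<times> UNIV. \<Omega> = hyp_space \<inter> (\<Inter>(z, s)\<in>F. horoball z s))"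

definition horo_support :: "'m::finite minkowski set \<Rightarrow> real ^ 'm \<Rightarrow> real" where
  "horo_support \<Omega> z = (SUP X\<in>\<Omega>. ln (- mink X (z, 1)))"


section \<open>Smooth bounded domains\<close>

text \<open>\<open>C\<^sup>k\<close> and \<open>C\<^sup>\<infinity>\<close> on an open set, through iterated directional derivatives.\<close>

primrec Ck_on :: "nat \<Rightarrow> 'a::euclidean_space set \<Rightarrow> ('a \<Rightarrow> real) \<Rightarrow> bool" where
  "Ck_on 0 U f \<longleftrightarrow> continuous_on U f"
| "Ck_on (Suc k) U f \<longleftrightarrow>
     (\<forall>x\<in>U. f differentiable (at x)) \<and>
     (\<forall>v. Ck_on k U (\<lambda>x. frechet_derivative f (at x) v))"

definition smooth_on :: "'a::euclidean_space set \<Rightarrow> ('a \<Rightarrow> real) \<Rightarrow> bool" where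
  "smooth_on U f \<longleftrightarrow> (\<forall>k. Ck_on k U f)"

text \<open>
  Near each boundary point the set is a sublevel set, inside hyperbolic space, of a smooth
  function whose differential does not vanish on the tangent space
  \<open>{v. mink v X = 0}\<close> of hyperbolic space at that point.
\<close>

definition smooth_boundary :: "'m::finite minkowski set \<Rightarrow> bool" where
  "smooth_boundary \<Omega> \<longleftrightarrow>
     (\<forall>X\<in>hyp_boundary \<Omega>. \<exists>U f. open U \<and> X \<in> U \<and> smooth_on U f \<and>
        \<Omega> \<inter> U = {Y \<in> hyp_space \<inter> U. f Y \<le> 0} \<and> f X = 0 \<and>
        (\<exists>v. mink v X = 0 \<and> frechet_derivative f (at X) v \<noteq> 0))"

definition smooth_bounded_domain :: "'m::finite minkowski set \<Rightarrow> bool" where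
  "smooth_bounded_domain \<Omega> \<longleftrightarrow>
     \<Omega> \<subseteq> hyp_space \<and> compact \<Omega> \<and> connected \<Omega> \<and> hyp_interior \<Omega> \<noteq> {} \<and> smooth_boundary \<Omega>"


section \<open>Principal curvatures and uniform h-convexity\<close>

definition tangent_space :: "'m::finite minkowski set \<Rightarrow> 'm minkowski \<Rightarrow> 'm minkowski set" where
  "tangent_space M X =
     {v. \<exists>\<gamma> \<epsilon>. \<epsilon> > 0 \<and> \<gamma> 0 = X \<and> (\<forall>t. \<bar>t\<bar> < \<epsilon> \<longrightarrow> \<gamma> t \<in> M) \<and>
             (\<gamma> has_vector_derivative v) (at (0::real))}"

text \<open>
  The last conjunct makes the normal outward: \<open>cosh t *\<^sub>R X + sinh t *\<^sub>R N\<close> is the unit speed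
  geodesic of hyperbolic space starting at \<open>X\<close> with velocity \<open>N\<close>.
\<close>

definition is_outward_normal ::
    "'m::finite minkowski set \<Rightarrow> 'm minkowski \<Rightarrow> 'm minkowski \<Rightarrow> bool" where
  "is_outward_normal \<Omega> X N \<longleftrightarrow>
     mink N X = 0 \<and> mink N N = 1 \<and>
     (\<forall>v\<in>tangent_space (hyp_boundary \<Omega>) X. mink N v = 0) \<and>
     (\<exists>\<epsilon>>0. \<forall>t. 0 < t \<and> t < \<epsilon> \<longrightarrow> cosh t *\<^sub>R X + sinh t *\<^sub>R N \<notin> \<Omega>)"

definition outward_normal :: "'m::finite minkowski set \<Rightarrow> 'm minkowski \<Rightarrow> 'm minkowski" where
  "outward_normal \<Omega> X = (THE N. is_outward_normal \<Omega> X N)"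

text \<open>
  The principal curvatures are the eigenvalues of the shape operator \<open>v \<mapsto> \<nabla>\<^sub>v N\<close> on the
  tangent space of the boundary. The hyperbolic covariant derivative \<open>\<nabla>\<^sub>v N\<close> is the ambient
  derivative of \<open>N\<close> along \<open>v\<close> minus the multiple \<open>mink v N\<close> of \<open>X\<close>; as \<open>mink v N = 0\<close>, it is the
  ambient derivative itself. The derivative \<open>A\<close> within the boundary is determined on tangent
  vectors only, which is all that is used. Geodesic spheres of radius \<open>r\<close> have principal
  curvatures \<open>cosh r / sinh r > 0\<close>.
\<close>

definition principal_curvature :: "'m::finite minkowski set \<Rightarrow> 'm minkowski \<Rightarrow> real \<Rightarrow> bool" where
  "principal_curvature \<Omega> X \<kappa> \<longleftrightarrow>
     (\<exists>A v. (outward_normal \<Omega> has_derivative A) (at X within hyp_boundary \<Omega>) \<and>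
            v \<in> tangent_space (hyp_boundary \<Omega>) X \<and> v \<noteq> 0 \<and> A v = \<kappa> *\<^sub>R v)"

definition smooth_uniformly_hconvex :: "'m::finite minkowski set \<Rightarrow> bool" where
  "smooth_uniformly_hconvex \<Omega> \<longleftrightarrow>
     smooth_bounded_domain \<Omega> \<and>
     (\<exists>\<delta>>0. \<forall>X\<in>hyp_boundary \<Omega>. \<forall>\<kappa>. principal_curvature \<Omega> X \<kappa> \<longrightarrow> \<kappa> > 1 + \<delta>)"


section \<open>The gradient on the sphere and the hyperbolic p-sum\<close>

text \<open>
  \<open>has_sphere_gradient \<phi> g z\<close>: the function \<open>\<phi>\<close>, restricted to the unit sphere, is
  differentiable at \<open>z\<close> with gradient \<open>g\<close>, a tangent vector of the sphere regarded as a
  vector of the ambient Euclidean space.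
\<close>

definition has_sphere_gradient :: "(real ^ 'm::finite \<Rightarrow> real) \<Rightarrow> real ^ 'm \<Rightarrow> real ^ 'm \<Rightarrow> bool" where
  "has_sphere_gradient \<phi> g z \<longleftrightarrow>
     g \<bullet> z = 0 \<and> (\<phi> has_derivative (\<lambda>h. g \<bullet> h)) (at z within sphere 0 1)"

definition psum_support ::
    "real \<Rightarrow> real \<Rightarrow> 'm::finite minkowski set \<Rightarrow> real \<Rightarrow> 'm minkowski set \<Rightarrow> real ^ 'm \<Rightarrow> real" where
  "psum_support p a K b L z =
     (1 / p) * ln (a * exp (p * horo_support K z) + b * exp (p * horo_support L z))"

text \<open>
  \<open>hyp_psum p a K b L\<close> is \<open>a \<cdot> K +\<^sub>p b \<cdot> L\<close>; it is only meaningful when such a domain exists and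
  is unique.
\<close>

definition hyp_psum ::
    "real \<Rightarrow> real \<Rightarrow> 'm::finite minkowski set \<Rightarrow> real \<Rightarrow> 'm minkowski set \<Rightarrow> 'm minkowski set" where
  "hyp_psum p a K b L =
     (THE \<Omega>. hconvex_bounded_domain \<Omega> \<and>
             (\<forall>z\<in>sphere 0 1. horo_support \<Omega> z = psum_support p a K b L z))"

end

theory Submission
  imports Defs
begin

text \<open>
  Write \<open>horo X z = - mink X (z, 1)\<close>, so that \<open>exp (horo_support \<Omega> z)\<close> is the maximum of \<open>horo X z\<close>
  over \<open>X \<in> \<Omega>\<close>. A positive function \<open>\<phi>\<close> on the sphere is of this form iff every \<open>z0\<close> has a
  point \<open>X\<close> of hyperbolic space with \<open>horo X z0 = \<phi> z0\<close> and \<open>horo X z \<le> \<phi> z\<close> for all \<open>z\<close>; for smooth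
  \<open>\<phi>\<close> the domain is smooth and uniformly h-convex as soon as a gap \<open>c * norm (z - z0)^2\<close> with
  uniform \<open>c > 0\<close> is available in the last inequality. Both conditions only involve a pair
  \<open>z, z0\<close>, and for the p-sum of two points they reduce to inequalities between power means of
  two numbers, which hold for \<open>1/2 \<le> p \<le> 2\<close> and have a strict form for \<open>1/2 < p < 2\<close>. For
  general \<open>K\<close> and \<open>L\<close> one applies this to the contact points of \<open>K\<close> and \<open>L\<close> at \<open>z0\<close>, and a gap of
  \<open>K\<close> or \<open>L\<close> is inherited by the p-sum. The boundary formula says that \<open>X\<close> is determined by the value
  and the gradient of \<open>\<phi>\<close> at a contact direction.
\<close>

section \<open>Smooth functions\<close>

text \<open>The curvature hypothesis on \<open>K\<close> is local, while a support function needs,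
  for every \<open>z\<close>, one global maximiser of \<open>horo _ z\<close>. Curvature above 1,
  the curvature of horospheres, only makes a critical boundary point a strict local maximum; a
  mountain pass argument on the connected set \<open>K\<close> turns this into uniqueness.
  Regularity then travels in both directions through the inverse function theorem: from the domain
  to \<phi> it solves the Lagrange equations of the maximiser, from \<phi> to the domain it solves
  the critical equation of \<open>horo Y z - \<phi> z\<close> in \<open>z\<close>, which the gap
  makes nondegenerate. The gap of a smooth domain is an interior sphere condition at its contact
  points. The bounds 1/2 and 2 come from splitting a multiple of a contact point along the null
  vectors \<open>(z0, 1)\<close>, \<open>(z, 1)\<close> and their spacelike orthogonal complement:
  Jensen's inequality is then applied to the exponents 2p and 1/p, or p and 2/p, which must be at
  least 1.\<close>

lemma Ck_on_cong:
  assumes "open U" "Ck_on k U f" "\<And>x. x \<in> U \<Longrightarrow> f x = g x"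
  shows "Ck_on k U g"
  using assms
proof (induction k arbitrary: f g)
  case 0
  then show ?case using continuous_on_cong by (metis Ck_on.simps(1))
next
  case (Suc k)
  have der: "(g has_derivative frechet_derivative f (at x)) (at x)" if "x \<in> U" for x
    by (rule has_derivative_transform_within_open[of f _ x UNIV U])
       (use Suc.prems that in \<open>auto simp: frechet_derivative_works\<close>)
  then have eq: "frechet_derivative f (at x) = frechet_derivative g (at x)" if "x \<in> U" for x
    using frechet_derivative_at that by blast
  have "Ck_on k U (\<lambda>x. frechet_derivative g (at x) v)" for v
    by (rule Suc.IH[where f = "\<lambda>x. frechet_derivative f (at x) v"]) (use Suc.prems eq in auto)
  then show ?case using der by (auto simp: differentiable_def)
qed

lemma Ck_on_SucI:
  assumes "open U" "\<And>x. x \<in> U \<Longrightarrow> (f has_derivative f' x) (at x)"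
    and "\<And>v. Ck_on k U (\<lambda>x. f' x v)"
  shows "Ck_on (Suc k) U f"
proof -
  have "f' x = frechet_derivative f (at x)" if "x \<in> U" for x
    using frechet_derivative_at assms(2) that by blast
  then have "Ck_on k U (\<lambda>x. frechet_derivative f (at x) v)" for v
    by (intro Ck_on_cong[OF assms(1) assms(3)[of v]]) auto
  then show ?thesis using assms by (auto simp: differentiable_def)
qed

lemma Ck_on_SucD:
  assumes "Ck_on (Suc k) U f"
  shows "x \<in> U \<Longrightarrow> (f has_derivative frechet_derivative f (at x)) (at x)"
    and "Ck_on k U (\<lambda>x. frechet_derivative f (at x) v)"
  using assms by (auto simp: frechet_derivative_works)

lemma Ck_on_imp_continuous_on: "Ck_on k U f \<Longrightarrow> continuous_on U f"
  by (cases k) (auto intro!: differentiable_imp_continuous_on differentiable_at_imp_differentiable_on)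

lemma Ck_on_Suc_imp: "Ck_on (Suc k) U f \<Longrightarrow> Ck_on k U f"
proof (induction k arbitrary: f)
  case 0
  then show ?case using Ck_on_imp_continuous_on[of "Suc 0"] by auto
next
  case (Suc k)
  then show ?case by (metis Ck_on.simps(2))
qed

lemma Ck_on_subset: "Ck_on k U f \<Longrightarrow> V \<subseteq> U \<Longrightarrow> Ck_on k V f"
  by (induction k arbitrary: f) (auto intro: continuous_on_subset)

lemma Ck_on_const: "open U \<Longrightarrow> Ck_on k U (\<lambda>x. c)"
  by (induction k arbitrary: c) (auto intro!: Ck_on_SucI[where f' = "\<lambda>x v. 0"] simp del: Ck_on.simps(2))

lemma Ck_on_bounded_linear: "open U \<Longrightarrow> bounded_linear f \<Longrightarrow> Ck_on k U f"
  by (cases k) (auto intro!: Ck_on_SucI[where f' = "\<lambda>x. f"] Ck_on_const bounded_linear_imp_has_derivative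
      linear_continuous_on simp del: Ck_on.simps(2))

lemma Ck_on_add: "open U \<Longrightarrow> Ck_on k U f \<Longrightarrow> Ck_on k U g \<Longrightarrow> Ck_on k U (\<lambda>x. f x + g x)"
proof (induction k arbitrary: f g)
  case (Suc k)
  show ?case
    by (rule Ck_on_SucI[OF Suc.prems(1) has_derivative_add[OF Ck_on_SucD(1)[OF Suc.prems(2)] Ck_on_SucD(1)[OF Suc.prems(3)]]])
       (use Suc in auto)
qed (auto intro: continuous_intros)

lemma Ck_on_mult: "open U \<Longrightarrow> Ck_on k U f \<Longrightarrow> Ck_on k U g \<Longrightarrow> Ck_on k U (\<lambda>x. f x * g x)"
proof (induction k arbitrary: f g)
  case (Suc k)
  show ?case
    by (rule Ck_on_SucI[OF Suc.prems(1) has_derivative_mult[OF Ck_on_SucD(1)[OF Suc.prems(2)] Ck_on_SucD(1)[OF Suc.prems(3)]]])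
       (use Suc in \<open>auto intro!: Ck_on_add Suc.IH Ck_on_Suc_imp[OF Suc.prems(2)] Ck_on_Suc_imp[OF Suc.prems(3)]\<close>)
qed (auto intro: continuous_intros)

lemma Ck_on_minus: "open U \<Longrightarrow> Ck_on k U f \<Longrightarrow> Ck_on k U (\<lambda>x. - f x)"
  using Ck_on_mult[OF _ Ck_on_const[of U k "-1"], of f] by simp

lemma Ck_on_diff: "open U \<Longrightarrow> Ck_on k U f \<Longrightarrow> Ck_on k U g \<Longrightarrow> Ck_on k U (\<lambda>x. f x - g x)"
  using Ck_on_add[OF _ _ Ck_on_minus, of U k f g] by simp

lemma Ck_on_sum: "open U \<Longrightarrow> (\<And>i. i \<in> I \<Longrightarrow> Ck_on k U (f i)) \<Longrightarrow> Ck_on k U (\<lambda>x. \<Sum>i\<in>I. f i x)"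
  by (induction I rule: infinite_finite_induct) (auto intro!: Ck_on_const Ck_on_add)

text \<open>Scalarised by all linear functionals, because \<open>Ck_on\<close> is formulated for
  real-valued functions.\<close>

definition Ckv_on :: "nat \<Rightarrow> 'a::euclidean_space set \<Rightarrow> ('a \<Rightarrow> 'b::euclidean_space) \<Rightarrow> bool" where
  "Ckv_on k U s \<longleftrightarrow> (\<forall>c. Ck_on k U (\<lambda>x. s x \<bullet> c))"

lemma Ckv_on_Basis:
  assumes "open U" "\<And>b. b \<in> Basis \<Longrightarrow> Ck_on k U (\<lambda>x. s x \<bullet> b)"
  shows "Ckv_on k U s"
  unfolding Ckv_on_def
proof
  fix c
  have "Ck_on k U (\<lambda>x. \<Sum>b\<in>Basis. (s x \<bullet> b) * (c \<bullet> b))"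
    by (intro Ck_on_sum Ck_on_mult Ck_on_const assms)
  then show "Ck_on k U (\<lambda>x. s x \<bullet> c)" by (simp flip: euclidean_inner)
qed

lemma Ckv_on_SucD:
  assumes "Ckv_on (Suc k) U s" "x \<in> U"
  shows "(s has_derivative frechet_derivative s (at x)) (at x)"
    and "frechet_derivative (\<lambda>x. s x \<bullet> c) (at x) v = frechet_derivative s (at x) v \<bullet> c"
proof -
  have "((\<lambda>x. s x \<bullet> b) has_derivative frechet_derivative (\<lambda>x. s x \<bullet> b) (at x)) (at x)" for b
    using assms Ck_on_SucD unfolding Ckv_on_def by blast
  then have "s differentiable (at x)"
    using differentiable_componentwise_within[of s x UNIV] by (auto simp: differentiable_def)
  then show d: "(s has_derivative frechet_derivative s (at x)) (at x)"
    by (simp add: frechet_derivative_works)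
  have "((\<lambda>x. s x \<bullet> c) has_derivative (\<lambda>v. frechet_derivative s (at x) v \<bullet> c)) (at x)"
    by (rule has_derivative_inner_left[OF d])
  then show "frechet_derivative (\<lambda>x. s x \<bullet> c) (at x) v = frechet_derivative s (at x) v \<bullet> c"
    by (metis frechet_derivative_at)
qed

lemma Ckv_on_Suc_imp: "Ckv_on (Suc k) U s \<Longrightarrow> Ckv_on k U s"
  using Ck_on_Suc_imp unfolding Ckv_on_def by blast

lemma has_derivative_linear_expand:
  fixes v :: "'a::euclidean_space"
  assumes "linear L"
  shows "L v = (\<Sum>b\<in>Basis. (v \<bullet> b) *\<^sub>R L b)"
proof -
  have "L v = L (\<Sum>b\<in>Basis. (v \<bullet> b) *\<^sub>R b)" by (simp add: euclidean_representation)
  then show ?thesis by (simp only: linear_sum[OF assms] linear_scale[OF assms])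
qed

text \<open>By the chain rule a directional derivative of the composite is the sum over basis
  vectors \<open>b\<close> of a derivative of the component \<open>s x \<bullet> b\<close> times the
  partial derivative of \<open>f\<close> along \<open>b\<close>, taken at \<open>s x\<close>. The
  second factor is again a composite, of order one less, so the induction runs over all
  \<open>f\<close>.\<close>

lemma Ck_on_compose:
  assumes "open U" "open V" "Ck_on k V f" "Ckv_on k U s" "s ` U \<subseteq> V"
  shows "Ck_on k U (\<lambda>x. f (s x))"
  using assms(3,4)
proof (induction k arbitrary: f)
  case 0
  have "continuous_on U s"
    using 0 by (intro continuous_on_componentwise[THEN iffD2]) (auto simp: Ckv_on_def)
  then have "continuous_on U (f \<circ> s)" using 0 assms(5)
    by (intro continuous_on_compose) (auto intro: continuous_on_subset)
  then show ?case by (simp add: o_def)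
next
  case (Suc k)
  have ds: "(s has_derivative frechet_derivative s (at x)) (at x)" if "x \<in> U" for x
    using Ckv_on_SucD(1) Suc.prems that by blast
  have df: "(f has_derivative frechet_derivative f (at y)) (at y)" if "y \<in> V" for y
    using Ck_on_SucD Suc.prems that by blast
  have d: "((\<lambda>x. f (s x)) has_derivative (\<lambda>v. frechet_derivative f (at (s x)) (frechet_derivative s (at x) v))) (at x)"
    if "x \<in> U" for x
    using diff_chain_at[OF ds[OF that] df] assms(5) that by (auto simp: o_def)
  show ?case
  proof (rule Ck_on_SucI[OF assms(1) d])
    fix v
    have 1: "frechet_derivative f (at (s x)) (frechet_derivative s (at x) v) =
        (\<Sum>b\<in>Basis. frechet_derivative (\<lambda>x. s x \<bullet> b) (at x) v * frechet_derivative f (at (s x)) b)" if "x \<in> U" for x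
    proof -
      have "s x \<in> V" using that assms by auto
      then have "linear (frechet_derivative f (at (s x)))" using df has_derivative_linear by blast
      then show ?thesis
        by (subst has_derivative_linear_expand) (auto simp: Ckv_on_SucD(2)[OF Suc.prems(2) that])
    qed
    have "Ck_on k U (\<lambda>x. \<Sum>b\<in>Basis. frechet_derivative (\<lambda>x. s x \<bullet> b) (at x) v * frechet_derivative f (at (s x)) b)"
    proof (intro Ck_on_sum Ck_on_mult assms)
      fix b :: 'b
      show "Ck_on k U (\<lambda>x. frechet_derivative (\<lambda>x. s x \<bullet> b) (at x) v)"
        using Suc.prems Ck_on_SucD unfolding Ckv_on_def by blast
      show "Ck_on k U (\<lambda>x. frechet_derivative f (at (s x)) b)"
        by (rule Suc.IH[OF Ck_on_SucD(2)[OF Suc.prems(1)] Ckv_on_Suc_imp[OF Suc.prems(2)]])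
    qed
    then show "Ck_on k U (\<lambda>x. frechet_derivative f (at (s x)) (frechet_derivative s (at x) v))"
      by (rule Ck_on_cong[OF assms(1)]) (use 1 in auto)
  qed auto
qed

lemma Ck_on_powr: "Ck_on k {0::real<..} (\<lambda>x. x powr a)"
proof (induction k arbitrary: a)
  case 0
  show ?case by (auto intro!: continuous_intros)
next
  case (Suc k)
  show ?case
  proof (rule Ck_on_SucI)
    show "((\<lambda>x. x powr a) has_derivative (\<lambda>v. v * (a * x powr (a - 1)))) (at x)" if "x \<in> {0<..}" for x
    proof -
      have "(\<lambda>v. v * (a * x powr (a - 1))) = (*) (a * x powr (a - 1))" by (simp add: fun_eq_iff)
      then show ?thesis using has_real_derivative_powr[of x a] that
        by (simp add: has_field_derivative_def)
    qed
    show "Ck_on k {0<..} (\<lambda>x. v * (a * x powr (a - 1)))" for v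
      by (intro Ck_on_mult Ck_on_const Suc) auto
  qed auto
qed

lemma Ck_on_compose_powr:
  assumes "open U" "Ck_on k U f" "\<And>x. x \<in> U \<Longrightarrow> f x > 0"
  shows "Ck_on k U (\<lambda>x. f x powr a)"
  by (rule Ck_on_compose[OF assms(1) _ Ck_on_powr])
     (use assms in \<open>auto intro!: Ckv_on_Basis\<close>)

lemma Ck_on_locally:
  assumes "\<And>x. x \<in> U \<Longrightarrow> \<exists>V. open V \<and> x \<in> V \<and> Ck_on k V f"
  shows "Ck_on k U f"
  using assms
proof (induction k arbitrary: f)
  case 0
  have "continuous (at x) f" if "x \<in> U" for x
    using 0[OF that] by (auto simp: continuous_on_eq_continuous_at)
  then show ?case by (auto intro: continuous_at_imp_continuous_on)
next
  case (Suc k)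
  have "f differentiable (at x)" if "x \<in> U" for x using Suc.prems[OF that] by auto
  moreover have "Ck_on k U (\<lambda>x. frechet_derivative f (at x) v)" for v
    by (rule Suc.IH) (use Suc.prems in fastforce)
  ultimately show ?case by auto
qed

lemma smooth_on_subset: "smooth_on U f \<Longrightarrow> V \<subseteq> U \<Longrightarrow> smooth_on V f"
  using Ck_on_subset unfolding smooth_on_def by blast

lemma smooth_on_has_derivative:
  assumes "smooth_on U f" "x \<in> U"
  shows "(f has_derivative frechet_derivative f (at x)) (at x)"
  using assms Ck_on_SucD(1) unfolding smooth_on_def by blast

lemma smooth_on_frechet_derivative:
  assumes "smooth_on U f"
  shows "smooth_on U (\<lambda>x. frechet_derivative f (at x) v)"
  using assms Ck_on_SucD(2) unfolding smooth_on_def by blast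

lemma smooth_on_imp_continuous_on: "smooth_on U f \<Longrightarrow> continuous_on U f"
  using Ck_on_imp_continuous_on unfolding smooth_on_def by blast

section \<open>Second derivatives: expansion in a basis, Taylor's formula, symmetry\<close>

definition hess :: "('a::euclidean_space \<Rightarrow> real) \<Rightarrow> 'a \<Rightarrow> 'a \<Rightarrow> 'a \<Rightarrow> real" where
  "hess f x v w = frechet_derivative (\<lambda>y. frechet_derivative f (at y) v) (at x) w"

lemma hess_continuous_on:
  assumes "smooth_on U f"
  shows "continuous_on U (\<lambda>x. hess f x v w)"
  unfolding hess_def by (intro smooth_on_imp_continuous_on smooth_on_frechet_derivative assms)

lemma hess_expand:
  assumes "open U" "smooth_on U f" "x \<in> U"
  shows "hess f x v w = (\<Sum>b\<in>Basis. \<Sum>c\<in>Basis. (v \<bullet> b) * (w \<bullet> c) * hess f x b c)"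
proof -
  let ?D = "\<lambda>v y. frechet_derivative f (at y) v"
  have d: "(?D v has_derivative frechet_derivative (?D v) (at y)) (at y)" if "y \<in> U" for y v
    using smooth_on_has_derivative[OF smooth_on_frechet_derivative[OF assms(2)] that] .
  have lin: "linear (frechet_derivative f (at y))" if "y \<in> U" for y
    using smooth_on_has_derivative[OF assms(2) that] has_derivative_linear by blast
  have "((\<lambda>y. \<Sum>b\<in>Basis. (v \<bullet> b) * ?D b y) has_derivative
      (\<lambda>w. \<Sum>b\<in>Basis. (v \<bullet> b) * hess f x b w)) (at x)"
    unfolding hess_def by (intro has_derivative_sum has_derivative_mult_right d assms)
  moreover have "(\<Sum>b\<in>Basis. (v \<bullet> b) * ?D b y) = ?D v y" if "y \<in> U" for y
    using has_derivative_linear_expand[OF lin[OF that], of v] by simp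
  ultimately have "(?D v has_derivative (\<lambda>w. \<Sum>b\<in>Basis. (v \<bullet> b) * hess f x b w)) (at x)"
    by (rule has_derivative_transform_within_open[OF _ assms(1,3)])
  then have "hess f x v = (\<lambda>w. \<Sum>b\<in>Basis. (v \<bullet> b) * hess f x b w)"
    unfolding hess_def by (rule frechet_derivative_at[symmetric])
  moreover have "hess f x b w = (\<Sum>c\<in>Basis. (w \<bullet> c) * hess f x b c)" for b
  proof -
    have "linear (hess f x b)" using d[OF assms(3), of b] has_derivative_linear
      unfolding hess_def by blast
    from has_derivative_linear_expand[OF this, of w] show ?thesis by simp
  qed
  ultimately show ?thesis
    by (simp add: sum_distrib_left mult.assoc)
qed

text \<open>Continuity is known for fixed directions only; the bilinear expansion in a basis makes
  it joint in the base point and both directions, as needed for Taylor remainders at moving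
  points.\<close>

lemma hess_tendsto:
  assumes "open U" "smooth_on U f" "x \<in> U" "(y \<longlongrightarrow> x) F" "(v \<longlongrightarrow> v') F" "(w \<longlongrightarrow> w') F"
  shows "((\<lambda>k. hess f (y k) (v k) (w k)) \<longlongrightarrow> hess f x v' w') F"
proof -
  have "((\<lambda>k. hess f (y k) b c) \<longlongrightarrow> hess f x b c) F" for b c
  proof -
    have "isCont (\<lambda>x. hess f x b c) x"
      using hess_continuous_on[OF assms(2), of b c] assms(1,3) continuous_on_eq_continuous_at by blast
    then show ?thesis using isCont_tendsto_compose assms(4) by fast
  qed
  then have "((\<lambda>k. \<Sum>b\<in>Basis. \<Sum>c\<in>Basis. (v k \<bullet> b) * (w k \<bullet> c) * hess f (y k) b c) \<longlongrightarrow>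
      (\<Sum>b\<in>Basis. \<Sum>c\<in>Basis. (v' \<bullet> b) * (w' \<bullet> c) * hess f x b c)) F"
    by (intro tendsto_intros assms)
  then have "((\<lambda>k. \<Sum>b\<in>Basis. \<Sum>c\<in>Basis. (v k \<bullet> b) * (w k \<bullet> c) * hess f (y k) b c) \<longlongrightarrow> hess f x v' w') F"
    by (subst hess_expand[OF assms(1-3)])
  moreover have "\<forall>\<^sub>F k in F. y k \<in> U"
    using assms(1,3,4) topological_tendstoD by blast
  then have "\<forall>\<^sub>F k in F. (\<Sum>b\<in>Basis. \<Sum>c\<in>Basis. (v k \<bullet> b) * (w k \<bullet> c) * hess f (y k) b c) = hess f (y k) (v k) (w k)"
    by eventually_elim (rule hess_expand[OF assms(1,2), symmetric])
  ultimately show ?thesis using tendsto_cong by fast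
qed

lemma smooth_on_line_derivative:
  fixes f :: "'a::euclidean_space \<Rightarrow> real"
  assumes "smooth_on U f" "x + t *\<^sub>R h \<in> U"
  shows "((\<lambda>t. f (x + t *\<^sub>R h)) has_real_derivative frechet_derivative f (at (x + t *\<^sub>R h)) h) (at t)"
proof -
  have d: "(f has_derivative frechet_derivative f (at (x + t *\<^sub>R h))) (at (x + t *\<^sub>R h))"
    using smooth_on_has_derivative[OF assms] .
  have "((\<lambda>t. x + t *\<^sub>R h) has_derivative (\<lambda>s. s *\<^sub>R h)) (at t)"
    by (auto intro!: derivative_eq_intros)
  from diff_chain_at[OF this d]
  have "((\<lambda>t. f (x + t *\<^sub>R h)) has_derivative (\<lambda>s. frechet_derivative f (at (x + t *\<^sub>R h)) (s *\<^sub>R h))) (at t)"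
    by (simp add: o_def)
  moreover have "frechet_derivative f (at (x + t *\<^sub>R h)) (s *\<^sub>R h) = frechet_derivative f (at (x + t *\<^sub>R h)) h * s" for s
    using linear_scale[OF has_derivative_linear[OF d]] by simp
  ultimately show ?thesis by (simp add: has_field_derivative_def)
qed

lemma smooth_on_Taylor2:
  fixes f :: "'a::euclidean_space \<Rightarrow> real"
  assumes "smooth_on U f" "\<And>t. 0 \<le> t \<Longrightarrow> t \<le> 1 \<Longrightarrow> x + t *\<^sub>R h \<in> U"
  obtains \<theta> where "0 < \<theta>" "\<theta> < 1"
    "f (x + h) = f x + frechet_derivative f (at x) h + hess f (x + \<theta> *\<^sub>R h) h h / 2"
proof -
  define d where "d m = (if m = 0 then (\<lambda>t. f (x + t *\<^sub>R h)) else if m = (1::nat) then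
    (\<lambda>t. frechet_derivative f (at (x + t *\<^sub>R h)) h) else (\<lambda>t. hess f (x + t *\<^sub>R h) h h))" for m
  have "DERIV (d m) t :> d (Suc m) t" if "m < 2" "0 \<le> t" "t \<le> 1" for m t
  proof (cases "m = 0")
    case True
    then show ?thesis using smooth_on_line_derivative[OF assms] that by (simp add: d_def)
  next
    case False
    then have "m = 1" using that by auto
    then show ?thesis using that
        smooth_on_line_derivative[OF smooth_on_frechet_derivative[OF assms(1)] assms(2), of t h]
      by (simp add: d_def hess_def)
  qed
  then obtain t where "0 < t" "t < 1" "d 0 1 = (\<Sum>m<2. d m 0 / fact m * 1 ^ m) + d 2 t / fact 2 * 1 ^ 2"
    using Maclaurin[of 1 2 d "d 0"] by auto
  then show ?thesis by (intro that[of t]) (auto simp: d_def eval_nat_numeral)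
qed

text \<open>Two mean value theorems, along \<open>v\<close> for the increment in \<open>w\<close>
  and then along \<open>w\<close>. The left-hand side is symmetric in \<open>v\<close> and
  \<open>w\<close>, which yields Schwarz's theorem in the limit.\<close>

lemma second_difference:
  fixes f :: "'a::euclidean_space \<Rightarrow> real"
  assumes "smooth_on U f" "ball x r \<subseteq> U" "0 < t" "t * (norm v + norm w) < r"
  obtains p where "dist x p \<le> t * (norm v + norm w)"
    "f (x + t *\<^sub>R v + t *\<^sub>R w) - f (x + t *\<^sub>R v) - f (x + t *\<^sub>R w) + f x = t\<^sup>2 * hess f p v w"
proof -
  have near: "dist x (x + s *\<^sub>R v + u *\<^sub>R w) \<le> t * (norm v + norm w)"
    if "0 \<le> s" "s \<le> t" "0 \<le> u" "u \<le> t" for s u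
  proof -
    have "norm (s *\<^sub>R v + u *\<^sub>R w) \<le> s * norm v + u * norm w"
      using norm_triangle_ineq[of "s *\<^sub>R v" "u *\<^sub>R w"] that by simp
    also have "\<dots> \<le> t * norm v + t * norm w"
      using that by (intro add_mono mult_right_mono) auto
    finally show ?thesis by (simp add: dist_norm algebra_simps norm_minus_commute[of x])
        (metis add_uminus_conv_diff minus_add_distrib norm_minus_cancel)
  qed
  then have inU: "x + s *\<^sub>R v + u *\<^sub>R w \<in> U"
    if "0 \<le> s" "s \<le> t" "0 \<le> u" "u \<le> t" for s u
    using assms(2,4) that by (smt (verit) mem_ball subsetD)
  define g where "g s = f (x + s *\<^sub>R v + t *\<^sub>R w) - f (x + s *\<^sub>R v)" for s
  have g': "DERIV g s :> frechet_derivative f (at (x + s *\<^sub>R v + t *\<^sub>R w)) v - frechet_derivative f (at (x + s *\<^sub>R v)) v"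
    if "0 \<le> s" "s \<le> t" for s
  proof -
    have "x + t *\<^sub>R w + s *\<^sub>R v \<in> U" using inU[of s t] that by (simp add: algebra_simps)
    from smooth_on_line_derivative[OF assms(1) this]
      smooth_on_line_derivative[OF assms(1), of x s v] inU[of s 0] that
    show ?thesis unfolding g_def by (auto intro!: derivative_eq_intros simp: algebra_simps)
  qed
  obtain \<xi> where \<xi>: "0 < \<xi>" "\<xi> < t" "g t - g 0 = (t - 0) * (frechet_derivative f (at (x + \<xi> *\<^sub>R v + t *\<^sub>R w)) v - frechet_derivative f (at (x + \<xi> *\<^sub>R v)) v)"
    using MVT2[OF assms(3) g'] by auto
  define k where "k u = frechet_derivative f (at (x + \<xi> *\<^sub>R v + u *\<^sub>R w)) v" for u
  have k': "DERIV k u :> hess f (x + \<xi> *\<^sub>R v + u *\<^sub>R w) v w" if "0 \<le> u" "u \<le> t" for u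
    unfolding k_def hess_def
    by (rule smooth_on_line_derivative[OF smooth_on_frechet_derivative[OF assms(1)]])
       (use inU[of \<xi> u] \<xi> that in auto)
  obtain \<eta> where \<eta>: "0 < \<eta>" "\<eta> < t" "k t - k 0 = (t - 0) * hess f (x + \<xi> *\<^sub>R v + \<eta> *\<^sub>R w) v w"
    using MVT2[OF assms(3) k'] by auto
  show ?thesis
  proof (rule that)
    show "dist x (x + \<xi> *\<^sub>R v + \<eta> *\<^sub>R w) \<le> t * (norm v + norm w)" using near \<xi> \<eta> by auto
    have "g t - g 0 = t * (t * hess f (x + \<xi> *\<^sub>R v + \<eta> *\<^sub>R w) v w)"
      using \<xi>(3) \<eta>(3) by (simp add: k_def)
    then show "f (x + t *\<^sub>R v + t *\<^sub>R w) - f (x + t *\<^sub>R v) - f (x + t *\<^sub>R w) + f x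
      = t\<^sup>2 * hess f (x + \<xi> *\<^sub>R v + \<eta> *\<^sub>R w) v w"
      unfolding g_def by (simp add: power2_eq_square)
  qed
qed

lemma hess_commute:
  fixes f :: "'a::euclidean_space \<Rightarrow> real"
  assumes "open U" "smooth_on U f" "x \<in> U"
  shows "hess f x v w = hess f x w v"
proof (rule ccontr)
  assume ne: "hess f x v w \<noteq> hess f x w v"
  define e where "e = \<bar>hess f x v w - hess f x w v\<bar> / 2"
  have "e > 0" using ne by (simp add: e_def)
  obtain r where r: "r > 0" "ball x r \<subseteq> U" using assms openE by blast
  obtain d1 where d1: "d1 > 0" "\<And>p. p \<in> U \<Longrightarrow> dist p x < d1 \<Longrightarrow> dist (hess f p v w) (hess f x v w) < e"
    using hess_continuous_on[OF assms(2), of v w] assms(3) \<open>e > 0\<close> unfolding continuous_on_iff by meson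
  obtain d2 where d2: "d2 > 0" "\<And>p. p \<in> U \<Longrightarrow> dist p x < d2 \<Longrightarrow> dist (hess f p w v) (hess f x w v) < e"
    using hess_continuous_on[OF assms(2), of w v] assms(3) \<open>e > 0\<close> unfolding continuous_on_iff by meson
  define m where "m = Min {r, d1, d2}"
  have m: "m > 0" "m \<le> r" "m \<le> d1" "m \<le> d2" using r d1 d2 by (auto simp: m_def)
  \<comment> \<open>Both intermediate points must fall within \<open>m\<close> of \<open>x\<close>;
    the summand 1 keeps the denominator positive when \<open>v\<close> and \<open>w\<close>
    vanish.\<close>
  define t where "t = m / (norm v + norm w + 1)"
  have np: "norm v + norm w + 1 > 0" by (smt (verit) norm_ge_zero)
  have t: "t > 0" unfolding t_def using m np by auto
  have tm: "t * (norm v + norm w) < m"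
  proof -
    have "t * (norm v + norm w) < t * (norm v + norm w + 1)" using t by simp
    also have "\<dots> = m" using np unfolding t_def by simp
    finally show ?thesis .
  qed
  obtain p where p: "dist x p \<le> t * (norm v + norm w)"
    "f (x + t *\<^sub>R v + t *\<^sub>R w) - f (x + t *\<^sub>R v) - f (x + t *\<^sub>R w) + f x = t\<^sup>2 * hess f p v w"
    by (rule second_difference[OF assms(2) r(2) t, of v w]) (use tm m(2) in linarith)
  obtain q where q: "dist x q \<le> t * (norm w + norm v)"
    "f (x + t *\<^sub>R w + t *\<^sub>R v) - f (x + t *\<^sub>R w) - f (x + t *\<^sub>R v) + f x = t\<^sup>2 * hess f q w v"
    by (rule second_difference[OF assms(2) r(2) t, of w v]) (use tm m(2) in \<open>simp add: add.commute\<close>)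
  have "t\<^sup>2 * hess f p v w = t\<^sup>2 * hess f q w v" using p(2) q(2) by (simp add: algebra_simps)
  then have eq: "hess f p v w = hess f q w v" using t by simp
  have pq: "dist p x < m" "dist q x < m" using p(1) q(1) tm by (simp_all add: dist_commute add.commute)
  then have "p \<in> U" "q \<in> U" using r m by (auto simp: dist_commute)
  then have "dist (hess f p v w) (hess f x v w) < e" "dist (hess f q w v) (hess f x w v) < e"
    using d1 d2 pq m by auto
  then show False using eq unfolding e_def dist_real_def by (simp add: abs_if split: if_splits)
qed

text \<open>One constant serves all base points \<open>x\<close> near \<open>x0\<close>, because the
  Hessian is bounded on a compact ball and the segment from \<open>x\<close> to \<open>y\<close>
  stays in it. The interior sphere estimate expands at varying boundary points and relies on this
  uniformity.\<close>

lemma smooth_on_quadratic_bound: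
  fixes f :: "'a::euclidean_space \<Rightarrow> real"
  assumes "open U" "smooth_on U f" "x0 \<in> U"
  obtains r C where "r > 0" "C > 0" "cball x0 r \<subseteq> U"
    "\<And>x y. x \<in> cball x0 r \<Longrightarrow> y \<in> cball x0 r \<Longrightarrow>
       \<bar>f y - f x - frechet_derivative f (at x) (y - x)\<bar> \<le> C * (norm (y - x))\<^sup>2"
proof -
  obtain r where r: "r > 0" "cball x0 r \<subseteq> U" using assms open_contains_cball by blast
  have "\<exists>M. \<forall>p\<in>cball x0 r. \<bar>hess f p b c\<bar> \<le> M" for b c
  proof -
    have "compact ((\<lambda>p. hess f p b c) ` cball x0 r)"
      by (intro compact_continuous_image continuous_on_subset[OF hess_continuous_on[OF assms(2)]] r compact_cball)
    then have "bounded ((\<lambda>p. hess f p b c) ` cball x0 r)" by (rule compact_imp_bounded)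
    then show ?thesis unfolding bounded_iff by auto
  qed
  then obtain M where M: "\<And>b c p. p \<in> cball x0 r \<Longrightarrow> \<bar>hess f p b c\<bar> \<le> M b c" by metis
  define C where "C = (\<Sum>b\<in>Basis. \<Sum>c\<in>Basis. \<bar>M b c\<bar>) + 1"
  have "C > 0" unfolding C_def by (intro add_nonneg_pos sum_nonneg) auto
  have bound: "\<bar>hess f p h h\<bar> \<le> C * (norm h)\<^sup>2" if "p \<in> cball x0 r" for p h
  proof -
    have "\<bar>hess f p h h\<bar> = \<bar>\<Sum>b\<in>Basis. \<Sum>c\<in>Basis. (h \<bullet> b) * (h \<bullet> c) * hess f p b c\<bar>"
      by (rule arg_cong[OF hess_expand[OF assms(1,2) subsetD[OF r(2) that]]])
    also have "\<dots> \<le> (\<Sum>b\<in>Basis. \<Sum>c\<in>Basis. \<bar>(h \<bullet> b) * (h \<bullet> c) * hess f p b c\<bar>)"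
      by (intro order_trans[OF sum_abs] sum_mono order_refl)
    also have "\<dots> \<le> (\<Sum>b\<in>Basis. \<Sum>c\<in>Basis. (norm h)\<^sup>2 * \<bar>M b c\<bar>)"
      unfolding abs_mult power2_eq_square
      by (intro sum_mono mult_mono Basis_le_norm) (use order_trans[OF M[OF that] abs_ge_self] in auto)
    also have "\<dots> \<le> C * (norm h)\<^sup>2" unfolding C_def sum_distrib_left[symmetric] by (simp add: algebra_simps)
    finally show ?thesis .
  qed
  show ?thesis
  proof (rule that[of r "C / 2"])
    fix x y assume xy: "x \<in> cball x0 r" "y \<in> cball x0 r"
    have seg: "x + t *\<^sub>R (y - x) \<in> cball x0 r" if "0 \<le> t" "t \<le> 1" for t
    proof -
      have "(1 - t) *\<^sub>R x + t *\<^sub>R y \<in> cball x0 r"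
        using convexD[OF convex_cball xy] that by simp
      then show ?thesis by (simp add: algebra_simps)
    qed
    obtain \<theta> where \<theta>: "0 < \<theta>" "\<theta> < 1" "f (x + (y - x)) = f x + frechet_derivative f (at x) (y - x) + hess f (x + \<theta> *\<^sub>R (y - x)) (y - x) (y - x) / 2"
      by (rule smooth_on_Taylor2[OF assms(2), of x "y - x"]) (use subsetD[OF r(2) seg] in auto)
    then show "\<bar>f y - f x - frechet_derivative f (at x) (y - x)\<bar> \<le> C / 2 * (norm (y - x))\<^sup>2"
      using bound[OF seg[of \<theta>], of "y - x"] by simp
  qed (use r \<open>C > 0\<close> in auto)
qed


section \<open>The inverse function theorem for smooth maps\<close>

text \<open>A product rule in which the second factor is merely continuous: the first one vanishes
  at \<open>y\<close>, so the variation of the second contributes only to higher order. It breaks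
  the circle in the regularity of inverse matrices and of normalised normals.\<close>

lemma has_derivative_mult_vanishing:
  fixes a c :: "'a::real_normed_vector \<Rightarrow> real"
  assumes "(a has_derivative a') (at y)" "a y = 0" "isCont c y"
  shows "((\<lambda>x. a x * c x) has_derivative (\<lambda>h. a' h * c y)) (at y)"
proof -
  have b: "((\<lambda>x. a x * c y) has_derivative (\<lambda>h. a' h * c y)) (at y)"
    by (rule has_derivative_mult_left[OF assms(1)])
  obtain B e where B: "B > 0" "e > 0" "\<And>x. norm (x - y) < e \<Longrightarrow> \<bar>a x\<bar> \<le> B * norm (x - y)"
  proof -
    obtain K where K: "\<And>h. norm (a' h) \<le> norm h * K" "K > 0"
      using bounded_linear.pos_bounded has_derivative_bounded_linear[OF assms(1)] by blast
    obtain d where d: "d > 0" "\<And>x. norm (x - y) < d \<Longrightarrow> norm (a x - a y - a' (x - y)) \<le> 1 * norm (x - y)"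
      using assms(1) zero_less_one unfolding has_derivative_at_alt by blast
    show ?thesis
    proof (rule that[of "K + 1" d])
      fix x assume "norm (x - y) < d"
      then have "\<bar>a x - a' (x - y)\<bar> \<le> norm (x - y)" using d(2)[of x] assms(2) by simp
      then show "\<bar>a x\<bar> \<le> (K + 1) * norm (x - y)" using K(1)[of "x - y"] by (simp add: algebra_simps)
    qed (use K d in auto)
  qed
  have "((\<lambda>x. a x * (c x - c y)) has_derivative (\<lambda>h. 0)) (at y)"
    unfolding has_derivative_at_alt
  proof (intro conjI allI impI)
    fix \<epsilon> :: real assume "\<epsilon> > 0"
    then obtain d where d: "d > 0" "\<And>x. dist x y < d \<Longrightarrow> dist (c x) (c y) < \<epsilon> / B"
      using assms(3) B(1) unfolding continuous_at_eps_delta by (meson divide_pos_pos)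
    show "\<exists>d>0. \<forall>x. norm (x - y) < d \<longrightarrow> norm (a x * (c x - c y) - a y * (c y - c y) - 0) \<le> \<epsilon> * norm (x - y)"
    proof (intro exI[of _ "min d e"] conjI allI impI)
      fix x assume x: "norm (x - y) < min d e"
      have "\<bar>a x\<bar> * \<bar>c x - c y\<bar> \<le> (B * norm (x - y)) * (\<epsilon> / B)"
        using x B(1) B(3)[of x] d(2)[of x] by (intro mult_mono) (auto simp: dist_norm)
      then show "norm (a x * (c x - c y) - a y * (c y - c y) - 0) \<le> \<epsilon> * norm (x - y)"
        using B(1) by (simp add: abs_mult mult.commute)
    qed (use d B in auto)
  qed simp
  from has_derivative_add[OF this b] show ?thesis by (simp add: algebra_simps)
qed

text \<open>The resolvent identity bounds \<open>R y - R y0\<close> by a small factor times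
  \<open>norm (R y)\<close>, which is not known to be bounded beforehand. Once the factor is below
  1/2, the same identity gives \<open>norm (R y) \<le> 2 * norm (R y0)\<close>.\<close>

lemma continuous_on_blinfun_inverse:
  fixes M R :: "'b::topological_space \<Rightarrow> ('a::real_normed_vector \<Rightarrow>\<^sub>L 'a)"
  assumes "continuous_on V M"
    and "\<And>y. y \<in> V \<Longrightarrow> R y o\<^sub>L M y = id_blinfun" "\<And>y. y \<in> V \<Longrightarrow> M y o\<^sub>L R y = id_blinfun"
  shows "continuous_on V R"
  unfolding continuous_on_def
proof
  fix y0 assume y0: "y0 \<in> V"
  have eq: "R y - R y0 = R y0 o\<^sub>L ((M y0 - M y) o\<^sub>L R y)" if "y \<in> V" for y
  proof (rule blinfun_eqI)
    fix i
    have *: "R y0 (M y0 j) = j" "M y (R y j) = j" for j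
      using assms(2)[OF y0] assms(3)[OF that] by (metis blinfun_apply_blinfun_compose blinfun_apply_id_blinfun)+
    show "(R y - R y0) i = (R y0 o\<^sub>L ((M y0 - M y) o\<^sub>L R y)) i"
      by (simp add: blinfun.diff_left blinfun.diff_right *)
  qed
  have M: "((\<lambda>y. M y0 - M y) \<longlongrightarrow> 0) (at y0 within V)"
    using assms(1) y0 unfolding continuous_on_def by (auto intro!: tendsto_eq_intros)
  then have T: "((\<lambda>y. norm (R y0) * norm (M y0 - M y)) \<longlongrightarrow> 0) (at y0 within V)"
    using tendsto_mult[OF tendsto_const[of "norm (R y0)"] tendsto_norm[OF M]] by simp
  then have small: "\<forall>\<^sub>F y in at y0 within V. norm (R y0) * norm (M y0 - M y) < 1 / 2"
    by (rule order_tendstoD) simp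
  have inV: "\<forall>\<^sub>F y in at y0 within V. y \<in> V" by (auto simp: eventually_at_topological)
  have "\<forall>\<^sub>F y in at y0 within V. norm (R y - R y0) \<le> (norm (R y0) * norm (M y0 - M y)) * (2 * norm (R y0))"
    using small inV
  proof eventually_elim
    case (elim y)
    have n: "norm (R y - R y0) \<le> norm (R y0) * norm (M y0 - M y) * norm (R y)"
      unfolding eq[OF elim(2)]
      by (metis (no_types, opaque_lifting) mult.assoc mult_left_mono norm_blinfun_compose norm_ge_zero order_trans)
    also have "\<dots> \<le> 1 / 2 * norm (R y)" using elim(1) by (intro mult_right_mono) auto
    finally have "norm (R y) \<le> 2 * norm (R y0)"
      using norm_triangle_ineq2[of "R y" "R y0"] by simp
    then show ?case using n by (smt (verit) mult_left_mono norm_ge_zero zero_le_mult_iff)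
  qed
  moreover have "((\<lambda>y. (norm (R y0) * norm (M y0 - M y)) * (2 * norm (R y0))) \<longlongrightarrow> 0) (at y0 within V)"
    by (rule tendsto_mult_left_zero[OF T])
  ultimately have "((\<lambda>y. R y - R y0) \<longlongrightarrow> 0) (at y0 within V)"
    by (rule Lim_null_comparison)
  then show "(R \<longlongrightarrow> R y0) (at y0 within V)" by (simp add: LIM_zero_iff)
qed

definition smoothv_on :: "'a::euclidean_space set \<Rightarrow> ('a \<Rightarrow> 'b::euclidean_space) \<Rightarrow> bool" where
  "smoothv_on U s \<longleftrightarrow> (\<forall>c. smooth_on U (\<lambda>x. s x \<bullet> c))"

lemma smoothv_on_imp_Ckv_on: "smoothv_on U s \<Longrightarrow> Ckv_on k U s"
  unfolding smoothv_on_def Ckv_on_def smooth_on_def by blast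

lemma smoothv_on_has_derivative:
  assumes "smoothv_on U s" "x \<in> U"
  shows "(s has_derivative frechet_derivative s (at x)) (at x)"
  using Ckv_on_SucD(1) smoothv_on_imp_Ckv_on assms by blast

theorem smooth_inverse_function:
  fixes \<Psi> :: "'a::euclidean_space \<Rightarrow> 'a"
  assumes "open U" "smoothv_on U \<Psi>" "y0 \<in> U"
    and inj: "\<And>v. frechet_derivative \<Psi> (at y0) v = 0 \<Longrightarrow> v = 0"
  obtains T V \<Theta> where "open T" "T \<subseteq> U" "y0 \<in> T" "open V" "\<Psi> y0 \<in> V"
    "homeomorphism T V \<Psi> \<Theta>" "smoothv_on V \<Theta>"
proof -
  let ?D = "\<lambda>y. frechet_derivative \<Psi> (at y)"
  have der: "(\<Psi> has_derivative ?D y) (at y)" if "y \<in> U" for y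
    using smoothv_on_has_derivative[OF assms(2) that] .
  define M where "M y = Blinfun (?D y)" for y
  have M: "blinfun_apply (M y) = ?D y" if "y \<in> U" for y
    unfolding M_def using bounded_linear_Blinfun_apply has_derivative_bounded_linear[OF der[OF that]] by blast
  have comp: "frechet_derivative (\<lambda>x. \<Psi> x \<bullet> c) (at y) b = M y b \<bullet> c" if "y \<in> U" for y b c
    using Ckv_on_SucD(2)[OF smoothv_on_imp_Ckv_on[OF assms(2)] that] M[OF that] by simp
  have smcomp: "smooth_on U (\<lambda>y. frechet_derivative (\<lambda>x. \<Psi> x \<bullet> c) (at y) b)" for b c
    using assms(2) smooth_on_frechet_derivative unfolding smoothv_on_def by blast
  have contM: "continuous_on U M"
  proof (rule continuous_on_blinfun_componentwise)
    fix i :: 'a assume "i \<in> Basis"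
    have "continuous_on U (\<lambda>y. M y i \<bullet> c)" for c
      using smooth_on_imp_continuous_on[OF smcomp[of c i]]
      by (rule continuous_on_cong[THEN iffD1, rotated -1]) (simp_all add: comp)
    then show "continuous_on U (\<lambda>y. M y i)" by (intro continuous_on_componentwise[THEN iffD2]) auto
  qed
  have injD: "inj (M y0)"
    using inj M[OF assms(3)] by (metis linear_injective_0 has_derivative_linear[OF der[OF assms(3)]])
  obtain g0 where g0: "linear g0" "g0 \<circ> M y0 = id"
    using linear_injective_left_inverse[OF bounded_linear.linear[OF blinfun.bounded_linear_right] injD] by blast
  define R0 where "R0 = Blinfun g0"
  have R0: "blinfun_apply R0 = g0" unfolding R0_def
    using g0(1) bounded_linear_Blinfun_apply linear_conv_bounded_linear by blast
  have R0M: "R0 o\<^sub>L M y0 = id_blinfun"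
    using g0(2) R0 by (intro blinfun_eqI) (simp add: fun_eq_iff)
  obtain T V \<Theta> g' where T: "open T" "T \<subseteq> U" "y0 \<in> T" "open V" "\<Psi> y0 \<in> V" and hom: "homeomorphism T V \<Psi> \<Theta>"
    and g': "\<And>y. y \<in> V \<Longrightarrow> (\<Theta> has_derivative (g' y)) (at y)" "\<And>y. y \<in> V \<Longrightarrow> g' y = inv (blinfun_apply (M (\<Theta> y)))"
    "\<And>y. y \<in> V \<Longrightarrow> bij (blinfun_apply (M (\<Theta> y)))"
    using inverse_function_theorem[OF assms(1) _ contM assms(3) R0M] der M by (metis (no_types, lifting))
  have "\<Theta> y \<in> T" if "y \<in> V" for y using hom that unfolding homeomorphism_def by blast
  then have \<Theta>U: "\<Theta> y \<in> U" if "y \<in> V" for y using T that by blast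
  define R where "R y = Blinfun (g' y)" for y
  have R: "blinfun_apply (R y) = g' y" if "y \<in> V" for y
    unfolding R_def using bounded_linear_Blinfun_apply has_derivative_bounded_linear[OF g'(1)[OF that]] by blast
  have RM: "R y (M (\<Theta> y) v) = v" "M (\<Theta> y) (R y v) = v" if "y \<in> V" for y v
    using g'(2,3)[OF that] R[OF that] by (simp_all add: bij_is_inj bij_is_surj surj_f_inv_f)
  have cont\<Theta>: "continuous_on V \<Theta>" using hom unfolding homeomorphism_def by blast
  have contM\<Theta>: "continuous_on V (\<lambda>y. M (\<Theta> y))"
    using continuous_on_compose2[OF contM cont\<Theta>] \<Theta>U by blast
  have contR: "continuous_on V R"
    by (rule continuous_on_blinfun_inverse[OF contM\<Theta>]) (auto intro!: blinfun_eqI simp: RM)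
  \<comment> \<open>The matrix entries of \<open>M (\<Theta> y)\<close>, extended by a formula that
    is visibly a composite of a smooth function with \<open>\<Theta>\<close>.\<close>
  define m where "m d e y = frechet_derivative (\<lambda>x. \<Psi> x \<bullet> e) (at (\<Theta> y)) d" for d e y
  have m: "m d e y = M (\<Theta> y) d \<bullet> e" if "y \<in> V" for y d e
    unfolding m_def using comp[OF \<Theta>U[OF that]] by simp
  have contr: "isCont (\<lambda>y. R y b \<bullet> c) y" if "y \<in> V" for b c y
  proof -
    have "isCont R y" using contR that T(4) continuous_on_eq_continuous_at by blast
    then show ?thesis by (intro continuous_intros)
  qed
  have dm: "(m d e has_derivative frechet_derivative (m d e) (at y)) (at y)" if "y \<in> V" for d e y
  proof -
    have "((\<lambda>y. frechet_derivative (\<lambda>x. \<Psi> x \<bullet> e) (at y) d) has_derivative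
      frechet_derivative (\<lambda>y. frechet_derivative (\<lambda>x. \<Psi> x \<bullet> e) (at y) d) (at (\<Theta> y))) (at (\<Theta> y))"
      by (rule smooth_on_has_derivative[OF smcomp \<Theta>U[OF that]])
    from diff_chain_at[OF g'(1)[OF that] this] have "m d e differentiable (at y)"
      unfolding m_def o_def differentiable_def by blast
    then show ?thesis by (simp add: frechet_derivative_works)
  qed
  have dR: "((\<lambda>y. R y b \<bullet> c) has_derivative
      (\<lambda>h. - (\<Sum>d\<in>Basis. \<Sum>e\<in>Basis. (R y b \<bullet> d) * (frechet_derivative (m d e) (at y) h * (R y e \<bullet> c))))) (at y)"
    if y: "y \<in> V" for b c y
  proof -
    \<comment> \<open>Writing \<open>R y b - R x b\<close> as \<open>R x\<close> applied to
      \<open>M (\<Theta> x) (R y b) - b\<close> puts every increment into the entries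
      \<open>m d e\<close>; this is the identity behind the derivative -R M' R of an inverse. The
      factor \<open>m d e x - m d e y\<close> vanishes at \<open>x = y\<close>, so continuity of
      \<open>R\<close> suffices to differentiate.\<close>
    have eq: "R y b \<bullet> c - (\<Sum>d\<in>Basis. \<Sum>e\<in>Basis. (R y b \<bullet> d) * ((m d e x - m d e y) * (R x e \<bullet> c))) = R x b \<bullet> c"
      if x: "x \<in> V" for x
    proof -
      let ?w = "M (\<Theta> x) (R y b) - b"
      have "R x ?w = R y b - R x b"
        by (simp add: blinfun.diff_right RM[OF x])
      moreover have "?w \<bullet> e = (\<Sum>d\<in>Basis. (R y b \<bullet> d) * (m d e x - m d e y))" for e
      proof -
        have "M (\<Theta> z) (R y b) \<bullet> e = (\<Sum>d\<in>Basis. (R y b \<bullet> d) * m d e z)" if "z \<in> V" for z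
          by (subst has_derivative_linear_expand[OF bounded_linear.linear[OF blinfun.bounded_linear_right]]) (simp add: inner_sum_left m[OF that])
        from this[OF x] this[OF y] show ?thesis
          by (simp add: inner_diff_left RM[OF y] right_diff_distrib sum_subtractf)
      qed
      moreover have "R x ?w \<bullet> c = (\<Sum>e\<in>Basis. (?w \<bullet> e) * (R x e \<bullet> c))"
        by (subst has_derivative_linear_expand[OF bounded_linear.linear[OF blinfun.bounded_linear_right]]) (simp add: inner_sum_left)
      ultimately have "(R y b - R x b) \<bullet> c = (\<Sum>e\<in>Basis. \<Sum>d\<in>Basis. (R y b \<bullet> d) * (m d e x - m d e y) * (R x e \<bullet> c))"
        by (simp add: sum_distrib_right)
      also have "\<dots> = (\<Sum>d\<in>Basis. \<Sum>e\<in>Basis. (R y b \<bullet> d) * ((m d e x - m d e y) * (R x e \<bullet> c)))"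
        by (subst sum.swap) (simp add: mult.assoc)
      finally show ?thesis by (simp add: inner_diff_left)
    qed
    have "((\<lambda>x. (m d e x - m d e y) * (R x e \<bullet> c)) has_derivative
        (\<lambda>h. frechet_derivative (m d e) (at y) h * (R y e \<bullet> c))) (at y)" for d e
    proof (rule has_derivative_mult_vanishing)
      show "((\<lambda>x. m d e x - m d e y) has_derivative frechet_derivative (m d e) (at y)) (at y)"
        using has_derivative_diff[OF dm[OF y] has_derivative_const] by simp
    qed (use contr y in auto)
    then have "((\<lambda>x. R y b \<bullet> c - (\<Sum>d\<in>Basis. \<Sum>e\<in>Basis. (R y b \<bullet> d) * ((m d e x - m d e y) * (R x e \<bullet> c)))) has_derivative
      (\<lambda>h. 0 - (\<Sum>d\<in>Basis. \<Sum>e\<in>Basis. (R y b \<bullet> d) * (frechet_derivative (m d e) (at y) h * (R y e \<bullet> c))))) (at y)"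
      by (intro has_derivative_diff has_derivative_const has_derivative_sum has_derivative_mult_right)
    from has_derivative_transform_within_open[OF this T(4) y eq] show ?thesis by simp
  qed
  \<comment> \<open>The two claims rise together: order k of \<open>R\<close> gives order k + 1 of
    \<open>\<Theta>\<close>, whose derivative is \<open>R\<close>; then \<open>m d e\<close> has
    order k + 1, and \<open>dR\<close> raises \<open>R\<close>.\<close>
  have *: "Ckv_on k V \<Theta> \<and> (\<forall>b c. Ck_on k V (\<lambda>y. R y b \<bullet> c))" for k
  proof (induction k)
    case 0
    have "continuous_on V (\<lambda>y. R y b \<bullet> c)" for b c
      using contr by (simp add: continuous_at_imp_continuous_on)
    then show ?case using cont\<Theta> unfolding Ckv_on_def by (auto intro!: continuous_intros)
  next
    case (Suc k)
    have "Ck_on (Suc k) V (\<lambda>y. \<Theta> y \<bullet> c)" for c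
    proof (rule Ck_on_SucI[OF T(4)])
      show "((\<lambda>y. \<Theta> y \<bullet> c) has_derivative (\<lambda>h. R y h \<bullet> c)) (at y)" if "y \<in> V" for y
        using has_derivative_inner_left[OF g'(1)[OF that], of c] R[OF that] by simp
    qed (use Suc in auto)
    then have 1: "Ckv_on (Suc k) V \<Theta>" unfolding Ckv_on_def by blast
    have "Ck_on (Suc k) V (m d e)" for d e
      unfolding m_def
      by (rule Ck_on_compose[OF T(4) assms(1) _ 1]) (use smcomp \<Theta>U in \<open>auto simp: smooth_on_def simp del: Ck_on.simps\<close>)
    then have 2: "Ck_on k V (\<lambda>y. frechet_derivative (m d e) (at y) v)" for d e v
      using Ck_on_SucD(2) by blast
    have "Ck_on (Suc k) V (\<lambda>y. R y b \<bullet> c)" for b c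
      by (rule Ck_on_SucI[OF T(4) dR])
         (use Suc 2 T(4) in \<open>auto intro!: Ck_on_minus Ck_on_sum Ck_on_mult\<close>)
    then show ?case using 1 by blast
  qed
  then have "smoothv_on V \<Theta>" unfolding smoothv_on_def smooth_on_def Ckv_on_def by blast
  then show ?thesis using that T hom by blast
qed

section \<open>Hyperbolic space and horospheres\<close>

lemma mink_eq: "mink X Y = fst X \<bullet> fst Y - snd X * snd Y"
  by (simp add: mink_def inner_vec_def)

lemma mink_commute: "mink X Y = mink Y X"
  by (simp add: mink_eq inner_commute)

lemma mink_simps [simp]:
  "mink (X + Y) Z = mink X Z + mink Y Z" "mink Z (X + Y) = mink Z X + mink Z Y"
  "mink (X - Y) Z = mink X Z - mink Y Z" "mink Z (X - Y) = mink Z X - mink Z Y"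
  "mink (c *\<^sub>R X) Z = c * mink X Z" "mink Z (c *\<^sub>R X) = c * mink Z X"
  "mink (- X) Z = - mink X Z" "mink Z (- X) = - mink Z X"
  "mink 0 Z = 0" "mink Z 0 = 0"
  by (simp_all add: mink_eq algebra_simps inner_diff_left inner_diff_right)

lemma bounded_bilinear_mink: "bounded_bilinear mink"
  unfolding bilinear_conv_bounded_bilinear[symmetric] bilinear_def
  by (intro conjI allI linearI) simp_all

lemmas continuous_on_mink [continuous_intros] = bounded_bilinear.continuous_on[OF bounded_bilinear_mink]
lemmas isCont_mink [continuous_intros] = bounded_bilinear.isCont[OF bounded_bilinear_mink]
lemmas tendsto_mink [tendsto_intros] = bounded_bilinear.tendsto[OF bounded_bilinear_mink]
lemmas has_derivative_mink [derivative_intros] = bounded_bilinear.FDERIV[OF bounded_bilinear_mink]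

text \<open>For unit \<open>z\<close> this is, on hyperbolic space, the exponential of the Busemann
  function of the ideal point \<open>z\<close>; its level sets are the horospheres centred at
  \<open>z\<close>.\<close>

definition horo :: "'m::finite minkowski \<Rightarrow> real ^ 'm \<Rightarrow> real" where
  "horo X z = snd X - fst X \<bullet> z"

lemma mink_horo [simp]: "mink X (z, 1) = - horo X z" "mink (z, 1) X = - horo X z"
  by (simp_all add: mink_eq horo_def inner_commute)

lemma horo_simps [simp]:
  "horo (X + Y) z = horo X z + horo Y z" "horo (X - Y) z = horo X z - horo Y z"
  "horo (c *\<^sub>R X) z = c * horo X z"
  by (simp_all add: horo_def algebra_simps inner_diff_left)

lemma continuous_on_horo [continuous_intros]:
  "continuous_on S f \<Longrightarrow> continuous_on S g \<Longrightarrow> continuous_on S (\<lambda>x. horo (f x) (g x))"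
  unfolding horo_def by (intro continuous_intros)

lemma hyp_spaceD:
  assumes "X \<in> hyp_space"
  shows "mink X X = -1" "snd X > 0" "snd X = sqrt (1 + (norm (fst X))\<^sup>2)" "norm (fst X) < snd X"
proof -
  show 1: "mink X X = -1" "snd X > 0" using assms by (auto simp: hyp_space_def)
  have "(snd X)\<^sup>2 = 1 + (norm (fst X))\<^sup>2"
    using 1 unfolding mink_eq power2_norm_eq_inner power2_eq_square[of "snd X"] by linarith
  then show "snd X = sqrt (1 + (norm (fst X))\<^sup>2)" using 1 by (metis real_sqrt_unique less_imp_le)
  then show "norm (fst X) < snd X"
    by (metis norm_ge_zero real_less_rsqrt less_add_same_cancel2 zero_less_one)
qed

lemma hyp_spaceI: "snd X = sqrt (1 + (norm (fst X))\<^sup>2) \<Longrightarrow> X \<in> hyp_space"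
proof -
  assume a: "snd X = sqrt (1 + (norm (fst X))\<^sup>2)"
  then have "(snd X)\<^sup>2 = 1 + (norm (fst X))\<^sup>2" by (simp add: add_nonneg_nonneg)
  moreover have "snd X > 0" unfolding a by (simp add: add_pos_nonneg)
  ultimately show ?thesis
    unfolding hyp_space_def mem_Collect_eq mink_eq power2_norm_eq_inner power2_eq_square[of "snd X"] by linarith
qed

lemma closed_hyp_space: "closed (hyp_space :: 'm::finite minkowski set)"
proof -
  have eq: "hyp_space = {X :: 'm minkowski. snd X = sqrt (1 + (norm (fst X))\<^sup>2)}"
    using hyp_spaceD(3) hyp_spaceI by auto
  show ?thesis unfolding eq by (intro closed_Collect_eq continuous_intros)
qed

lemma inner_le_norm_unit: "norm z = 1 \<Longrightarrow> \<bar>x \<bullet> z\<bar> \<le> norm x"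
  using Cauchy_Schwarz_ineq2[of x z] by simp

lemma horo_pos: "X \<in> hyp_space \<Longrightarrow> norm z = 1 \<Longrightarrow> horo X z > 0"
  using hyp_spaceD(4)[of X] inner_le_norm_unit[of z "fst X"] by (simp add: horo_def)

text \<open>Compares Euclidean and Minkowski length on a tangent space of hyperbolic space:
  orthogonality expresses \<open>snd v * snd X\<close> as an inner product, and Cauchy-Schwarz does
  the rest. Definiteness and compactness of unit tangent spheres both rest on it.\<close>

lemma mink_orthogonal_bound:
  assumes "X \<in> hyp_space" "mink v X = 0"
  shows "(norm v)\<^sup>2 \<le> 2 * (snd X)\<^sup>2 * mink v v"
proof -
  let ?x = "fst X" let ?t = "snd X"
  have t: "?t > 0" "?t\<^sup>2 = 1 + (norm ?x)\<^sup>2"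
    using hyp_spaceD[OF assms(1)] by (auto simp: add_nonneg_nonneg)
  have "(snd v * ?t)\<^sup>2 \<le> (norm (fst v))\<^sup>2 * (norm ?x)\<^sup>2"
    using assms(2) Cauchy_Schwarz_ineq[of "fst v" ?x]
    by (simp add: mink_eq power2_norm_eq_inner)
  then have 1: "(snd v)\<^sup>2 * ?t\<^sup>2 \<le> (norm (fst v))\<^sup>2 * (norm ?x)\<^sup>2" by (simp add: power_mult_distrib)
  have m: "mink v v = (norm (fst v))\<^sup>2 - (snd v)\<^sup>2"
    by (simp add: mink_eq power2_norm_eq_inner power2_eq_square[of "snd v"])
  have n: "(norm v)\<^sup>2 = (norm (fst v))\<^sup>2 + (snd v)\<^sup>2"
    by (simp add: norm_prod_def)
  have 2: "?t\<^sup>2 * mink v v \<ge> (norm (fst v))\<^sup>2"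
    using 1 t(2) by (simp add: m algebra_simps)
  have "?t\<^sup>2 * mink v v \<ge> (snd v)\<^sup>2"
  proof -
    have "(snd v)\<^sup>2 \<le> (norm (fst v))\<^sup>2"
    proof -
      have "(snd v)\<^sup>2 * ?t\<^sup>2 \<le> (norm (fst v))\<^sup>2 * ?t\<^sup>2"
        using 1 t(2) by (simp add: algebra_simps add_increasing)
      then show ?thesis using t(1) by simp
    qed
    then show ?thesis using 2 by simp
  qed
  then show ?thesis using 2 n by simp
qed

lemma mink_orthogonal_nonneg: "X \<in> hyp_space \<Longrightarrow> mink v X = 0 \<Longrightarrow> mink v v \<ge> 0"
  using mink_orthogonal_bound[of X v] hyp_spaceD(2)[of X]
  by (smt (verit, best) mult_nonneg_nonneg mult_pos_neg zero_le_power2 zero_less_power)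

lemma mink_orthogonal_eq_0: "X \<in> hyp_space \<Longrightarrow> mink v X = 0 \<Longrightarrow> mink v v = 0 \<Longrightarrow> v = 0"
  using mink_orthogonal_bound[of X v] by simp

lemma mink_orthogonal_pos: "X \<in> hyp_space \<Longrightarrow> mink v X = 0 \<Longrightarrow> v \<noteq> 0 \<Longrightarrow> mink v v > 0"
  using mink_orthogonal_nonneg[of X v] mink_orthogonal_eq_0[of X v] by force

lemma timelike_normalise:
  assumes "mink T T < 0" "snd T > 0"
  shows "(1 / sqrt (- mink T T)) *\<^sub>R T \<in> hyp_space"
  using assms by (simp add: hyp_space_def field_simps)

lemma mink_timelike_orthogonal_nonneg:
  assumes "mink T T < 0" "snd T > 0" "mink U T = 0"
  shows "mink U U \<ge> 0"
  using mink_orthogonal_nonneg[OF timelike_normalise[OF assms(1,2)], of U] assms(3) by simp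

text \<open>The component of \<open>Y\<close> orthogonal to \<open>X\<close> is spacelike, and its
  Minkowski square is \<open>(mink X Y)\<^sup>2 - 1\<close>.\<close>

lemma hyp_mink_le: "X \<in> hyp_space \<Longrightarrow> Y \<in> hyp_space \<Longrightarrow> mink X Y \<le> - 1"
  and hyp_mink_eq_imp: "X \<in> hyp_space \<Longrightarrow> Y \<in> hyp_space \<Longrightarrow> mink X Y = - 1 \<Longrightarrow> X = Y"
proof -
  assume X: "X \<in> hyp_space" and Y: "Y \<in> hyp_space"
  let ?v = "Y + mink X Y *\<^sub>R X"
  note XX = hyp_spaceD(1)[OF X] and YY = hyp_spaceD(1)[OF Y]
  have o: "mink ?v X = 0" using XX by (simp add: mink_commute[of Y X])
  have vv: "mink ?v ?v = (mink X Y)\<^sup>2 - 1"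
    using XX YY by (simp add: mink_commute[of Y X] power2_eq_square)
  have neg: "mink X Y < 0"
  proof -
    have "fst X \<bullet> fst Y \<le> norm (fst X) * norm (fst Y)" by (rule norm_cauchy_schwarz)
    also have "\<dots> < snd X * snd Y"
      using hyp_spaceD(4)[OF X] hyp_spaceD(4)[OF Y] by (intro mult_strict_mono') auto
    finally show ?thesis by (simp add: mink_eq)
  qed
  have "(mink X Y)\<^sup>2 \<ge> 1" using mink_orthogonal_nonneg[OF X o] vv by simp
  then show "mink X Y \<le> - 1" using neg
    by (metis abs_le_square_iff abs_one abs_of_neg le_minus_iff power_one)
  show "X = Y" if "mink X Y = - 1"
    using mink_orthogonal_eq_0[OF X o] vv that by simp
qed

section \<open>Sets cut out by a horospherical majorant\<close>

text \<open>The horospherical analogue of the Wulff shape of \<phi>.\<close>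

definition horo_hull :: "(real ^ 'm::finite \<Rightarrow> real) \<Rightarrow> 'm minkowski set" where
  "horo_hull \<phi> = {X \<in> hyp_space. \<forall>z\<in>sphere 0 1. horo X z \<le> \<phi> z}"

lemma horoball_iff: "norm z = 1 \<Longrightarrow> X \<in> horoball z s \<longleftrightarrow> X \<in> hyp_space \<and> horo X z \<le> exp s"
  using horo_pos[of X z] by (auto simp: horoball_def) (metis exp_le_cancel_iff exp_ln)+

lemma hyp_bounded_iff:
  assumes "\<Omega> \<subseteq> hyp_space"
  shows "hyp_bounded \<Omega> \<longleftrightarrow> bounded \<Omega>"
proof
  assume "hyp_bounded \<Omega>"
  then obtain C where C: "\<And>X Y. X \<in> \<Omega> \<Longrightarrow> Y \<in> \<Omega> \<Longrightarrow> arcosh (- mink X Y) \<le> C"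
    by (auto simp: hyp_bounded_def hyp_dist_def)
  show "bounded \<Omega>"
  proof (cases "\<Omega> = {}")
    case False
    then obtain Y where Y: "Y \<in> \<Omega>" by blast
    then have Yh: "Y \<in> hyp_space" using assms by blast
    \<comment> \<open>Positive because \<open>Y\<close> is timelike; it turns a bound on
      \<open>- mink X Y\<close> into the bound \<open>cosh C / d\<close> on
      \<open>snd X\<close>.\<close>
    define d where "d = snd Y - norm (fst Y)"
    have d: "d > 0" using hyp_spaceD(4)[OF Yh] by (simp add: d_def)
    have "norm X \<le> 2 * (cosh C / d)" if X: "X \<in> \<Omega>" for X
    proof -
      have Xh: "X \<in> hyp_space" using X assms by blast
      have ge1: "- mink X Y \<ge> 1" using hyp_mink_le[OF Xh Yh] by simp
      have "- mink X Y = cosh (arcosh (- mink X Y))" using ge1 by (simp add: cosh_arcosh_real)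
      also have "\<dots> \<le> cosh C"
        using C[OF X Y] ge1 by (metis cosh_real_nonneg_le_iff arcosh_nonneg_real order_trans)
      finally have "snd X * snd Y \<le> cosh C + fst X \<bullet> fst Y" by (simp add: mink_eq)
      also have "fst X \<bullet> fst Y \<le> snd X * norm (fst Y)"
        using norm_cauchy_schwarz[of "fst X" "fst Y"] hyp_spaceD(4)[OF Xh]
        by (smt (verit) mult_right_mono norm_ge_zero)
      finally have "snd X * d \<le> cosh C" by (simp add: d_def algebra_simps)
      then have "snd X \<le> cosh C / d" using d by (simp add: field_simps)
      moreover have "norm X \<le> norm (fst X) + norm (snd X)"
        using norm_Pair_le[of "fst X" "snd X"] by simp
      ultimately show ?thesis using hyp_spaceD(2,4)[OF Xh] by simp
    qed
    then show ?thesis unfolding bounded_iff by blast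
  qed simp
next
  assume "bounded \<Omega>"
  then obtain B where B: "\<And>X. X \<in> \<Omega> \<Longrightarrow> norm X \<le> B" by (auto simp: bounded_iff)
  obtain K where K: "K > 0" "\<And>X Y :: 'a minkowski. norm (mink X Y) \<le> norm X * norm Y * K"
    using bounded_bilinear.pos_bounded[OF bounded_bilinear_mink] by blast
  have "arcosh (- mink X Y) \<le> arcosh (max 1 (B * B * K))" if "X \<in> \<Omega>" "Y \<in> \<Omega>" for X Y
  proof -
    have "- mink X Y \<ge> 1" using hyp_mink_le[of X Y] assms that by auto
    moreover have "- mink X Y \<le> B * B * K"
    proof -
      have "norm X * norm Y * K \<le> B * B * K"
        using B[OF that(1)] B[OF that(2)] K(1) norm_ge_zero[of X] by (intro mult_right_mono mult_mono) (auto intro: order_trans[OF norm_ge_zero])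
      then show ?thesis using K(2)[of X Y] by simp
    qed
    moreover have "arcosh m \<le> arcosh M" if "1 \<le> m" "m \<le> M" for m M :: real
      using that arcosh_less_iff_real[of M m] by (simp add: not_less[symmetric])
    ultimately show ?thesis by simp
  qed
  then show "hyp_bounded \<Omega>" unfolding hyp_bounded_def hyp_dist_def by blast
qed

lemma bounded_horo_bdd:
  assumes "bounded \<Omega>" "norm z = 1"
  shows "\<exists>B. \<forall>X\<in>\<Omega>. horo X z \<le> B"
proof -
  obtain B where B: "\<And>X. X \<in> \<Omega> \<Longrightarrow> norm X \<le> B" using assms(1) by (auto simp: bounded_iff)
  have "horo X z \<le> B + B" if "X \<in> \<Omega>" for X
  proof -
    have "norm (fst X) \<le> norm X" "norm (snd X) \<le> norm X"
      by (metis norm_fst_le prod.collapse, metis norm_snd_le prod.collapse)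
    then show ?thesis
      using B[OF that] inner_le_norm_unit[OF assms(2), of "fst X"] by (simp add: horo_def)
  qed
  then show ?thesis by blast
qed

lemma horo_support_max:
  assumes "\<Omega> \<subseteq> hyp_space" "X \<in> \<Omega>" "\<And>Y. Y \<in> \<Omega> \<Longrightarrow> horo Y z \<le> horo X z" "norm z = 1"
  shows "exp (horo_support \<Omega> z) = horo X z"
proof -
  have "(SUP Y\<in>\<Omega>. ln (- mink Y (z, 1))) = ln (horo X z)"
  proof (rule cSup_eq_maximum)
    fix x assume "x \<in> (\<lambda>Y. ln (- mink Y (z, 1))) ` \<Omega>"
    then obtain Y where Y: "Y \<in> \<Omega>" "x = ln (horo Y z)" by auto
    then show "x \<le> ln (horo X z)" using assms(3)[of Y] horo_pos[of Y z] assms(1,4) by (auto intro!: ln_mono)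
  qed (use assms in auto)
  then show ?thesis using horo_pos[of X z] assms by (auto simp: horo_support_def)
qed

text \<open>The source of uniqueness: a domain is recovered from its support function. The
  horo-balls of the defining family need not touch the domain, but each of them contains the
  touching one with the same centre.\<close>

lemma hconvex_eq_horo_hull:
  assumes "hconvex_bounded_domain \<Omega>"
  shows "\<Omega> = horo_hull (\<lambda>z. exp (horo_support \<Omega> z))"
proof -
  obtain F where ne: "\<Omega> \<noteq> {}" and hb: "hyp_bounded \<Omega>" and F: "F \<subseteq> sphere 0 1 \<times> UNIV"
    and \<Omega>: "\<Omega> = hyp_space \<inter> (\<Inter>(z, s)\<in>F. horoball z s)"
    using assms by (auto simp: hconvex_bounded_domain_def)
  have sub: "\<Omega> \<subseteq> hyp_space" using \<Omega> by blast
  have bd: "bounded \<Omega>" using hyp_bounded_iff[OF sub] hb by blast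
  have up: "horo X z \<le> exp (horo_support \<Omega> z)" if "X \<in> \<Omega>" "norm z = 1" for X z
  proof -
    have z: "norm z = 1" by (rule that)
    obtain B where B: "\<And>X. X \<in> \<Omega> \<Longrightarrow> horo X z \<le> B" using bounded_horo_bdd[OF bd z] by blast
    have "bdd_above ((\<lambda>Y. ln (- mink Y (z, 1))) ` \<Omega>)"
      unfolding bdd_above_def using B horo_pos[OF _ z] sub
      by (intro exI[of _ "ln B"]) (auto intro!: ln_mono dest: subsetD)
    then have "ln (- mink X (z, 1)) \<le> horo_support \<Omega> z"
      unfolding horo_support_def using that by (intro cSUP_upper) auto
    then show ?thesis using horo_pos[of X z] that sub
      by (metis exp_le_cancel_iff exp_ln mink_horo(1) minus_minus subsetD)
  qed
  have low: "exp (horo_support \<Omega> z) \<le> exp s" if "(z, s) \<in> F" for z s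
  proof -
    have "horo_support \<Omega> z \<le> s" unfolding horo_support_def
      by (rule cSUP_least[OF ne]) (use \<Omega> that in \<open>auto simp: horoball_def\<close>)
    then show ?thesis by simp
  qed
  show ?thesis
  proof
    show "\<Omega> \<subseteq> horo_hull (\<lambda>z. exp (horo_support \<Omega> z))" using up sub by (auto simp: horo_hull_def)
    show "horo_hull (\<lambda>z. exp (horo_support \<Omega> z)) \<subseteq> \<Omega>"
    proof
      fix X assume X: "X \<in> horo_hull (\<lambda>z. exp (horo_support \<Omega> z))"
      then have Xh: "X \<in> hyp_space" by (simp add: horo_hull_def)
      have "X \<in> horoball z s" if zs: "(z, s) \<in> F" for z s
      proof -
        have z: "norm z = 1" using F zs by auto
        then have "horo X z \<le> exp (horo_support \<Omega> z)" using X by (simp add: horo_hull_def)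
        then show ?thesis using low[OF zs] horoball_iff[OF z, of X s] Xh by linarith
      qed
      then show "X \<in> \<Omega>" using Xh \<Omega> by auto
    qed
  qed
qed

lemma bounded_horo_hull:
  fixes \<phi> :: "real ^ 'm::finite \<Rightarrow> real"
  assumes "\<And>z. norm z = 1 \<Longrightarrow> \<phi> z \<le> B"
  shows "bounded (horo_hull \<phi>)"
proof -
  obtain z :: "real ^ 'm" where z: "norm z = 1" using vector_choose_size[of 1] by auto
  have "norm X \<le> B + B" if "X \<in> horo_hull \<phi>" for X
  proof -
    have h: "X \<in> hyp_space" "horo X z \<le> B" "horo X (- z) \<le> B"
      using that assms[of z] assms[of "- z"] z by (auto simp: horo_hull_def intro: order_trans)
    \<comment> \<open>Opposite directions add up:
      \<open>horo X z + horo X (- z) = 2 * snd X\<close>.\<close>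
    then have "snd X \<le> B" by (simp add: horo_def)
    then show ?thesis
      using norm_Pair_le[of "fst X" "snd X"] hyp_spaceD(2,4)[OF h(1)] by simp
  qed
  then show ?thesis unfolding bounded_iff by blast
qed

lemma closed_horo_hull: "closed (horo_hull \<phi>)"
proof -
  have "horo_hull \<phi> = hyp_space \<inter> (\<Inter>z\<in>sphere 0 1. {X. horo X z \<le> \<phi> z})"
    by (auto simp: horo_hull_def)
  then show ?thesis
    by (auto intro!: closed_Int closed_hyp_space closed_INT closed_Collect_le continuous_intros)
qed

text \<open>The constant \<open>c\<close> is uniform in \<open>z0\<close> while the contact point
  \<open>X\<close> varies. The value \<open>c = 0\<close> is attainment alone, as for a single
  point; a positive \<open>c\<close> makes the maximum over \<open>z\<close> nondegenerate.\<close>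

definition supported :: "real \<Rightarrow> (real ^ 'm::finite \<Rightarrow> real) \<Rightarrow> bool" where
  "supported c \<phi> \<longleftrightarrow> (\<forall>z0. norm z0 = 1 \<longrightarrow> (\<exists>X\<in>hyp_space. horo X z0 = \<phi> z0 \<and>
      (\<forall>z. norm z = 1 \<longrightarrow> \<phi> z \<ge> horo X z + c * (norm (z - z0))\<^sup>2)))"

lemma supportedE:
  assumes "supported c \<phi>" "c \<ge> 0" "norm z0 = 1"
  obtains X where "X \<in> horo_hull \<phi>" "horo X z0 = \<phi> z0" 
    "\<And>z. norm z = 1 \<Longrightarrow> \<phi> z \<ge> horo X z + c * (norm (z - z0))\<^sup>2"
proof -
  obtain X where X: "X \<in> hyp_space" "horo X z0 = \<phi> z0"
    "\<And>z. norm z = 1 \<Longrightarrow> \<phi> z \<ge> horo X z + c * (norm (z - z0))\<^sup>2"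
    using assms unfolding supported_def by blast
  moreover have "X \<in> horo_hull \<phi>"
    unfolding horo_hull_def using X
    by auto (smt (verit) X(3) assms(2) mult_nonneg_nonneg zero_le_power2)
  ultimately show ?thesis using that by blast
qed

lemma horo_hull_supported:
  fixes \<phi> :: "real ^ 'm::finite \<Rightarrow> real"
  assumes "supported c \<phi>" "c \<ge> 0" "\<And>z. norm z = 1 \<Longrightarrow> \<phi> z \<le> B"
  shows "hconvex_bounded_domain (horo_hull \<phi>)"
    and "norm z = 1 \<Longrightarrow> exp (horo_support (horo_hull \<phi>) z) = \<phi> z"
proof -
  have pos: "\<phi> z > 0" if z: "norm z = 1" for z
    using supportedE[OF assms(1,2) z] horo_pos[OF _ z] by (metis (no_types, lifting) horo_hull_def mem_Collect_eq)
  show "hconvex_bounded_domain (horo_hull \<phi>)"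
    unfolding hconvex_bounded_domain_def
  proof (intro conjI)
    obtain z :: "real ^ 'm" where z: "norm z = 1" using vector_choose_size[of 1] by auto
    show "horo_hull \<phi> \<noteq> {}" using supportedE[OF assms(1,2) z] by blast
    show "hyp_bounded (horo_hull \<phi>)"
      using hyp_bounded_iff[of "horo_hull \<phi>"] bounded_horo_hull[of \<phi> B] assms(3) by (auto simp: horo_hull_def)
    have "horo_hull \<phi> = hyp_space \<inter> (\<Inter>(z, s)\<in>(\<lambda>z. (z, ln (\<phi> z))) ` sphere 0 1. horoball z s)"
      using pos by (auto simp: horo_hull_def horoball_iff)
    then show "\<exists>F\<subseteq>sphere 0 1 \<times> UNIV. horo_hull \<phi> = hyp_space \<inter> (\<Inter>(z, s)\<in>F. horoball z s)"
      by (intro exI[of _ "(\<lambda>z. (z, ln (\<phi> z))) ` sphere 0 1"]) auto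
  qed
  show "exp (horo_support (horo_hull \<phi>) z) = \<phi> z" if z: "norm z = 1"
  proof -
    obtain X where X: "X \<in> horo_hull \<phi>" "horo X z = \<phi> z" using supportedE[OF assms(1,2) z] by blast
    show ?thesis
      using horo_support_max[of "horo_hull \<phi>" X z] X z by (auto simp: horo_hull_def)
  qed
qed


section \<open>Power means\<close>

lemma powr_mean_le:
  fixes x y t \<mu> \<nu> :: real
  assumes "t \<ge> 1" "x > 0" "y > 0" "\<mu> \<ge> 0" "\<nu> \<ge> 0" "\<mu> + \<nu> = 1"
  shows "(\<mu> * x + \<nu> * y) powr t \<le> \<mu> * x powr t + \<nu> * y powr t"
  using convex_onD[OF powr_convex[OF assms(1)], of \<nu> x y] assms
  by (simp add: eq_diff_eq[symmetric])

lemma powr_mean_pos: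
  fixes x y \<mu> \<nu> :: real
  assumes "x > 0" "y > 0" "\<mu> \<ge> 0" "\<nu> \<ge> 0" "\<mu> + \<nu> = 1"
  shows "\<mu> * x + \<nu> * y > 0"
  using assms by (cases "\<mu> = 0") (auto intro: add_pos_nonneg)

text \<open>The triangle inequality for the weighted planar vectors \<open>(s1, C1)\<close> and
  \<open>(s2, C2)\<close>. The term \<open>G\<close> takes the place of \<open>C1 * C2\<close>
  because the spacelike vectors of lengths \<open>C1\<close>, \<open>C2\<close> that it will pair
  need not be parallel.\<close>

lemma minkowski_sqrt:
  fixes \<mu> \<nu> s1 s2 C1 C2 G :: real
  assumes "\<mu> \<ge> 0" "\<nu> \<ge> 0" "s1 \<ge> 0" "s2 \<ge> 0" "C1 \<ge> 0" "C2 \<ge> 0" "G \<le> C1 * C2"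
  shows "(\<mu> * s1 + \<nu> * s2)\<^sup>2 + (\<mu>\<^sup>2 * C1\<^sup>2 + 2 * \<mu> * \<nu> * G + \<nu>\<^sup>2 * C2\<^sup>2)
    \<le> (\<mu> * sqrt (s1\<^sup>2 + C1\<^sup>2) + \<nu> * sqrt (s2\<^sup>2 + C2\<^sup>2))\<^sup>2"
proof -
  have "(s1 * s2 + C1 * C2)\<^sup>2 \<le> (s1\<^sup>2 + C1\<^sup>2) * (s2\<^sup>2 + C2\<^sup>2)"
    using zero_le_power2[of "s1 * C2 - s2 * C1"] by (simp add: power2_eq_square algebra_simps)
  then have "s1 * s2 + C1 * C2 \<le> sqrt (s1\<^sup>2 + C1\<^sup>2) * sqrt (s2\<^sup>2 + C2\<^sup>2)"
    by (simp add: real_le_rsqrt flip: real_sqrt_mult)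
  then have "2 * \<mu> * \<nu> * (s1 * s2 + G) \<le> 2 * \<mu> * \<nu> * (sqrt (s1\<^sup>2 + C1\<^sup>2) * sqrt (s2\<^sup>2 + C2\<^sup>2))"
    using assms by (intro mult_left_mono) auto
  moreover have "(\<mu> * sqrt (s1\<^sup>2 + C1\<^sup>2) + \<nu> * sqrt (s2\<^sup>2 + C2\<^sup>2))\<^sup>2 = \<mu>\<^sup>2 * (s1\<^sup>2 + C1\<^sup>2) + \<nu>\<^sup>2 * (s2\<^sup>2 + C2\<^sup>2)
     + 2 * \<mu> * \<nu> * (sqrt (s1\<^sup>2 + C1\<^sup>2) * sqrt (s2\<^sup>2 + C2\<^sup>2))"
    by (simp add: power2_sum power_mult_distrib algebra_simps)
  ultimately show ?thesis by (simp add: power2_sum power_mult_distrib algebra_simps)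
qed

text \<open>The origin of the range of \<open>p\<close>. For \<open>p \<le> 1\<close>, Jensen with
  exponent \<open>2 * p \<ge> 1\<close> passes to square roots, the triangle inequality separates
  the two parts, and exponent \<open>1 / p\<close> treats \<open>s1\<close>, \<open>s2\<close>. For
  \<open>p > 1\<close>, Jensen with exponents \<open>p\<close> and \<open>2 / p \<ge> 1\<close>
  reduces everything to convexity of the square.\<close>

lemma power_mean_minkowski:
  fixes p \<mu> \<nu> s1 s2 C1 C2 G :: real
  assumes "1 / 2 \<le> p" "p \<le> 2" "\<mu> \<ge> 0" "\<nu> \<ge> 0" "\<mu> + \<nu> = 1" "s1 > 0" "s2 > 0"
    "C1 \<ge> 0" "C2 \<ge> 0" "G \<le> C1 * C2"
  shows "(\<mu> * s1 powr p + \<nu> * s2 powr p) powr (2 / p) + (\<mu>\<^sup>2 * C1\<^sup>2 + 2 * \<mu> * \<nu> * G + \<nu>\<^sup>2 * C2\<^sup>2)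
    \<le> (\<mu> * (s1\<^sup>2 + C1\<^sup>2) powr p + \<nu> * (s2\<^sup>2 + C2\<^sup>2) powr p) powr (1 / p)"
proof -
  define A B where "A = s1\<^sup>2 + C1\<^sup>2" and "B = s2\<^sup>2 + C2\<^sup>2"
  have AB: "A > 0" "B > 0" unfolding A_def B_def using assms by (simp_all add: add_pos_nonneg)
  have pos: "\<mu> * x + \<nu> * y > 0" if "x > 0" "y > 0" for x y using powr_mean_pos that assms by blast
  have p: "p > 0" using assms by simp
  show ?thesis
  proof (cases "p \<le> 1")
    case True
    have "(\<mu> * sqrt A + \<nu> * sqrt B) powr (2 * p) \<le> \<mu> * sqrt A powr (2 * p) + \<nu> * sqrt B powr (2 * p)"
      using assms AB by (intro powr_mean_le) auto
    also have "\<dots> = \<mu> * A powr p + \<nu> * B powr p"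
      using AB by (simp add: powr_half_sqrt[symmetric] powr_powr)
    finally have "((\<mu> * sqrt A + \<nu> * sqrt B) powr (2 * p)) powr (1 / p) \<le> (\<mu> * A powr p + \<nu> * B powr p) powr (1 / p)"
      using p by (intro powr_mono2) auto
    moreover have "((\<mu> * sqrt A + \<nu> * sqrt B) powr (2 * p)) powr (1 / p) = (\<mu> * sqrt A + \<nu> * sqrt B)\<^sup>2"
      using p pos[of "sqrt A" "sqrt B"] AB by (simp add: powr_powr)
    moreover have "(\<mu> * s1 powr p + \<nu> * s2 powr p) powr (2 / p) \<le> (\<mu> * s1 + \<nu> * s2)\<^sup>2"
    proof -
      have "(\<mu> * s1 powr p + \<nu> * s2 powr p) powr (1 / p) \<le> \<mu> * (s1 powr p) powr (1 / p) + \<nu> * (s2 powr p) powr (1 / p)"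
        using assms True by (intro powr_mean_le) auto
      also have "\<dots> = \<mu> * s1 + \<nu> * s2" using assms p by (simp add: powr_powr)
      finally have "((\<mu> * s1 powr p + \<nu> * s2 powr p) powr (1 / p))\<^sup>2 \<le> (\<mu> * s1 + \<nu> * s2)\<^sup>2"
        by (intro power_mono) auto
      moreover have "((\<mu> * s1 powr p + \<nu> * s2 powr p) powr (1 / p))\<^sup>2 = (\<mu> * s1 powr p + \<nu> * s2 powr p) powr (2 / p)"
        using pos[of "s1 powr p" "s2 powr p"] assms by (simp add: powr_powr flip: powr_numeral)
      ultimately show ?thesis by simp
    qed
    ultimately show ?thesis
      using minkowski_sqrt[of \<mu> \<nu> s1 s2 C1 C2 G] assms unfolding A_def B_def by simp
  next
    case False
    have "(\<mu> * A + \<nu> * B) powr p \<le> \<mu> * A powr p + \<nu> * B powr p"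
      using assms AB False by (intro powr_mean_le) auto
    then have "((\<mu> * A + \<nu> * B) powr p) powr (1 / p) \<le> (\<mu> * A powr p + \<nu> * B powr p) powr (1 / p)"
      using p by (intro powr_mono2) auto
    then have 1: "\<mu> * A + \<nu> * B \<le> (\<mu> * A powr p + \<nu> * B powr p) powr (1 / p)"
      using p pos[OF AB] by (simp add: powr_powr)
    have "(\<mu> * s1 powr p + \<nu> * s2 powr p) powr (2 / p) \<le> \<mu> * (s1 powr p) powr (2 / p) + \<nu> * (s2 powr p) powr (2 / p)"
      using assms p by (intro powr_mean_le) auto
    also have "\<dots> = \<mu> * s1\<^sup>2 + \<nu> * s2\<^sup>2" using assms p by (simp add: powr_powr)
    finally have 2: "(\<mu> * s1 powr p + \<nu> * s2 powr p) powr (2 / p) \<le> \<mu> * s1\<^sup>2 + \<nu> * s2\<^sup>2" .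
    have "\<mu>\<^sup>2 * C1\<^sup>2 + 2 * \<mu> * \<nu> * G + \<nu>\<^sup>2 * C2\<^sup>2 \<le> \<mu> * C1\<^sup>2 + \<nu> * C2\<^sup>2"
    proof -
      have n: "\<nu> = 1 - \<mu>" using assms by simp
      have "\<mu> * \<nu> * G \<le> \<mu> * \<nu> * (C1 * C2)" using assms by (intro mult_left_mono) auto
      moreover have "\<mu> * \<nu> * (C1 - C2)\<^sup>2 \<ge> 0" using assms by simp
      ultimately show ?thesis unfolding n by (simp add: power2_eq_square algebra_simps)
    qed
    then show ?thesis using 1 2 unfolding A_def B_def by (simp add: algebra_simps)
  qed
qed

section \<open>Two directions on the sphere and the Minkowski frame they span\<close>

lemma nonneg_quadratic_discriminant:
  fixes A B G :: real
  assumes "\<And>t. A + 2 * t * G + t\<^sup>2 * B \<ge> 0" "B \<ge> 0"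
  shows "G\<^sup>2 \<le> A * B"
proof (cases "B = 0")
  case True
  have "G = 0"
  proof (rule ccontr)
    assume "G \<noteq> 0"
    \<comment> \<open>With \<open>B = 0\<close> the expression is affine in \<open>t\<close>; at
      this \<open>t\<close> it equals \<open>A - \<bar>A\<bar> - 1\<close>, which is
      negative.\<close>
    then have "2 * (- (\<bar>A\<bar> + 1) / (2 * G)) * G = - (\<bar>A\<bar> + 1)" by simp
    then show False using assms(1)[of "- (\<bar>A\<bar> + 1) / (2 * G)"] True by simp
  qed
  then show ?thesis using True by simp
next
  case False
  then show ?thesis using assms(1)[of "- G / B"] assms(2)
    by (simp add: power2_eq_square field_simps)
qed

text \<open>Split \<open>s1\<close> times \<open>X1\<close> and \<open>s2\<close> times
  \<open>X2\<close> along the null vectors \<open>(z0, 1)\<close>, \<open>(z, 1)\<close> and their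
  orthogonal complement. The scaling gives both the same coefficient \<beta>/k at
  \<open>(z, 1)\<close>. Comparing Minkowski squares produces
  \<open>s1\<^sup>2 + C1\<^sup>2\<close>, where \<open>C1\<close> is the length of the orthogonal
  part; \<open>G\<close> is the inner product of the two orthogonal parts. A combination
  \<open>Z\<close> with weights of sum 1 keeps the coefficient at \<open>(z, 1)\<close> and combines
  the orthogonal parts, whence the last formula.\<close>

lemma two_point_frame:
  fixes X1 X2 :: "'m::finite minkowski" and z z0 :: "real ^ 'm" and \<beta> s1 s2 k :: real
  assumes X: "X1 \<in> hyp_space" "X2 \<in> hyp_space" and z: "norm z = 1" "norm z0 = 1" and \<beta>: "\<beta> > 0"
    and k: "k = 1 - z \<bullet> z0" "k > 0"
    and s: "s1 = \<beta> / horo X1 z0" "s2 = \<beta> / horo X2 z0"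
  obtains C1 C2 G where "C1 \<ge> 0" "C2 \<ge> 0" "G \<le> C1 * C2"
    "2 * \<beta> * s1 * horo X1 z / k = s1\<^sup>2 + C1\<^sup>2" "2 * \<beta> * s2 * horo X2 z / k = s2\<^sup>2 + C2\<^sup>2"
    "C1\<^sup>2 - 2 * G + C2\<^sup>2 = - s1\<^sup>2 - s2\<^sup>2 - 2 * s1 * s2 * mink X1 X2"
    "\<And>\<mu> \<nu> \<tau> Z. \<mu> + \<nu> = 1 \<Longrightarrow> Z = (\<mu> * s1) *\<^sub>R X1 + (\<nu> * s2) *\<^sub>R X2 + \<tau> *\<^sub>R (z0, 1) \<Longrightarrow> mink Z Z = -1 \<Longrightarrow>
      2 * \<beta> * horo Z z / k = 1 + (\<mu>\<^sup>2 * C1\<^sup>2 + 2 * \<mu> * \<nu> * G + \<nu>\<^sup>2 * C2\<^sup>2)"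
proof -
  define E0 E :: "'m minkowski" where "E0 = (z0, 1)" and "E = (z, 1)"
  have h0: "horo E0 z = k" "horo E z0 = k" "horo E z = 0" "horo E0 z0 = 0"
    using z k by (simp_all add: E0_def E_def horo_def inner_commute dot_square_norm)
  have hE: "mink X E0 = - horo X z0" "mink E0 X = - horo X z0" "mink X E = - horo X z" "mink E X = - horo X z" for X
    by (simp_all add: E0_def E_def)
  define U where "U Y s = s *\<^sub>R Y - (s * horo Y z / k) *\<^sub>R E0 - (\<beta> / k) *\<^sub>R E" for Y s
  have al: "s1 * horo X1 z0 = \<beta>" "s2 * horo X2 z0 = \<beta>"
    using s horo_pos[OF X(1) z(2)] horo_pos[OF X(2) z(2)] by auto
  have XX: "mink X1 X1 = -1" "mink X2 X2 = -1" using hyp_spaceD(1) X by blast+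
  \<comment> \<open>A timelike vector orthogonal to the vectors \<open>U Y s\<close>, so that the
    Minkowski form is semidefinite on their span and Cauchy-Schwarz applies.\<close>
  let ?T = "E0 + E"
  have T: "mink ?T ?T < 0" "snd ?T > 0" using k(2) h0 by (simp_all add: hE) (simp add: E0_def E_def)
  have UT: "mink (U Y s) ?T = 0" if "s * horo Y z0 = \<beta>" for Y s
    using that k(2) by (simp add: U_def h0 hE)
  have UU: "mink (U Y s) (U Y s) = 2 * \<beta> * s * horo Y z / k - s\<^sup>2"
    if "mink Y Y = -1" "s * horo Y z0 = \<beta>" for Y s
  proof -
    define q r where "q = s * horo Y z / k" and "r = \<beta> / k"
    have "mink (U Y s) (U Y s) = - s\<^sup>2 + 2 * q * (s * horo Y z0) + 2 * (s * horo Y z) * r - 2 * q * (r * k)"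
      unfolding U_def q_def[symmetric] r_def[symmetric] using that(1)
      by (simp add: h0 hE power2_eq_square algebra_simps)
    also have "\<dots> = - s\<^sup>2 + 2 * (s * horo Y z) * r"
      using that(2) k(2) by (simp add: r_def)
    finally show ?thesis by (simp add: r_def mult_ac)
  qed
  define G where "G = mink (U X1 s1) (U X2 s2)"
  define A B where "A = mink (U X1 s1) (U X1 s1)" and "B = mink (U X2 s2) (U X2 s2)"
  have AB: "A \<ge> 0" "B \<ge> 0" unfolding A_def B_def
    using mink_timelike_orthogonal_nonneg[OF T UT] al by blast+
  have "A + 2 * t * G + t\<^sup>2 * B \<ge> 0" for t
  proof -
    have "mink (U X1 s1 + t *\<^sub>R U X2 s2) ?T = 0" using UT al by (simp del: mink_simps(2))
    from mink_timelike_orthogonal_nonneg[OF T this] show ?thesis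
      by (simp add: A_def B_def G_def mink_commute[of "U X2 s2" "U X1 s1"] power2_eq_square algebra_simps)
  qed
  from nonneg_quadratic_discriminant[OF this AB(2)] have "G\<^sup>2 \<le> (sqrt A * sqrt B)\<^sup>2" using AB by (simp add: power_mult_distrib)
  then have GAB: "G \<le> sqrt A * sqrt B" using AB power2_le_imp_le[of G "sqrt A * sqrt B"] by auto
  have Aeq: "A = 2 * \<beta> * s1 * horo X1 z / k - s1\<^sup>2" and Beq: "B = 2 * \<beta> * s2 * horo X2 z / k - s2\<^sup>2"
    unfolding A_def B_def using UU XX al by auto
  \<comment> \<open>The square of the difference of the orthogonal parts does not depend on
    \<open>z\<close>: the multiples of \<open>E\<close> cancel, and \<open>E0\<close> is null and
    orthogonal to the difference of the scaled points. This independence later allows a gap uniform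
    in \<open>z\<close>.\<close>
  have Geq: "A - 2 * G + B = - s1\<^sup>2 - s2\<^sup>2 - 2 * s1 * s2 * mink X1 X2"
  proof -
    have "mink (U X1 s1 - U X2 s2) (U X1 s1 - U X2 s2) = - s1\<^sup>2 - s2\<^sup>2 - 2 * s1 * s2 * mink X1 X2"
    proof -
      define r where "r = s1 * horo X1 z / k - s2 * horo X2 z / k"
      have "U X1 s1 - U X2 s2 = s1 *\<^sub>R X1 - s2 *\<^sub>R X2 - r *\<^sub>R E0"
        by (simp add: U_def r_def algebra_simps)
      moreover have "mink (s1 *\<^sub>R X1 - s2 *\<^sub>R X2 - r *\<^sub>R E0) (s1 *\<^sub>R X1 - s2 *\<^sub>R X2 - r *\<^sub>R E0)
        = - s1\<^sup>2 - s2\<^sup>2 - 2 * s1 * s2 * mink X1 X2 + 2 * r * (s1 * horo X1 z0) - 2 * r * (s2 * horo X2 z0)"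
        using XX by (simp add: h0 hE mink_commute[of X2 X1] power2_eq_square algebra_simps)
      ultimately show ?thesis using al by simp
    qed
    then show ?thesis by (simp add: A_def B_def G_def mink_commute[of "U X2 s2" "U X1 s1"])
  qed
  show ?thesis
  proof (rule that[of "sqrt A" "sqrt B" G])
    fix \<mu> \<nu> \<tau> Z
    assume \<mu>: "\<mu> + \<nu> = 1" and Z: "Z = (\<mu> * s1) *\<^sub>R X1 + (\<nu> * s2) *\<^sub>R X2 + \<tau> *\<^sub>R (z0, 1)" and ZZ: "mink Z Z = -1"
    note Z = Z[folded E0_def]
    have "mink Z Z = - (\<mu> * s1)\<^sup>2 - (\<nu> * s2)\<^sup>2 + 2 * (\<mu> * s1) * (\<nu> * s2) * mink X1 X2
        - 2 * \<tau> * (\<mu> * (s1 * horo X1 z0) + \<nu> * (s2 * horo X2 z0))"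
      unfolding Z using XX by (simp add: h0 hE mink_commute[of X2 X1] power2_eq_square algebra_simps)
    also have "\<dots> = - (\<mu> * s1)\<^sup>2 - (\<nu> * s2)\<^sup>2 + 2 * (\<mu> * s1) * (\<nu> * s2) * mink X1 X2 - 2 * \<tau> * ((\<mu> + \<nu>) * \<beta>)"
      unfolding al by (simp add: algebra_simps)
    finally have 1: "2 * \<beta> * \<tau> = 1 - (\<mu> * s1)\<^sup>2 - (\<nu> * s2)\<^sup>2 + 2 * (\<mu> * s1) * (\<nu> * s2) * mink X1 X2"
      using ZZ \<mu> by (simp add: mult_ac)
    have "2 * \<beta> * horo Z z / k = \<mu> * (2 * \<beta> * s1 * horo X1 z / k) + \<nu> * (2 * \<beta> * s2 * horo X2 z / k) + 2 * \<beta> * \<tau>"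
      unfolding Z using k(2) by (simp add: h0 field_simps)
    also have "\<dots> = \<mu> * (A + s1\<^sup>2) + \<nu> * (B + s2\<^sup>2) + 2 * \<beta> * \<tau>" by (simp add: Aeq Beq)
    also have "\<dots> = 1 + (\<mu>\<^sup>2 * A + \<mu> * \<nu> * (A + B + s1\<^sup>2 + s2\<^sup>2 + 2 * s1 * s2 * mink X1 X2) + \<nu>\<^sup>2 * B)"
    proof -
      have n: "\<nu> = 1 - \<mu>" using \<mu> by simp
      show ?thesis unfolding 1 unfolding n by (simp add: power2_eq_square algebra_simps)
    qed
    also have "A + B + s1\<^sup>2 + s2\<^sup>2 + 2 * s1 * s2 * mink X1 X2 = 2 * G" using Geq by simp
    finally show "2 * \<beta> * horo Z z / k = 1 + (\<mu>\<^sup>2 * (sqrt A)\<^sup>2 + 2 * \<mu> * \<nu> * G + \<nu>\<^sup>2 * (sqrt B)\<^sup>2)"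
      using AB by (simp add: algebra_simps)
  qed (use AB GAB Aeq Beq Geq in auto)
qed

section \<open>Supporting points of the p-sum\<close>

lemma unit_inner_diff:
  assumes "norm z = 1" "norm z0 = 1"
  shows "1 - z \<bullet> z0 = (norm (z - z0))\<^sup>2 / 2"
proof -
  have "z \<bullet> z = 1" "z0 \<bullet> z0 = 1" using assms by (simp_all add: dot_square_norm)
  then show ?thesis
    unfolding power2_norm_eq_inner by (simp add: inner_diff_left inner_diff_right inner_commute)
qed

text \<open>The point \<open>Z\<close> is forced by first-order contact at \<open>z0\<close>: the
  weights \<mu>, \<nu> are those of the logarithmic gradient of the p-sum, and value and gradient of
  a horospherical function determine its point modulo \<open>(z0, 1)\<close>. Hence \<open>Z\<close>
  divided by \<beta> is the weighted combination of \<open>X1\<close> and \<open>X2\<close>, each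
  divided by its value at \<open>z0\<close>, up to that null vector.\<close>

lemma psum_contact:
  fixes X1 X2 :: "'m::finite minkowski" and z0 :: "real ^ 'm" and a b p :: real
  defines "\<beta> \<equiv> (a * horo X1 z0 powr p + b * horo X2 z0 powr p) powr (1 / p)"
  defines "\<mu> \<equiv> a * horo X1 z0 powr p / \<beta> powr p" and "\<nu> \<equiv> b * horo X2 z0 powr p / \<beta> powr p"
  defines "s1 \<equiv> \<beta> / horo X1 z0" and "s2 \<equiv> \<beta> / horo X2 z0"
  assumes X: "X1 \<in> hyp_space" "X2 \<in> hyp_space" and z0: "norm z0 = 1"
    and ab: "a \<ge> 0" "b \<ge> 0" "a + b > 0" and p: "p > 0"
  obtains Z where "\<beta> > 0" "s1 > 0" "s2 > 0" "\<mu> \<ge> 0" "\<nu> \<ge> 0" "\<mu> + \<nu> = 1" "\<mu> * s1 powr p = a" "\<nu> * s2 powr p = b"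
    "Z \<in> hyp_space" "horo Z z0 = \<beta>"
    "\<And>z. norm z = 1 \<Longrightarrow> z \<noteq> z0 \<Longrightarrow> \<exists>C1 C2 G. C1 \<ge> 0 \<and> C2 \<ge> 0 \<and> G \<le> C1 * C2 \<and>
      2 * \<beta> * s1 * horo X1 z / (1 - z \<bullet> z0) = s1\<^sup>2 + C1\<^sup>2 \<and> 2 * \<beta> * s2 * horo X2 z / (1 - z \<bullet> z0) = s2\<^sup>2 + C2\<^sup>2 \<and>
      C1\<^sup>2 - 2 * G + C2\<^sup>2 = - s1\<^sup>2 - s2\<^sup>2 - 2 * s1 * s2 * mink X1 X2 \<and>
      2 * \<beta> * horo Z z / (1 - z \<bullet> z0) = 1 + (\<mu>\<^sup>2 * C1\<^sup>2 + 2 * \<mu> * \<nu> * G + \<nu>\<^sup>2 * C2\<^sup>2)"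
proof -
  have al: "horo X1 z0 > 0" "horo X2 z0 > 0" using horo_pos X z0 by blast+
  have sum: "a * horo X1 z0 powr p + b * horo X2 z0 powr p > 0"
    using ab al by (cases "a = 0") (auto intro: add_pos_nonneg)
  have \<beta>: "\<beta> > 0" unfolding \<beta>_def using sum by simp
  have \<beta>p: "\<beta> powr p = a * horo X1 z0 powr p + b * horo X2 z0 powr p"
    unfolding \<beta>_def using p sum by (simp add: powr_powr)
  have s: "s1 > 0" "s2 > 0" unfolding s1_def s2_def using \<beta> al by auto
  have \<mu>: "\<mu> \<ge> 0" "\<nu> \<ge> 0" unfolding \<mu>_def \<nu>_def using ab by auto
  have \<mu>1: "\<mu> + \<nu> = 1" unfolding \<mu>_def \<nu>_def using sum by (simp add: \<beta>p flip: add_divide_distrib)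
  have \<mu>s: "\<mu> * s1 powr p = a" "\<nu> * s2 powr p = b"
    unfolding \<mu>_def \<nu>_def s1_def s2_def using \<beta> al by (simp_all add: powr_divide)
  define W where "W = (\<mu> * s1) *\<^sub>R X1 + (\<nu> * s2) *\<^sub>R X2"
  \<comment> \<open>The multiple of the null vector that brings \<open>mink Z Z\<close> to -1 while
    leaving \<open>horo Z z0\<close> unchanged.\<close>
  define \<tau> where "\<tau> = (1 + mink W W) / (2 * \<beta>)"
  define E0 :: "'m minkowski" where "E0 = (z0, 1)"
  define Z where "Z = W + \<tau> *\<^sub>R E0"
  have h0: "horo E0 z0 = 0" using z0 by (simp add: E0_def horo_def dot_square_norm)
  have hE: "mink X E0 = - horo X z0" "mink E0 X = - horo X z0" for X by (simp_all add: E0_def)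
  have "horo W z0 = \<mu> * (s1 * horo X1 z0) + \<nu> * (s2 * horo X2 z0)" by (simp add: W_def)
  also have "\<dots> = (\<mu> + \<nu>) * \<beta>" using al by (simp add: s1_def s2_def algebra_simps)
  finally have hW: "horo W z0 = \<beta>" using \<mu>1 by simp
  have hZ: "horo Z z0 = \<beta>" unfolding Z_def using hW h0 by simp
  have ZZ: "mink Z Z = -1"
  proof -
    have "mink Z Z = mink W W - 2 * \<tau> * \<beta>" by (simp add: Z_def hE h0 hW)
    moreover have "2 * \<tau> * \<beta> = 1 + mink W W" using \<beta> by (simp add: \<tau>_def)
    ultimately show ?thesis by simp
  qed
  \<comment> \<open>Of the two sheets of \<open>mink Z Z = -1\<close>, the positive value at
    \<open>z0\<close> selects the upper one.\<close>
  have "snd Z > 0"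
  proof (rule ccontr)
    assume "\<not> snd Z > 0"
    then have neg: "snd Z \<le> 0" by simp
    have "(norm (fst Z))\<^sup>2 < (snd Z)\<^sup>2"
      using ZZ by (simp add: mink_eq power2_norm_eq_inner power2_eq_square[of "snd Z"])
    then have "norm (fst Z) < - snd Z" using neg
      power_less_imp_less_base[of "norm (fst Z)" 2 "- snd Z"] by simp
    then have "horo Z z0 < 0" using inner_le_norm_unit[OF z0, of "fst Z"] by (simp add: horo_def)
    then show False using hZ \<beta> by simp
  qed
  then have Z: "Z \<in> hyp_space" using ZZ by (simp add: hyp_space_def)
  have frame: "\<exists>C1 C2 G. C1 \<ge> 0 \<and> C2 \<ge> 0 \<and> G \<le> C1 * C2 \<and>
      2 * \<beta> * s1 * horo X1 z / (1 - z \<bullet> z0) = s1\<^sup>2 + C1\<^sup>2 \<and> 2 * \<beta> * s2 * horo X2 z / (1 - z \<bullet> z0) = s2\<^sup>2 + C2\<^sup>2 \<and>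
      C1\<^sup>2 - 2 * G + C2\<^sup>2 = - s1\<^sup>2 - s2\<^sup>2 - 2 * s1 * s2 * mink X1 X2 \<and>
      2 * \<beta> * horo Z z / (1 - z \<bullet> z0) = 1 + (\<mu>\<^sup>2 * C1\<^sup>2 + 2 * \<mu> * \<nu> * G + \<nu>\<^sup>2 * C2\<^sup>2)"
    if z: "norm z = 1" "z \<noteq> z0" for z
  proof -
    have "(norm (z - z0))\<^sup>2 > 0" using z by simp
    then have k: "1 - z \<bullet> z0 > 0"
      unfolding unit_inner_diff[OF z(1) z0] by simp
    show ?thesis
      by (rule two_point_frame[OF X z(1) z0 \<beta> refl k s1_def[THEN meta_eq_to_obj_eq] s2_def[THEN meta_eq_to_obj_eq]])
         (use \<mu>1 Z_def[unfolded E0_def] W_def ZZ in blast)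
  qed
  show ?thesis using that[OF \<beta> s \<mu> \<mu>1 \<mu>s Z hZ frame] by blast
qed

definition psum :: "real \<Rightarrow> real \<Rightarrow> real \<Rightarrow> ('a \<Rightarrow> real) \<Rightarrow> ('a \<Rightarrow> real) \<Rightarrow> 'a \<Rightarrow> real" where
  "psum p a b f g z = (a * f z powr p + b * g z powr p) powr (1 / p)"

lemma supported_psum:
  fixes f g :: "real ^ 'm::finite \<Rightarrow> real"
  assumes p: "1 / 2 \<le> p" "p \<le> 2" and ab: "a \<ge> 0" "b \<ge> 0" "a + b \<ge> 1"
    and f: "supported c1 f" "c1 \<ge> 0" and g: "supported c2 g" "c2 \<ge> 0"
    and m: "m > 0" "\<And>z. norm z = 1 \<Longrightarrow> f z \<ge> m" "\<And>z. norm z = 1 \<Longrightarrow> g z \<ge> m"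
    and B: "B > 0" "\<And>z. norm z = 1 \<Longrightarrow> psum p a b f g z \<le> B"
  obtains c where "c \<ge> 0" "supported c (psum p a b f g)"
    "a + b > 1 \<or> (a > 0 \<and> c1 > 0) \<or> (b > 0 \<and> c2 > 0) \<Longrightarrow> c > 0"
proof -
  have p0: "p > 0" using p by simp
  \<comment> \<open>Lower bound for the sum of the weights once the gaps of \<open>f\<close> and
    \<open>g\<close> have been absorbed into them; \<open>S > 1\<close> exactly reflects that some
    gap or excess weight is present. The 4 in \<open>c\<close> combines the 2 of the frame identity
    with \<open>1 - z \<bullet> z0 = (norm (z - z0))\<^sup>2 / 2\<close>, and \<open>B\<close>
    bounds \<beta>.\<close>
  define S where "S = a * (1 + 4 * c1 * m) powr (p / 2) + b * (1 + 4 * c2 * m) powr (p / 2)"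
  define c where "c = (S powr (2 / p) - 1) / (4 * B)"
  have ge1: "(1 + 4 * c1 * m) powr (p / 2) \<ge> 1" "(1 + 4 * c2 * m) powr (p / 2) \<ge> 1"
    using f g m p0 by (auto intro!: ge_one_powr_ge_zero)
  have mono: "a * 1 \<le> a * (1 + 4 * c1 * m) powr (p / 2)" "b * 1 \<le> b * (1 + 4 * c2 * m) powr (p / 2)"
    using ab ge1 by (intro mult_left_mono; simp)+
  then have Sab: "S \<ge> a + b" by (simp add: S_def)
  have S: "S \<ge> 1" using Sab ab by simp
  have c0: "c \<ge> 0" unfolding c_def using S B p0 ge_one_powr_ge_zero[of S "2 / p"] by simp
  have cpos: "c > 0" if "a + b > 1 \<or> (a > 0 \<and> c1 > 0) \<or> (b > 0 \<and> c2 > 0)"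
  proof -
    have "S > 1"
    proof -
      have "a * 1 < a * (1 + 4 * c1 * m) powr (p / 2)" if "a > 0" "c1 > 0"
        using that m p0 powr_less_mono2[of "p / 2" 1 "1 + 4 * c1 * m"] by (intro mult_strict_left_mono) auto
      moreover have "b * 1 < b * (1 + 4 * c2 * m) powr (p / 2)" if "b > 0" "c2 > 0"
        using that m p0 powr_less_mono2[of "p / 2" 1 "1 + 4 * c2 * m"] by (intro mult_strict_left_mono) auto
      ultimately show ?thesis
        using mono that ab unfolding S_def mult_1_right by linarith
    qed
    then show ?thesis unfolding c_def using B p0 powr_less_mono2[of "2 / p" 1 S] by simp
  qed
  have "\<exists>Z\<in>hyp_space. horo Z z0 = psum p a b f g z0 \<and>
      (\<forall>z. norm z = 1 \<longrightarrow> psum p a b f g z \<ge> horo Z z + c * (norm (z - z0))\<^sup>2)" if z0: "norm z0 = 1" for z0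
  proof -
    obtain X1 where X1: "X1 \<in> hyp_space" "horo X1 z0 = f z0" "\<And>z. norm z = 1 \<Longrightarrow> f z \<ge> horo X1 z + c1 * (norm (z - z0))\<^sup>2"
      using f z0 unfolding supported_def by blast
    obtain X2 where X2: "X2 \<in> hyp_space" "horo X2 z0 = g z0" "\<And>z. norm z = 1 \<Longrightarrow> g z \<ge> horo X2 z + c2 * (norm (z - z0))\<^sup>2"
      using g z0 unfolding supported_def by blast
    define \<beta> where "\<beta> = (a * horo X1 z0 powr p + b * horo X2 z0 powr p) powr (1 / p)"
    define \<mu> where "\<mu> = a * horo X1 z0 powr p / \<beta> powr p"
    define \<nu> where "\<nu> = b * horo X2 z0 powr p / \<beta> powr p"
    define s1 where "s1 = \<beta> / horo X1 z0"
    define s2 where "s2 = \<beta> / horo X2 z0"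
    have ab0: "a + b > 0" using ab by simp
    obtain Z where \<beta>: "\<beta> > 0" and s: "s1 > 0" "s2 > 0" and \<mu>: "\<mu> \<ge> 0" "\<nu> \<ge> 0" "\<mu> + \<nu> = 1" and \<mu>s: "\<mu> * s1 powr p = a" "\<nu> * s2 powr p = b"
      and Z: "Z \<in> hyp_space" "horo Z z0 = \<beta>"
      and frame: "\<And>z. norm z = 1 \<Longrightarrow> z \<noteq> z0 \<Longrightarrow> \<exists>C1 C2 G. C1 \<ge> 0 \<and> C2 \<ge> 0 \<and> G \<le> C1 * C2 \<and>
      2 * \<beta> * s1 * horo X1 z / (1 - z \<bullet> z0) = s1\<^sup>2 + C1\<^sup>2 \<and> 2 * \<beta> * s2 * horo X2 z / (1 - z \<bullet> z0) = s2\<^sup>2 + C2\<^sup>2 \<and>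
      C1\<^sup>2 - 2 * G + C2\<^sup>2 = - s1\<^sup>2 - s2\<^sup>2 - 2 * s1 * s2 * mink X1 X2 \<and>
      2 * \<beta> * horo Z z / (1 - z \<bullet> z0) = 1 + (\<mu>\<^sup>2 * C1\<^sup>2 + 2 * \<mu> * \<nu> * G + \<nu>\<^sup>2 * C2\<^sup>2)"
      by (rule psum_contact[OF X1(1) X2(1) z0 ab(1,2) ab0 p0, folded \<beta>_def,
          folded \<mu>_def \<nu>_def s1_def s2_def]) (rule that; assumption)
    have \<beta>eq: "\<beta> = psum p a b f g z0" by (simp add: \<beta>_def psum_def X1 X2)
    have \<beta>B: "\<beta> \<le> B" using B(2)[OF z0] \<beta>eq by simp
    have al: "horo X1 z0 \<ge> m" "horo X2 z0 \<ge> m" using X1 X2 m z0 by auto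
    have "psum p a b f g z \<ge> horo Z z + c * (norm (z - z0))\<^sup>2" if z: "norm z = 1" for z
    proof (cases "z = z0")
      case True
      then show ?thesis using Z \<beta>eq by simp
    next
      case False
      define k where "k = 1 - z \<bullet> z0"
      have kn: "k = (norm (z - z0))\<^sup>2 / 2" unfolding k_def by (rule unit_inner_diff[OF z z0])
      have k: "k > 0" unfolding kn using False by simp
      obtain C1 C2 G where C: "C1 \<ge> 0" "C2 \<ge> 0" "G \<le> C1 * C2"
        and e1: "2 * \<beta> * s1 * horo X1 z / k = s1\<^sup>2 + C1\<^sup>2" and e2: "2 * \<beta> * s2 * horo X2 z / k = s2\<^sup>2 + C2\<^sup>2"
        and eZ: "2 * \<beta> * horo Z z / k = 1 + (\<mu>\<^sup>2 * C1\<^sup>2 + 2 * \<mu> * \<nu> * G + \<nu>\<^sup>2 * C2\<^sup>2)"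
        using frame[OF z False] unfolding k_def by blast
      \<comment> \<open>A gap adds \<open>2 * c1 * k\<close> to \<open>horo X1 z\<close>. In the
        frame identity this adds \<open>4 * c1 * s1 * \<beta>\<close>, which is the effect of
        enlarging \<open>s1\<close> by the factor \<open>sqrt r1\<close>; the power mean inequality
        is applied to the enlarged scales.\<close>
      define r1 r2 where "r1 = 1 + 4 * c1 * horo X1 z0" and "r2 = 1 + 4 * c2 * horo X2 z0"
      have r: "r1 \<ge> 1 + 4 * c1 * m" "r2 \<ge> 1 + 4 * c2 * m"
        unfolding r1_def r2_def using al f(2) g(2) by (simp_all add: mult_left_mono)
      have r1pos: "r1 > 0" "r2 > 0" using r f(2) g(2) m(1) by (smt (verit) mult_nonneg_nonneg)+
      define y1 y2 where "y1 = horo X1 z + 2 * c1 * k" and "y2 = horo X2 z + 2 * c2 * k"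
      have y: "y1 > 0" "y2 > 0" unfolding y1_def y2_def
        using horo_pos[OF X1(1) z] horo_pos[OF X2(1) z] f(2) g(2) k by (simp_all add: add_pos_nonneg)
      have sq: "(s1 * sqrt r1)\<^sup>2 + C1\<^sup>2 = 2 * \<beta> * s1 * y1 / k" "(s2 * sqrt r2)\<^sup>2 + C2\<^sup>2 = 2 * \<beta> * s2 * y2 / k"
      proof -
        have "s1 * horo X1 z0 = \<beta>" "s2 * horo X2 z0 = \<beta>" using al m by (simp_all add: s1_def s2_def)
        then have q: "s1\<^sup>2 * r1 = s1\<^sup>2 + 4 * c1 * s1 * \<beta>" "s2\<^sup>2 * r2 = s2\<^sup>2 + 4 * c2 * s2 * \<beta>"
          unfolding r1_def r2_def by (simp_all add: power2_eq_square algebra_simps)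
        have "2 * \<beta> * s1 * y1 / k = 2 * \<beta> * s1 * horo X1 z / k + 4 * c1 * s1 * \<beta>"
          "2 * \<beta> * s2 * y2 / k = 2 * \<beta> * s2 * horo X2 z / k + 4 * c2 * s2 * \<beta>"
          unfolding y1_def y2_def using k by (simp_all add: field_simps)
        then show "(s1 * sqrt r1)\<^sup>2 + C1\<^sup>2 = 2 * \<beta> * s1 * y1 / k" "(s2 * sqrt r2)\<^sup>2 + C2\<^sup>2 = 2 * \<beta> * s2 * y2 / k"
          using q r1pos e1 e2 by (simp_all add: power_mult_distrib)
      qed
      have "(\<mu> * (s1 * sqrt r1) powr p + \<nu> * (s2 * sqrt r2) powr p) powr (2 / p) + (\<mu>\<^sup>2 * C1\<^sup>2 + 2 * \<mu> * \<nu> * G + \<nu>\<^sup>2 * C2\<^sup>2)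
        \<le> (\<mu> * ((s1 * sqrt r1)\<^sup>2 + C1\<^sup>2) powr p + \<nu> * ((s2 * sqrt r2)\<^sup>2 + C2\<^sup>2) powr p) powr (1 / p)"
        using s r1pos by (intro power_mean_minkowski p \<mu> C) auto
      also have "\<mu> * (s1 * sqrt r1) powr p + \<nu> * (s2 * sqrt r2) powr p = a * r1 powr (p / 2) + b * r2 powr (p / 2)"
        using s r1pos \<mu>s by (simp add: powr_mult powr_half_sqrt[symmetric] powr_powr mult.assoc[symmetric])
      also have "\<mu> * ((s1 * sqrt r1)\<^sup>2 + C1\<^sup>2) powr p + \<nu> * ((s2 * sqrt r2)\<^sup>2 + C2\<^sup>2) powr p
        = (2 * \<beta> / k) powr p * (a * y1 powr p + b * y2 powr p)"
      proof -
        have "\<mu> * (2 * \<beta> * s1 * y1 / k) powr p = (2 * \<beta> / k) powr p * (a * y1 powr p)"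
          "\<nu> * (2 * \<beta> * s2 * y2 / k) powr p = (2 * \<beta> / k) powr p * (b * y2 powr p)"
          using \<beta> k s y by (simp_all add: \<mu>s[symmetric] powr_mult powr_divide)
        then show ?thesis unfolding sq by (simp add: algebra_simps)
      qed
      also have "((2 * \<beta> / k) powr p * (a * y1 powr p + b * y2 powr p)) powr (1 / p) = 2 * \<beta> / k * (a * y1 powr p + b * y2 powr p) powr (1 / p)"
        using \<beta> k p0 y ab by (simp add: powr_mult powr_powr)
      finally have main: "(a * r1 powr (p / 2) + b * r2 powr (p / 2)) powr (2 / p) - 1 + 2 * \<beta> * horo Z z / k
         \<le> 2 * \<beta> / k * (a * y1 powr p + b * y2 powr p) powr (1 / p)" using eZ by simp
      have "S \<le> a * r1 powr (p / 2) + b * r2 powr (p / 2)"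
        unfolding S_def using ab r p0 f(2) g(2) m(1) by (intro add_mono mult_left_mono powr_mono2) auto
      then have "S powr (2 / p) \<le> (a * r1 powr (p / 2) + b * r2 powr (p / 2)) powr (2 / p)"
        using S p0 by (intro powr_mono2) auto
      moreover have "(a * y1 powr p + b * y2 powr p) powr (1 / p) \<le> psum p a b f g z"
        unfolding psum_def y1_def y2_def using X1(3)[OF z] X2(3)[OF z] y ab p0 
        by (intro powr_mono2 add_mono mult_left_mono) (auto simp: y1_def y2_def kn)
      then have "2 * \<beta> / k * (a * y1 powr p + b * y2 powr p) powr (1 / p) \<le> 2 * \<beta> / k * psum p a b f g z"
        using \<beta> k by (intro mult_left_mono) auto
      ultimately have "S powr (2 / p) - 1 + 2 * \<beta> * horo Z z / k \<le> 2 * \<beta> / k * psum p a b f g z" using main by linarith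
      then have "(k / (2 * \<beta>)) * (S powr (2 / p) - 1 + 2 * \<beta> * horo Z z / k) \<le> (k / (2 * \<beta>)) * (2 * \<beta> / k * psum p a b f g z)"
        using \<beta> k by (intro mult_left_mono) auto
      then have 3: "k / (2 * \<beta>) * (S powr (2 / p) - 1) + horo Z z \<le> psum p a b f g z"
        using \<beta> k by (simp add: distrib_left)
      have "c * (norm (z - z0))\<^sup>2 = k / (2 * B) * (S powr (2 / p) - 1)" unfolding c_def kn using B by (simp add: field_simps)
      also have "\<dots> \<le> k / (2 * \<beta>) * (S powr (2 / p) - 1)"
        using \<beta> \<beta>B k S p0 ge_one_powr_ge_zero[of S "2 / p"] by (intro mult_right_mono divide_left_mono) auto
      finally show ?thesis using 3 by simp
    qed
    then show ?thesis using Z \<beta>eq by auto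
  qed
  then have "supported c (psum p a b f g)" unfolding supported_def by blast
  then show ?thesis using that c0 cpos by blast
qed


section \<open>Strict power mean inequalities and the p-sum of two distinct points\<close>

text \<open>Taylor at 1: the second derivative is decreasing for \<open>q \<le> 2\<close>, so its
  value at \<open>T\<close> bounds it from below on the interval.\<close>

lemma powr_above_tangent_quadratic:
  fixes q T t :: real
  assumes q: "1 < q" "q \<le> 2" and t: "0 < t" "t \<le> T" and T: "1 \<le> T"
  shows "1 + q * (t - 1) + q * (q - 1) / 2 * T powr (q - 2) * (t - 1)\<^sup>2 \<le> t powr q"
proof -
  define c where "c = q * (q - 1) / 2 * T powr (q - 2)"
  define d where "d n = (if n = 0 then (\<lambda>x. x powr q) else if n = (1::nat) then (\<lambda>x. q * x powr (q - 1))
      else (\<lambda>x. q * ((q - 1) * x powr (q - 2))))" for n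
  have der: "\<forall>n x. n < 2 \<and> min t 1 \<le> x \<and> x \<le> max t 1 \<longrightarrow> DERIV (d n) x :> d (Suc n) x"
  proof (intro allI impI)
    fix n :: nat and x assume nx: "n < 2 \<and> min t 1 \<le> x \<and> x \<le> max t 1"
    then have "x > 0" using t by auto
    then show "DERIV (d n) x :> d (Suc n) x"
      using nx by (cases "n = 0") (auto simp: d_def less_2_cases_iff intro!: derivative_eq_intros)
  qed
  show ?thesis
  proof (cases "t = 1")
    case False
    obtain x where x: "if t < 1 then t < x \<and> x < 1 else 1 < x \<and> x < t"
      "t powr q = (\<Sum>m<2. d m 1 / fact m * (t - 1) ^ m) + d 2 x / fact 2 * (t - 1) ^ 2"
      using Taylor[of 2 d "d 0" "min t 1" "max t 1" 1 t] der False by (auto simp: d_def)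
    have xT: "0 < x" "x \<le> T" using x(1) t T by (auto split: if_splits)
    have "T powr (q - 2) \<le> x powr (q - 2)" using xT q by (intro powr_mono2') auto
    then have "c \<le> q * (q - 1) / 2 * x powr (q - 2)" unfolding c_def using q by (intro mult_left_mono) auto
    then have "c * (t - 1)\<^sup>2 \<le> q * (q - 1) / 2 * x powr (q - 2) * (t - 1)\<^sup>2" by (intro mult_right_mono) auto
    then show ?thesis using x(2) by (simp add: d_def c_def eval_nat_numeral)
  qed simp
qed

text \<open>Jensen with a remainder. After division by the mean the linear terms cancel and the
  quadratic ones give the variance \<open>\<mu> * \<nu> * ((x - y) / m)\<^sup>2\<close>. The
  quotients are at most \<open>1 / \<mu>\<close> and \<open>1 / \<nu>\<close>, so \<open>T\<close>
  bounds them independently of \<open>x\<close> and \<open>y\<close>.\<close>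

lemma powr_mean_gap:
  fixes q x y \<mu> \<nu> T :: real
  assumes q: "1 < q" "q \<le> 2" and xy: "x > 0" "y > 0" and \<mu>: "\<mu> > 0" "\<nu> > 0" "\<mu> + \<nu> = 1"
    and T: "1 / \<mu> \<le> T" "1 / \<nu> \<le> T"
  shows "(\<mu> * x + \<nu> * y) powr q * (1 + q * (q - 1) / 2 * T powr (q - 2) * (\<mu> * \<nu>) * ((x - y) / (\<mu> * x + \<nu> * y))\<^sup>2)
    \<le> \<mu> * x powr q + \<nu> * y powr q"
proof -
  define m where "m = \<mu> * x + \<nu> * y"
  define c where "c = q * (q - 1) / 2 * T powr (q - 2)"
  have m: "m > 0" unfolding m_def using xy \<mu> by (simp add: add_pos_pos)
  have mx: "\<mu> * x \<le> m" "\<nu> * y \<le> m" unfolding m_def using xy \<mu> by auto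
  have "x / m \<le> 1 / \<mu>" "y / m \<le> 1 / \<nu>" using mx m \<mu> by (simp_all add: field_simps)
  then have le: "x / m \<le> T" "y / m \<le> T" using T by auto
  have T1: "1 \<le> T" using T(1) \<mu> by (smt (verit) le_divide_eq_1)
  have "1 + q * (x / m - 1) + c * (x / m - 1)\<^sup>2 \<le> (x / m) powr q" "1 + q * (y / m - 1) + c * (y / m - 1)\<^sup>2 \<le> (y / m) powr q"
    unfolding c_def using xy m le T1 by (intro powr_above_tangent_quadratic q; simp)+
  then have "\<mu> * (1 + q * (x / m - 1) + c * (x / m - 1)\<^sup>2) + \<nu> * (1 + q * (y / m - 1) + c * (y / m - 1)\<^sup>2)
     \<le> \<mu> * (x / m) powr q + \<nu> * (y / m) powr q" using \<mu> by (intro add_mono mult_left_mono) auto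
  moreover have "\<mu> * (1 + q * (x / m - 1) + c * (x / m - 1)\<^sup>2) + \<nu> * (1 + q * (y / m - 1) + c * (y / m - 1)\<^sup>2)
    = 1 + c * (\<mu> * \<nu>) * ((x - y) / m)\<^sup>2"
  proof -
    define u v where "u = x / m" and "v = y / m"
    have uv: "\<mu> * u + \<nu> * v = 1" unfolding u_def v_def using m by (simp add: m_def flip: add_divide_distrib)
    have nu: "\<nu> = 1 - \<mu>" using \<mu> by simp
    have u1: "u - 1 = \<nu> * (u - v)" "v - 1 = - (\<mu> * (u - v))" using uv unfolding nu by (simp_all add: algebra_simps)
    have "\<mu> * (1 + q * (u - 1) + c * (u - 1)\<^sup>2) + \<nu> * (1 + q * (v - 1) + c * (v - 1)\<^sup>2) = 1 + c * (\<mu> * \<nu>) * (u - v)\<^sup>2"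
      unfolding u1 power_mult_distrib power2_minus unfolding nu by (simp add: power2_eq_square algebra_simps)
    then show ?thesis by (simp add: u_def v_def diff_divide_distrib)
  qed
  ultimately have "m powr q * (1 + c * (\<mu> * \<nu>) * ((x - y) / m)\<^sup>2) \<le> m powr q * (\<mu> * (x / m) powr q + \<nu> * (y / m) powr q)"
    by (intro mult_left_mono) auto
  also have "\<dots> = \<mu> * x powr q + \<nu> * y powr q" using m xy by (simp add: powr_divide distrib_left)
  finally show ?thesis unfolding c_def m_def .
qed

text \<open>Two losses are collected: the Jensen remainder for the exponent
  \<open>2 * p > 1\<close>, proportional to \<open>(r1 - r2)\<^sup>2\<close>, and the defect
  \<open>r1 * r2 - s1 * s2 - G\<close> of the triangle inequality. Twice the defect plus
  \<open>(r1 - r2)\<^sup>2\<close> is the stated combination, which in the frame of two points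
  equals \<open>2 * s1 * s2 * (- 1 - mink X1 X2)\<close>.\<close>

lemma power_mean_gap_low:
  fixes p \<mu> \<nu> s1 s2 C1 C2 G T :: real
  assumes p: "1 / 2 < p" "p \<le> 1" and \<mu>: "\<mu> > 0" "\<nu> > 0" "\<mu> + \<nu> = 1" and s: "s1 > 0" "s2 > 0"
    and C: "C1 \<ge> 0" "C2 \<ge> 0" "G \<le> C1 * C2" and T: "1 / \<mu> \<le> T" "1 / \<nu> \<le> T"
    and mean: "\<mu> * s1 powr p + \<nu> * s2 powr p \<ge> 1"
  shows "1 + (\<mu>\<^sup>2 * C1\<^sup>2 + 2 * \<mu> * \<nu> * G + \<nu>\<^sup>2 * C2\<^sup>2)
     + p * (2 * p - 1) * T powr (2 * p - 2) * (\<mu> * \<nu>) * (s1\<^sup>2 + s2\<^sup>2 - 2 * s1 * s2 + (C1\<^sup>2 - 2 * G + C2\<^sup>2))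
    \<le> (\<mu> * (s1\<^sup>2 + C1\<^sup>2) powr p + \<nu> * (s2\<^sup>2 + C2\<^sup>2) powr p) powr (1 / p)"
proof -
  define r1 r2 where "r1 = sqrt (s1\<^sup>2 + C1\<^sup>2)" and "r2 = sqrt (s2\<^sup>2 + C2\<^sup>2)"
  define m where "m = \<mu> * r1 + \<nu> * r2"
  define c where "c = p * (2 * p - 1) * T powr (2 * p - 2)"
  have AB: "s1\<^sup>2 + C1\<^sup>2 > 0" "s2\<^sup>2 + C2\<^sup>2 > 0" using s by (simp_all add: add_pos_nonneg)
  have r: "r1 > 0" "r2 > 0" unfolding r1_def r2_def using AB by auto
  have m: "m > 0" unfolding m_def using r \<mu> by (simp add: add_pos_pos)
  have T1: "1 \<le> T" using T(1) \<mu> by (smt (verit) le_divide_eq_1)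
  \<comment> \<open>With \<open>c \<le> 1\<close> a fraction \<open>c\<close> of the triangle defect
    can be kept, matching the coefficient of the Jensen remainder.\<close>
  have c: "0 \<le> c" "c \<le> 1"
  proof -
    show "0 \<le> c" unfolding c_def using p by simp
    have "p * (2 * p - 1) \<le> 1 * 1" using p by (intro mult_mono) auto
    moreover have "T powr (2 * p - 2) \<le> 1" using T1 p powr_mono[of "2 * p - 2" 0 T] by simp
    ultimately have "p * (2 * p - 1) * T powr (2 * p - 2) \<le> 1 * 1" using p by (intro mult_mono) auto
    then show "c \<le> 1" unfolding c_def by simp
  qed
  define e where "e = c * (\<mu> * \<nu>) * ((r1 - r2) / m)\<^sup>2"
  have e: "e \<ge> 0" unfolding e_def using c \<mu> by simp
  have "m powr (2 * p) * (1 + e) \<le> \<mu> * r1 powr (2 * p) + \<nu> * r2 powr (2 * p)"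
    using powr_mean_gap[of "2 * p" r1 r2 \<mu> \<nu> T] p r \<mu> T unfolding e_def c_def m_def by simp
  also have "\<dots> = \<mu> * (s1\<^sup>2 + C1\<^sup>2) powr p + \<nu> * (s2\<^sup>2 + C2\<^sup>2) powr p"
    unfolding r1_def r2_def using AB by (simp add: powr_half_sqrt[symmetric] powr_powr)
  finally have "(m powr (2 * p) * (1 + e)) powr (1 / p) \<le> (\<mu> * (s1\<^sup>2 + C1\<^sup>2) powr p + \<nu> * (s2\<^sup>2 + C2\<^sup>2) powr p) powr (1 / p)"
    using p e by (intro powr_mono2) auto
  moreover have "(m powr (2 * p) * (1 + e)) powr (1 / p) = m\<^sup>2 * (1 + e) powr (1 / p)"
    using p m e by (simp add: powr_mult powr_powr)
  moreover have "m\<^sup>2 * (1 + e) \<le> m\<^sup>2 * (1 + e) powr (1 / p)"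
    using p e powr_mono[of 1 "1 / p" "1 + e"] by (intro mult_left_mono) auto
  moreover have "m\<^sup>2 * e = c * (\<mu> * \<nu>) * (r1 - r2)\<^sup>2" unfolding e_def using m by (simp add: power_divide)
  ultimately have 1: "m\<^sup>2 + c * (\<mu> * \<nu>) * (r1 - r2)\<^sup>2 \<le> (\<mu> * (s1\<^sup>2 + C1\<^sup>2) powr p + \<nu> * (s2\<^sup>2 + C2\<^sup>2) powr p) powr (1 / p)"
    by (simp add: algebra_simps)
  have rr: "r1\<^sup>2 = s1\<^sup>2 + C1\<^sup>2" "r2\<^sup>2 = s2\<^sup>2 + C2\<^sup>2" unfolding r1_def r2_def using AB by auto
  have rsG: "r1 * r2 - s1 * s2 - G \<ge> 0"
  proof -
    have "(s1 * s2 + C1 * C2)\<^sup>2 \<le> (r1 * r2)\<^sup>2"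
      unfolding power_mult_distrib[of r1] rr
      using zero_le_power2[of "s1 * C2 - s2 * C1"] by (simp add: power2_eq_square algebra_simps)
    then have "s1 * s2 + C1 * C2 \<le> r1 * r2" using power2_le_imp_le r by (metis less_imp_le mult_pos_pos)
    then show ?thesis using C by simp
  qed
  have 2: "m\<^sup>2 = (\<mu> * s1 + \<nu> * s2)\<^sup>2 + (\<mu>\<^sup>2 * C1\<^sup>2 + 2 * \<mu> * \<nu> * G + \<nu>\<^sup>2 * C2\<^sup>2) + 2 * (\<mu> * \<nu>) * (r1 * r2 - s1 * s2 - G)"
    unfolding m_def power2_sum power_mult_distrib rr by (simp add: algebra_simps)
  have "c * (2 * (\<mu> * \<nu>) * (r1 * r2 - s1 * s2 - G)) \<le> 1 * (2 * (\<mu> * \<nu>) * (r1 * r2 - s1 * s2 - G))"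
    using c rsG \<mu> by (intro mult_right_mono) auto
  then have 3: "(\<mu> * s1 + \<nu> * s2)\<^sup>2 + (\<mu>\<^sup>2 * C1\<^sup>2 + 2 * \<mu> * \<nu> * G + \<nu>\<^sup>2 * C2\<^sup>2)
      + c * (\<mu> * \<nu>) * (2 * (r1 * r2 - s1 * s2 - G) + (r1 - r2)\<^sup>2) \<le> m\<^sup>2 + c * (\<mu> * \<nu>) * (r1 - r2)\<^sup>2"
    unfolding 2 by (simp add: algebra_simps)
  have 4: "2 * (r1 * r2 - s1 * s2 - G) + (r1 - r2)\<^sup>2 = s1\<^sup>2 + s2\<^sup>2 - 2 * s1 * s2 + (C1\<^sup>2 - 2 * G + C2\<^sup>2)"
    unfolding power2_diff rr by (simp add: algebra_simps)
  have 5: "1 \<le> (\<mu> * s1 + \<nu> * s2)\<^sup>2"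
  proof -
    have "1 \<le> (\<mu> * s1 powr p + \<nu> * s2 powr p) powr (1 / p)" using mean p by (intro ge_one_powr_ge_zero) auto
    also have "\<dots> \<le> \<mu> * (s1 powr p) powr (1 / p) + \<nu> * (s2 powr p) powr (1 / p)"
      using s \<mu> p by (intro powr_mean_le) auto
    also have "\<dots> = \<mu> * s1 + \<nu> * s2" using s p by (simp add: powr_powr)
    finally show ?thesis by (simp add: one_le_power)
  qed
  show ?thesis using 1 3 5 unfolding 4 c_def by linarith
qed

text \<open>After Jensen with exponent \<open>p\<close> the rest is an identity: the weighted mean
  of the squares exceeds the square of the weighted mean by \<open>\<mu> * \<nu>\<close> times the
  square of the difference.\<close>

lemma power_mean_gap_high:
  fixes p \<mu> \<nu> s1 s2 C1 C2 G :: real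
  assumes p: "1 \<le> p" and \<mu>: "\<mu> > 0" "\<nu> > 0" "\<mu> + \<nu> = 1" and s: "s1 > 0" "s2 > 0"
  shows "(\<mu> * s1\<^sup>2 + \<nu> * s2\<^sup>2) + (\<mu>\<^sup>2 * C1\<^sup>2 + 2 * \<mu> * \<nu> * G + \<nu>\<^sup>2 * C2\<^sup>2) + (\<mu> * \<nu>) * (C1\<^sup>2 - 2 * G + C2\<^sup>2)
    \<le> (\<mu> * (s1\<^sup>2 + C1\<^sup>2) powr p + \<nu> * (s2\<^sup>2 + C2\<^sup>2) powr p) powr (1 / p)"
proof -
  define A B where "A = s1\<^sup>2 + C1\<^sup>2" and "B = s2\<^sup>2 + C2\<^sup>2"
  have AB: "A > 0" "B > 0" unfolding A_def B_def using s by (simp_all add: add_pos_nonneg)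
  have "(\<mu> * A + \<nu> * B) powr p \<le> \<mu> * A powr p + \<nu> * B powr p"
    using AB p \<mu> by (intro powr_mean_le) auto
  then have "((\<mu> * A + \<nu> * B) powr p) powr (1 / p) \<le> (\<mu> * A powr p + \<nu> * B powr p) powr (1 / p)"
    using p by (intro powr_mono2) auto
  then have 1: "\<mu> * A + \<nu> * B \<le> (\<mu> * A powr p + \<nu> * B powr p) powr (1 / p)"
    using p AB \<mu> by (simp add: powr_powr add_pos_pos)
  have n: "\<nu> = 1 - \<mu>" using \<mu> by simp
  have "(\<mu> * s1\<^sup>2 + \<nu> * s2\<^sup>2) + (\<mu>\<^sup>2 * C1\<^sup>2 + 2 * \<mu> * \<nu> * G + \<nu>\<^sup>2 * C2\<^sup>2) + (\<mu> * \<nu>) * (C1\<^sup>2 - 2 * G + C2\<^sup>2) = \<mu> * A + \<nu> * B"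
    unfolding A_def B_def n by (simp add: power2_eq_square algebra_simps)
  then show ?thesis using 1 unfolding A_def B_def by simp
qed

text \<open>For \<open>s1 = s2\<close> the strictness comes from \<open>g < - 1\<close>, that is,
  from distinct points; for different scales it comes from Jensen with exponent
  \<open>2 / p > 1\<close>.\<close>

lemma power_mean_square_gap:
  fixes p \<mu> \<nu> s1 s2 g :: real
  assumes p: "1 \<le> p" "p < 2" and \<mu>: "\<mu> > 0" "\<nu> > 0" "\<mu> + \<nu> = 1" and s: "s1 > 0" "s2 > 0"
    and g: "g < - 1" and nonneg: "- s1\<^sup>2 - s2\<^sup>2 - 2 * s1 * s2 * g \<ge> 0"
    and mean: "\<mu> * s1 powr p + \<nu> * s2 powr p \<ge> 1"
  shows "\<mu> * s1\<^sup>2 + \<nu> * s2\<^sup>2 - 1 + \<mu> * \<nu> * (- s1\<^sup>2 - s2\<^sup>2 - 2 * s1 * s2 * g) > 0"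
proof -
  define m where "m = \<mu> * s1 powr p + \<nu> * s2 powr p"
  have m0: "m \<ge> 1" using mean unfolding m_def .
  define e where "e = 2 / p * (2 / p - 1) / 2 * (1 / \<mu> + 1 / \<nu>) powr (2 / p - 2) * (\<mu> * \<nu>) * ((s1 powr p - s2 powr p) / m)\<^sup>2"
  have q1: "2 / p - 1 > 0" using p by (simp add: field_simps)
  have e: "e \<ge> 0" unfolding e_def
    using p \<mu> q1 by (intro mult_nonneg_nonneg divide_nonneg_nonneg) auto
  have T: "1 / \<mu> + 1 / \<nu> > 0" using \<mu> by (simp add: add_pos_pos)
  have "m powr (2 / p) * (1 + e) \<le> \<mu> * (s1 powr p) powr (2 / p) + \<nu> * (s2 powr p) powr (2 / p)"
    unfolding e_def m_def by (rule powr_mean_gap) (use p s \<mu> in \<open>auto simp: field_simps\<close>)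
  also have "\<dots> = \<mu> * s1\<^sup>2 + \<nu> * s2\<^sup>2" using s p by (simp add: powr_powr)
  finally have 1: "m powr (2 / p) * (1 + e) \<le> \<mu> * s1\<^sup>2 + \<nu> * s2\<^sup>2" .
  have "m powr (2 / p) \<ge> 1" using m0 p by (intro ge_one_powr_ge_zero) auto
  then have "1 * (1 + e) \<le> m powr (2 / p) * (1 + e)" using e by (intro mult_right_mono) auto
  then have 2: "1 + e \<le> \<mu> * s1\<^sup>2 + \<nu> * s2\<^sup>2" using 1 by simp
  show ?thesis
  proof (cases "s1 = s2")
    case True
    have "- s1\<^sup>2 - s2\<^sup>2 - 2 * s1 * s2 * g = 2 * s1\<^sup>2 * (- 1 - g)" unfolding True by (simp add: power2_eq_square algebra_simps)
    moreover have "2 * s1\<^sup>2 * (- 1 - g) > 0" using s g by simp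
    ultimately have "\<mu> * \<nu> * (- s1\<^sup>2 - s2\<^sup>2 - 2 * s1 * s2 * g) > 0" using \<mu> by simp
    then show ?thesis using 2 e by linarith
  next
    case False
    then have "s1 powr p \<noteq> s2 powr p" using s p by (metis powr_less_mono2 less_irrefl linorder_neqE_linordered_idom less_imp_le less_le_trans zero_less_one)
    then have "((s1 powr p - s2 powr p) / m)\<^sup>2 > 0" using m0 by simp
    then have "e > 0" unfolding e_def
      using p \<mu> T q1 by (intro mult_pos_pos divide_pos_pos) auto
    moreover have "\<mu> * \<nu> * (- s1\<^sup>2 - s2\<^sup>2 - 2 * s1 * s2 * g) \<ge> 0" using nonneg \<mu> by (intro mult_nonneg_nonneg) auto
    ultimately show ?thesis using 2 by linarith
  qed
qed


lemma supported_psum_points: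
  fixes X1 X2 :: "'m::finite minkowski" and a b p :: real
  assumes X: "X1 \<in> hyp_space" "X2 \<in> hyp_space" "X1 \<noteq> X2"
    and p: "1 / 2 < p" "p < 2" and ab: "a > 0" "b > 0" "a + b \<ge> 1"
  obtains c where "c > 0" "supported c (psum p a b (horo X1) (horo X2))"
proof -
  let ?S = "sphere 0 1 :: (real ^ 'm) set"
  define \<beta> where "\<beta> z = (a * horo X1 z powr p + b * horo X2 z powr p) powr (1 / p)" for z
  define \<mu> where "\<mu> z = a * horo X1 z powr p / \<beta> z powr p" for z
  define \<nu> where "\<nu> z = b * horo X2 z powr p / \<beta> z powr p" for z
  define s1 where "s1 z = \<beta> z / horo X1 z" for z
  define s2 where "s2 z = \<beta> z / horo X2 z" for z
  define g where "g = mink X1 X2"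
  have g: "g < -1" unfolding g_def using hyp_mink_le[OF X(1,2)] hyp_mink_eq_imp[OF X(1,2)] X(3) by fastforce
  \<comment> \<open>A bound for the excess that involves \<open>z0\<close> alone, since
    \<open>C1\<^sup>2 - 2 * G + C2\<^sup>2\<close> does not depend on the second direction.
    Continuity and positivity on the compact sphere then give one constant.\<close>
  define gap where "gap z = (if p \<le> 1
      then p * (2 * p - 1) * (1 / \<mu> z + 1 / \<nu> z) powr (2 * p - 2) * (\<mu> z * \<nu> z) * (2 * s1 z * s2 z * (- 1 - g))
      else \<mu> z * (s1 z)\<^sup>2 + \<nu> z * (s2 z)\<^sup>2 - 1 + \<mu> z * \<nu> z * (- (s1 z)\<^sup>2 - (s2 z)\<^sup>2 - 2 * s1 z * s2 z * g))" for z
  have p0: "p > 0" and ab0: "a + b > 0" "a \<ge> 0" "b \<ge> 0" using p ab by auto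
  have al: "horo X1 z > 0" "horo X2 z > 0" if "norm z = 1" for z using horo_pos X that by blast+
  have contact: "\<exists>Z. \<beta> z0 > 0 \<and> s1 z0 > 0 \<and> s2 z0 > 0 \<and> \<mu> z0 \<ge> 0 \<and> \<nu> z0 \<ge> 0 \<and> \<mu> z0 + \<nu> z0 = 1 \<and>
      \<mu> z0 * s1 z0 powr p = a \<and> \<nu> z0 * s2 z0 powr p = b \<and> Z \<in> hyp_space \<and> horo Z z0 = \<beta> z0 \<and>
    (\<forall>z. norm z = 1 \<longrightarrow> z \<noteq> z0 \<longrightarrow> (\<exists>C1 C2 G. C1 \<ge> 0 \<and> C2 \<ge> 0 \<and> G \<le> C1 * C2 \<and>
      2 * \<beta> z0 * s1 z0 * horo X1 z / (1 - z \<bullet> z0) = (s1 z0)\<^sup>2 + C1\<^sup>2 \<and>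
      2 * \<beta> z0 * s2 z0 * horo X2 z / (1 - z \<bullet> z0) = (s2 z0)\<^sup>2 + C2\<^sup>2 \<and>
      C1\<^sup>2 - 2 * G + C2\<^sup>2 = - (s1 z0)\<^sup>2 - (s2 z0)\<^sup>2 - 2 * s1 z0 * s2 z0 * g \<and>
      2 * \<beta> z0 * horo Z z / (1 - z \<bullet> z0) = 1 + ((\<mu> z0)\<^sup>2 * C1\<^sup>2 + 2 * \<mu> z0 * \<nu> z0 * G + (\<nu> z0)\<^sup>2 * C2\<^sup>2)))"
    if z0: "norm z0 = 1" for z0
    by (rule psum_contact[OF X(1,2) z0 ab0(2,3,1) p0, folded \<beta>_def, folded \<mu>_def \<nu>_def s1_def s2_def g_def]) blast
  have \<mu>pos: "\<mu> z > 0" "\<nu> z > 0" if "norm z = 1" for z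
    unfolding \<mu>_def \<nu>_def using contact[OF that] al[OF that] ab by auto
  have gappos: "gap z0 > 0" if z0: "norm z0 = 1" for z0
  proof (cases "p \<le> 1")
    case True
    have "1 / \<mu> z0 + 1 / \<nu> z0 > 0" using \<mu>pos[OF z0] by (simp add: add_pos_pos)
    moreover have "s1 z0 > 0" "s2 z0 > 0" using contact[OF z0] by blast+
    ultimately show ?thesis
      unfolding gap_def using True \<mu>pos[OF z0] p g by (simp add: zero_less_mult_iff)
  next
    case False
    \<comment> \<open>Any direction other than \<open>z0\<close> has a frame; the antipode serves as
      a witness that the direction-independent square in \<open>gap\<close> is nonnegative.\<close>
    have "- z0 \<noteq> z0"
    proof
      assume "- z0 = z0"
      then have "2 *\<^sub>R z0 = 0" by (metis add.right_inverse scaleR_2)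
      then show False using z0 by simp
    qed
    then obtain C1 C2 G where "C1 \<ge> 0" "C2 \<ge> 0" "G \<le> C1 * C2"
       "C1\<^sup>2 - 2 * G + C2\<^sup>2 = - (s1 z0)\<^sup>2 - (s2 z0)\<^sup>2 - 2 * s1 z0 * s2 z0 * g"
      using contact[OF z0] z0 norm_minus_cancel[of z0] by metis
    moreover have "C1\<^sup>2 + C2\<^sup>2 - 2 * (C1 * C2) \<ge> 0"
      using zero_le_power2[of "C1 - C2"] by (simp add: power2_diff)
    ultimately have nn: "- (s1 z0)\<^sup>2 - (s2 z0)\<^sup>2 - 2 * s1 z0 * s2 z0 * g \<ge> 0" by linarith
    have c: "\<mu> z0 + \<nu> z0 = 1" "s1 z0 > 0" "s2 z0 > 0" "\<mu> z0 * s1 z0 powr p + \<nu> z0 * s2 z0 powr p \<ge> 1"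
      using contact[OF z0] ab by auto
    show ?thesis unfolding gap_def
      using power_mean_square_gap[OF _ p(2) \<mu>pos[OF z0] c(1-3) g nn c(4)] False by auto
  qed
  have \<beta>pos: "\<beta> z > 0" if "norm z = 1" for z using contact[OF that] by blast
  have ne: "horo X1 z \<noteq> 0" "horo X2 z \<noteq> 0" "\<beta> z \<noteq> 0" "\<mu> z \<noteq> 0" "\<nu> z \<noteq> 0" "1 / \<mu> z + 1 / \<nu> z \<noteq> 0"
    "a * horo X1 z powr p + b * horo X2 z powr p \<noteq> 0" if "z \<in> ?S" for z
  proof -
    have z: "norm z = 1" using that by simp
    note q = al[OF z] \<beta>pos[OF z] \<mu>pos[OF z]
    then show "horo X1 z \<noteq> 0" "horo X2 z \<noteq> 0" "\<beta> z \<noteq> 0" "\<mu> z \<noteq> 0" "\<nu> z \<noteq> 0" by auto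
    have "1 / \<mu> z + 1 / \<nu> z > 0" using q by (simp add: add_pos_pos)
    then show "1 / \<mu> z + 1 / \<nu> z \<noteq> 0" by simp
    show "a * horo X1 z powr p + b * horo X2 z powr p \<noteq> 0" using q(3) unfolding \<beta>_def by auto
  qed
  have ch: "continuous_on ?S (horo X1)" "continuous_on ?S (horo X2)"
    by (intro continuous_intros)+
  have c\<beta>: "continuous_on ?S \<beta>"
    unfolding \<beta>_def using ne by (intro continuous_intros ch) auto
  have c\<mu>: "continuous_on ?S \<mu>" "continuous_on ?S \<nu>"
    unfolding \<mu>_def \<nu>_def using ne by (intro continuous_intros ch c\<beta>; auto)+
  have cs: "continuous_on ?S s1" "continuous_on ?S s2"
    unfolding s1_def s2_def using ne by (intro continuous_intros ch c\<beta>; auto)+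
  have cgap: "continuous_on ?S gap"
    unfolding gap_def using ne by (cases "p \<le> 1") (simp_all, (intro continuous_intros c\<mu> cs; auto)+)
  \<comment> \<open>The excess \<open>gap z0\<close> of the frame identity is multiplied by
    \<open>k / (2 * \<beta> z0)\<close> when solved for the p-sum, and \<open>k\<close> is half the
    squared distance; hence the quotient by \<open>4 * \<beta>\<close>.\<close>
  have "\<exists>z1\<in>?S. \<forall>z\<in>?S. gap z1 / (4 * \<beta> z1) \<le> gap z / (4 * \<beta> z)"
    using ne by (intro continuous_attains_inf continuous_intros cgap c\<beta>) auto
  then obtain z1 where z1: "norm z1 = 1" "\<And>z. norm z = 1 \<Longrightarrow> gap z1 / (4 * \<beta> z1) \<le> gap z / (4 * \<beta> z)" by auto
  define c where "c = gap z1 / (4 * \<beta> z1)"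
  have c: "c > 0" unfolding c_def using gappos[OF z1(1)] \<beta>pos[OF z1(1)] by simp
  have "\<exists>Z\<in>hyp_space. horo Z z0 = psum p a b (horo X1) (horo X2) z0 \<and>
      (\<forall>z. norm z = 1 \<longrightarrow> psum p a b (horo X1) (horo X2) z \<ge> horo Z z + c * (norm (z - z0))\<^sup>2)" if z0: "norm z0 = 1" for z0
  proof -
    obtain Z where \<beta>: "\<beta> z0 > 0" and s: "s1 z0 > 0" "s2 z0 > 0" and \<mu>1: "\<mu> z0 + \<nu> z0 = 1"
      and \<mu>s: "\<mu> z0 * s1 z0 powr p = a" "\<nu> z0 * s2 z0 powr p = b"
      and Z: "Z \<in> hyp_space" "horo Z z0 = \<beta> z0"
      and frame: "\<And>z. norm z = 1 \<Longrightarrow> z \<noteq> z0 \<Longrightarrow> (\<exists>C1 C2 G. C1 \<ge> 0 \<and> C2 \<ge> 0 \<and> G \<le> C1 * C2 \<and>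
      2 * \<beta> z0 * s1 z0 * horo X1 z / (1 - z \<bullet> z0) = (s1 z0)\<^sup>2 + C1\<^sup>2 \<and>
      2 * \<beta> z0 * s2 z0 * horo X2 z / (1 - z \<bullet> z0) = (s2 z0)\<^sup>2 + C2\<^sup>2 \<and>
      C1\<^sup>2 - 2 * G + C2\<^sup>2 = - (s1 z0)\<^sup>2 - (s2 z0)\<^sup>2 - 2 * s1 z0 * s2 z0 * g \<and>
      2 * \<beta> z0 * horo Z z / (1 - z \<bullet> z0) = 1 + ((\<mu> z0)\<^sup>2 * C1\<^sup>2 + 2 * \<mu> z0 * \<nu> z0 * G + (\<nu> z0)\<^sup>2 * C2\<^sup>2))"
      using contact[OF z0] by blast
    note \<mu> = \<mu>pos[OF z0]
    have \<beta>eq: "\<beta> z0 = psum p a b (horo X1) (horo X2) z0" by (simp add: \<beta>_def psum_def)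
    have "psum p a b (horo X1) (horo X2) z \<ge> horo Z z + c * (norm (z - z0))\<^sup>2" if z: "norm z = 1" for z
    proof (cases "z = z0")
      case True
      then show ?thesis using Z \<beta>eq by simp
    next
      case False
      define k where "k = 1 - z \<bullet> z0"
      have kn: "k = (norm (z - z0))\<^sup>2 / 2" unfolding k_def by (rule unit_inner_diff[OF z z0])
      have k: "k > 0" unfolding kn using False by simp
      obtain C1 C2 G where C: "C1 \<ge> 0" "C2 \<ge> 0" "G \<le> C1 * C2"
        and e1: "2 * \<beta> z0 * s1 z0 * horo X1 z / k = (s1 z0)\<^sup>2 + C1\<^sup>2" and e2: "2 * \<beta> z0 * s2 z0 * horo X2 z / k = (s2 z0)\<^sup>2 + C2\<^sup>2"
        and eG: "C1\<^sup>2 - 2 * G + C2\<^sup>2 = - (s1 z0)\<^sup>2 - (s2 z0)\<^sup>2 - 2 * s1 z0 * s2 z0 * g"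
        and eZ: "2 * \<beta> z0 * horo Z z / k = 1 + ((\<mu> z0)\<^sup>2 * C1\<^sup>2 + 2 * \<mu> z0 * \<nu> z0 * G + (\<nu> z0)\<^sup>2 * C2\<^sup>2)"
        using frame[OF z False] unfolding k_def by blast
      let ?M = "\<mu> z0 * ((s1 z0)\<^sup>2 + C1\<^sup>2) powr p + \<nu> z0 * ((s2 z0)\<^sup>2 + C2\<^sup>2) powr p"
      have 1: "1 + ((\<mu> z0)\<^sup>2 * C1\<^sup>2 + 2 * \<mu> z0 * \<nu> z0 * G + (\<nu> z0)\<^sup>2 * C2\<^sup>2) + gap z0 \<le> ?M powr (1 / p)"
      proof (cases "p \<le> 1")
        case True
        have e: "(s1 z0)\<^sup>2 + (s2 z0)\<^sup>2 - 2 * s1 z0 * s2 z0 + (C1\<^sup>2 - 2 * G + C2\<^sup>2) = 2 * s1 z0 * s2 z0 * (- 1 - g)"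
          unfolding eG by (simp add: algebra_simps)
        show ?thesis
          using power_mean_gap_low[OF p(1) True \<mu> \<mu>1 s C, of "1 / \<mu> z0 + 1 / \<nu> z0"] True \<mu> \<mu>s ab
          unfolding gap_def e by simp
      next
        case False
        then show ?thesis
          using power_mean_gap_high[of p, OF _ \<mu> \<mu>1 s, of C1 G C2] unfolding gap_def eG by simp
      qed
      have "?M = (2 * \<beta> z0 / k) powr p * (a * horo X1 z powr p + b * horo X2 z powr p)"
      proof -
        have "\<mu> z0 * (2 * \<beta> z0 * s1 z0 * horo X1 z / k) powr p = (2 * \<beta> z0 / k) powr p * (a * horo X1 z powr p)"
          "\<nu> z0 * (2 * \<beta> z0 * s2 z0 * horo X2 z / k) powr p = (2 * \<beta> z0 / k) powr p * (b * horo X2 z powr p)"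
          using \<beta> k s al[OF z] by (simp_all add: \<mu>s[symmetric] powr_mult powr_divide)
        then show ?thesis unfolding e1 e2 by (simp add: algebra_simps)
      qed
      then have "?M powr (1 / p) = 2 * \<beta> z0 / k * psum p a b (horo X1) (horo X2) z"
        using \<beta> k p0 al[OF z] ab by (simp add: powr_mult powr_powr psum_def)
      then have "2 * \<beta> z0 * horo Z z / k + gap z0 \<le> 2 * \<beta> z0 / k * psum p a b (horo X1) (horo X2) z"
        using 1 eZ by simp
      then have "(k / (2 * \<beta> z0)) * (2 * \<beta> z0 * horo Z z / k + gap z0) \<le> (k / (2 * \<beta> z0)) * (2 * \<beta> z0 / k * psum p a b (horo X1) (horo X2) z)"
        using \<beta> k by (intro mult_left_mono) auto
      then have 3: "horo Z z + k / (2 * \<beta> z0) * gap z0 \<le> psum p a b (horo X1) (horo X2) z"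
        using \<beta> k by (simp add: distrib_left)
      have "c * (norm (z - z0))\<^sup>2 \<le> gap z0 / (4 * \<beta> z0) * (norm (z - z0))\<^sup>2"
        unfolding c_def by (intro mult_right_mono z1(2) z0) auto
      also have "\<dots> = k / (2 * \<beta> z0) * gap z0" unfolding kn using \<beta> by (simp add: field_simps)
      finally show ?thesis using 3 by simp
    qed
    then show ?thesis using Z \<beta>eq by auto
  qed
  then have "supported c (psum p a b (horo X1) (horo X2))" unfolding supported_def by blast
  then show ?thesis using that c by blast
qed

section \<open>Smooth boundaries and their second fundamental form\<close>

lemma smooth_on_const: "open U \<Longrightarrow> smooth_on U (\<lambda>x. c)"
  by (simp add: smooth_on_def Ck_on_const)

lemma smooth_on_add: "open U \<Longrightarrow> smooth_on U f \<Longrightarrow> smooth_on U g \<Longrightarrow> smooth_on U (\<lambda>x. f x + g x)"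
  by (simp add: smooth_on_def Ck_on_add)

lemma smooth_on_diff: "open U \<Longrightarrow> smooth_on U f \<Longrightarrow> smooth_on U g \<Longrightarrow> smooth_on U (\<lambda>x. f x - g x)"
  by (simp add: smooth_on_def Ck_on_diff)

lemma smooth_on_minus: "open U \<Longrightarrow> smooth_on U f \<Longrightarrow> smooth_on U (\<lambda>x. - f x)"
  by (simp add: smooth_on_def Ck_on_minus)

lemma smooth_on_mult: "open U \<Longrightarrow> smooth_on U f \<Longrightarrow> smooth_on U g \<Longrightarrow> smooth_on U (\<lambda>x. f x * g x)"
  by (simp add: smooth_on_def Ck_on_mult)

lemma smooth_on_bounded_linear: "open U \<Longrightarrow> bounded_linear f \<Longrightarrow> smooth_on U f"
  by (simp add: smooth_on_def Ck_on_bounded_linear)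

lemma smooth_on_powr:
  "open U \<Longrightarrow> smooth_on U f \<Longrightarrow> (\<And>x. x \<in> U \<Longrightarrow> f x > 0) \<Longrightarrow> smooth_on U (\<lambda>x. f x powr a)"
  by (simp add: smooth_on_def Ck_on_compose_powr)

lemma smooth_on_sum: "open U \<Longrightarrow> (\<And>i. i \<in> I \<Longrightarrow> smooth_on U (f i)) \<Longrightarrow> smooth_on U (\<lambda>x. \<Sum>i\<in>I. f i x)"
  by (simp add: smooth_on_def Ck_on_sum)

lemma smooth_on_cong:
  assumes "open U" "smooth_on U f" "\<And>x. x \<in> U \<Longrightarrow> f x = g x"
  shows "smooth_on U g"
  using Ck_on_cong[OF assms(1) _ assms(3)] assms(2) by (simp add: smooth_on_def)

lemma smooth_on_compose:
  assumes "open U" "open V" "smooth_on V f" "smoothv_on U s" "s ` U \<subseteq> V"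
  shows "smooth_on U (\<lambda>x. f (s x))"
  using Ck_on_compose[OF assms(1,2) _ smoothv_on_imp_Ckv_on[OF assms(4)] assms(5)] assms(3)
  by (simp add: smooth_on_def)

lemma smooth_on_inverse: "open U \<Longrightarrow> smooth_on U f \<Longrightarrow> (\<And>x. x \<in> U \<Longrightarrow> f x > 0) \<Longrightarrow> smooth_on U (\<lambda>x. 1 / f x)"
  by (rule smooth_on_cong[OF _ smooth_on_powr[where a = "-1"]]) (auto simp: powr_minus field_simps abs_of_pos)

lemma smooth_on_sqrt: "open U \<Longrightarrow> smooth_on U f \<Longrightarrow> (\<And>x. x \<in> U \<Longrightarrow> f x > 0) \<Longrightarrow> smooth_on U (\<lambda>x. sqrt (f x))"
  by (rule smooth_on_cong[OF _ smooth_on_powr[where a = "1/2"]]) (auto simp: powr_half_sqrt less_imp_le)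

lemma smoothv_onI_Basis: "open U \<Longrightarrow> (\<And>b. b \<in> Basis \<Longrightarrow> smooth_on U (\<lambda>x. s x \<bullet> b)) \<Longrightarrow> smoothv_on U s"
  unfolding smoothv_on_def smooth_on_def using Ckv_on_Basis unfolding Ckv_on_def by blast

lemma smoothv_onD: "smoothv_on U s \<Longrightarrow> smooth_on U (\<lambda>x. s x \<bullet> c)"
  unfolding smoothv_on_def by blast

lemma smoothv_on_const: "open U \<Longrightarrow> smoothv_on U (\<lambda>x. c)"
  unfolding smoothv_on_def by (simp add: smooth_on_const)

lemma smoothv_on_bounded_linear: "open U \<Longrightarrow> bounded_linear s \<Longrightarrow> smoothv_on U s"
  by (simp add: smoothv_on_def smooth_on_bounded_linear bounded_linear_inner_left_comp)

lemma smoothv_on_id: "open U \<Longrightarrow> smoothv_on U (\<lambda>x. x)"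
  by (intro smoothv_on_bounded_linear bounded_linear_ident)

lemma smoothv_on_add: "open U \<Longrightarrow> smoothv_on U s \<Longrightarrow> smoothv_on U t \<Longrightarrow> smoothv_on U (\<lambda>x. s x + t x)"
  by (simp add: smoothv_on_def inner_add_left smooth_on_add)

lemma smoothv_on_diff: "open U \<Longrightarrow> smoothv_on U s \<Longrightarrow> smoothv_on U t \<Longrightarrow> smoothv_on U (\<lambda>x. s x - t x)"
  by (simp add: smoothv_on_def inner_diff_left smooth_on_diff)

lemma smoothv_on_scaleR: "open U \<Longrightarrow> smooth_on U f \<Longrightarrow> smoothv_on U s \<Longrightarrow> smoothv_on U (\<lambda>x. f x *\<^sub>R s x)"
  by (simp add: smoothv_on_def smooth_on_mult)

lemma smoothv_on_Pair: "open U \<Longrightarrow> smoothv_on U s \<Longrightarrow> smoothv_on U t \<Longrightarrow> smoothv_on U (\<lambda>x. (s x, t x))"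
  unfolding smoothv_on_def inner_prod_def fst_conv snd_conv by (intro allI smooth_on_add) blast+

lemma smoothv_on_real: "smoothv_on U s \<longleftrightarrow> smooth_on U s" if "open U" for s :: "_ \<Rightarrow> real"
proof
  show "smooth_on U s" if "smoothv_on U s" using smoothv_onD[OF that, of 1] by simp
  show "smoothv_on U s" if "smooth_on U s"
    using smooth_on_mult[OF \<open>open U\<close> that smooth_on_const[OF \<open>open U\<close>]] unfolding smoothv_on_def by simp
qed

lemma smoothv_on_fst: "smoothv_on U s \<Longrightarrow> smoothv_on U (\<lambda>x. fst (s x))"
  and smoothv_on_snd: "smoothv_on U s \<Longrightarrow> smoothv_on U (\<lambda>x. snd (s x))"
proof -
  assume s: "smoothv_on U s"
  have "smooth_on U (\<lambda>x. fst (s x) \<bullet> c)" for c using smoothv_onD[OF s, of "(c, 0)"] by (simp add: inner_prod_def)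
  then show "smoothv_on U (\<lambda>x. fst (s x))" unfolding smoothv_on_def by blast
  have "smooth_on U (\<lambda>x. snd (s x) \<bullet> c)" for c using smoothv_onD[OF s, of "(0, c)"] by (simp add: inner_prod_def)
  then show "smoothv_on U (\<lambda>x. snd (s x))" unfolding smoothv_on_def by blast
qed

lemma smooth_on_inner:
  assumes "open U" "smoothv_on U s" "smoothv_on U t"
  shows "smooth_on U (\<lambda>x. s x \<bullet> t x)"
proof -
  have "smooth_on U (\<lambda>x. \<Sum>b\<in>Basis. (s x \<bullet> b) * (t x \<bullet> b))"
    by (intro smooth_on_sum smooth_on_mult smoothv_onD assms)
  then show ?thesis by (simp flip: euclidean_inner)
qed

lemma smoothv_on_compose:
  assumes "open U" "open V" "smoothv_on V f" "smoothv_on U s" "s ` U \<subseteq> V"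
  shows "smoothv_on U (\<lambda>x. f (s x))"
  unfolding smoothv_on_def
  using smooth_on_compose[OF assms(1,2) smoothv_onD[OF assms(3)] assms(4,5)] by blast

lemma smoothv_on_subset: "smoothv_on U f \<Longrightarrow> V \<subseteq> U \<Longrightarrow> smoothv_on V f"
  using smooth_on_subset unfolding smoothv_on_def by blast

lemma smoothv_on_imp_continuous_on: "smoothv_on U s \<Longrightarrow> continuous_on U s"
  by (rule continuous_on_componentwise[THEN iffD2]) (intro ballI smooth_on_imp_continuous_on smoothv_onD)

lemma smooth_on_mink:
  fixes s t :: "'a::euclidean_space \<Rightarrow> 'm::finite minkowski"
  assumes "open U" "smoothv_on U s" "smoothv_on U t"
  shows "smooth_on U (\<lambda>x. mink (s x) (t x))"
proof -
  have "smooth_on U (\<lambda>x. fst (s x) \<bullet> fst (t x) - snd (s x) \<bullet> snd (t x))"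
    by (intro smooth_on_diff smooth_on_inner smoothv_on_fst smoothv_on_snd assms)
  then show ?thesis by (simp add: mink_eq)
qed

section \<open>Normals of sublevel sets in hyperbolic space\<close>

definition mgrad :: "('m::finite minkowski \<Rightarrow> real) \<Rightarrow> 'm minkowski \<Rightarrow> 'm minkowski" where
  "mgrad F Y = (\<Sum>b\<in>Basis. frechet_derivative F (at Y) b *\<^sub>R (fst b, - snd b))"

lemma mink_mgrad:
  assumes "F differentiable (at Y)"
  shows "mink (mgrad F Y) v = frechet_derivative F (at Y) v"
proof -
  have lin: "linear (frechet_derivative F (at Y))"
    using assms frechet_derivative_works has_derivative_linear by blast
  have J: "mink (fst b, - snd b) v = v \<bullet> b" for b :: "'a minkowski"
    by (simp add: mink_eq inner_prod_def inner_commute)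
  have "mink (mgrad F Y) v = (\<Sum>b\<in>Basis. frechet_derivative F (at Y) b * (v \<bullet> b))"
    unfolding mgrad_def linear_sum[OF bounded_linear.linear[OF bounded_bilinear.bounded_linear_left[OF bounded_bilinear_mink]]] mink_simps J ..
  also have "\<dots> = frechet_derivative F (at Y) v"
    using has_derivative_linear_expand[OF lin, of v] by (simp add: mult.commute)
  finally show ?thesis .
qed

lemma smoothv_on_mgrad:
  assumes "open U" "smooth_on U F"
  shows "smoothv_on U (mgrad F)"
proof -
  have "smooth_on U (\<lambda>Y. \<Sum>b\<in>Basis. frechet_derivative F (at Y) b * ((fst b, - snd b) \<bullet> c))" for c
    by (intro smooth_on_sum smooth_on_mult smooth_on_const smooth_on_frechet_derivative assms)
  then show ?thesis by (simp only: smoothv_on_def mgrad_def inner_sum_left inner_scaleR_left simp_thms)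
qed

text \<open>On hyperbolic space this is the hyperbolic gradient: the gradient \<open>mgrad\<close>
  with respect to the Minkowski form, projected to the tangent space. The projection has a plus sign
  because \<open>mink Y Y = -1\<close>. The formula is kept off the hyperboloid so that the field
  can be differentiated in the ambient space.\<close>

definition nrm :: "('m::finite minkowski \<Rightarrow> real) \<Rightarrow> 'm minkowski \<Rightarrow> 'm minkowski" where
  "nrm F Y = mgrad F Y + mink (mgrad F Y) Y *\<^sub>R Y"

definition unit_normal :: "('m::finite minkowski \<Rightarrow> real) \<Rightarrow> 'm minkowski \<Rightarrow> 'm minkowski" where
  "unit_normal F Y = (1 / sqrt (mink (nrm F Y) (nrm F Y))) *\<^sub>R nrm F Y"

lemma smoothv_on_nrm: "open U \<Longrightarrow> smooth_on U F \<Longrightarrow> smoothv_on U (nrm F)"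
  unfolding nrm_def by (intro smoothv_on_add smoothv_on_scaleR smooth_on_mink smoothv_on_mgrad smoothv_on_id)

lemma mink_nrm_self: "Y \<in> hyp_space \<Longrightarrow> mink (nrm F Y) Y = 0"
  using hyp_spaceD(1)[of Y] by (simp add: nrm_def)

lemma mink_nrm: "F differentiable (at Y) \<Longrightarrow> mink v Y = 0 \<Longrightarrow> mink (nrm F Y) v = frechet_derivative F (at Y) v"
  by (simp add: nrm_def mink_mgrad mink_commute[of Y v])

lemma hyp_spaceI_mink:
  assumes X: "X \<in> hyp_space" and YY: "mink Y Y = -1" and neg: "mink Y X < 0"
  shows "Y \<in> hyp_space"
proof -
  have "snd Y > 0"
  proof (rule ccontr)
    assume "\<not> snd Y > 0"
    then have n: "snd Y \<le> 0" by simp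
    have "(norm (fst Y))\<^sup>2 < (snd Y)\<^sup>2"
      using YY unfolding mink_eq power2_norm_eq_inner power2_eq_square[of "snd Y"] by linarith
    then have l: "norm (fst Y) < - snd Y" using n power_less_imp_less_base[of "norm (fst Y)" 2 "- snd Y"] by simp
    have "- (fst Y \<bullet> fst X) \<le> norm (fst Y) * norm (fst X)"
      using Cauchy_Schwarz_ineq2[of "fst Y" "fst X"] by simp
    also have "\<dots> \<le> (- snd Y) * snd X" using l n hyp_spaceD(4)[OF X] by (intro mult_mono) auto
    finally have "mink Y X \<ge> 0" by (simp add: mink_eq)
    then show False using neg by simp
  qed
  then show ?thesis using YY by (simp add: hyp_space_def)
qed

lemma hyp_geodesic:
  assumes "X \<in> hyp_space" "mink N X = 0" "mink N N = 1"
  shows "cosh t *\<^sub>R X + sinh t *\<^sub>R N \<in> hyp_space"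
proof -
  let ?Y = "cosh t *\<^sub>R X + sinh t *\<^sub>R N"
  have "mink ?Y ?Y = (sinh t)\<^sup>2 - (cosh t)\<^sup>2"
    using assms(2,3) hyp_spaceD(1)[OF assms(1)] by (simp add: mink_commute[of X N] power2_eq_square)
  then have YY: "mink ?Y ?Y = -1" by (simp add: cosh_square_eq)
  have YX: "mink ?Y X = - cosh t" using assms(2) hyp_spaceD(1)[OF assms(1)] by simp
  show ?thesis by (rule hyp_spaceI_mink[OF assms(1) YY]) (use YX cosh_real_pos[of t] in simp)
qed

lemma geodesic_derivative:
  fixes Y N :: "'a::real_normed_vector"
  shows "((\<lambda>t::real. cosh t *\<^sub>R Y + sinh t *\<^sub>R N) has_derivative (\<lambda>h. h *\<^sub>R N)) (at 0)"
  by (auto intro!: derivative_eq_intros)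

lemma open_less_on:
  fixes f :: "'a::topological_space \<Rightarrow> real"
  assumes "open U" "continuous_on U f" "continuous_on U g"
  shows "open {x \<in> U. f x < g x}"
proof -
  obtain A where "open A" "A \<inter> U = {x \<in> U. f x < g x}" using open_Collect_less_Int[OF assms(2,3)] by blast
  then show ?thesis using open_Int[of A U] assms(1) by simp
qed

section \<open>Boundary charts, tangent spaces and the shape operator\<close>

lemma hyp_boundary_iff:
  "X \<in> hyp_boundary \<Omega> \<longleftrightarrow> X \<in> hyp_space \<and>
    (\<forall>V. open V \<and> X \<in> V \<longrightarrow> (\<exists>Y\<in>V \<inter> hyp_space. Y \<in> \<Omega>) \<and> (\<exists>Y\<in>V \<inter> hyp_space. Y \<notin> \<Omega>))"
proof -
  have i: "X \<in> top_of_set hyp_space interior_of \<Omega> \<longleftrightarrow> (\<exists>V. open V \<and> X \<in> V \<inter> hyp_space \<and> V \<inter> hyp_space \<subseteq> \<Omega>)"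
    by (auto simp: interior_of_def openin_open Int_commute)
  have c: "X \<in> top_of_set hyp_space closure_of \<Omega> \<longleftrightarrow>
      X \<in> hyp_space \<and> (\<forall>V. open V \<and> X \<in> V \<longrightarrow> (\<exists>Y\<in>V \<inter> hyp_space. Y \<in> \<Omega>))"
    by (auto simp: closure_of_def openin_open)
  show ?thesis unfolding hyp_boundary_def frontier_of_def Diff_iff i c by blast
qed

text \<open>Regularity is demanded on all of \<open>U\<close>, also off the hyperboloid, so that
  \<open>unit_normal F\<close> is smooth on an open set of the ambient space.\<close>

locale boundary_chart =
  fixes \<Omega> U :: "'m::finite minkowski set" and F :: "'m minkowski \<Rightarrow> real"
  assumes open_U: "open U" and smooth_F: "smooth_on U F"
    and Omega_U: "\<Omega> \<inter> U = {Y \<in> hyp_space \<inter> U. F Y \<le> 0}"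
    and regular: "\<And>Y. Y \<in> U \<Longrightarrow> mink (nrm F Y) (nrm F Y) > 0"
begin

lemma F_derivative: "Y \<in> U \<Longrightarrow> (F has_derivative frechet_derivative F (at Y)) (at Y)"
  using smooth_on_has_derivative[OF smooth_F] .

lemma F_differentiable: "Y \<in> U \<Longrightarrow> F differentiable (at Y)"
  using F_derivative differentiable_def by blast

lemma normal_properties:
  assumes "Y \<in> U"
  shows "mink (unit_normal F Y) (unit_normal F Y) = 1"
    and "Y \<in> hyp_space \<Longrightarrow> mink (unit_normal F Y) Y = 0"
    and "mink v Y = 0 \<Longrightarrow> mink (unit_normal F Y) v = frechet_derivative F (at Y) v / sqrt (mink (nrm F Y) (nrm F Y))"
    and "Y \<in> hyp_space \<Longrightarrow> frechet_derivative F (at Y) (unit_normal F Y) = sqrt (mink (nrm F Y) (nrm F Y))"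
proof -
  have p: "mink (nrm F Y) (nrm F Y) > 0" using regular assms by blast
  then show 1: "mink (unit_normal F Y) (unit_normal F Y) = 1" by (simp add: unit_normal_def)
  show 2: "mink (unit_normal F Y) Y = 0" if "Y \<in> hyp_space"
    using mink_nrm_self[OF that] by (simp add: unit_normal_def)
  show 3: "mink (unit_normal F Y) v = frechet_derivative F (at Y) v / sqrt (mink (nrm F Y) (nrm F Y))" if "mink v Y = 0" for v
    using mink_nrm[OF F_differentiable[OF assms] that] by (simp add: unit_normal_def)
  show "frechet_derivative F (at Y) (unit_normal F Y) = sqrt (mink (nrm F Y) (nrm F Y))" if "Y \<in> hyp_space"
    using 3[OF 2[OF that]] 1 p by simp
qed

lemma F_along_geodesic:
  assumes "Y \<in> U"
  shows "((\<lambda>t. F (cosh t *\<^sub>R Y + sinh t *\<^sub>R N)) has_real_derivative frechet_derivative F (at Y) N) (at 0)"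
proof -
  note geodesic_derivative[of Y N]
  moreover have "(F has_derivative frechet_derivative F (at Y)) (at (cosh 0 *\<^sub>R Y + sinh 0 *\<^sub>R N))"
    using F_derivative[OF assms] by simp
  ultimately have "((\<lambda>t. F (cosh t *\<^sub>R Y + sinh t *\<^sub>R N)) has_derivative (\<lambda>h. frechet_derivative F (at Y) (h *\<^sub>R N))) (at 0)"
    using diff_chain_at[of "\<lambda>t::real. cosh t *\<^sub>R Y + sinh t *\<^sub>R N" _ 0 F] by (simp add: o_def)
  then show ?thesis
    using linear_scale[OF has_derivative_linear[OF F_derivative[OF assms]]]
    by (simp add: has_field_derivative_def mult_commute_abs)
qed

lemma geodesic_eventually_in_open:
  fixes Y N :: "'m minkowski"
  assumes "open V" "Y \<in> V"
  shows "\<forall>\<^sub>F t in at_right (0::real). cosh t *\<^sub>R Y + sinh t *\<^sub>R N \<in> V"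
proof -
  have "isCont (\<lambda>t::real. cosh t *\<^sub>R Y + sinh t *\<^sub>R N) 0"
    using has_derivative_continuous[OF geodesic_derivative] .
  then have "((\<lambda>t::real. cosh t *\<^sub>R Y + sinh t *\<^sub>R N) \<longlongrightarrow> Y) (at 0)" by (simp add: isCont_def)
  then have "((\<lambda>t::real. cosh t *\<^sub>R Y + sinh t *\<^sub>R N) \<longlongrightarrow> Y) (at_right 0)"
    by (rule filterlim_mono) (auto simp: at_le)
  then show ?thesis using topological_tendstoD assms by blast
qed

lemma geodesic_outside:
  assumes "Y \<in> U" "Y \<in> hyp_space" "F Y = 0" "frechet_derivative F (at Y) N > 0"
  shows "\<forall>\<^sub>F t in at_right 0. cosh t *\<^sub>R Y + sinh t *\<^sub>R N \<notin> \<Omega>"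
proof -
  obtain d where d: "d > 0" "\<And>h. h > 0 \<Longrightarrow> h < d \<Longrightarrow> F (cosh 0 *\<^sub>R Y + sinh 0 *\<^sub>R N) < F (cosh (0 + h) *\<^sub>R Y + sinh (0 + h) *\<^sub>R N)"
    using DERIV_pos_inc_right[OF F_along_geodesic[OF assms(1), of N] assms(4)] by blast
  have "\<forall>\<^sub>F t in at_right 0. t < d \<and> t > 0" using d(1) eventually_at_right_less eventually_at_right[of 0 d] by (auto simp: eventually_conj_iff eventually_at_right_field)
  then show ?thesis using geodesic_eventually_in_open[OF open_U assms(1), of N]
  proof eventually_elim
    case (elim t)
    then have "F (cosh t *\<^sub>R Y + sinh t *\<^sub>R N) > 0" using d(2)[of t] assms(3) by simp
    then show ?case using elim Omega_U by force
  qed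
qed

lemma geodesic_inside:
  assumes "Y \<in> U" "Y \<in> hyp_space" "F Y = 0" "frechet_derivative F (at Y) N < 0" "mink N Y = 0" "mink N N = 1"
  shows "\<forall>\<^sub>F t in at_right 0. cosh t *\<^sub>R Y + sinh t *\<^sub>R N \<in> \<Omega>"
proof -
  obtain d where d: "d > 0" "\<And>h. h > 0 \<Longrightarrow> h < d \<Longrightarrow> F (cosh 0 *\<^sub>R Y + sinh 0 *\<^sub>R N) > F (cosh (0 + h) *\<^sub>R Y + sinh (0 + h) *\<^sub>R N)"
    using DERIV_neg_dec_right[OF F_along_geodesic[OF assms(1), of N] assms(4)] by blast
  have "\<forall>\<^sub>F t in at_right 0. t < d \<and> t > 0" using d(1) by (auto simp: eventually_conj_iff eventually_at_right_field)
  then show ?thesis using geodesic_eventually_in_open[OF open_U assms(1), of N]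
  proof eventually_elim
    case (elim t)
    then have "F (cosh t *\<^sub>R Y + sinh t *\<^sub>R N) < 0" using d(2)[of t] assms(3) by simp
    then show ?case using elim Omega_U hyp_geodesic[OF assms(2,5,6)] by force
  qed
qed

lemma boundary_iff:
  assumes "Y \<in> U"
  shows "Y \<in> hyp_boundary \<Omega> \<longleftrightarrow> Y \<in> hyp_space \<and> F Y = 0"
proof
  assume Y: "Y \<in> hyp_space \<and> F Y = 0"
  show "Y \<in> hyp_boundary \<Omega>" unfolding hyp_boundary_iff
  proof (intro conjI allI impI)
    fix V assume V: "open V \<and> Y \<in> V"
    have "Y \<in> \<Omega>" using Y assms Omega_U by force
    then show "\<exists>Y\<in>V \<inter> hyp_space. Y \<in> \<Omega>" using V Y by blast
    \<comment> \<open>The geodesic with this initial velocity leaves the sublevel set at once, which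
      supplies outside points in every neighbourhood.\<close>
    let ?N = "unit_normal F Y"
    have "frechet_derivative F (at Y) ?N > 0" using normal_properties(4)[OF assms] regular[OF assms] Y by simp
    then have "\<forall>\<^sub>F t in at_right 0. cosh t *\<^sub>R Y + sinh t *\<^sub>R ?N \<notin> \<Omega> \<and> cosh t *\<^sub>R Y + sinh t *\<^sub>R ?N \<in> V"
      using geodesic_outside[OF assms] Y geodesic_eventually_in_open[of V Y] V by (simp add: eventually_conj_iff)
    then obtain t where "cosh t *\<^sub>R Y + sinh t *\<^sub>R ?N \<notin> \<Omega>" "cosh t *\<^sub>R Y + sinh t *\<^sub>R ?N \<in> V"
      using eventually_happens' trivial_limit_at_right_real by blast
    then show "\<exists>Y\<in>V \<inter> hyp_space. Y \<notin> \<Omega>"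
      using hyp_geodesic[of Y ?N t] normal_properties(1,2)[OF assms] Y by blast
  qed (use Y in simp)
next
  assume b: "Y \<in> hyp_boundary \<Omega>"
  then have h: "Y \<in> hyp_space" by (simp add: hyp_boundary_iff)
  have op: "open {Z \<in> U. F Z < 0}" "open {Z \<in> U. 0 < F Z}"
    by (intro open_less_on open_U smooth_on_imp_continuous_on[OF smooth_F] continuous_on_const)+
  have "\<not> F Y < 0"
  proof
    assume "F Y < 0"
    then obtain Z where "Z \<in> {Z \<in> U. F Z < 0}" "Z \<in> hyp_space" "Z \<notin> \<Omega>"
      using b op(1) assms unfolding hyp_boundary_iff by blast
    then show False using Omega_U by force
  qed
  moreover have "\<not> F Y > 0"
  proof
    assume "F Y > 0"
    then obtain Z where "Z \<in> {Z \<in> U. F Z > 0}" "Z \<in> hyp_space" "Z \<in> \<Omega>"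
      using b op(2) assms unfolding hyp_boundary_iff by blast
    then show False using Omega_U by force
  qed
  ultimately show "Y \<in> hyp_space \<and> F Y = 0" using h by simp
qed

end

text \<open>A differential that is nonzero on the tangent space gives a nonzero tangent vector
  \<open>nrm F X\<close>, which is spacelike; continuity extends the positivity of its square to a
  smaller open set.\<close>

lemma smooth_boundary_chart:
  assumes "smooth_boundary \<Omega>" "X \<in> hyp_boundary \<Omega>"
  obtains U F where "boundary_chart \<Omega> U F" "X \<in> U"
proof -
  obtain U F where U: "open U" "X \<in> U" "smooth_on U F" "\<Omega> \<inter> U = {Y \<in> hyp_space \<inter> U. F Y \<le> 0}" "F X = 0"
    and v: "\<exists>v. mink v X = 0 \<and> frechet_derivative F (at X) v \<noteq> 0"
    using bspec[OF assms(1)[unfolded smooth_boundary_def] assms(2)] by (elim exE conjE) (rule that; assumption?; blast)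
  have Xh: "X \<in> hyp_space" using assms(2) by (simp add: hyp_boundary_iff)
  have "F differentiable (at X)"
    using smooth_on_has_derivative[OF U(3,2)] differentiable_def by blast
  then have "nrm F X \<noteq> 0" using v mink_nrm[of F X] by force
  then have pos: "mink (nrm F X) (nrm F X) > 0" using mink_orthogonal_pos[OF Xh mink_nrm_self[OF Xh]] by blast
  define U' where "U' = {Y \<in> U. 0 < mink (nrm F Y) (nrm F Y)}"
  have c: "continuous_on U (\<lambda>Y. mink (nrm F Y) (nrm F Y))"
    by (intro smooth_on_imp_continuous_on smooth_on_mink smoothv_on_nrm U)
  have o: "open U'"
    unfolding U'_def by (intro open_less_on c U(1) continuous_on_const)
  have "boundary_chart \<Omega> U' F"
    by unfold_locales (use o U smooth_on_subset[OF U(3)] in \<open>auto simp: U'_def\<close>)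
  then show ?thesis using that U pos unfolding U'_def by blast
qed

context boundary_chart
begin

lemma smooth_on_isCont: "open V \<Longrightarrow> smooth_on V f \<Longrightarrow> x \<in> V \<Longrightarrow> isCont f x"
  using smooth_on_imp_continuous_on continuous_on_eq_continuous_at by blast

lemma boundary_tangent_sub:
  assumes "X \<in> U" "X \<in> hyp_boundary \<Omega>" "v \<in> tangent_space (hyp_boundary \<Omega>) X"
  shows "mink v X = 0" "frechet_derivative F (at X) v = 0"
proof -
  obtain \<gamma> \<epsilon> where \<gamma>: "\<epsilon> > 0" "\<gamma> 0 = X" "\<And>t. \<bar>t\<bar> < \<epsilon> \<Longrightarrow> \<gamma> t \<in> hyp_boundary \<Omega>"
    "(\<gamma> has_vector_derivative v) (at 0)"
    using assms(3) unfolding tangent_space_def by blast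
  have d\<gamma>: "(\<gamma> has_derivative (\<lambda>h. h *\<^sub>R v)) (at 0)" using \<gamma>(4) by (simp add: has_vector_derivative_def)
  have "((\<lambda>t. mink (\<gamma> t) (\<gamma> t)) has_derivative (\<lambda>h. mink (\<gamma> 0) (h *\<^sub>R v) + mink (h *\<^sub>R v) (\<gamma> 0))) (at 0)"
    by (rule has_derivative_mink[OF d\<gamma> d\<gamma>])
  moreover have "((\<lambda>t. mink (\<gamma> t) (\<gamma> t)) has_derivative (\<lambda>h. 0)) (at 0)"
  proof (rule has_derivative_transform_within_open[OF has_derivative_const[of "-1"], where s = "{-\<epsilon><..<\<epsilon>}"])
    fix t assume "t \<in> {-\<epsilon><..<\<epsilon>}"
    then have "\<bar>t\<bar> < \<epsilon>" by auto
    then have "\<gamma> t \<in> hyp_space" using \<gamma>(3)[of t] by (simp add: hyp_boundary_iff)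
    then show "- 1 = mink (\<gamma> t) (\<gamma> t)" using hyp_spaceD(1)[of "\<gamma> t"] by simp
  qed (use \<gamma> in auto)
  ultimately have "(\<lambda>h. mink (\<gamma> 0) (h *\<^sub>R v) + mink (h *\<^sub>R v) (\<gamma> 0)) = (\<lambda>h. 0)"
    by (rule has_derivative_unique)
  then have "mink X (1 *\<^sub>R v) + mink (1 *\<^sub>R v) X = 0" using \<gamma>(2) by metis
  then show "mink v X = 0" by (simp add: mink_commute)
  have "isCont \<gamma> 0" using has_derivative_continuous[OF d\<gamma>] .
  then have "\<forall>\<^sub>F t in at 0. \<gamma> t \<in> U"
    using topological_tendstoD[OF _ open_U, of \<gamma> "\<gamma> 0" "at 0"] assms(1) \<gamma>(2) by (simp add: isCont_def)
  then obtain d where d: "d > 0" "\<And>t. t \<noteq> 0 \<Longrightarrow> \<bar>t\<bar> < d \<Longrightarrow> \<gamma> t \<in> U"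
    unfolding eventually_at by (auto simp: dist_norm)
  have "((\<lambda>t. F (\<gamma> t)) has_derivative (\<lambda>h. frechet_derivative F (at X) (h *\<^sub>R v))) (at 0)"
    using diff_chain_at[OF d\<gamma>, of F] F_derivative[OF assms(1)] \<gamma>(2) by (simp add: o_def)
  moreover have "((\<lambda>t. F (\<gamma> t)) has_derivative (\<lambda>h. 0)) (at 0)"
  proof (rule has_derivative_transform_within_open[OF has_derivative_const[of 0], where s = "{- min \<epsilon> d <..< min \<epsilon> d}"])
    fix t assume t: "t \<in> {- min \<epsilon> d <..< min \<epsilon> d}"
    then have "\<gamma> t \<in> U" using d(2)[of t] \<gamma>(2) assms(1) by (cases "t = 0") auto
    moreover have "\<gamma> t \<in> hyp_boundary \<Omega>" using \<gamma>(3)[of t] t by auto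
    ultimately show "0 = F (\<gamma> t)" using boundary_iff by auto
  qed (use \<gamma> d in auto)
  ultimately have "(\<lambda>h. frechet_derivative F (at X) (h *\<^sub>R v)) = (\<lambda>h. 0)"
    by (rule has_derivative_unique)
  then show "frechet_derivative F (at X) v = 0" by (metis scaleR_one)
qed

text \<open>
  The map \<open>\<Psi>\<close> below has derivative the identity at \<open>X\<close> and carries the boundary into the
  tangent space, so the preimage of a straight line is a curve in the boundary.
\<close>

lemma boundary_tangent_sup:
  assumes "X \<in> U" "X \<in> hyp_boundary \<Omega>" "mink v X = 0" "frechet_derivative F (at X) v = 0"
  shows "v \<in> tangent_space (hyp_boundary \<Omega>) X"
proof -
  have X: "X \<in> hyp_space" "F X = 0" using boundary_iff assms by blast+
  let ?D = "frechet_derivative F (at X)"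
  have blD: "bounded_linear ?D" using F_derivative[OF assms(1)] has_derivative_bounded_linear by blast
  note linD = bounded_linear.linear[OF blD]
  define w where "w = mink (nrm F X) (nrm F X)"
  have w: "w > 0" unfolding w_def using regular assms by blast
  \<comment> \<open>\<open>e1\<close> and \<open>e2\<close> are dual to the two constraints: the
    differential of \<open>F\<close> takes the values 1 and 0 on them, the product with
    \<open>X\<close> the values 0 and 1. They let \<open>\<Psi>\<close> replace the linear parts of
    the constraint functions by the functions themselves.\<close>
  define e1 where "e1 = (1 / w) *\<^sub>R nrm F X"
  define e2 where "e2 = ?D X *\<^sub>R e1 - X"
  have "?D (nrm F X) = w"
    unfolding w_def using mink_nrm[OF F_differentiable[OF assms(1)] mink_nrm_self[OF X(1), of F]] by simp
  then have e1: "?D e1 = 1" "mink e1 X = 0"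
    using w mink_nrm_self[OF X(1), of F] linear_scale[OF linD] by (simp_all add: e1_def)
  have e2: "?D e2 = 0" "mink e2 X = 1"
    using e1 hyp_spaceD(1)[OF X(1)] by (simp_all add: e2_def linear_diff[OF linD] linear_scale[OF linD])
  define \<Psi> where "\<Psi> Y = (Y - X) + (F Y - ?D (Y - X)) *\<^sub>R e1 + (1 / 2 * (mink Y Y + 1) - mink (Y - X) X) *\<^sub>R e2" for Y
  have \<Psi>0: "\<Psi> X = 0" unfolding \<Psi>_def using X(2) hyp_spaceD(1)[OF X(1)] linear_0[OF linD] by simp
  have sD: "smooth_on U (\<lambda>Y. ?D (Y - X))"
    using smooth_on_diff[OF open_U smooth_on_bounded_linear[OF open_U blD] smooth_on_const[OF open_U, of "?D X"]]
    by (simp add: linear_diff[OF linD])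
  have sm: "smoothv_on U \<Psi>"
    unfolding \<Psi>_def
    by (intro smoothv_on_add smoothv_on_diff smoothv_on_scaleR smoothv_on_const smoothv_on_id
        smooth_on_diff smooth_F sD smooth_on_mink open_U smooth_on_add smooth_on_const
        smooth_on_mult)
  have der: "(\<Psi> has_derivative (\<lambda>h. h)) (at X)"
  proof -
    have d0: "((\<lambda>Y. Y - X) has_derivative (\<lambda>h. h - 0)) (at X)"
      by (intro has_derivative_diff has_derivative_ident has_derivative_const)
    have d1: "((\<lambda>Y. ?D (Y - X)) has_derivative (\<lambda>h. ?D (h - 0))) (at X)"
      by (rule bounded_linear.has_derivative[OF blD d0])
    have "(\<Psi> has_derivative (\<lambda>h. (h - 0) + (?D h - ?D (h - 0)) *\<^sub>R e1
        + (1 / 2 * ((mink X h + mink h X) + 0) - (mink (X - X) 0 + mink (h - 0) X)) *\<^sub>R e2)) (at X)"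
      unfolding \<Psi>_def
      by (intro has_derivative_add has_derivative_scaleR_left has_derivative_diff[OF F_derivative[OF assms(1)] d1]
          has_derivative_diff[OF has_derivative_mult_right has_derivative_mink[OF d0 has_derivative_const]]
          has_derivative_mink has_derivative_ident has_derivative_const d0)
    then show ?thesis by (simp add: mink_commute[of X])
  qed
  have "frechet_derivative \<Psi> (at X) = (\<lambda>h. h)" using frechet_derivative_at[OF der] by simp
  then obtain T V \<Theta> where T: "open T" "T \<subseteq> U" "X \<in> T" "open V" "\<Psi> X \<in> V" and hom: "homeomorphism T V \<Psi> \<Theta>"
    and s\<Theta>: "smoothv_on V \<Theta>"
    using smooth_inverse_function[OF open_U sm assms(1)] by metis
  have V0: "0 \<in> V" using T \<Psi>0 by simp
  have \<Theta>0: "\<Theta> 0 = X" using hom T \<Psi>0 unfolding homeomorphism_def by metis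
  have d\<Theta>: "(\<Theta> has_derivative frechet_derivative \<Theta> (at 0)) (at 0)"
    using smoothv_on_has_derivative[OF s\<Theta> V0] .
  have "((\<lambda>Y. \<Theta> (\<Psi> Y)) has_derivative frechet_derivative \<Theta> (at 0)) (at X)"
    using diff_chain_at[OF der, of \<Theta>] d\<Theta> \<Psi>0 by (simp add: o_def)
  moreover have "((\<lambda>Y. \<Theta> (\<Psi> Y)) has_derivative (\<lambda>h. h)) (at X)"
    by (rule has_derivative_transform_within_open[OF has_derivative_ident T(1,3)])
       (use hom in \<open>auto simp: homeomorphism_def\<close>)
  ultimately have d1: "frechet_derivative \<Theta> (at 0) = (\<lambda>h. h)" by (rule has_derivative_unique)
  define \<gamma> where "\<gamma> t = \<Theta> (t *\<^sub>R v)" for t :: real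
  have d\<gamma>: "(\<gamma> has_vector_derivative v) (at 0)"
  proof -
    have "((\<lambda>t::real. t *\<^sub>R v) has_derivative (\<lambda>h. h *\<^sub>R v)) (at 0)" by (auto intro!: derivative_eq_intros)
    from diff_chain_at[OF this, of \<Theta>] d\<Theta> d1 show ?thesis
      by (simp add: \<gamma>_def[abs_def] o_def has_vector_derivative_def)
  qed
  then have "isCont \<gamma> 0" using has_derivative_continuous by (auto simp: has_vector_derivative_def)
  then have t1: "(\<gamma> \<longlongrightarrow> X) (at 0)" by (simp add: isCont_def \<gamma>_def \<Theta>0)
  have "((\<lambda>t. mink (\<gamma> t) X) \<longlongrightarrow> mink X X) (at 0)" by (intro tendsto_intros t1)
  \<comment> \<open>Keeps the curve on the upper sheet of the hyperboloid.\<close>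
  then have ev1: "\<forall>\<^sub>F t in at 0. mink (\<gamma> t) X < 0" using hyp_spaceD(1)[OF X(1)] order_tendstoD(2)[of "\<lambda>t. mink (\<gamma> t) X" "mink X X" "at 0" 0] by simp
  have "((\<lambda>t::real. t *\<^sub>R v) \<longlongrightarrow> 0) (at 0)" by (auto intro!: tendsto_eq_intros)
  then have ev2: "\<forall>\<^sub>F t in at 0. t *\<^sub>R v \<in> V" using topological_tendstoD T(4) V0 by blast
  have "\<forall>\<^sub>F t in at 0. \<gamma> t \<in> hyp_boundary \<Omega>"
    using ev1 ev2
  proof eventually_elim
    case (elim t)
    have \<gamma>T: "\<gamma> t \<in> T" and \<Psi>\<gamma>: "\<Psi> (\<gamma> t) = t *\<^sub>R v"
      using hom elim(2) unfolding \<gamma>_def homeomorphism_def by auto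
    have "?D (\<Psi> (\<gamma> t)) = F (\<gamma> t)" unfolding \<Psi>_def
      by (simp add: linear_add[OF linD] linear_scale[OF linD] e1 e2)
    then have F0: "F (\<gamma> t) = 0" using \<Psi>\<gamma> assms(4) by (simp add: linear_scale[OF linD])
    have "mink (\<Psi> (\<gamma> t)) X = (mink (\<gamma> t) (\<gamma> t) + 1) / 2" unfolding \<Psi>_def using e1 e2 by simp
    then have "mink (\<gamma> t) (\<gamma> t) = -1" using \<Psi>\<gamma> assms(3) by simp
    then have "\<gamma> t \<in> hyp_space" using hyp_spaceI_mink[OF X(1) _ elim(1)] by blast
    then show ?case using boundary_iff[of "\<gamma> t"] F0 \<gamma>T T(2) by blast
  qed
  then obtain \<epsilon> where \<epsilon>: "\<epsilon> > 0" "\<And>t. t \<noteq> 0 \<Longrightarrow> \<bar>t\<bar> < \<epsilon> \<Longrightarrow> \<gamma> t \<in> hyp_boundary \<Omega>"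
    unfolding eventually_at by (auto simp: dist_norm)
  have "\<gamma> 0 = X" by (simp add: \<gamma>_def \<Theta>0)
  then have "\<gamma> t \<in> hyp_boundary \<Omega>" if "\<bar>t\<bar> < \<epsilon>" for t using \<epsilon>(2)[of t] that assms(2) by (cases "t = 0") auto
  then show ?thesis unfolding tangent_space_def using \<epsilon>(1) \<open>\<gamma> 0 = X\<close> d\<gamma> by blast
qed

text \<open>The tangent space is the whole kernel of the differential of \<open>F\<close> within the
  tangent space of hyperbolic space, so a unit normal is determined up to sign. The opposite sign
  fails the outward test, as its geodesic enters the domain.\<close>

lemma outward_normal_eq:
  assumes "X \<in> U" "X \<in> hyp_boundary \<Omega>"
  shows "outward_normal \<Omega> X = unit_normal F X"
  unfolding outward_normal_def
proof (rule the_equality)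
  let ?N = "unit_normal F X" and ?D = "frechet_derivative F (at X)"
  define r where "r = sqrt (mink (nrm F X) (nrm F X))"
  have r: "r > 0" unfolding r_def using regular assms by simp
  have X: "X \<in> hyp_space" "F X = 0" using boundary_iff assms by blast+
  note N = normal_properties(1,2)[OF assms(1)] 
  have NX: "mink ?N X = 0" using N(2) X by blast
  have NF: "mink ?N v = ?D v / r" if "mink v X = 0" for v
    using normal_properties(3)[OF assms(1) that] by (simp add: r_def)
  have DN: "?D ?N = r" using normal_properties(4)[OF assms(1) X(1)] by (simp add: r_def)
  show "is_outward_normal \<Omega> X ?N"
    unfolding is_outward_normal_def
  proof (intro conjI ballI)
    show "mink ?N v = 0" if "v \<in> tangent_space (hyp_boundary \<Omega>) X" for v
      using boundary_tangent_sub[OF assms that] NF by simp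
    have "\<forall>\<^sub>F t in at_right 0. cosh t *\<^sub>R X + sinh t *\<^sub>R ?N \<notin> \<Omega>"
      using geodesic_outside[OF assms(1) X, of ?N] DN r by simp
    then show "\<exists>\<epsilon>>0. \<forall>t. 0 < t \<and> t < \<epsilon> \<longrightarrow> cosh t *\<^sub>R X + sinh t *\<^sub>R ?N \<notin> \<Omega>"
      unfolding eventually_at_right_field by auto
  qed (use N NX in auto)
  fix N' assume N': "is_outward_normal \<Omega> X N'"
  then have N'X: "mink N' X = 0" "mink N' N' = 1"
    and orth: "\<And>v. v \<in> tangent_space (hyp_boundary \<Omega>) X \<Longrightarrow> mink N' v = 0"
    and out: "\<exists>\<epsilon>>0. \<forall>t. 0 < t \<and> t < \<epsilon> \<longrightarrow> cosh t *\<^sub>R X + sinh t *\<^sub>R N' \<notin> \<Omega>"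
    unfolding is_outward_normal_def by blast+
  define c where "c = mink ?N N'"
  define u where "u = N' - c *\<^sub>R ?N"
  have uX: "mink u X = 0" using N'X NX by (simp add: u_def)
  have Nu: "mink ?N u = 0" using N by (simp add: u_def c_def)
  then have "?D u = 0" using NF[OF uX] r by simp
  then have "mink N' u = 0" using orth boundary_tangent_sup[OF assms uX] by blast
  then have "mink u u = 0" using Nu by (simp add: u_def[of] mink_commute)
  then have "u = 0" using mink_orthogonal_eq_0[OF X(1) uX] by blast
  then have N'c: "N' = c *\<^sub>R ?N" by (simp add: u_def)
  then have "c * c = 1" using N'X(2) N(1) by simp
  then consider "c = 1" | "c = -1" by (metis mult_minus_left square_eq_1_iff)
  then show "N' = ?N"
  proof cases
    case 2
    have "?D N' < 0" using N'c 2 DN r linear_neg[OF has_derivative_linear[OF F_derivative[OF assms(1)]], of ?N] by simp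
    then have "\<forall>\<^sub>F t in at_right 0. cosh t *\<^sub>R X + sinh t *\<^sub>R N' \<in> \<Omega>"
      using geodesic_inside[OF assms(1) X] N'X by blast
    moreover have "\<forall>\<^sub>F t in at_right 0. cosh t *\<^sub>R X + sinh t *\<^sub>R N' \<notin> \<Omega>"
      using out unfolding eventually_at_right_field by auto
    ultimately have "\<forall>\<^sub>F t in at_right (0::real). False" by eventually_elim simp
    then show ?thesis by simp
  qed (use N'c in simp)
qed

lemma smoothv_on_unit_normal: "smoothv_on U (unit_normal F)"
  unfolding unit_normal_def
  by (intro smoothv_on_scaleR smooth_on_inverse smooth_on_sqrt smooth_on_mink smoothv_on_nrm open_U smooth_F)
     (use regular in auto)

lemma normal_derivative: "Y \<in> U \<Longrightarrow> (unit_normal F has_derivative frechet_derivative (unit_normal F) (at Y)) (at Y)"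
  using smoothv_on_has_derivative[OF smoothv_on_unit_normal] .

lemma outward_normal_derivative:
  assumes "X \<in> U" "X \<in> hyp_boundary \<Omega>"
  shows "(outward_normal \<Omega> has_derivative frechet_derivative (unit_normal F) (at X)) (at X within hyp_boundary \<Omega>)"
proof -
  obtain d where d: "d > 0" "ball X d \<subseteq> U" using open_U assms(1) openE by blast
  show ?thesis
  proof (rule has_derivative_transform_within[OF has_derivative_at_withinI[OF normal_derivative[OF assms(1)]] d(1) assms(2)])
    fix Y assume "Y \<in> hyp_boundary \<Omega>" "dist Y X < d"
    moreover from this have "Y \<in> U" using d(2) by (auto simp: dist_commute)
    ultimately show "unit_normal F Y = outward_normal \<Omega> Y" using outward_normal_eq[of Y] by simp
  qed
qed

text \<open>The first claim differentiates the constant length. Orthogonality to \<open>Y\<close>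
  itself holds on the hyperboloid only, so the second claim must control the error in its
  neighbourhood.\<close>

lemma normal_derivative_orthogonal:
  assumes "X \<in> U" "X \<in> hyp_space" "mink v X = 0"
  shows "mink (frechet_derivative (unit_normal F) (at X) v) (unit_normal F X) = 0"
    and "mink (unit_normal F X) v = 0 \<Longrightarrow> mink (frechet_derivative (unit_normal F) (at X) v) X = 0"
proof -
  let ?A = "frechet_derivative (unit_normal F) (at X)"
  note dN = normal_derivative[OF assms(1)]
  have "((\<lambda>Y. mink (unit_normal F Y) (unit_normal F Y)) has_derivative
     (\<lambda>h. mink (unit_normal F X) (?A h) + mink (?A h) (unit_normal F X))) (at X)"
    by (rule has_derivative_mink[OF dN dN])
  moreover have "((\<lambda>Y. mink (unit_normal F Y) (unit_normal F Y)) has_derivative (\<lambda>h. 0)) (at X)"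
    by (rule has_derivative_transform_within_open[OF has_derivative_const[of 1] open_U assms(1)])
       (simp add: normal_properties(1))
  ultimately have "(\<lambda>h. mink (unit_normal F X) (?A h) + mink (?A h) (unit_normal F X)) = (\<lambda>h. 0)"
    by (rule has_derivative_unique)
  then have "mink (unit_normal F X) (?A v) + mink (?A v) (unit_normal F X) = 0" by metis
  then show "mink (?A v) (unit_normal F X) = 0" by (simp add: mink_commute)
  show "mink (?A v) X = 0" if Nv: "mink (unit_normal F X) v = 0"
  proof -
    \<comment> \<open>The product of the normal with \<open>Y\<close> is
      \<open>(mink Y Y + 1) * q Y\<close>; its first factor vanishes at \<open>X\<close>, and so
      does the derivative of that factor along tangent vectors.\<close>
    define q where "q Y = mink (mgrad F Y) Y / sqrt (mink (nrm F Y) (nrm F Y))" for Y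
    have c1: "isCont (\<lambda>Y. mink (mgrad F Y) Y) X"
      by (rule smooth_on_isCont[OF open_U _ assms(1)])
         (intro smooth_on_mink smoothv_on_mgrad smoothv_on_id open_U smooth_F)
    have "isCont (\<lambda>Y. mink (nrm F Y) (nrm F Y)) X"
      by (rule smooth_on_isCont[OF open_U _ assms(1)]) (intro smooth_on_mink smoothv_on_nrm open_U smooth_F)
    then have "isCont (\<lambda>Y. sqrt (mink (nrm F Y) (nrm F Y))) X" by (rule continuous_real_sqrt)
    then have "isCont q X" unfolding q_def using regular[OF assms(1)] by (intro isCont_divide c1) auto
    moreover have "((\<lambda>Y. mink Y Y + 1) has_derivative (\<lambda>h. mink X h + mink h X)) (at X)"
      by (auto intro!: derivative_eq_intros)
    ultimately have "((\<lambda>Y. (mink Y Y + 1) * q Y) has_derivative (\<lambda>h. (mink X h + mink h X) * q X)) (at X)"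
      by (intro has_derivative_mult_vanishing) (use hyp_spaceD(1)[OF assms(2)] in auto)
    moreover have "(mink Y Y + 1) * q Y = mink (unit_normal F Y) Y" for Y
      by (simp add: q_def unit_normal_def nrm_def algebra_simps add_divide_distrib)
    ultimately have "((\<lambda>Y. mink (unit_normal F Y) Y) has_derivative (\<lambda>h. (mink X h + mink h X) * q X)) (at X)" by simp
    moreover have "((\<lambda>Y. mink (unit_normal F Y) Y) has_derivative (\<lambda>h. mink (unit_normal F X) h + mink (?A h) X)) (at X)"
      by (rule has_derivative_mink[OF dN has_derivative_ident])
    ultimately have "(\<lambda>h. (mink X h + mink h X) * q X) = (\<lambda>h. mink (unit_normal F X) h + mink (?A h) X)"
      by (rule has_derivative_unique)
    then have "(mink X v + mink v X) * q X = mink (unit_normal F X) v + mink (?A v) X" by metis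
    then show ?thesis using Nv assms(3) by (simp add: mink_commute)
  qed
qed

text \<open>The Hessian on the hyperboloid is the ambient one plus the radial derivative of
  \<open>F\<close> times the metric; dividing by the length of the gradient gives the second
  fundamental form of the level set.\<close>

lemma second_fundamental_form:
  assumes "X \<in> U" "X \<in> hyp_space" "mink v X = 0" "mink w X = 0" "frechet_derivative F (at X) w = 0"
  shows "mink (frechet_derivative (unit_normal F) (at X) v) w =
    (hess F X w v + frechet_derivative F (at X) X * mink v w) / sqrt (mink (nrm F X) (nrm F X))"
proof -
  let ?A = "frechet_derivative (unit_normal F) (at X)" and ?D = "\<lambda>Y. frechet_derivative F (at Y)"
  define \<rho> where "\<rho> Y = 1 / sqrt (mink (nrm F Y) (nrm F Y))" for Y
  have "smooth_on U \<rho>" unfolding \<rho>_def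
    by (intro smooth_on_inverse smooth_on_sqrt smooth_on_mink smoothv_on_nrm open_U smooth_F)
       (use regular in auto)
  then have c\<rho>: "isCont \<rho> X"
    using smooth_on_isCont[OF open_U] assms(1) by blast
  \<comment> \<open>\<open>a\<close> vanishes at \<open>X\<close>, so the derivative of the
    normalising factor \<rho> drops out and its continuity suffices.\<close>
  define a where "a Y = ?D Y w + ?D Y Y * mink Y w" for Y
  have sP: "smooth_on U (\<lambda>Y. mink (mgrad F Y) Y)"
    by (intro smooth_on_mink smoothv_on_mgrad smoothv_on_id open_U smooth_F)
  have eqP: "mink (mgrad F Y) Y = ?D Y Y" if "Y \<in> U" for Y using mink_mgrad[OF F_differentiable[OF that]] .
  have sD: "smooth_on U (\<lambda>Y. ?D Y Y)" by (rule smooth_on_cong[OF open_U sP eqP])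
  have d1: "((\<lambda>Y. ?D Y w) has_derivative hess F X w) (at X)"
    unfolding hess_def[abs_def] using smooth_on_has_derivative[OF smooth_on_frechet_derivative[OF smooth_F] assms(1)] .
  have d2: "((\<lambda>Y. mink Y w * ?D Y Y) has_derivative (\<lambda>h. mink h w * ?D X X)) (at X)"
  proof (rule has_derivative_mult_vanishing)
    show "((\<lambda>Y. mink Y w) has_derivative (\<lambda>h. mink h w)) (at X)" by (auto intro!: derivative_eq_intros)
    show "isCont (\<lambda>Y. ?D Y Y) X"
      using smooth_on_isCont[OF open_U sD assms(1)] .
  qed (use assms(4) in \<open>simp add: mink_commute\<close>)
  have "(a has_derivative (\<lambda>h. hess F X w h + mink h w * ?D X X)) (at X)"
    using has_derivative_add[OF d1 d2] unfolding a_def by (simp add: mult.commute)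
  moreover have "a X = 0" using assms(4,5) by (simp add: a_def mink_commute)
  ultimately have "((\<lambda>Y. a Y * \<rho> Y) has_derivative (\<lambda>h. (hess F X w h + mink h w * ?D X X) * \<rho> X)) (at X)"
    using has_derivative_mult_vanishing c\<rho> by blast
  moreover have "a Y * \<rho> Y = mink (unit_normal F Y) w" if "Y \<in> U" for Y
    using mink_mgrad[OF F_differentiable[OF that]]
    by (simp add: a_def \<rho>_def unit_normal_def nrm_def)
  ultimately have "((\<lambda>Y. mink (unit_normal F Y) w) has_derivative (\<lambda>h. (hess F X w h + mink h w * ?D X X) * \<rho> X)) (at X)"
    by (rule has_derivative_transform_within_open[OF _ open_U assms(1)])
  moreover have "((\<lambda>Y. mink (unit_normal F Y) w) has_derivative (\<lambda>h. mink (unit_normal F X) 0 + mink (?A h) w)) (at X)"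
    by (rule has_derivative_mink[OF normal_derivative[OF assms(1)] has_derivative_const])
  ultimately have "(\<lambda>h. (hess F X w h + mink h w * ?D X X) * \<rho> X) = (\<lambda>h. mink (unit_normal F X) 0 + mink (?A h) w)"
    by (rule has_derivative_unique)
  then have "(hess F X w v + mink v w * ?D X X) * \<rho> X = mink (unit_normal F X) 0 + mink (?A v) w" by metis
  then show ?thesis by (simp add: \<rho>_def mult.commute)
qed

text \<open>
  The smallest value of the second fundamental form on unit tangent vectors is a principal
  curvature.
\<close>

lemma second_fundamental_form_gt:
  assumes "X \<in> U" "X \<in> hyp_boundary \<Omega>" and curv: "\<And>\<kappa>. principal_curvature \<Omega> X \<kappa> \<Longrightarrow> \<kappa> > c"
    and v: "mink v X = 0" "frechet_derivative F (at X) v = 0" "v \<noteq> 0"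
  shows "mink (frechet_derivative (unit_normal F) (at X) v) v > c * mink v v"
proof -
  have X: "X \<in> hyp_space" "F X = 0" using boundary_iff assms by blast+
  let ?D = "frechet_derivative F (at X)" and ?N = "unit_normal F X"
  define A where "A = frechet_derivative (unit_normal F) (at X)"
  have blA: "bounded_linear A" unfolding A_def using normal_derivative[OF assms(1)] has_derivative_bounded_linear by blast
  note linA = bounded_linear.linear[OF blA]
  have blD: "bounded_linear ?D" using F_derivative[OF assms(1)] has_derivative_bounded_linear by blast
  note linD = bounded_linear.linear[OF blD]
  define T where "T = {u. mink u X = 0 \<and> ?D u = 0}"
  have T_add: "u + w \<in> T" "r *\<^sub>R u \<in> T" if "u \<in> T" "w \<in> T" for u w r
    using that by (auto simp: T_def linear_add[OF linD] linear_scale[OF linD])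
  have sym: "mink (A u) w = mink (A w) u" if "u \<in> T" "w \<in> T" for u w
    unfolding A_def using second_fundamental_form[OF assms(1) X(1)] that hess_commute[OF open_U smooth_F assms(1)]
    by (auto simp: T_def mink_commute)
  define S where "S = {u \<in> T. mink u u = 1}"
  have "compact S"
  proof -
    have "closed S"
    proof -
      have "S = {u. mink u X = 0} \<inter> {u. ?D u = 0} \<inter> {u. mink u u = 1}" unfolding S_def T_def by auto
      then show ?thesis
        by (auto intro!: closed_Int closed_Collect_eq continuous_intros linear_continuous_on[OF blD])
    qed
    moreover have "norm u \<le> sqrt (2 * (snd X)\<^sup>2)" if "u \<in> S" for u
    proof -
      have "(norm u)\<^sup>2 \<le> 2 * (snd X)\<^sup>2 * mink u u"
        using mink_orthogonal_bound[OF X(1), of u] that by (simp add: S_def T_def)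
      then show ?thesis using that by (intro real_le_rsqrt) (simp add: S_def)
    qed
    then have "bounded S" unfolding bounded_iff by blast
    ultimately show ?thesis by (simp add: compact_eq_bounded_closed)
  qed
  moreover have vv: "mink v v > 0" using mink_orthogonal_pos[OF X(1)] v by blast
  have vT: "v \<in> T" using v by (simp add: T_def)
  have "(1 / sqrt (mink v v)) *\<^sub>R v \<in> S" using T_add(2)[OF vT vT] vv by (simp add: S_def)
  then have "S \<noteq> {}" by blast
  moreover have "continuous_on S (\<lambda>u. mink (A u) u)"
    by (intro continuous_intros linear_continuous_on[OF blA])
  ultimately obtain u where u: "u \<in> S" "\<And>w. w \<in> S \<Longrightarrow> mink (A u) u \<le> mink (A w) w"
    using continuous_attains_inf[of S "\<lambda>u. mink (A u) u"] by auto
  define \<kappa> where "\<kappa> = mink (A u) u"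
  have uT: "u \<in> T" "mink u u = 1" using u by (auto simp: S_def)
  have min: "\<kappa> * mink w w \<le> mink (A w) w" if w: "w \<in> T" for w
  proof (cases "w = 0")
    case False
    have ww: "mink w w > 0" using mink_orthogonal_pos[OF X(1)] w False by (simp add: T_def)
    let ?w = "(1 / sqrt (mink w w)) *\<^sub>R w"
    have "?w \<in> S" using T_add(2)[OF w w] ww by (simp add: S_def)
    from u(2)[OF this] have "\<kappa> \<le> mink (A w) w / mink w w"
      using ww by (simp add: \<kappa>_def linear_scale[OF linA])
    then show ?thesis using ww by (simp add: field_simps)
  qed (simp add: linear_0[OF linA])
  \<comment> \<open>Along \<open>u + t *\<^sub>R w\<close> the form minus \<kappa> times the metric
    is a nonnegative quadratic polynomial with constant term 0; its linear coefficient must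
    vanish.\<close>
  have eig: "mink (A u) w = \<kappa> * mink u w" if w: "w \<in> T" for w
  proof -
    define G where "G = mink (A u) w - \<kappa> * mink u w"
    define B where "B = mink (A w) w - \<kappa> * mink w w"
    have B: "B \<ge> 0" unfolding B_def using min[OF w] by simp
    have "0 + 2 * t * G + t\<^sup>2 * B \<ge> 0" for t
    proof -
      have "u + t *\<^sub>R w \<in> T" using T_add[of u "t *\<^sub>R w"] T_add(2)[OF w w] uT by blast
      from min[OF this] show ?thesis
        using sym[OF uT(1) w] uT(2)
        by (simp add: G_def B_def linear_add[OF linA] linear_scale[OF linA] \<kappa>_def[symmetric] mink_commute[of w u] power2_eq_square algebra_simps)
    qed
    from nonneg_quadratic_discriminant[OF this B] have "G = 0" by simp
    then show ?thesis by (simp add: G_def)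
  qed
  \<comment> \<open>The operator preserves the tangent space of the boundary, so the defect
    \<open>e\<close> is itself an admissible test vector and is orthogonal to itself.\<close>
  have Au: "A u = \<kappa> *\<^sub>R u"
  proof -
    have uX: "mink u X = 0" "?D u = 0" using uT by (auto simp: T_def)
    have Nu: "mink ?N u = 0" using normal_properties(3)[OF assms(1) uX(1)] uX by simp
    define e where "e = A u - \<kappa> *\<^sub>R u"
    have eX: "mink e X = 0" using normal_derivative_orthogonal(2)[OF assms(1) X(1) uX(1) Nu] uX by (simp add: e_def A_def)
    have eN: "mink e ?N = 0"
      using normal_derivative_orthogonal(1)[OF assms(1) X(1) uX(1)] Nu by (simp add: e_def A_def mink_commute)
    have "?D e = 0"
      using normal_properties(3)[OF assms(1) eX] eN regular[OF assms(1)] by (simp add: mink_commute)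
    then have "e \<in> T" using eX by (simp add: T_def)
    then have "mink (A u - \<kappa> *\<^sub>R u) e = 0" using eig by simp
    then have "mink e e = 0" unfolding e_def[symmetric] .
    then show ?thesis using mink_orthogonal_eq_0[OF X(1) eX] by (simp add: e_def)
  qed
  have "u \<noteq> 0" using uT by auto
  moreover have "u \<in> tangent_space (hyp_boundary \<Omega>) X"
    using boundary_tangent_sup[OF assms(1,2)] uT by (simp add: T_def)
  ultimately have "principal_curvature \<Omega> X \<kappa>"
    unfolding principal_curvature_def using outward_normal_derivative[OF assms(1,2)] Au unfolding A_def by blast
  then have "\<kappa> > c" by (rule curv)
  then have "c * mink v v < \<kappa> * mink v v" using vv by simp
  then show ?thesis using min[OF vT] by (simp add: A_def)
qed

end

section \<open>Second-order comparison of the boundary with horospheres\<close>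

lemma hess_scaleR:
  assumes "open U" "smooth_on U f" "x \<in> U"
  shows "hess f x (a *\<^sub>R v) (a *\<^sub>R v) = a * a * hess f x v v"
  unfolding hess_expand[OF assms, of "a *\<^sub>R v"] hess_expand[OF assms, of v v]
  by (simp add: sum_distrib_left mult_ac)

text \<open>For \<open>X\<close> in hyperbolic space and unit \<open>z\<close>, the unit normal at
  \<open>X\<close> of the horosphere centred at \<open>z\<close> through \<open>X\<close>, pointing
  to larger values of \<open>horo _ z\<close>: the hyperbolic gradient of its logarithm.\<close>

definition horo_normal :: "'m::finite minkowski \<Rightarrow> real ^ 'm \<Rightarrow> 'm minkowski" where
  "horo_normal X z = X - (1 / horo X z) *\<^sub>R (z, 1)"

lemma horo_normal:
  assumes "X \<in> hyp_space" "norm z = 1"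
  shows "mink (horo_normal X z) X = 0" "mink (horo_normal X z) (horo_normal X z) = 1"
    and "horo v z = horo X z * (mink (horo_normal X z) v - mink X v)"
proof -
  have p: "horo X z > 0" using horo_pos assms by blast
  define E where "E = (z, 1 :: real)"
  have E: "mink E v = - horo v z" "mink v E = - horo v z" "horo E z = 0" for v
    using assms(2) by (simp_all add: E_def) (simp add: horo_def dot_square_norm)
  have XX: "mink X X = -1" using hyp_spaceD(1) assms by blast
  show "mink (horo_normal X z) X = 0" "mink (horo_normal X z) (horo_normal X z) = 1"
     "horo v z = horo X z * (mink (horo_normal X z) v - mink X v)"
    unfolding horo_normal_def E_def[symmetric] using p XX
    by (simp_all add: E field_simps)
qed

context boundary_chart
begin

text \<open>Horospheres have all principal curvatures equal to 1. A domain that touches one at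
  \<open>X\<close> with larger curvatures stays strictly inside near \<open>X\<close>. The proof
  follows a sequence of counterexamples to a limiting direction and compares second-order
  terms.\<close>

lemma strict_local_max:
  assumes XU: "X \<in> U" and Xb: "X \<in> hyp_boundary \<Omega>" and z: "norm z = 1" and N: "unit_normal F X = horo_normal X z"
    and II: "\<And>v. mink v X = 0 \<Longrightarrow> frechet_derivative F (at X) v = 0 \<Longrightarrow> v \<noteq> 0 \<Longrightarrow>
      mink (frechet_derivative (unit_normal F) (at X) v) v > mink v v"
  shows "\<exists>V. open V \<and> X \<in> V \<and> (\<forall>Y\<in>\<Omega> \<inter> V. Y \<noteq> X \<longrightarrow> horo Y z < horo X z)"
proof (rule ccontr)
  assume neg: "\<not> ?thesis"
  have X: "X \<in> hyp_space" "F X = 0" using boundary_iff XU Xb by blast+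
  let ?D = "frechet_derivative F (at X)"
  have linD: "linear ?D" using F_derivative[OF XU] has_derivative_linear by blast
  have blD: "bounded_linear ?D" using F_derivative[OF XU] has_derivative_bounded_linear by blast
  define \<rho> where "\<rho> = sqrt (mink (nrm F X) (nrm F X))"
  have \<rho>: "\<rho> > 0" unfolding \<rho>_def using regular[OF XU] by simp
  define \<phi> where "\<phi> = horo X z"
  have \<phi>: "\<phi> > 0" unfolding \<phi>_def using horo_pos X z by blast
  define lam where "lam = \<phi> / \<rho>"
  have lam: "lam > 0" unfolding lam_def using \<phi> \<rho> by simp
  define \<sigma> where "\<sigma> = lam * ?D X - \<phi>"
  \<comment> \<open>Equality of the normals as a Lagrange condition: \<open>lam\<close> and \<sigma>
    are the multipliers of the constraint \<open>F\<close> and of the hyperboloid.\<close>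
  have lag: "horo v z = lam * ?D v + \<sigma> * mink v X" for v
  proof -
    have "mink (unit_normal F X) v = (?D v + ?D X * mink v X) / \<rho>"
      using mink_mgrad[OF F_differentiable[OF XU]]
      by (simp add: unit_normal_def nrm_def \<rho>_def mink_commute)
    then show ?thesis
      unfolding horo_normal(3)[OF X(1) z, of v] N[symmetric] \<phi>_def[symmetric] \<sigma>_def lam_def
      using \<rho> by (simp add: field_simps mink_commute)
  qed
  obtain r0 where r0: "r0 > 0" "cball X r0 \<subseteq> U" using open_U XU open_contains_cball by blast
  have "\<exists>Y\<in>\<Omega>. dist Y X < min r0 (1 / real (Suc n)) \<and> Y \<noteq> X \<and> horo Y z \<ge> horo X z" for n
  proof -
    have "open (ball X (min r0 (1 / real (Suc n))))" "X \<in> ball X (min r0 (1 / real (Suc n)))" using r0 by auto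
    then show ?thesis using neg by (metis IntD1 IntD2 dist_commute mem_ball not_le)
  qed
  then obtain Y where Y: "\<And>n. Y n \<in> \<Omega>" "\<And>n. dist (Y n) X < min r0 (1 / real (Suc n))" "\<And>n. Y n \<noteq> X" "\<And>n. horo (Y n) z \<ge> horo X z"
    by metis
  define h where "h n = Y n - X" for n
  have "Y n \<in> U" for n using Y(2)[of n] r0(2) by (auto simp: dist_commute)
  then have Yh: "Y n \<in> hyp_space" "F (Y n) \<le> 0" for n using Y(1)[of n] Omega_U by blast+
  define r where "r n = norm (h n)" for n
  have r: "r n > 0" "r n < 1 / real (Suc n)" "r n < r0" for n
    using Y(2,3)[of n] by (auto simp: r_def h_def dist_norm)
  have r_lim: "r \<longlonglongrightarrow> 0"
  proof (rule tendsto_sandwich[of "\<lambda>_. 0" _ _ "\<lambda>n. 1 / real (Suc n)"])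
    show "(\<lambda>n. 1 / real (Suc n)) \<longlonglongrightarrow> 0" using LIMSEQ_inverse_real_of_nat by (simp add: inverse_eq_divide)
  qed (use r in \<open>auto intro!: always_eventually less_imp_le\<close>)
  define w where "w n = (1 / r n) *\<^sub>R h n" for n
  have w1: "w n \<in> sphere 0 1" for n using r(1)[of n] by (simp add: w_def r_def)
  have hw: "h n = r n *\<^sub>R w n" for n using r(1)[of n] by (simp add: w_def)
  obtain v k where v: "v \<in> sphere 0 1" and k: "strict_mono k" and wk: "(w \<circ> k) \<longlonglongrightarrow> v"
    using compact_sphere[of 0 1, unfolded compact_def] w1 by metis
  have wk: "(\<lambda>n. w (k n)) \<longlonglongrightarrow> v" using wk by (simp add: o_def)
  have rk: "(\<lambda>n. r (k n)) \<longlonglongrightarrow> 0" using LIMSEQ_subseq_LIMSEQ[OF r_lim k] by (simp add: o_def)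
  have hk: "(\<lambda>n. h (k n)) \<longlonglongrightarrow> 0" unfolding hw using tendsto_scaleR[OF rk wk] by simp
  \<comment> \<open>Chords of the hyperboloid are tangent up to second order, with an explicit
    correction that enters the final inequality through \<sigma>.\<close>
  have hX: "mink (h n) X = - mink (h n) (h n) / 2" for n
  proof -
    have "mink (X + h n) (X + h n) = -1" using hyp_spaceD(1)[OF Yh(1)[of n]] by (simp add: h_def)
    then show ?thesis using hyp_spaceD(1)[OF X(1)] by (simp add: mink_commute[of X "h n"])
  qed
  have wX: "mink (w n) X = - r n * mink (w n) (w n) / 2" for n
  proof -
    have "r n * (mink (w n) X + r n * mink (w n) (w n) / 2) = 0"
      using hX[of n] unfolding hw by (simp add: algebra_simps)
    then show ?thesis using r(1)[of n] by simp
  qed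
  have "(\<lambda>n. - r (k n) * mink (w (k n)) (w (k n)) / 2) \<longlonglongrightarrow> - 0 * mink v v / 2"
    by (intro tendsto_intros rk wk) simp
  then have "(\<lambda>n. mink (w (k n)) X) \<longlonglongrightarrow> 0" unfolding wX by simp
  moreover have "(\<lambda>n. mink (w (k n)) X) \<longlonglongrightarrow> mink v X" by (intro tendsto_intros wk)
  ultimately have vX: "mink v X = 0" using LIMSEQ_unique by blast
  have "\<exists>\<theta>. 0 < \<theta> \<and> \<theta> < 1 \<and> F (Y n) = ?D (h n) + hess F (X + \<theta> *\<^sub>R h n) (h n) (h n) / 2" for n
  proof -
    have seg: "X + t *\<^sub>R h n \<in> U" if "0 \<le> t" "t \<le> 1" for t
    proof -
      have "norm (t *\<^sub>R h n) \<le> 1 * r n" using that r(1)[of n] by (auto simp: r_def intro!: mult_right_mono)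
      then show ?thesis using r(3)[of n] r0(2) by (auto simp: dist_norm)
    qed
    obtain \<theta> where "0 < \<theta>" "\<theta> < 1"
      "F (X + h n) = F X + ?D (h n) + hess F (X + \<theta> *\<^sub>R h n) (h n) (h n) / 2"
      by (rule smooth_on_Taylor2[OF smooth_F seg])
    then show ?thesis using X(2) by (auto simp: h_def)
  qed
  then obtain \<theta> where \<theta>: "\<And>n. 0 < \<theta> n" "\<And>n. \<theta> n < 1"
    and FY: "\<And>n. F (Y n) = ?D (h n) + hess F (X + \<theta> n *\<^sub>R h n) (h n) (h n) / 2" by metis
  define q where "q n = hess F (X + \<theta> n *\<^sub>R h n) (w n) (w n)" for n
  have "(\<lambda>n. \<theta> (k n) *\<^sub>R h (k n)) \<longlonglongrightarrow> 0"
  proof (rule Lim_null_comparison[OF _ tendsto_norm_zero[OF hk]])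
    show "\<forall>\<^sub>F n in sequentially. norm (\<theta> (k n) *\<^sub>R h (k n)) \<le> norm (h (k n))"
    proof (intro always_eventually allI)
      show "norm (\<theta> (k n) *\<^sub>R h (k n)) \<le> norm (h (k n))" for n
        using mult_left_le_one_le[of "norm (h (k n))" "\<theta> (k n)"] \<theta>[of "k n"] by simp
    qed
  qed
  then have "(\<lambda>n. X + \<theta> (k n) *\<^sub>R h (k n)) \<longlonglongrightarrow> X" using tendsto_add[OF tendsto_const[of X]] by fastforce
  then have qk: "(\<lambda>n. q (k n)) \<longlonglongrightarrow> hess F X v v"
    unfolding q_def by (intro hess_tendsto[OF open_U smooth_F XU] wk)
  have segU: "X + \<theta> n *\<^sub>R h n \<in> U" for n
  proof -
    have "norm (\<theta> n *\<^sub>R h n) \<le> 1 * r n" using \<theta>(1,2)[of n] r(1)[of n] by (auto simp: r_def intro!: mult_right_mono)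
    then show ?thesis using r(3)[of n] r0(2) by (auto simp: dist_norm)
  qed
  have hq: "hess F (X + \<theta> n *\<^sub>R h n) (h n) (h n) = r n * r n * q n" for n
    using hess_scaleR[OF open_U smooth_F segU[of n], of "r n" "w n"] unfolding q_def hw[of n, symmetric] .
  have FY': "F (Y n) = r n * (?D (w n) + r n * q n / 2)" for n
    unfolding FY hq unfolding hw by (simp add: linear_scale[OF linD] algebra_simps)
  \<comment> \<open>\<open>F (Y n) \<le> 0\<close> forbids the limit direction to leave the domain,
    \<open>horo (Y n) z \<ge> horo X z\<close> forbids it to enter; it is tangent to the
    boundary.\<close>
  have Dv: "?D v = 0"
  proof -
    have "?D (w n) + r n * q n / 2 \<le> 0" for n
      using Yh(2)[of n] r(1)[of n] unfolding FY' by (simp add: mult_le_0_iff)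
    moreover have "(\<lambda>n. ?D (w (k n)) + r (k n) * q (k n) / 2) \<longlonglongrightarrow> ?D v + 0 * hess F X v v / 2"
      by (intro tendsto_intros rk qk bounded_linear.tendsto[OF blD] wk) simp
    ultimately have "?D v + 0 * hess F X v v / 2 \<le> 0" using LIMSEQ_le_const2 by blast
    moreover have "horo (w n) z \<ge> 0" for n
      using Y(4)[of n] r(1)[of n] by (simp add: w_def h_def)
    moreover have "(\<lambda>n. horo (w (k n)) z) \<longlonglongrightarrow> horo v z"
      unfolding lag by (intro tendsto_intros bounded_linear.tendsto[OF blD] wk)
    ultimately have "?D v \<le> 0" "horo v z \<ge> 0" using LIMSEQ_le_const by (simp, blast)
    then show ?thesis using lag[of v] vX lam by (simp add: zero_le_mult_iff)
  qed
  \<comment> \<open>In \<open>horo (h n) z - lam * F (Y n)\<close> the differentials of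
    \<open>F\<close> cancel by \<open>lag\<close>; all remaining terms carry the factor
    \<open>r n * r n\<close>, which is divided out before the limit.\<close>
  have "- \<sigma> * mink (w n) (w n) - lam * q n \<ge> 0" for n
  proof -
    have "horo (h n) z - lam * F (Y n) \<ge> 0"
      using Y(4)[of n] mult_nonneg_nonpos[of lam "F (Y n)"] Yh(2)[of n] lam by (simp add: h_def)
    then have "\<sigma> * mink (h n) X - lam * hess F (X + \<theta> n *\<^sub>R h n) (h n) (h n) / 2 \<ge> 0"
      unfolding lag FY by (simp add: algebra_simps)
    then have "r n * r n * (- \<sigma> * mink (w n) (w n) - lam * q n) \<ge> 0"
      unfolding hX hq unfolding hw by (simp add: algebra_simps)
    then show ?thesis using mult_pos_pos[OF r(1)[of n] r(1)[of n]] by (simp add: zero_le_mult_iff)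
  qed
  moreover have "(\<lambda>n. - \<sigma> * mink (w (k n)) (w (k n)) - lam * q (k n)) \<longlonglongrightarrow> - \<sigma> * mink v v - lam * hess F X v v"
    by (intro tendsto_intros wk qk)
  ultimately have 1: "- \<sigma> * mink v v - lam * hess F X v v \<ge> 0" using LIMSEQ_le_const by blast
  have "v \<noteq> 0" using v by auto
  then have "mink v v < (hess F X v v + ?D X * mink v v) / \<rho>"
    using II[OF vX Dv] second_fundamental_form[OF XU X(1) vX vX Dv] by (simp add: \<rho>_def)
  then have "\<phi> * mink v v < \<phi> * ((hess F X v v + ?D X * mink v v) / \<rho>)" using \<phi> by (rule mult_strict_left_mono)
  also have "\<dots> = lam * hess F X v v + lam * ?D X * mink v v" by (simp add: lam_def field_simps add_divide_distrib)
  finally show False using 1 by (simp add: \<sigma>_def algebra_simps)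
qed

end

section \<open>The graph chart of hyperbolic space over its Euclidean component\<close>

definition lift :: "real ^ 'm::finite \<Rightarrow> 'm minkowski" where
  "lift x = (x, sqrt (1 + (norm x)\<^sup>2))"

lemma lift_hyp: "lift x \<in> hyp_space"
  by (rule hyp_spaceI) (simp add: lift_def)

lemma lift_fst: "X \<in> hyp_space \<Longrightarrow> lift (fst X) = X"
  using hyp_spaceD(3)[of X] by (simp add: lift_def prod_eq_iff)

lemma smoothv_on_lift: "smoothv_on UNIV lift"
proof -
  have "smooth_on UNIV (\<lambda>x :: real ^ 'a. sqrt (1 + x \<bullet> x))"
    by (intro smooth_on_sqrt smooth_on_add smooth_on_const smooth_on_inner smoothv_on_id)
       (auto simp: add_pos_nonneg)
  then show ?thesis unfolding lift_def
    by (intro smoothv_on_Pair smoothv_on_id) (auto simp: smoothv_on_real power2_norm_eq_inner)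
qed

lemma continuous_lift: "continuous_on S lift"
  using smoothv_on_imp_continuous_on[OF smoothv_on_lift] continuous_on_subset by blast

lemma lift_derivative:
  assumes "X \<in> hyp_space" "mink V X = 0"
  shows "frechet_derivative lift (at (fst X)) (fst V) = V"
proof -
  have pos: "1 + fst X \<bullet> fst X > 0" by (simp add: add_pos_nonneg)
  have sq: "sqrt (1 + fst X \<bullet> fst X) = snd X" using hyp_spaceD(3)[OF assms(1)] by (simp add: power2_norm_eq_inner)
  have "((\<lambda>x :: real ^ 'a. (x, sqrt (1 + x \<bullet> x))) has_derivative (\<lambda>h. (h, (fst X \<bullet> h) / sqrt (1 + fst X \<bullet> fst X)))) (at (fst X))"
    using pos by (auto intro!: derivative_eq_intros simp: inner_commute field_simps fun_eq_iff)
  then have "(lift has_derivative (\<lambda>h. (h, (fst X \<bullet> h) / snd X))) (at (fst X))"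
    unfolding lift_def[abs_def] power2_norm_eq_inner sq .
  then have "frechet_derivative lift (at (fst X)) = (\<lambda>h. (h, (fst X \<bullet> h) / snd X))"
    using frechet_derivative_at by metis
  moreover have "(fst X \<bullet> fst V) / snd X = snd V"
    using assms(2) hyp_spaceD(2)[OF assms(1)] by (simp add: mink_eq inner_commute field_simps)
  ultimately show ?thesis by simp
qed

lemma short_step:
  fixes v :: "'a::real_normed_vector"
  assumes "0 \<le> s" "s \<le> R / (2 * (norm v + 1))"
  shows "norm (s *\<^sub>R v) \<le> R / 2"
proof -
  have "s * (2 * (norm v + 1)) \<le> R" using assms(2) by (subst (asm) pos_le_divide_eq) (simp_all add: add_nonneg_pos)
  then show ?thesis using assms(1) by (simp add: algebra_simps)
qed

text \<open>The directional derivative stays positive near \<open>x\<close>, so one radius and one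
  direction serve all nearby base points; a continuous deformation requires this uniformity.\<close>

lemma smooth_increasing:
  fixes f :: "'a::euclidean_space \<Rightarrow> real"
  assumes "open W" "smooth_on W f" "x \<in> W" "frechet_derivative f (at x) v > 0"
  shows "\<exists>r>0. \<forall>y\<in>ball x r. \<forall>s. 0 < s \<and> s \<le> r \<longrightarrow> f y < f (y + s *\<^sub>R v)"
proof -
  have "continuous_on W (\<lambda>y. frechet_derivative f (at y) v)"
    by (intro smooth_on_imp_continuous_on smooth_on_frechet_derivative assms)
  then have "open {y \<in> W. 0 < frechet_derivative f (at y) v}" by (intro open_less_on assms continuous_on_const)
  then obtain R where R: "R > 0" "ball x R \<subseteq> {y \<in> W. 0 < frechet_derivative f (at y) v}"
    using assms by (metis (mono_tags, lifting) mem_Collect_eq openE)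
  define r where "r = min (R / 2) (R / (2 * (norm v + 1)))"
  have r: "r > 0" unfolding r_def using R by (simp add: add_nonneg_pos)
  have "f y < f (y + s *\<^sub>R v)" if y: "y \<in> ball x r" and s: "0 < s" "s \<le> r" for y s
  proof -
    have in_ball: "y + t *\<^sub>R v \<in> ball x R" if "0 \<le> t" "t \<le> s" for t
    proof -
      have "dist y (y + t *\<^sub>R v) \<le> R / 2"
        using short_step[of t R v] that s by (simp add: dist_norm r_def)
      moreover have "dist x y < R / 2" using y by (simp add: r_def)
      ultimately show ?thesis using dist_triangle[of x "y + t *\<^sub>R v" y] by simp
    qed
    have "((\<lambda>t. f (y + t *\<^sub>R v)) has_real_derivative frechet_derivative f (at (y + t *\<^sub>R v)) v) (at t)"
      if "0 \<le> t" "t \<le> s" for t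
      using smooth_on_line_derivative[OF assms(2)] in_ball[OF that] R(2) by blast
    from MVT2[OF s(1) this] obtain \<xi> where \<xi>: "0 < \<xi>" "\<xi> < s" "f (y + s *\<^sub>R v) - f (y + 0 *\<^sub>R v) = (s - 0) * frechet_derivative f (at (y + \<xi> *\<^sub>R v)) v"
      by auto
    have "frechet_derivative f (at (y + \<xi> *\<^sub>R v)) v > 0" using in_ball[of \<xi>] \<xi> R(2) by auto
    then have "(s - 0) * frechet_derivative f (at (y + \<xi> *\<^sub>R v)) v > 0" using s by simp
    then show ?thesis using \<xi>(3) by simp
  qed
  then show ?thesis using r by blast
qed

lemma hyp_boundary_complement:
  assumes "X \<in> \<Omega>" "X \<in> hyp_space" "X \<notin> hyp_boundary \<Omega>"
  obtains V where "open V" "X \<in> V" "V \<inter> hyp_space \<subseteq> \<Omega>"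
  using assms unfolding hyp_boundary_iff by blast

lemma horo_lift_smooth: "smooth_on UNIV (\<lambda>x. horo (lift x) z)"
proof -
  have "smooth_on UNIV (\<lambda>x. snd (lift x) - fst (lift x) \<bullet> z)"
    by (intro smooth_on_diff smooth_on_inner smoothv_on_fst smoothv_on_const smoothv_on_lift
        smoothv_on_real[THEN iffD1, OF _ smoothv_on_snd]) auto
  then show ?thesis by (simp add: horo_def)
qed

lemma horo_lift_derivative:
  assumes "X \<in> hyp_space" "mink V X = 0"
  shows "frechet_derivative (\<lambda>x. horo (lift x) z) (at (fst X)) (fst V) = horo V z"
proof -
  have d: "(lift has_derivative frechet_derivative lift (at (fst X))) (at (fst X))"
    using smoothv_on_has_derivative[OF smoothv_on_lift] by blast
  have "((\<lambda>x. snd (lift x) - fst (lift x) \<bullet> z) has_derivative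
    (\<lambda>h. snd (frechet_derivative lift (at (fst X)) h) - fst (frechet_derivative lift (at (fst X)) h) \<bullet> z)) (at (fst X))"
    by (intro has_derivative_diff has_derivative_snd has_derivative_inner_left has_derivative_fst d)
  from frechet_derivative_at[OF this, symmetric] show ?thesis
    unfolding horo_def by (simp add: lift_derivative[OF assms])
qed

section \<open>Maximisers of horospherical functions\<close>

text \<open>One vector in the graph chart moves a whole neighbourhood in the set, so the motion can
  be cut off to a continuous self-map. Asking only for larger values near \<open>X\<close> would not
  permit this.\<close>

definition pushable :: "'m::finite minkowski set \<Rightarrow> real ^ 'm \<Rightarrow> 'm minkowski \<Rightarrow> bool" where
  "pushable \<Omega> z X \<longleftrightarrow> (\<exists>v r. r > 0 \<and> (\<forall>Y\<in>\<Omega>. dist Y X < r \<longrightarrow> (\<forall>s. 0 < s \<and> s \<le> r \<longrightarrow>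
      lift (fst Y + s *\<^sub>R v) \<in> \<Omega> \<and> horo Y z < horo (lift (fst Y + s *\<^sub>R v)) z)))"

lemma pushable_interior:
  assumes "X \<in> \<Omega>" "\<Omega> \<subseteq> hyp_space" "X \<notin> hyp_boundary \<Omega>" "norm z = 1"
  shows "pushable \<Omega> z X"
proof -
  have X: "X \<in> hyp_space" using assms by blast
  obtain V where V: "open V" "X \<in> V" "V \<inter> hyp_space \<subseteq> \<Omega>" using hyp_boundary_complement[OF assms(1) X assms(3)] by blast
  let ?E = "horo_normal X z"
  have "horo ?E z = horo X z"
    using horo_normal(3)[OF X assms(4), of ?E] horo_normal(1,2)[OF X assms(4)] by (simp add: mink_commute)
  then have "frechet_derivative (\<lambda>x. horo (lift x) z) (at (fst X)) (fst ?E) > 0"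
    using horo_lift_derivative[OF X horo_normal(1)[OF X assms(4)]] horo_pos[OF X assms(4)] by simp
  then obtain r1 where r1: "r1 > 0" "\<And>y s. y \<in> ball (fst X) r1 \<Longrightarrow> 0 < s \<Longrightarrow> s \<le> r1 \<Longrightarrow> horo (lift y) z < horo (lift (y + s *\<^sub>R fst ?E)) z"
    using smooth_increasing[OF open_UNIV horo_lift_smooth] by (metis UNIV_I)
  have "open (lift -` V)" by (rule open_vimage[OF V(1) continuous_lift])
  moreover have "fst X \<in> lift -` V" using V(2) lift_fst[OF X] by simp
  ultimately obtain R where R: "R > 0" "ball (fst X) R \<subseteq> lift -` V" using openE by blast
  define r where "r = min r1 (min (R / 2) (R / (2 * (norm (fst ?E) + 1))))"
  have r: "r > 0" unfolding r_def using R r1 by (simp add: add_nonneg_pos)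
  have "lift (fst Y + s *\<^sub>R fst ?E) \<in> \<Omega> \<and> horo Y z < horo (lift (fst Y + s *\<^sub>R fst ?E)) z"
    if Y: "Y \<in> \<Omega>" "dist Y X < r" and s: "0 < s" "s \<le> r" for Y s
  proof -
    have Yh: "Y \<in> hyp_space" using Y assms by blast
    have d: "dist (fst X) (fst Y) < r" using Y(2) dist_fst_le[of Y X] by (simp add: dist_commute)
    then have "horo (lift (fst Y)) z < horo (lift (fst Y + s *\<^sub>R fst ?E)) z"
      using s by (intro r1(2)) (auto simp: r_def)
    moreover have "fst Y + s *\<^sub>R fst ?E \<in> ball (fst X) R"
    proof -
      have "dist (fst Y) (fst Y + s *\<^sub>R fst ?E) \<le> R / 2"
        using short_step[of s R "fst ?E"] s by (simp add: dist_norm r_def)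
      moreover have "dist (fst X) (fst Y) < R / 2" using d by (simp add: r_def)
      ultimately show ?thesis using dist_triangle[of "fst X" "fst Y + s *\<^sub>R fst ?E" "fst Y"] by simp
    qed
    then have "lift (fst Y + s *\<^sub>R fst ?E) \<in> V \<inter> hyp_space" using R(2) lift_hyp by blast
    ultimately show ?thesis using lift_fst[OF Yh] V(3) by auto
  qed
  then show ?thesis unfolding pushable_def using r by blast
qed

text \<open>For two different unit normals the vector \<open>horo_normal X z\<close> minus
  \<open>unit_normal F X\<close> makes an obtuse angle with the boundary normal and an acute one
  with the horosphere normal: it points into the domain and raises \<open>horo _ z\<close>.\<close>

lemma (in boundary_chart) pushable_boundary:
  assumes sub: "\<Omega> \<subseteq> hyp_space" and XU: "X \<in> U" and Xb: "X \<in> hyp_boundary \<Omega>" and z: "norm z = 1"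
    and ne: "unit_normal F X \<noteq> horo_normal X z"
  shows "pushable \<Omega> z X"
proof -
  have X: "X \<in> hyp_space" "F X = 0" using boundary_iff XU Xb by blast+
  let ?E = "horo_normal X z" and ?N = "unit_normal F X"
  define V where "V = ?E - ?N"
  have E: "mink ?E X = 0" "mink ?E ?E = 1" using horo_normal[OF X(1) z] by blast+
  have N: "mink ?N X = 0" "mink ?N ?N = 1" using normal_properties(1,2)[OF XU] X by blast+
  have VX: "mink V X = 0" using E N by (simp add: V_def)
  have "mink V V > 0" using mink_orthogonal_pos[OF X(1) VX] ne by (simp add: V_def)
  then have NE: "mink ?N ?E < 1" using E N by (simp add: V_def mink_commute)
  have "horo V z = horo X z * (1 - mink ?N ?E)"
    using horo_normal(3)[OF X(1) z, of V] E N by (simp add: V_def mink_commute)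
  then have hV: "horo V z > 0" using horo_pos[OF X(1) z] NE by simp
  have "mink ?N V < 0" using N NE by (simp add: V_def)
  then have DV: "frechet_derivative F (at X) V < 0"
    using normal_properties(3)[OF XU VX] regular[OF XU] by (simp add: divide_less_0_iff)
  have opl: "open (lift -` U)" by (rule open_vimage[OF open_U continuous_lift])
  have xU: "fst X \<in> lift -` U" using XU lift_fst[OF X(1)] by simp
  have smg: "smooth_on (lift -` U) (\<lambda>x. - F (lift x))"
    by (intro smooth_on_minus smooth_on_compose[OF opl open_U smooth_F] opl smoothv_on_subset[OF smoothv_on_lift]) auto
  have "(lift has_derivative frechet_derivative lift (at (fst X))) (at (fst X))"
    using smoothv_on_has_derivative[OF smoothv_on_lift] by blast
  from diff_chain_at[OF this, of F] F_derivative[OF XU] lift_fst[OF X(1)]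
  have "((\<lambda>x. F (lift x)) has_derivative (\<lambda>h. frechet_derivative F (at X) (frechet_derivative lift (at (fst X)) h))) (at (fst X))"
    by (simp add: o_def)
  from has_derivative_minus[OF this]
  have "frechet_derivative (\<lambda>x. - F (lift x)) (at (fst X)) (fst V) = - frechet_derivative F (at X) V"
    using frechet_derivative_at[symmetric] lift_derivative[OF X(1) VX] by fastforce
  then have "frechet_derivative (\<lambda>x. - F (lift x)) (at (fst X)) (fst V) > 0" using DV by simp
  then obtain r2 where r2: "r2 > 0" "\<And>y s. y \<in> ball (fst X) r2 \<Longrightarrow> 0 < s \<Longrightarrow> s \<le> r2 \<Longrightarrow> F (lift (y + s *\<^sub>R fst V)) < F (lift y)"
    using smooth_increasing[OF opl smg xU] by (metis neg_less_iff_less)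
  have "frechet_derivative (\<lambda>x. horo (lift x) z) (at (fst X)) (fst V) > 0"
    using horo_lift_derivative[OF X(1) VX] hV by simp
  then obtain r1 where r1: "r1 > 0" "\<And>y s. y \<in> ball (fst X) r1 \<Longrightarrow> 0 < s \<Longrightarrow> s \<le> r1 \<Longrightarrow> horo (lift y) z < horo (lift (y + s *\<^sub>R fst V)) z"
    using smooth_increasing[OF open_UNIV horo_lift_smooth] by (metis UNIV_I)
  obtain R where R: "R > 0" "ball (fst X) R \<subseteq> lift -` U" using openE[OF opl xU] by blast
  obtain R' where R': "R' > 0" "ball X R' \<subseteq> U" using openE[OF open_U XU] by blast
  define r where "r = min (min r1 r2) (min R' (min (R / 2) (R / (2 * (norm (fst V) + 1)))))"
  have r: "r > 0" unfolding r_def using R R' r1 r2 by (simp add: add_nonneg_pos)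
  have "lift (fst Y + s *\<^sub>R fst V) \<in> \<Omega> \<and> horo Y z < horo (lift (fst Y + s *\<^sub>R fst V)) z"
    if Y: "Y \<in> \<Omega>" "dist Y X < r" and s: "0 < s" "s \<le> r" for Y s
  proof -
    have Yh: "Y \<in> hyp_space" using Y sub by blast
    have "Y \<in> U" using Y(2) R'(2) by (auto simp: r_def dist_commute)
    then have FY: "F Y \<le> 0" using Y Omega_U by blast
    have d: "dist (fst X) (fst Y) < r" using Y(2) dist_fst_le[of Y X] by (simp add: dist_commute)
    then have 1: "horo (lift (fst Y)) z < horo (lift (fst Y + s *\<^sub>R fst V)) z"
      using s by (intro r1(2)) (auto simp: r_def)
    have 2: "F (lift (fst Y + s *\<^sub>R fst V)) < F (lift (fst Y))"
      using s d by (intro r2(2)) (auto simp: r_def)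
    have "fst Y + s *\<^sub>R fst V \<in> ball (fst X) R"
    proof -
      have "dist (fst Y) (fst Y + s *\<^sub>R fst V) \<le> R / 2"
        using short_step[of s R "fst V"] s by (simp add: dist_norm r_def)
      moreover have "dist (fst X) (fst Y) < R / 2" using d by (simp add: r_def)
      ultimately show ?thesis using dist_triangle[of "fst X" "fst Y + s *\<^sub>R fst V" "fst Y"] by simp
    qed
    then have "lift (fst Y + s *\<^sub>R fst V) \<in> hyp_space \<inter> U" using R(2) lift_hyp by blast
    then have "lift (fst Y + s *\<^sub>R fst V) \<in> \<Omega>" using 2 FY lift_fst[OF Yh] Omega_U by force
    then show ?thesis using 1 lift_fst[OF Yh] by simp
  qed
  then show ?thesis unfolding pushable_def using r by blast
qed

lemma pushable_not_maximal:
  assumes "pushable \<Omega> z X" "X \<in> \<Omega>"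
  shows "\<exists>Y\<in>\<Omega>. horo X z < horo Y z"
proof -
  obtain v r where "r > 0" "\<forall>Y\<in>\<Omega>. dist Y X < r \<longrightarrow> (\<forall>s. 0 < s \<and> s \<le> r \<longrightarrow>
      lift (fst Y + s *\<^sub>R v) \<in> \<Omega> \<and> horo Y z < horo (lift (fst Y + s *\<^sub>R v)) z)"
    using assms(1) unfolding pushable_def by blast
  then show ?thesis using assms(2) by (metis dist_self order_refl)
qed

lemma push_map:
  assumes push: "pushable \<Omega> z X" and sub: "\<Omega> \<subseteq> hyp_space" and d: "d > 0"
  obtains \<Phi> \<delta> where "\<delta> > 0" "\<delta> \<le> d" "continuous_on \<Omega> \<Phi>" "\<Phi> ` \<Omega> \<subseteq> \<Omega>"
    "\<And>Y. Y \<in> \<Omega> \<Longrightarrow> horo Y z \<le> horo (\<Phi> Y) z"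
    "\<And>Y. Y \<in> \<Omega> \<Longrightarrow> dist Y X < \<delta> \<Longrightarrow> horo Y z < horo (\<Phi> Y) z"
    "\<And>Y. Y \<in> \<Omega> \<Longrightarrow> \<not> dist Y X < \<delta> \<Longrightarrow> \<Phi> Y = Y"
proof -
  obtain v r where r: "r > 0" and vr: "\<And>Y s. Y \<in> \<Omega> \<Longrightarrow> dist Y X < r \<Longrightarrow> 0 < s \<Longrightarrow> s \<le> r \<Longrightarrow>
      lift (fst Y + s *\<^sub>R v) \<in> \<Omega> \<and> horo Y z < horo (lift (fst Y + s *\<^sub>R v)) z"
    using push unfolding pushable_def by blast
  define \<delta> where "\<delta> = min r d"
  \<comment> \<open>The step length fades out continuously at distance \<delta> from
    \<open>X\<close>, where the map becomes the identity.\<close>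
  define \<eta> where "\<eta> Y = max 0 (\<delta> - dist Y X)" for Y
  define \<Phi> where "\<Phi> Y = lift (fst Y + \<eta> Y *\<^sub>R v)" for Y
  have \<delta>: "\<delta> > 0" "\<delta> \<le> d" "\<delta> \<le> r" unfolding \<delta>_def using r d by auto
  have in1: "\<Phi> Y \<in> \<Omega> \<and> horo Y z < horo (\<Phi> Y) z" if "Y \<in> \<Omega>" "dist Y X < \<delta>" for Y
    unfolding \<Phi>_def by (rule vr) (use that \<delta> zero_le_dist[of Y X] in \<open>auto simp: \<eta>_def max_def simp del: zero_le_dist\<close>)
  have in2: "\<Phi> Y = Y" if "Y \<in> \<Omega>" "\<not> dist Y X < \<delta>" for Y
    using that lift_fst[of Y] sub by (auto simp: \<Phi>_def \<eta>_def max_def)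
  show ?thesis
  proof (rule that[OF \<delta>(1,2)])
    show "continuous_on \<Omega> \<Phi>" unfolding \<Phi>_def \<eta>_def
      by (intro continuous_on_compose2[OF continuous_lift[of UNIV]] continuous_intros) auto
    show "\<Phi> ` \<Omega> \<subseteq> \<Omega>" using in1 in2 by (metis image_subsetI)
    show "horo Y z \<le> horo (\<Phi> Y) z" if "Y \<in> \<Omega>" for Y using in1[OF that] in2[OF that] by (cases "dist Y X < \<delta>") auto
  qed (use in1 in2 in blast)+
qed

text \<open>
  A mountain pass argument: the superlevel set components of \<open>horo _ z\<close> that contain two
  different maximisers could only merge at a point that is neither pushable nor a strict local
  maximum.
\<close>

lemma unique_maximiser:
  assumes K: "K \<subseteq> hyp_space" "compact K" "connected K"
    and alt: "\<And>X. X \<in> K \<Longrightarrow> pushable K z X \<or> (\<exists>V. open V \<and> X \<in> V \<and> (\<forall>Y\<in>K \<inter> V. Y \<noteq> X \<longrightarrow> horo Y z < horo X z))"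
    and X1: "X1 \<in> K" "\<And>Y. Y \<in> K \<Longrightarrow> horo Y z \<le> horo X1 z"
    and X2: "X2 \<in> K" "horo X2 z = horo X1 z"
  shows "X1 = X2"
proof (rule ccontr)
  assume ne: "X1 \<noteq> X2"
  define M where "M = horo X1 z"
  define L where "L c = {Y \<in> K. c \<le> horo Y z}" for c
  have ch: "continuous_on UNIV (\<lambda>Y. horo Y z)" by (intro continuous_intros)
  have Leq: "L c = K \<inter> {Y. c \<le> horo Y z}" for c by (auto simp: L_def)
  have compL: "compact (L c)" for c
    unfolding Leq by (intro compact_Int_closed K closed_Collect_le ch continuous_intros)
  define CC where "CC c = connected_component_set (L c) X1" for c
  have CC_sub: "CC c \<subseteq> L c" for c unfolding CC_def by (rule connected_component_subset)
  have compCC: "compact (CC c)" for c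
  proof (cases "X1 \<in> L c")
    case True
    then show ?thesis unfolding CC_def using compact_components[OF compL] by (auto simp: components_def)
  next
    case False
    then have "CC c = {}" unfolding CC_def by (simp only: connected_component_eq_empty not_False_eq_True)
    then show ?thesis by simp
  qed
  have connCC: "connected (CC c)" for c unfolding CC_def by simp
  have mono: "CC c \<subseteq> CC c'" if "c' \<le> c" for c c'
    unfolding CC_def by (rule connected_component_mono) (use that in \<open>auto simp: L_def\<close>)
  \<comment> \<open>The levels at which \<open>X1\<close> and \<open>X2\<close> lie in one component
    of the superlevel set; their supremum \<open>c0\<close> is the mountain pass level.\<close>
  define T where "T = {c. c \<le> M \<and> X2 \<in> CC c}"
  obtain X0 where X0: "X0 \<in> K" "\<And>Y. Y \<in> K \<Longrightarrow> horo X0 z \<le> horo Y z"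
    using continuous_attains_inf[OF K(2) _ continuous_on_subset[OF ch]] X1(1) by blast
  have "L (horo X0 z) = K" using X0 by (auto simp: L_def)
  then have "horo X0 z \<in> T"
  proof -
    have "connected_component (L (horo X0 z)) X1 X2"
      unfolding connected_component_def \<open>L (horo X0 z) = K\<close> using K(3) X1(1) X2(1) by blast
    then show ?thesis using X1(2)[OF X0(1)] by (simp add: T_def CC_def M_def)
  qed
  then have Tne: "T \<noteq> {}" by blast
  have bdd: "bdd_above T" unfolding T_def bdd_above_def by auto
  define c0 where "c0 = Sup T"
  have c0M: "c0 \<le> M" unfolding c0_def by (rule cSup_least[OF Tne]) (simp add: T_def)
  define C where "C = (\<Inter>c\<in>T. CC c)"
  \<comment> \<open>A decreasing family of continua has a connected intersection, so the two
    maximisers are still joined at the level \<open>c0\<close> itself.\<close>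
  have connC: "connected C" unfolding C_def
  proof (rule connected_chain)
    show "compact S \<and> connected S" if "S \<in> CC ` T" for S using that compCC connCC by blast
    show "S \<subseteq> S' \<or> S' \<subseteq> S" if "S \<in> CC ` T \<and> S' \<in> CC ` T" for S S' using that mono by (metis imageE linear)
  qed
  have X1C: "X1 \<in> C" unfolding C_def CC_def T_def using X1(1) by (auto simp: L_def M_def)
  have X2C: "X2 \<in> C" unfolding C_def T_def by auto
  have CK: "C \<subseteq> K" unfolding C_def using CC_sub Tne by (auto simp: L_def)
  have Cge: "c0 \<le> horo Y z" if "Y \<in> C" for Y
    unfolding c0_def by (rule cSup_least[OF Tne]) (use that CC_sub in \<open>auto simp: C_def L_def\<close>)
  \<comment> \<open>A strict local maximum at the lowest level of \<open>C\<close> would be an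
    isolated point of a connected set with at least two points.\<close>
  have isolated: False if X: "X \<in> C" "horo X z = c0" and V: "open V" "X \<in> V" "\<forall>Y\<in>K \<inter> V. Y \<noteq> X \<longrightarrow> horo Y z < horo X z" for X V
  proof -
    have "C \<inter> V = {X}" using V Cge CK X by force
    then have "openin (top_of_set C) {X}" using V(1) by (metis openin_open)
    moreover have "closedin (top_of_set C) {X}" using X(1) by simp
    ultimately have "C = {X}" using connC X(1) unfolding connected_clopen by blast
    then show False using X1C X2C ne by simp
  qed
  have "c0 \<noteq> M"
  proof
    assume "c0 = M"
    have "\<not> pushable K z X1" using pushable_not_maximal X1 by (meson not_le)
    then show False using alt[OF X1(1)] isolated[OF X1C] \<open>c0 = M\<close> M_def by blast
  qed
  then have c0lt: "c0 < M" using c0M by simp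
  define C0 where "C0 = {Y \<in> C. horo Y z = c0}"
  have compC: "compact C"
  proof -
    have "closed C" unfolding C_def using compCC by (intro closed_INT) (auto simp: compact_imp_closed)
    then show ?thesis using CK K(2) compact_Int_closed[of K C] by (simp add: Int_absorb1)
  qed
  have "C0 = C \<inter> {Y. horo Y z = c0}" by (auto simp: C0_def)
  then have compC0: "compact C0"
    by (simp add: compact_Int_closed[OF compC] closed_Collect_eq[OF ch continuous_on_const])
  have pushC0: "pushable K z X" if "X \<in> C0" for X
    using alt[of X] that isolated[of X] CK unfolding C0_def by blast
  \<comment> \<open>Points of \<open>C0\<close> lie strictly below the level of \<open>X1\<close>
    and \<open>X2\<close>, so each push can be supported away from both.\<close>
  have "\<exists>\<Phi> \<delta>. \<delta> > 0 \<and> continuous_on K \<Phi> \<and> \<Phi> ` K \<subseteq> K \<and>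
    (\<forall>Y\<in>K. horo Y z \<le> horo (\<Phi> Y) z) \<and> (\<forall>Y\<in>K. dist Y X < \<delta> \<longrightarrow> horo Y z < horo (\<Phi> Y) z) \<and>
    (\<forall>Y\<in>K. \<not> dist Y X < \<delta> \<longrightarrow> \<Phi> Y = Y) \<and> \<Phi> X1 = X1 \<and> \<Phi> X2 = X2" if X: "X \<in> C0" for X
  proof -
    have "X \<noteq> X1" "X \<noteq> X2" using X c0lt X2(2) by (auto simp: C0_def M_def)
    then have d: "min (dist X1 X) (dist X2 X) > 0" by simp
    obtain \<Phi> \<delta> where P: "\<delta> > 0" "\<delta> \<le> min (dist X1 X) (dist X2 X)" "continuous_on K \<Phi>" "\<Phi> ` K \<subseteq> K"
      "\<And>Y. Y \<in> K \<Longrightarrow> horo Y z \<le> horo (\<Phi> Y) z"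
      "\<And>Y. Y \<in> K \<Longrightarrow> dist Y X < \<delta> \<Longrightarrow> horo Y z < horo (\<Phi> Y) z"
      "\<And>Y. Y \<in> K \<Longrightarrow> \<not> dist Y X < \<delta> \<Longrightarrow> \<Phi> Y = Y"
      by (rule push_map[OF pushC0[OF X] K(1) d]) (rule that; assumption)
    have "\<Phi> X1 = X1" "\<Phi> X2 = X2" using P(2) P(7)[OF X1(1)] P(7)[OF X2(1)] by auto
    then show ?thesis using P(1,3-7) by blast
  qed
  then obtain \<Phi> \<delta> where \<Phi>: "\<And>X. X \<in> C0 \<Longrightarrow> \<delta> X > 0 \<and> continuous_on K (\<Phi> X) \<and> \<Phi> X ` K \<subseteq> K \<and>
    (\<forall>Y\<in>K. horo Y z \<le> horo (\<Phi> X Y) z) \<and> (\<forall>Y\<in>K. dist Y X < \<delta> X \<longrightarrow> horo Y z < horo (\<Phi> X Y) z) \<and>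
    (\<forall>Y\<in>K. \<not> dist Y X < \<delta> X \<longrightarrow> \<Phi> X Y = Y) \<and> \<Phi> X X1 = X1 \<and> \<Phi> X X2 = X2" by metis
  \<comment> \<open>No push lowers \<open>horo _ z\<close>, hence a strict increase by one of them
    survives the composition; outside its ball a push is the identity and the others act on the
    original point.\<close>
  have "\<exists>\<Psi>. continuous_on K \<Psi> \<and> \<Psi> ` K \<subseteq> K \<and> (\<forall>Y\<in>K. horo Y z \<le> horo (\<Psi> Y) z) \<and>
      (\<forall>Y\<in>K. (\<exists>X\<in>A. dist Y X < \<delta> X) \<longrightarrow> horo Y z < horo (\<Psi> Y) z) \<and> \<Psi> X1 = X1 \<and> \<Psi> X2 = X2"
    if "finite A" "A \<subseteq> C0" for A
    using that
  proof (induction A rule: finite_induct)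
    case empty
    show ?case by (rule exI[of _ "\<lambda>x. x"]) auto
  next
    case (insert X A)
    then obtain \<Psi> where \<Psi>: "continuous_on K \<Psi>" "\<Psi> ` K \<subseteq> K" "\<And>Y. Y \<in> K \<Longrightarrow> horo Y z \<le> horo (\<Psi> Y) z"
      "\<And>Y. Y \<in> K \<Longrightarrow> (\<exists>X\<in>A. dist Y X < \<delta> X) \<Longrightarrow> horo Y z < horo (\<Psi> Y) z" "\<Psi> X1 = X1" "\<Psi> X2 = X2"
      by auto
    have "X \<in> C0" using insert by auto
    note P = \<Phi>[OF this]
    have PK: "\<Phi> X Y \<in> K" if "Y \<in> K" for Y using P that by blast
    show ?case
    proof (intro exI[of _ "\<lambda>Y. \<Psi> (\<Phi> X Y)"] conjI ballI impI)
      show "continuous_on K (\<lambda>Y. \<Psi> (\<Phi> X Y))"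
        using continuous_on_compose2[OF \<Psi>(1)] P by blast
      show "(\<lambda>Y. \<Psi> (\<Phi> X Y)) ` K \<subseteq> K" using PK \<Psi>(2) by blast
      show "\<Psi> (\<Phi> X X1) = X1" "\<Psi> (\<Phi> X X2) = X2" using P \<Psi> by auto
      fix Y assume Y: "Y \<in> K"
      have le: "horo Y z \<le> horo (\<Phi> X Y) z" "horo (\<Phi> X Y) z \<le> horo (\<Psi> (\<Phi> X Y)) z" using P Y PK \<Psi>(3) by auto
      show "horo Y z \<le> horo (\<Psi> (\<Phi> X Y)) z" using le by simp
      show "horo Y z < horo (\<Psi> (\<Phi> X Y)) z" if ex: "\<exists>X'\<in>insert X A. dist Y X' < \<delta> X'"
      proof (cases "dist Y X < \<delta> X")
        case True
        then show ?thesis using P Y le by fastforce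
      next
        case False
        then have "\<Phi> X Y = Y" using P Y by blast
        then show ?thesis using \<Psi>(4)[OF Y] ex False by auto
      qed
    qed
  qed
  moreover obtain A where A: "finite A" "A \<subseteq> C0" "C0 \<subseteq> (\<Union>X\<in>A. ball X (\<delta> X))"
    by (rule compactE_image[OF compC0, of C0 "\<lambda>X. ball X (\<delta> X)"]) (use \<Phi> in auto)
  ultimately obtain \<Psi> where \<Psi>: "continuous_on K \<Psi>" "\<Psi> ` K \<subseteq> K" "\<And>Y. Y \<in> K \<Longrightarrow> horo Y z \<le> horo (\<Psi> Y) z"
      "\<And>Y. Y \<in> K \<Longrightarrow> (\<exists>X\<in>A. dist Y X < \<delta> X) \<Longrightarrow> horo Y z < horo (\<Psi> Y) z" "\<Psi> X1 = X1" "\<Psi> X2 = X2"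
    by (metis (no_types, lifting))
  have gt: "c0 < horo (\<Psi> Y) z" if Y: "Y \<in> C" for Y
  proof (cases "Y \<in> C0")
    case True
    then obtain X where "X \<in> A" "Y \<in> ball X (\<delta> X)" using A(3) by blast
    then have "\<exists>X\<in>A. dist Y X < \<delta> X" by (metis dist_commute mem_ball)
    then show ?thesis using \<Psi>(4)[of Y] Y CK True by (auto simp: C0_def)
  next
    case False
    then have "c0 < horo Y z" using Y Cge[OF Y] by (auto simp: C0_def)
    then show ?thesis using \<Psi>(3)[of Y] Y CK by auto
  qed
  have cC: "continuous_on C \<Psi>" using \<Psi>(1) CK continuous_on_subset by blast
  have comp\<Psi>: "compact (\<Psi> ` C)" and conn\<Psi>: "connected (\<Psi> ` C)"
    using compact_continuous_image[OF cC compC] connected_continuous_image[OF cC connC] by blast+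
  \<comment> \<open>The deformed continuum still joins \<open>X1\<close> to \<open>X2\<close>, and
    its lowest level, attained at \<open>Y1\<close>, exceeds \<open>c0\<close>; this contradicts the
    supremum.\<close>
  obtain Y1 where Y1: "Y1 \<in> \<Psi> ` C" "\<And>Y. Y \<in> \<Psi> ` C \<Longrightarrow> horo Y1 z \<le> horo Y z"
    using continuous_attains_inf[OF comp\<Psi> _ continuous_on_subset[OF ch]] X1C by blast
  have X\<Psi>: "X1 \<in> \<Psi> ` C" "X2 \<in> \<Psi> ` C" using X1C X2C \<Psi>(5,6) by (metis imageI)+
  have "\<Psi> ` C \<subseteq> L (horo Y1 z)"
  proof
    fix Y assume Y: "Y \<in> \<Psi> ` C"
    then have "Y \<in> K" using \<Psi>(2) CK by blast
    then show "Y \<in> L (horo Y1 z)" using Y1(2)[OF Y] by (simp add: L_def)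
  qed
  then have "\<Psi> ` C \<subseteq> CC (horo Y1 z)"
    unfolding CC_def using connected_component_maximal[OF X\<Psi>(1) conn\<Psi>] by blast
  then have "X2 \<in> CC (horo Y1 z)" using X\<Psi> by blast
  moreover have "horo Y1 z \<le> M" unfolding M_def using Y1(2)[OF X\<Psi>(1)] .
  ultimately have "horo Y1 z \<in> T" by (simp add: T_def)
  then have "horo Y1 z \<le> c0" unfolding c0_def using cSup_upper bdd by blast
  then show False using gt Y1(1) by force
qed

text \<open>By compactness, maximisers for parameters tending to \<open>x0\<close> accumulate at a
  maximiser for \<open>x0\<close>, and \<open>y0\<close> is the only one.\<close>

lemma argmax_neighbourhood:
  fixes f :: "'a::metric_space \<Rightarrow> 'b::metric_space \<Rightarrow> real"
  assumes S: "compact S" and f: "continuous_on (UNIV \<times> S) (\<lambda>(x, y). f x y)"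
    and y0: "y0 \<in> S" "\<And>y. y \<in> S \<Longrightarrow> y \<noteq> y0 \<Longrightarrow> f x0 y < f x0 y0" and V: "open V" "y0 \<in> V"
  shows "\<exists>r>0. \<forall>x y. dist x x0 < r \<longrightarrow> y \<in> S \<longrightarrow> (\<forall>y'\<in>S. f x y' \<le> f x y) \<longrightarrow> y \<in> V"
proof (rule ccontr)
  assume "\<not> ?thesis"
  then have "\<exists>x y. dist x x0 < 1 / real (Suc n) \<and> y \<in> S \<and> (\<forall>y'\<in>S. f x y' \<le> f x y) \<and> y \<notin> V" for n
    by (metis of_nat_0_less_iff zero_less_Suc zero_less_divide_1_iff)
  then obtain x y where xy: "\<And>n. dist (x n) x0 < 1 / real (Suc n)" "\<And>n. y n \<in> S" "\<And>n y'. y' \<in> S \<Longrightarrow> f (x n) y' \<le> f (x n) (y n)" "\<And>n. y n \<notin> V"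
    by metis
  obtain l k where l: "l \<in> S" and k: "strict_mono (k :: nat \<Rightarrow> nat)" and yl: "(y \<circ> k) \<longlonglongrightarrow> l"
    using S xy(2) unfolding compact_def by blast
  have yl: "(\<lambda>n. y (k n)) \<longlonglongrightarrow> l" using yl by (simp add: o_def)
  have "x \<longlonglongrightarrow> x0"
  proof (rule tendstoI)
    fix e :: real assume "e > 0"
    then obtain N where N: "1 / real (Suc N) < e" using nat_approx_posE by metis
    have "dist (x n) x0 < e" if "n \<ge> N" for n
    proof -
      have "1 / real (Suc n) \<le> 1 / real (Suc N)" using that by (simp add: frac_le)
      then show ?thesis using xy(1)[of n] N by simp
    qed
    then show "\<forall>\<^sub>F n in sequentially. dist (x n) x0 < e" unfolding eventually_sequentially by blast
  qed
  from LIMSEQ_subseq_LIMSEQ[OF this k] have xk: "(\<lambda>n. x (k n)) \<longlonglongrightarrow> x0" by (simp add: o_def)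
  have lim: "(\<lambda>n. f (x (k n)) (w n)) \<longlonglongrightarrow> f x0 w0" if w: "w \<longlonglongrightarrow> w0" "w0 \<in> S" "\<And>n. w n \<in> S" for w w0
  proof -
    have "(\<lambda>n. (x (k n), w n)) \<longlonglongrightarrow> (x0, w0)" by (intro tendsto_Pair xk w)
    from continuous_on_tendsto_compose[OF f this] show ?thesis using w by (simp add: always_eventually)
  qed
  have "f x0 y0 \<le> f x0 l"
    by (rule LIMSEQ_le[OF lim[OF tendsto_const y0(1) y0(1)] lim[OF yl l]]) (use xy y0 in auto)
  then have "l = y0" using y0(2)[OF l] by force
  then have "\<forall>\<^sub>F n in sequentially. y (k n) \<in> V" using topological_tendstoD[OF yl V(1)] V(2) by simp
  then show False using xy(4) by (auto simp: eventually_sequentially)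
qed

lemma smooth_bounded_domain_compact:
  assumes "smooth_uniformly_hconvex K"
  shows "K \<subseteq> hyp_space" "compact K" "connected K" "K \<noteq> {}" "smooth_boundary K"
  using assms unfolding smooth_uniformly_hconvex_def smooth_bounded_domain_def
  by (auto simp: hyp_interior_def)

text \<open>A maximiser cannot be pushed, so it is a boundary point whose normal is that of the
  horosphere; there the curvature bound gives a strict local maximum. The condition on normals is
  stated for every chart, since later arguments choose their own.\<close>

lemma horo_maximiser:
  fixes K :: "'m::finite minkowski set"
  assumes K: "smooth_uniformly_hconvex K" and z: "norm z = 1"
  obtains X where "X \<in> K" "X \<in> hyp_boundary K" "\<And>Y. Y \<in> K \<Longrightarrow> Y \<noteq> X \<Longrightarrow> horo Y z < horo X z"
    "\<And>U F. boundary_chart K U F \<Longrightarrow> X \<in> U \<Longrightarrow> unit_normal F X = horo_normal X z"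
proof -
  note k = smooth_bounded_domain_compact[OF K]
  obtain X where X: "X \<in> K" "\<And>Y. Y \<in> K \<Longrightarrow> horo Y z \<le> horo X z"
  proof -
    have "continuous_on K (\<lambda>Y. horo Y z)" by (intro continuous_intros)
    from continuous_attains_sup[OF k(2,4) this] show ?thesis using that by blast
  qed
  have push: "\<not> pushable K z X" if X: "X \<in> K" "\<And>Y. Y \<in> K \<Longrightarrow> horo Y z \<le> horo X z" for X
    using pushable_not_maximal X by (meson not_le)
  obtain \<delta> where \<delta>: "\<delta> > 0" "\<And>X \<kappa>. X \<in> hyp_boundary K \<Longrightarrow> principal_curvature K X \<kappa> \<Longrightarrow> \<kappa> > 1 + \<delta>"
    using K unfolding smooth_uniformly_hconvex_def by blast
  have alt: "pushable K z X \<or> (\<exists>V. open V \<and> X \<in> V \<and> (\<forall>Y\<in>K \<inter> V. Y \<noteq> X \<longrightarrow> horo Y z < horo X z))" if X: "X \<in> K" for X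
  proof (cases "X \<in> hyp_boundary K")
    case True
    obtain U F where c: "boundary_chart K U F" "X \<in> U" by (rule smooth_boundary_chart[OF k(5) True])
    then interpret boundary_chart K U F by blast
    show ?thesis
    proof (cases "unit_normal F X = horo_normal X z")
      case eq: True
      have "mink (frechet_derivative (unit_normal F) (at X) v) v > mink v v"
        if "mink v X = 0" "frechet_derivative F (at X) v = 0" "v \<noteq> 0" for v
        using second_fundamental_form_gt[OF c(2) True, of 1 v] \<delta>(2)[OF True] \<delta>(1) that by fastforce
      then show ?thesis using strict_local_max[OF c(2) True z eq] by blast
    next
      case False
      then show ?thesis using pushable_boundary[OF k(1) c(2) True z] by blast
    qed
  next
    case False
    then show ?thesis using pushable_interior[OF X k(1) _ z] by blast
  qed
  have bd: "X \<in> hyp_boundary K" using pushable_interior[OF X(1) k(1) _ z] push X by blast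
  show ?thesis
  proof (rule that[OF X(1) bd])
    show "horo Y z < horo X z" if "Y \<in> K" "Y \<noteq> X" for Y
      using unique_maximiser[OF k(1-3) alt X that(1)] X(2)[OF that(1)] that(2) by fastforce
    show "unit_normal F X = horo_normal X z" if "boundary_chart K U F" "X \<in> U" for U F
      using boundary_chart.pushable_boundary[OF that(1) k(1) that(2) bd z] push X by blast
  qed
qed

section \<open>The support function of a smooth uniformly h-convex domain\<close>

text \<open>Smoothness on the sphere is expressed through the extension constant along rays, because
  \<open>smooth_on\<close> differentiates in open sets.\<close>

definition smooth_sphere :: "(real ^ 'm::finite \<Rightarrow> real) \<Rightarrow> bool" where
  "smooth_sphere \<phi> \<longleftrightarrow> smooth_on (- {0}) (\<lambda>w. \<phi> (sgn w))"

lemma smoothv_on_sgn: "smoothv_on (- {0}) (sgn :: 'a::euclidean_space \<Rightarrow> 'a)"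
proof -
  have "smoothv_on (- {0}) (\<lambda>x :: 'a. (1 / sqrt (x \<bullet> x)) *\<^sub>R x)"
    by (intro smoothv_on_scaleR smooth_on_inverse smooth_on_sqrt smooth_on_inner smoothv_on_id) auto
  then show ?thesis by (simp add: sgn_div_norm[abs_def] norm_eq_sqrt_inner inverse_eq_divide)
qed

text \<open>With \<open>q\<close> the Minkowski square of the chord, \<open>Y - X\<close> is a
  tangent vector at \<open>X\<close> plus \<open>q / 2\<close> times \<open>X\<close>; for
  \<open>q \<le> 1\<close> this correction is absorbed into the constant 6.\<close>

lemma hyp_distance_bound:
  assumes "X \<in> hyp_space" "Y \<in> hyp_space" "mink (Y - X) (Y - X) \<le> 1"
  shows "mink (Y - X) (Y - X) \<ge> 0" "(norm (Y - X))\<^sup>2 \<le> 6 * (snd X)\<^sup>2 * mink (Y - X) (Y - X)"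
proof -
  define u where "u = Y - X"
  define q where "q = mink u u"
  have XX: "mink X X = -1" and YY: "mink Y Y = -1" using hyp_spaceD(1) assms by blast+
  have q2: "q = - 2 - 2 * mink X Y" unfolding q_def u_def using XX YY by (simp add: mink_commute[of Y X])
  then show "mink (Y - X) (Y - X) \<ge> 0" using hyp_mink_le[OF assms(1,2)] by (simp add: q_def u_def)
  then have q0: "q \<ge> 0" "q \<le> 1" using assms(3) by (simp_all add: q_def u_def)
  have uX: "mink u X = - q / 2" unfolding u_def using XX q2 by (simp add: mink_commute[of Y X] u_def)
  define w where "w = u + mink u X *\<^sub>R X"
  have wX: "mink w X = 0" using XX by (simp add: w_def)
  have ww: "mink w w = q + q\<^sup>2 / 4"
    using XX uX by (simp add: w_def mink_commute[of X u] q_def[symmetric] power2_eq_square)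
  have nw: "(norm w)\<^sup>2 \<le> 2 * (snd X)\<^sup>2 * (q + q\<^sup>2 / 4)"
    using mink_orthogonal_bound[OF assms(1) wX] ww by simp
  have nX: "(norm X)\<^sup>2 \<le> 2 * (snd X)\<^sup>2"
  proof -
    have "(norm (fst X))\<^sup>2 \<le> (snd X)\<^sup>2" using hyp_spaceD(4)[OF assms(1)] by (intro power_mono) auto
    then show ?thesis by (simp add: norm_prod_def)
  qed
  have "u = w + (q / 2) *\<^sub>R X" by (simp add: w_def uX)
  then have "norm u \<le> norm w + q / 2 * norm X" using norm_triangle_ineq[of w "(q / 2) *\<^sub>R X"] q0 by simp
  then have "(norm u)\<^sup>2 \<le> (norm w + q / 2 * norm X)\<^sup>2" by (intro power_mono) auto
  also have "\<dots> \<le> 2 * (norm w)\<^sup>2 + 2 * (q / 2 * norm X)\<^sup>2"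
    using zero_le_power2[of "norm w - q / 2 * norm X"] by (simp add: power2_sum power2_diff)
  also have "\<dots> \<le> 2 * (2 * (snd X)\<^sup>2 * (q + q\<^sup>2 / 4)) + q\<^sup>2 / 2 * (2 * (snd X)\<^sup>2)"
  proof (intro add_mono)
    have "q\<^sup>2 / 2 * (norm X)\<^sup>2 \<le> q\<^sup>2 / 2 * (2 * (snd X)\<^sup>2)" using nX by (intro mult_left_mono) auto
    then show "2 * (q / 2 * norm X)\<^sup>2 \<le> q\<^sup>2 / 2 * (2 * (snd X)\<^sup>2)"
      by (simp add: power_mult_distrib power_divide)
  qed (use nw in simp)
  also have "\<dots> = (4 * q + 2 * q\<^sup>2) * (snd X)\<^sup>2" by (simp add: algebra_simps)
  also have "\<dots> \<le> (6 * q) * (snd X)\<^sup>2"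
    using q0 by (intro mult_right_mono) (auto simp: power2_eq_square mult_left_le)
  finally show "(norm (Y - X))\<^sup>2 \<le> 6 * (snd X)\<^sup>2 * mink (Y - X) (Y - X)"
    unfolding u_def[symmetric] q_def[symmetric] by (simp only: mult_ac)
qed

text \<open>
  The point with outward direction \<open>z\<close> on the geodesic sphere that touches the horosphere of
  direction \<open>z0\<close> through \<open>X\<close> from inside at \<open>X\<close>; its radius \<open>r\<close> satisfies \<open>a = sinh r * exp r\<close>.
\<close>

definition inner_sphere :: "'m::finite minkowski \<Rightarrow> real ^ 'm \<Rightarrow> real \<Rightarrow> real ^ 'm \<Rightarrow> 'm minkowski" where
  "inner_sphere X z0 a z = X + (a / horo X z0) *\<^sub>R (z0, 1)
     - (a / (horo X z + a * (1 - z \<bullet> z0) / horo X z0)) *\<^sub>R (z, 1)"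

text \<open>The second claim is the origin of the gap: the point with direction \<open>z\<close>
  raises \<open>horo X z\<close> by \<open>a * k / horo X z0\<close>, and \<open>k\<close> is half
  the squared distance of \<open>z\<close> and \<open>z0\<close>. The products with \<open>X\<close>
  and the normal prepare the first-order expansion that places the sphere inside a domain.\<close>

lemma inner_sphere:
  fixes X :: "'m::finite minkowski" and z z0 :: "real ^ 'm" and a :: real
  assumes X: "X \<in> hyp_space" and z: "norm z0 = 1" "norm z = 1" and a: "a > 0"
  defines "Y \<equiv> inner_sphere X z0 a z"
  defines "k \<equiv> 1 - z \<bullet> z0"
  defines "q \<equiv> 2 * a\<^sup>2 * k / (horo X z0 * (horo X z + a * k / horo X z0))"
  shows "Y \<in> hyp_space" "horo Y z = horo X z + a * k / horo X z0"
    "mink (Y - X) (Y - X) = q" "mink (Y - X) X = - q / 2" "mink (Y - X) (horo_normal X z0) = - (q / 2) * (1 + 1 / a)"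
proof -
  define E0 E :: "'m minkowski" where "E0 = (z0, 1)" and "E = (z, 1)"
  have E: "mink v E0 = - horo v z0" "mink E0 v = - horo v z0" "mink v E = - horo v z" "mink E v = - horo v z" for v
    by (simp_all add: E0_def E_def)
  have hE: "horo E0 z0 = 0" "horo E z = 0" "horo E0 z = k" "horo E z0 = k"
    using z by (simp_all add: E0_def E_def horo_def k_def dot_square_norm inner_commute)
  have k0: "k \<ge> 0" unfolding k_def unit_inner_diff[OF z(2,1)] by simp
  define f0 f m where "f0 = horo X z0" and "f = horo X z" and "m = f + a * k / f0"
  have f: "f0 > 0" "f > 0" unfolding f0_def f_def using horo_pos X z by blast+
  have m: "m > 0" unfolding m_def using f a k0 by (simp add: add_pos_nonneg)
  have XX: "mink X X = -1" using hyp_spaceD(1) X by blast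
  have Yd: "Y - X = (a / f0) *\<^sub>R E0 - (a / m) *\<^sub>R E"
    unfolding Y_def inner_sphere_def E0_def E_def m_def f_def f0_def k_def by simp
  have qq: "q = 2 * (a / f0) * (a / m) * k" by (simp add: q_def m_def f_def f0_def power2_eq_square)
  show hY: "horo Y z = horo X z + a * k / horo X z0"
  proof -
    have "horo (Y - X) z = a / f0 * k" unfolding Yd by (simp add: hE)
    then show ?thesis by (simp add: f0_def)
  qed
  have am: "a / m * f = a - (a / f0) * (a / m) * k" using f m unfolding m_def by (simp add: field_simps)
  show 1: "mink (Y - X) (Y - X) = q" unfolding Yd qq by (simp add: E hE)
  show 2: "mink (Y - X) X = - q / 2" unfolding Yd using am f
    by (simp add: E f0_def[symmetric] f_def[symmetric] qq)
  have 3: "mink (Y - X) E0 = (a / m) * k" unfolding Yd by (simp add: E hE)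
  show "mink (Y - X) (horo_normal X z0) = - (q / 2) * (1 + 1 / a)"
    unfolding horo_normal_def E0_def[symmetric] f0_def[symmetric] mink_simps(4,6) 2 3 qq
    using a f m by (simp add: field_simps) (simp add: add_divide_distrib)?
  have YY: "mink Y Y = -1"
  proof -
    have "mink (Y - X) (Y - X) = mink Y Y - 2 * mink (Y - X) X - mink X X"
      by (simp add: mink_commute[of X Y])
    then show ?thesis using 1 2 XX by simp
  qed
  have "mink Y X < 0"
  proof -
    have "mink Y X = - 1 - q / 2" using 2 XX by simp
    moreover have "q \<ge> 0" unfolding qq using a f m k0 by simp
    ultimately show ?thesis by simp
  qed
  then show "Y \<in> hyp_space" using hyp_spaceI_mink[OF X YY] by blast
qed

context boundary_chart
begin

text \<open>An interior sphere condition uniform near \<open>X0\<close>. Expanding \<open>F\<close>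
  at the contact point, the first-order part is \<open>q / 2 * (d X - s * (1 + 1 / a))\<close> and
  the remainder is bounded by a constant times \<open>q\<close>; for small \<open>a\<close> the term
  in \<open>1 / a\<close> makes \<open>F\<close> nonpositive.\<close>

lemma inner_sphere_local:
  assumes XU: "X0 \<in> U" and X0: "X0 \<in> hyp_space" and fm: "fm > 0"
  shows "\<exists>a0>0. \<exists>V. open V \<and> X0 \<in> V \<and> (\<forall>X z0 z a. X \<in> V \<inter> hyp_space \<longrightarrow> X \<in> U \<longrightarrow> F X = 0 \<longrightarrow> norm z0 = 1 \<longrightarrow> norm z = 1 \<longrightarrow>
     unit_normal F X = horo_normal X z0 \<longrightarrow> fm \<le> horo X z0 \<longrightarrow> fm \<le> horo X z \<longrightarrow> 0 < a \<longrightarrow> a \<le> a0 \<longrightarrow>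
     inner_sphere X z0 a z \<in> \<Omega>)"
proof -
  obtain r C where r: "r > 0" "C > 0" "cball X0 r \<subseteq> U"
    and quad: "\<And>x y. x \<in> cball X0 r \<Longrightarrow> y \<in> cball X0 r \<Longrightarrow>
       \<bar>F y - F x - frechet_derivative F (at x) (y - x)\<bar> \<le> C * (norm (y - x))\<^sup>2"
    by (rule smooth_on_quadratic_bound[OF open_U smooth_F XU]) (rule that; assumption)
  define g where "g X = mink (nrm F X) (nrm F X)" for X
  define d where "d X = mink (mgrad F X) X" for X
  have cg: "continuous_on U g" unfolding g_def
    by (intro smooth_on_imp_continuous_on smooth_on_mink smoothv_on_nrm open_U smooth_F)
  have cd: "continuous_on U d" unfolding d_def
    by (intro smooth_on_imp_continuous_on smooth_on_mink smoothv_on_mgrad smoothv_on_id open_U smooth_F)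
  have g0: "g X0 > 0" unfolding g_def using regular XU by blast
  define \<rho> where "\<rho> = sqrt (g X0 / 2)"
  have \<rho>: "\<rho> > 0" unfolding \<rho>_def using g0 by simp
  define D where "D = \<bar>d X0\<bar> + 1"
  define x0 where "x0 = snd X0 + 1"
  have x0: "x0 > 1" unfolding x0_def using hyp_spaceD(2)[OF X0] by simp
  define V where "V = {X \<in> U. g X0 / 2 < g X} \<inter> {X \<in> U. d X < D} \<inter> {X. snd X < x0} \<inter> ball X0 (r / 2)"
  have V: "open V" unfolding V_def
    by (intro open_Int open_less_on open_U cg cd continuous_on_const open_ball open_Collect_less continuous_intros)
  have XV: "X0 \<in> V" unfolding V_def D_def x0_def using XU g0 r by (auto simp: abs_if)
  define A where "A = D + 12 * C * x0\<^sup>2"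
  have A: "A > 0" unfolding A_def D_def using r x0 by (simp add: add_pos_nonneg)
  \<comment> \<open>The entries ensure, in this order, the sign of the expansion, the bound
    \<open>q \<le> 1\<close>, and that the sphere stays within \<open>r / 2\<close> of its contact
    point.\<close>
  define a0 where "a0 = Min {\<rho> / A, fm / 2, fm * r / (12 * x0)}"
  have a0: "a0 > 0" "a0 \<le> \<rho> / A" "a0 \<le> fm / 2" "a0 \<le> fm * r / (12 * x0)"
  proof -
    show "a0 > 0" unfolding a0_def using \<rho> A fm r x0 by simp
    show "a0 \<le> \<rho> / A" "a0 \<le> fm / 2" "a0 \<le> fm * r / (12 * x0)"
      unfolding a0_def by (rule Min_le; simp)+
  qed
  have "inner_sphere X z0 a z \<in> \<Omega>"
    if X: "X \<in> V \<inter> hyp_space" "X \<in> U" "F X = 0" and z: "norm z0 = 1" "norm z = 1"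
      and N: "unit_normal F X = horo_normal X z0" and h: "fm \<le> horo X z0" "fm \<le> horo X z" and a: "0 < a" "a \<le> a0" for X z0 z a
  proof -
    define Y where "Y = inner_sphere X z0 a z"
    define k where "k = 1 - z \<bullet> z0"
    define q where "q = 2 * a\<^sup>2 * k / (horo X z0 * (horo X z + a * k / horo X z0))"
    have Xh: "X \<in> hyp_space" using X by blast
    have k: "0 \<le> k" "k \<le> 2"
      using Cauchy_Schwarz_ineq2[of z z0] z unfolding k_def by (auto simp: abs_le_iff)
    note Y = inner_sphere[OF Xh z a(1), folded Y_def, folded k_def, folded q_def]
    have hpos: "horo X z0 > 0" "horo X z > 0" using h fm by auto
    have q4: "q \<le> 4 * a\<^sup>2 / fm\<^sup>2"
    proof -
      have "fm * fm \<le> horo X z0 * (horo X z + a * k / horo X z0)"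
        using h fm a k hpos by (intro mult_mono) (auto simp: add_increasing2)
      then show ?thesis unfolding q_def using k fm a by (intro frac_le) (auto simp: power2_eq_square)
    qed
    have "2 * a \<le> fm" using a a0 by simp
    then have "(2 * a)\<^sup>2 \<le> fm\<^sup>2" using a by (intro power_mono) auto
    then have "4 * a\<^sup>2 / fm\<^sup>2 \<le> 1" using fm by (simp add: power_mult_distrib divide_le_eq_1)
    then have q1: "q \<le> 1" using q4 by simp
    have nb: "q \<ge> 0" "(norm (Y - X))\<^sup>2 \<le> 6 * (snd X)\<^sup>2 * q"
      using hyp_distance_bound[OF Xh Y(1)] q1 unfolding Y(3) by auto
    have sX: "0 < snd X" "snd X < x0" using hyp_spaceD(2)[OF Xh] X(1) unfolding V_def by auto
    have "(snd X)\<^sup>2 \<le> x0\<^sup>2" using sX by (intro power_mono) auto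
    then have nb2: "(norm (Y - X))\<^sup>2 \<le> 6 * x0\<^sup>2 * q" using nb by (smt (verit) mult_right_mono)
    have dY: "dist X Y \<le> r / 2"
    proof -
      have "(norm (Y - X))\<^sup>2 \<le> 6 * x0\<^sup>2 * (4 * a\<^sup>2 / fm\<^sup>2)"
        using nb2 q4 by (smt (verit) mult_left_mono zero_le_power2)
      also have "\<dots> \<le> (6 * x0 * a / fm)\<^sup>2" using fm by (simp add: power_mult_distrib power_divide field_simps)
      finally have "norm (Y - X) \<le> 6 * x0 * a / fm" by (rule power2_le_imp_le) (use x0 a fm in auto)
      also have "\<dots> \<le> r / 2"
      proof -
        have "a \<le> fm * r / (12 * x0)" using a a0 by simp
        then show ?thesis using x0 fm by (simp add: field_simps)
      qed
      finally show ?thesis by (simp add: dist_norm norm_minus_commute)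
    qed
    have XB: "dist X0 X < r / 2" using X(1) unfolding V_def by simp
    then have "dist X0 Y \<le> r" using dY dist_triangle[of X0 Y X] by simp
    then have inb: "X \<in> cball X0 r" "Y \<in> cball X0 r" using XB r by auto
    define s where "s = sqrt (g X)"
    have "g X0 / 2 < g X" using X(1) unfolding V_def by blast
    then have s: "\<rho> \<le> s" unfolding s_def \<rho>_def by simp
    then have s0: "s > 0" using \<rho> by simp
    have nrmX: "nrm F X = s *\<^sub>R horo_normal X z0"
      unfolding N[symmetric] unit_normal_def using s0 by (simp add: s_def g_def)
    have "frechet_derivative F (at X) (Y - X) = mink (nrm F X) (Y - X) - d X * mink X (Y - X)"
    proof -
      have "mink (nrm F X) (Y - X) = mink (mgrad F X) (Y - X) + d X * mink X (Y - X)"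
        unfolding nrm_def d_def by (simp only: mink_simps(1,5))
      then show ?thesis using mink_mgrad[OF F_differentiable[OF X(2)], of "Y - X"] by linarith
    qed
    also have "\<dots> = s * mink (Y - X) (horo_normal X z0) - d X * mink (Y - X) X"
      unfolding nrmX by (simp only: mink_simps(5)) (simp only: mink_commute)
    also have "\<dots> = q / 2 * (d X - s * (1 + 1 / a))" unfolding Y(4,5) by (simp add: algebra_simps)
    finally have DF: "frechet_derivative F (at X) (Y - X) = q / 2 * (d X - s * (1 + 1 / a))" .
    have "F Y \<le> frechet_derivative F (at X) (Y - X) + C * (norm (Y - X))\<^sup>2" using quad[OF inb] X(3) by (simp add: abs_le_iff)
    also have "\<dots> \<le> q / 2 * (d X - s * (1 + 1 / a)) + C * (6 * x0\<^sup>2 * q)"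
      unfolding DF using nb2 r(2) by (intro add_left_mono mult_left_mono) auto
    also have "\<dots> = q / 2 * (d X + 12 * C * x0\<^sup>2 - s - s / a)" by (simp add: algebra_simps)
    also have "\<dots> \<le> q / 2 * 0"
    proof (intro mult_left_mono)
      have "a \<le> \<rho> / A" using a a0(2) by linarith
      then have "a * A \<le> \<rho>" using A by (simp add: pos_le_divide_eq)
      then have "A \<le> \<rho> / a" using a by (simp add: field_simps)
      also have "\<dots> \<le> s / a" using s a by (intro divide_right_mono) auto
      finally have "A \<le> s / a" .
      moreover have "d X < D" using X(1) unfolding V_def by blast
      ultimately show "d X + 12 * C * x0\<^sup>2 - s - s / a \<le> 0" using s0 unfolding A_def by simp
    qed (use nb in simp)
    finally have "F Y \<le> 0" by simp
    then show ?thesis using Y(1) inb(2) r(3) Omega_U unfolding Y_def by blast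
  qed
  then show ?thesis using a0(1) V XV by blast
qed

text \<open>The critical equation for \<open>horo _ z\<close> under the constraints
  \<open>F = 0\<close> and \<open>mink X X = -1\<close>, with its multipliers in closed form. It is
  the equality of normals cleared of the normalisation.\<close>

lemma lagrange:
  assumes "X \<in> U" "X \<in> hyp_space" "norm z = 1" "unit_normal F X = horo_normal X z"
  defines "l \<equiv> horo X z / sqrt (mink (nrm F X) (nrm F X))"
  shows "l *\<^sub>R mgrad F X + (l * mink (mgrad F X) X - horo X z) *\<^sub>R X = - (z, 1)"
proof -
  define \<rho> where "\<rho> = sqrt (mink (nrm F X) (nrm F X))"
  have \<rho>: "\<rho> > 0" unfolding \<rho>_def using regular[OF assms(1)] by simp
  have h: "horo X z > 0" using horo_pos assms by blast
  define e where "e = (z, 1 :: real)"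
  have "l *\<^sub>R nrm F X = horo X z *\<^sub>R unit_normal F X"
    unfolding l_def unit_normal_def by simp
  also have "\<dots> = horo X z *\<^sub>R X - e" unfolding assms(4) horo_normal_def e_def[symmetric] using h
    by (simp add: scaleR_diff_right)
  finally have "l *\<^sub>R mgrad F X + (l * mink (mgrad F X) X - horo X z) *\<^sub>R X = (horo X z *\<^sub>R X - e) - horo X z *\<^sub>R X"
    by (simp add: nrm_def algebra_simps)
  then show ?thesis unfolding e_def[symmetric] by simp
qed

lemma lagrange_map_derivative:
  assumes "X \<in> U"
  defines "\<Psi> \<equiv> \<lambda>p. (fst (snd p) *\<^sub>R mgrad F (fst p) + snd (snd p) *\<^sub>R fst p, F (fst p), mink (fst p) (fst p))"
  shows "smoothv_on (U \<times> UNIV) \<Psi>"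
    and "frechet_derivative \<Psi> (at (X, l, s)) (v, t, u) =
      (l *\<^sub>R frechet_derivative (mgrad F) (at X) v + t *\<^sub>R mgrad F X + (s *\<^sub>R v + u *\<^sub>R X),
       frechet_derivative F (at X) v, mink X v + mink v X)"
proof -
  have o: "open (U \<times> (UNIV :: (real \<times> real) set))" using open_U by (simp add: open_Times)
  note sf = smoothv_on_fst[OF smoothv_on_id[OF o]] smoothv_on_snd[OF smoothv_on_id[OF o]]
  have s1: "smooth_on (U \<times> UNIV) (\<lambda>p :: 'm minkowski \<times> real \<times> real. fst (snd p))"
    by (rule smoothv_on_real[OF o, THEN iffD1, OF smoothv_on_fst[OF sf(2)]])
  have s2: "smooth_on (U \<times> UNIV) (\<lambda>p :: 'm minkowski \<times> real \<times> real. snd (snd p))"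
    by (rule smoothv_on_real[OF o, THEN iffD1, OF smoothv_on_snd[OF sf(2)]])
  show "smoothv_on (U \<times> UNIV) \<Psi>" unfolding \<Psi>_def
    by (intro smoothv_on_Pair o smoothv_on_add smoothv_on_scaleR s1 s2 sf
        smoothv_on_compose[OF o open_U smoothv_on_mgrad[OF open_U smooth_F]]
        smoothv_on_real[OF o, THEN iffD2] smooth_on_compose[OF o open_U smooth_F] smooth_on_mink) auto
  have dP: "(mgrad F has_derivative frechet_derivative (mgrad F) (at X)) (at X)"
    using smoothv_on_has_derivative[OF smoothv_on_mgrad[OF open_U smooth_F] assms(1)] .
  have f: "(fst has_derivative fst) (at (X, l, s))" by (auto intro!: derivative_eq_intros)
  have c1: "((\<lambda>p. mgrad F (fst p)) has_derivative (\<lambda>h. frechet_derivative (mgrad F) (at X) (fst h))) (at (X, l, s))"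
    using diff_chain_at[OF f, of "mgrad F"] dP by (simp add: o_def)
  have c2: "((\<lambda>p. F (fst p)) has_derivative (\<lambda>h. frechet_derivative F (at X) (fst h))) (at (X, l, s))"
    using diff_chain_at[OF f, of F] F_derivative[OF assms(1)] by (simp add: o_def)
  have g1: "((\<lambda>p. fst (snd p)) has_derivative (\<lambda>h. fst (snd h))) (at (X, l, s))"
    and g2: "((\<lambda>p. snd (snd p)) has_derivative (\<lambda>h. snd (snd h))) (at (X, l, s))"
    by (auto intro!: derivative_eq_intros)
  have "(\<Psi> has_derivative (\<lambda>h. ((fst (snd (X, l, s)) *\<^sub>R frechet_derivative (mgrad F) (at X) (fst h) + fst (snd h) *\<^sub>R mgrad F (fst (X, l, s)))
      + (snd (snd (X, l, s)) *\<^sub>R fst h + snd (snd h) *\<^sub>R fst (X, l, s)),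
      frechet_derivative F (at X) (fst h), mink (fst (X, l, s)) (fst h) + mink (fst h) (fst (X, l, s))))) (at (X, l, s))"
    unfolding \<Psi>_def
    by (intro has_derivative_Pair has_derivative_add has_derivative_scaleR g1 g2 c1 c2 f has_derivative_mink)
  from frechet_derivative_at[OF this, symmetric]
  show "frechet_derivative \<Psi> (at (X, l, s)) (v, t, u) =
      (l *\<^sub>R frechet_derivative (mgrad F) (at X) v + t *\<^sub>R mgrad F X + (s *\<^sub>R v + u *\<^sub>R X),
       frechet_derivative F (at X) v, mink X v + mink v X)" by simp
qed

lemma mgrad_derivative_hess:
  assumes "X \<in> U"
  shows "mink (frechet_derivative (mgrad F) (at X) v) w = hess F X w v"
proof -
  have dP: "(mgrad F has_derivative frechet_derivative (mgrad F) (at X)) (at X)"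
    using smoothv_on_has_derivative[OF smoothv_on_mgrad[OF open_U smooth_F] assms(1)] .
  have "((\<lambda>Y. mink (mgrad F Y) w) has_derivative (\<lambda>h. mink (mgrad F X) 0 + mink (frechet_derivative (mgrad F) (at X) h) w)) (at X)"
    by (rule has_derivative_mink[OF dP has_derivative_const])
  from has_derivative_transform_within_open[OF this open_U assms(1) mink_mgrad[OF F_differentiable]]
  have "((\<lambda>Y. frechet_derivative F (at Y) w) has_derivative (\<lambda>h. mink (frechet_derivative (mgrad F) (at X) h) w)) (at X)"
    by simp
  from frechet_derivative_at[OF this, symmetric] show ?thesis by (simp add: hess_def)
qed

text \<open>Pairing the linearised equation with \<open>v\<close> gives
  \<open>l * hess F X v v + s * mink v v\<close>, which is \<open>horo X z\<close> times the excess
  of the second fundamental form over that of the horosphere. Curvature above 1 makes it positive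
  unless \<open>v = 0\<close>; the multipliers then vanish because the normal and \<open>X\<close>
  are independent.\<close>

lemma lagrange_map_injective:
  assumes XU: "X \<in> U" and X: "X \<in> hyp_space" "X \<in> hyp_boundary \<Omega>" and z: "norm z = 1" and N: "unit_normal F X = horo_normal X z"
    and curv: "\<And>\<kappa>. principal_curvature \<Omega> X \<kappa> \<Longrightarrow> \<kappa> > 1"
  defines "l \<equiv> horo X z / sqrt (mink (nrm F X) (nrm F X))"
  defines "s \<equiv> l * mink (mgrad F X) X - horo X z"
  assumes zero: "l *\<^sub>R frechet_derivative (mgrad F) (at X) v + t *\<^sub>R mgrad F X + (s *\<^sub>R v + u *\<^sub>R X) = 0"
    "frechet_derivative F (at X) v = 0" "mink v X = 0"
  shows "v = 0" "t = 0" "u = 0"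
proof -
  define \<rho> where "\<rho> = sqrt (mink (nrm F X) (nrm F X))"
  have \<rho>: "\<rho> > 0" unfolding \<rho>_def using regular[OF XU] by simp
  have h: "horo X z > 0" using horo_pos X z by blast
  have l: "l > 0" unfolding l_def using h \<rho> by (simp add: \<rho>_def)
  have lr: "l * \<rho> = horo X z" unfolding l_def \<rho>_def[symmetric] using \<rho> by simp
  have PX: "mink (mgrad F X) w = frechet_derivative F (at X) w" for w using mink_mgrad[OF F_differentiable[OF XU]] .
  show v0: "v = 0"
  proof (rule ccontr)
    assume "v \<noteq> 0"
    then have "mink (frechet_derivative (unit_normal F) (at X) v) v > 1 * mink v v"
      using second_fundamental_form_gt[OF XU X(2), of 1 v] curv zero by simp
    then have "mink v v < (hess F X v v + mink (mgrad F X) X * mink v v) / \<rho>"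
      unfolding second_fundamental_form[OF XU X(1) zero(3,3,2)] by (simp add: \<rho>_def PX)
    then have "horo X z * mink v v < horo X z * ((hess F X v v + mink (mgrad F X) X * mink v v) / \<rho>)"
      using h by (rule mult_strict_left_mono)
    also have "\<dots> = l * hess F X v v + l * mink (mgrad F X) X * mink v v"
      unfolding lr[symmetric] using \<rho> by (simp add: field_simps)
    finally have 1: "l * hess F X v v + s * mink v v > 0" unfolding s_def by (simp add: algebra_simps)
    have "mink (l *\<^sub>R frechet_derivative (mgrad F) (at X) v + t *\<^sub>R mgrad F X + (s *\<^sub>R v + u *\<^sub>R X)) v = 0"
      using zero(1) by simp
    then have "l * hess F X v v + s * mink v v = 0"
      using zero(2,3) by (simp add: mgrad_derivative_hess[OF XU] PX mink_commute[of X v])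
    then show False using 1 by simp
  qed
  have "linear (frechet_derivative (mgrad F) (at X))"
    using smoothv_on_has_derivative[OF smoothv_on_mgrad[OF open_U smooth_F] XU] has_derivative_linear by blast
  then have eq: "t *\<^sub>R mgrad F X + u *\<^sub>R X = 0" using zero(1) v0 by (simp add: linear_0)
  have "mink (t *\<^sub>R mgrad F X + u *\<^sub>R X) (unit_normal F X) = 0" using eq by simp
  then have "t * \<rho> = 0"
    using normal_properties(2,4)[OF XU] X by (simp add: PX mink_commute[of X] \<rho>_def)
  then show t0: "t = 0" using \<rho> by simp
  have "X \<noteq> 0" using hyp_spaceD(2)[OF X(1)] by auto
  then show "u = 0" using eq t0 by simp
qed

end

text \<open>The local hypothesis covers all smaller values of \<open>a\<close>, so the minimum over
  a finite subcover is admissible everywhere.\<close>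

lemma compact_uniform_positive:
  fixes P :: "'a::topological_space \<Rightarrow> real \<Rightarrow> bool"
  assumes "compact S"
    and "\<And>x. x \<in> S \<Longrightarrow> \<exists>a0>0. \<exists>V. open V \<and> x \<in> V \<and> (\<forall>y\<in>V \<inter> S. \<forall>a. 0 < a \<and> a \<le> a0 \<longrightarrow> P y a)"
  shows "\<exists>a>0. \<forall>y\<in>S. P y a"
proof -
  obtain f V where fV: "\<And>x. x \<in> S \<Longrightarrow> f x > 0 \<and> open (V x) \<and> x \<in> V x \<and> (\<forall>y\<in>V x \<inter> S. \<forall>a. 0 < a \<and> a \<le> f x \<longrightarrow> P y a)"
    using assms(2) by metis
  obtain A where A: "finite A" "A \<subseteq> S" "S \<subseteq> (\<Union>x\<in>A. V x)"
    by (rule compactE_image[OF assms(1), of S V]) (use fV in auto)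
  define a where "a = Min (insert 1 (f ` A))"
  have "a > 0" unfolding a_def using A fV by auto
  moreover have "P y a" if "y \<in> S" for y
  proof -
    obtain x where x: "x \<in> A" "y \<in> V x" using A(3) \<open>y \<in> S\<close> by blast
    have "a \<le> f x" unfolding a_def using A(1) x(1) by simp
    then show ?thesis using fV[of x] x A(2) that \<open>a > 0\<close> by blast
  qed
  ultimately show ?thesis by blast
qed

lemma smooth_on_locally:
  assumes "\<And>x. x \<in> U \<Longrightarrow> \<exists>V. open V \<and> x \<in> V \<and> smooth_on V f"
  shows "smooth_on U f"
  unfolding smooth_on_def
proof
  fix k
  show "Ck_on k U f" by (rule Ck_on_locally) (use assms in \<open>auto simp: smooth_on_def simp del: Ck_on.simps\<close>)
qed

lemma horo_bounds:
  assumes "compact K" "K \<subseteq> hyp_space" "K \<noteq> {}"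
  obtains m B where "m > 0" "B > 0" "\<And>X z. X \<in> K \<Longrightarrow> norm z = 1 \<Longrightarrow> m \<le> horo X z \<and> horo X z \<le> B"
proof -
  let ?S = "sphere 0 1 :: (real ^ 'a) set"
  let ?h = "\<lambda>p :: 'a minkowski \<times> (real ^ 'a). horo (fst p) (snd p)"
  have c: "compact (K \<times> ?S)" using assms by (simp add: compact_Times)
  obtain z :: "real ^ 'a" where z: "norm z = 1" using vector_choose_size[of 1] by auto
  then have ne: "K \<times> ?S \<noteq> {}" using assms(3) by auto
  have ch: "continuous_on (K \<times> ?S) ?h" by (intro continuous_intros)
  obtain p where p: "p \<in> K \<times> ?S" "\<And>q. q \<in> K \<times> ?S \<Longrightarrow> ?h p \<le> ?h q"
    using continuous_attains_inf[OF c ne ch] by blast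
  obtain p' where p': "p' \<in> K \<times> ?S" "\<And>q. q \<in> K \<times> ?S \<Longrightarrow> ?h q \<le> ?h p'"
    using continuous_attains_sup[OF c ne ch] by blast
  have pos: "?h q > 0" if "q \<in> K \<times> ?S" for q
    using that assms(2) by (auto simp: mem_Times_iff intro!: horo_pos)
  note pos[OF p(1)] pos[OF p'(1)]
  moreover have "?h p \<le> horo X z \<and> horo X z \<le> ?h p'" if "X \<in> K" "norm z = 1" for X z
    using p(2)[of "(X, z)"] p'(2)[of "(X, z)"] that by simp
  ultimately show ?thesis using that by blast
qed

text \<open>The gap comes from fitting interior spheres of one common parameter at all maximisers
  \<open>Xm z\<close>; smoothness comes from recognising \<open>Xm z\<close>, with its multipliers,
  as a solution of the Lagrange equations near a given one.\<close>

theorem smooth_domain_support: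
  fixes K :: "'m::finite minkowski set"
  assumes K: "smooth_uniformly_hconvex K"
  shows "smooth_sphere (\<lambda>z. exp (horo_support K z))"
    and "\<exists>c>0. supported c (\<lambda>z. exp (horo_support K z))"
proof -
  note k = smooth_bounded_domain_compact[OF K]
  obtain \<delta> where \<delta>: "\<delta> > 0" "\<And>X \<kappa>. X \<in> hyp_boundary K \<Longrightarrow> principal_curvature K X \<kappa> \<Longrightarrow> \<kappa> > 1 + \<delta>"
    using K unfolding smooth_uniformly_hconvex_def by blast
  define Q where "Q z X \<longleftrightarrow> X \<in> K \<and> X \<in> hyp_boundary K \<and> (\<forall>Y\<in>K. Y \<noteq> X \<longrightarrow> horo Y z < horo X z) \<and>
      (\<forall>U F. boundary_chart K U F \<longrightarrow> X \<in> U \<longrightarrow> unit_normal F X = horo_normal X z)" for z X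
  have "\<exists>X. Q z X" if "norm z = 1" for z
    unfolding Q_def by (rule horo_maximiser[OF K that]) blast
  then obtain Xm where Q: "\<And>z. norm z = 1 \<Longrightarrow> Q z (Xm z)" by metis
  have Xm: "norm z = 1 \<Longrightarrow> Xm z \<in> K" "norm z = 1 \<Longrightarrow> Xm z \<in> hyp_boundary K"
    "norm z = 1 \<Longrightarrow> Y \<in> K \<Longrightarrow> Y \<noteq> Xm z \<Longrightarrow> horo Y z < horo (Xm z) z"
    "norm z = 1 \<Longrightarrow> boundary_chart K U F \<Longrightarrow> Xm z \<in> U \<Longrightarrow> unit_normal F (Xm z) = horo_normal (Xm z) z" for z Y U F
    using Q[of z] unfolding Q_def by blast+
  have Xh: "Xm z \<in> hyp_space" if "norm z = 1" for z using Xm(1)[OF that] k(1) by blast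
  have max: "horo Y z \<le> horo (Xm z) z" if "norm z = 1" "Y \<in> K" for Y z
  proof (cases "Y = Xm z")
    case False
    then show ?thesis by (rule less_imp_le[OF Xm(3)[OF that]])
  qed simp
  define ph where "ph z = exp (horo_support K z)" for z
  have ph: "ph z = horo (Xm z) z" if "norm z = 1" for z
    unfolding ph_def using horo_support_max[OF k(1) Xm(1)[OF that]] max that by blast
  have near: "\<exists>r>0. \<forall>z. norm z = 1 \<longrightarrow> dist z z0 < r \<longrightarrow> Xm z \<in> V" if "norm z0 = 1" "open V" "Xm z0 \<in> V" for z0 V
  proof -
    have "continuous_on (UNIV \<times> K) (\<lambda>(z, Y). horo Y z)"
      unfolding case_prod_unfold by (intro continuous_intros)
    from argmax_neighbourhood[OF k(2) this Xm(1)[OF that(1)] Xm(3)[OF that(1)] that(2,3)]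
    obtain r where r: "r > 0" "\<forall>z Y. dist z z0 < r \<longrightarrow> Y \<in> K \<longrightarrow> (\<forall>y'\<in>K. horo y' z \<le> horo Y z) \<longrightarrow> Y \<in> V" by auto
    then have "Xm z \<in> V" if "norm z = 1" "dist z z0 < r" for z using Xm(1) max that by blast
    then show ?thesis using r(1) by blast
  qed
  obtain m B where mB: "m > 0" "B > 0" "\<And>X z. X \<in> K \<Longrightarrow> norm z = 1 \<Longrightarrow> m \<le> horo X z \<and> horo X z \<le> B"
    by (rule horo_bounds[OF k(2,1,4)]) (rule that; assumption)
  have chart: "\<exists>U F. boundary_chart K U F \<and> Xm z \<in> U" if "norm z = 1" for z
    by (rule smooth_boundary_chart[OF k(5) Xm(2)[OF that]]) blast
  \<comment> \<open>Charts are local, but by \<open>near\<close> the maximisers for directions close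
    to \<open>z0\<close> stay in one chart; compactness of the sphere yields a common
    \<open>a\<close>.\<close>
  have "\<exists>a>0. \<forall>z0\<in>sphere 0 1. \<forall>z. norm z = 1 \<longrightarrow> inner_sphere (Xm z0) z0 a z \<in> K"
  proof (rule compact_uniform_positive)
    fix z0 :: "real ^ 'm" assume "z0 \<in> sphere 0 1"
    then have z0: "norm z0 = 1" by simp
    obtain U F where c: "boundary_chart K U F" "Xm z0 \<in> U" using chart[OF z0] by blast
    then interpret boundary_chart K U F by blast
    obtain a0 V where a0: "a0 > 0" "open V" "Xm z0 \<in> V" and aV: "\<And>X z0 z a. X \<in> V \<inter> hyp_space \<Longrightarrow> X \<in> U \<Longrightarrow> F X = 0 \<Longrightarrow> norm z0 = 1 \<Longrightarrow> norm z = 1 \<Longrightarrow>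
     unit_normal F X = horo_normal X z0 \<Longrightarrow> m \<le> horo X z0 \<Longrightarrow> m \<le> horo X z \<Longrightarrow> 0 < a \<Longrightarrow> a \<le> a0 \<Longrightarrow>
     inner_sphere X z0 a z \<in> K"
      using inner_sphere_local[OF c(2) Xh[OF z0] mB(1)] by blast
    obtain r where r: "r > 0" "\<And>z. norm z = 1 \<Longrightarrow> dist z z0 < r \<Longrightarrow> Xm z \<in> V \<inter> U"
      using near[OF z0 open_Int[OF a0(2) open_U]] a0(3) c(2) by blast
    have "inner_sphere (Xm y) y a z \<in> K" if y: "y \<in> ball z0 r" "norm y = 1" and a: "0 < a" "a \<le> a0" and z: "norm z = 1" for y a z
    proof -
      have yV: "Xm y \<in> V" "Xm y \<in> U" using r(2)[OF y(2)] y(1) by (auto simp: dist_commute)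
      show ?thesis
        using yV Xh[OF y(2)] boundary_iff[OF yV(2)] Xm(2)[OF y(2)] Xm(4)[OF y(2) c(1) yV(2)] mB(3)[OF Xm(1)[OF y(2)]] y z a
        by (intro aV) auto
    qed
    then show "\<exists>a0>0. \<exists>V. open V \<and> z0 \<in> V \<and> (\<forall>y\<in>V \<inter> sphere 0 1. \<forall>a. 0 < a \<and> a \<le> a0 \<longrightarrow>
        (\<forall>z. norm z = 1 \<longrightarrow> inner_sphere (Xm y) y a z \<in> K))"
      using a0(1) r(1) by (intro exI[of _ a0] conjI exI[of _ "ball z0 r"]) auto
  qed simp
  then obtain a where a: "a > 0" "\<And>z0 z. norm z0 = 1 \<Longrightarrow> norm z = 1 \<Longrightarrow> inner_sphere (Xm z0) z0 a z \<in> K" by auto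
  \<comment> \<open>The sphere gains \<open>a * (1 - z \<bullet> z0) / horo (Xm z0) z0\<close>; the
    2 comes from the squared distance and \<open>B\<close> bounds the denominator.\<close>
  have "supported (a / (2 * B)) ph"
    unfolding supported_def
  proof (intro allI impI)
    fix z0 :: "real ^ 'm" assume z0: "norm z0 = 1"
    show "\<exists>X\<in>hyp_space. horo X z0 = ph z0 \<and> (\<forall>z. norm z = 1 \<longrightarrow> horo X z + a / (2 * B) * (norm (z - z0))\<^sup>2 \<le> ph z)"
    proof (intro bexI[of _ "Xm z0"] conjI allI impI)
      fix z :: "real ^ 'm" assume z: "norm z = 1"
      have h: "0 < horo (Xm z0) z0" "horo (Xm z0) z0 \<le> B" using horo_pos[OF Xh[OF z0] z0] mB(3)[OF Xm(1)[OF z0] z0] by auto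
      have "a / (2 * B) * (norm (z - z0))\<^sup>2 = a * (1 - z \<bullet> z0) / B" unfolding unit_inner_diff[OF z z0] by simp
      also have "\<dots> \<le> a * (1 - z \<bullet> z0) / horo (Xm z0) z0"
      proof -
        have "0 \<le> 1 - z \<bullet> z0" unfolding unit_inner_diff[OF z z0] by simp
        then have "0 \<le> a * (1 - z \<bullet> z0)" using a(1) by simp
        then show ?thesis using h by (intro divide_left_mono) auto
      qed
      finally show "horo (Xm z0) z + a / (2 * B) * (norm (z - z0))\<^sup>2 \<le> ph z"
        using max[OF z a(2)[OF z0 z]] inner_sphere(2)[OF Xh[OF z0] z0 z a(1)] ph[OF z] by simp
    qed (use Xh ph z0 in auto)
  qed
  then show "\<exists>c>0. supported c (\<lambda>z. exp (horo_support K z))"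
    using a(1) mB(2) by (intro exI[of _ "a / (2 * B)"]) (simp add: ph_def[abs_def])
  have "smooth_on (- {0}) (\<lambda>w. ph (sgn w))"
  proof (rule smooth_on_locally)
    fix w0 :: "real ^ 'm" assume "w0 \<in> - {0}"
    then have w0: "w0 \<noteq> 0" by simp
    define z0 where "z0 = sgn w0"
    have z0: "norm z0 = 1" unfolding z0_def using w0 by (simp add: norm_sgn)
    obtain U F where c: "boundary_chart K U F" "Xm z0 \<in> U" using chart[OF z0] by blast
    then interpret boundary_chart K U F by blast
    define \<Psi> where "\<Psi> p = (fst (snd p) *\<^sub>R mgrad F (fst p) + snd (snd p) *\<^sub>R fst p, F (fst p), mink (fst p) (fst p))"
      for p :: "'m minkowski \<times> real \<times> real"
    define l where "l X z = horo X z / sqrt (mink (nrm F X) (nrm F X))" for X z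
    define s where "s X z = l X z * mink (mgrad F X) X - horo X z" for X z
    \<comment> \<open>\<open>P\<close> completes a point and a direction by the Lagrange
      multipliers. On a completed contact point \<open>\<Psi>\<close> depends on the direction only,
      so a local inverse of \<open>\<Psi>\<close> recovers the point smoothly from the
      direction.\<close>
    define P where "P q = (fst q, l (fst q) (snd q), s (fst q) (snd q))" for q :: "'m minkowski \<times> (real ^ 'm)"
    have \<Psi>P: "\<Psi> (P (X, z)) = (- (z, 1), 0, -1)"
      if "X \<in> U" "X \<in> hyp_boundary K" "norm z = 1" "unit_normal F X = horo_normal X z" for X z
    proof -
      have X: "X \<in> hyp_space" "F X = 0" using boundary_iff[OF that(1)] that(2) by blast+
      show ?thesis
        using lagrange[OF that(1) X(1) that(3,4)] X hyp_spaceD(1)[OF X(1)]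
        unfolding \<Psi>_def P_def s_def l_def by simp
    qed
    have oU: "open (U \<times> (UNIV :: (real \<times> real) set))" "open (U \<times> (UNIV :: (real ^ 'm) set))"
      using open_U by (simp_all add: open_Times)
    have sm\<Psi>: "smoothv_on (U \<times> UNIV) \<Psi>"
      using lagrange_map_derivative(1)[OF c(2)] unfolding \<Psi>_def[abs_def] .
    note XmU = Xm(4)[OF z0 c]
    have bX: "Xm z0 \<in> hyp_space" using Xh z0 by blast
    define p0 where "p0 = P (Xm z0, z0)"
    have p0U: "p0 \<in> U \<times> UNIV" unfolding p0_def P_def using c(2) by simp
    have inj: "h = 0" if h0: "frechet_derivative \<Psi> (at p0) h = 0" for h
    proof -
      obtain v t u where h: "h = (v, t, u)" by (metis prod.collapse)
      have "(l (Xm z0) z0 *\<^sub>R frechet_derivative (mgrad F) (at (Xm z0)) v + t *\<^sub>R mgrad F (Xm z0) + (s (Xm z0) z0 *\<^sub>R v + u *\<^sub>R Xm z0),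
       frechet_derivative F (at (Xm z0)) v, mink (Xm z0) v + mink v (Xm z0)) = 0"
        using h0 lagrange_map_derivative(2)[OF c(2), of "l (Xm z0) z0" "s (Xm z0) z0" v t u]
        unfolding h p0_def P_def \<Psi>_def[abs_def] by simp
      then have e: "l (Xm z0) z0 *\<^sub>R frechet_derivative (mgrad F) (at (Xm z0)) v + t *\<^sub>R mgrad F (Xm z0) + (s (Xm z0) z0 *\<^sub>R v + u *\<^sub>R Xm z0) = 0"
        "frechet_derivative F (at (Xm z0)) v = 0" "mink v (Xm z0) = 0"
        unfolding zero_prod_def by (auto simp: mink_commute[of "Xm z0" v])
      have curv: "\<And>\<kappa>. principal_curvature K (Xm z0) \<kappa> \<Longrightarrow> \<kappa> > 1" using \<delta>(2)[OF Xm(2)[OF z0]] \<delta>(1) by fastforce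
      show ?thesis
        using lagrange_map_injective[OF c(2) bX Xm(2)[OF z0] z0 XmU curv e(1)[unfolded s_def l_def] e(2,3)]
        unfolding h by (simp add: zero_prod_def)
    qed
    obtain T V \<Theta> where T: "open T" "T \<subseteq> U \<times> UNIV" "p0 \<in> T" "open V" "\<Psi> p0 \<in> V"
      and hom: "homeomorphism T V \<Psi> \<Theta>" and s\<Theta>: "smoothv_on V \<Theta>"
      by (rule smooth_inverse_function[OF oU(1) sm\<Psi> p0U inj]) (assumption, (rule that; assumption))
    have "continuous_on (U \<times> UNIV) P"
    proof -
      have n: "continuous_on U (\<lambda>X. mink (nrm F X) (nrm F X))" "continuous_on U (\<lambda>X. mink (mgrad F X) X)"
        by (intro smooth_on_imp_continuous_on smooth_on_mink smoothv_on_nrm smoothv_on_mgrad smoothv_on_id open_U smooth_F)+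
      have n': "continuous_on (U \<times> (UNIV :: (real ^ 'm) set)) (\<lambda>q. mink (nrm F (fst q)) (nrm F (fst q)))"
        "continuous_on (U \<times> (UNIV :: (real ^ 'm) set)) (\<lambda>q. mink (mgrad F (fst q)) (fst q))"
        by (rule continuous_on_compose2[OF n(1) continuous_on_fst[OF continuous_on_id]], force,
            rule continuous_on_compose2[OF n(2) continuous_on_fst[OF continuous_on_id]], force)
      show ?thesis unfolding P_def s_def l_def
        using regular by (intro continuous_intros n') force+
    qed
    \<comment> \<open>The inverse only sees triples in \<open>T\<close>; continuity of
      \<open>P\<close> together with \<open>near\<close> keeps the completed contact points in
      \<open>T\<close> for directions close to \<open>z0\<close>.\<close>
    then have "open (P -` T \<inter> (U \<times> UNIV))" using continuous_on_open_vimage[OF oU(2)] T(1) by blast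
    moreover have "(Xm z0, z0) \<in> P -` T \<inter> (U \<times> UNIV)" using T(3) c(2) by (simp add: p0_def)
    ultimately obtain A A' where A: "open A" "open A'" "Xm z0 \<in> A" "z0 \<in> A'" "A \<times> A' \<subseteq> P -` T \<inter> (U \<times> UNIV)"
      by (rule open_prod_elim) auto
    obtain r where r: "r > 0" "\<And>z. norm z = 1 \<Longrightarrow> dist z z0 < r \<Longrightarrow> Xm z \<in> A" using near[OF z0 A(1,3)] by blast
    define W where "W = sgn -` (A' \<inter> ball z0 r) \<inter> - {0}"
    have oW: "open W" unfolding W_def
      using continuous_on_open_vimage[of "- {0}" sgn] smoothv_on_imp_continuous_on[OF smoothv_on_sgn] A(2)
      by (metis open_Compl closed_singleton open_Int open_ball)
    have wW: "w0 \<in> W" unfolding W_def using w0 A(4) r(1) by (simp add: z0_def)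
    define q where "q w = (- (sgn w, 1 :: real), 0 :: real, - 1 :: real)" for w :: "real ^ 'm"
    have W: "P (Xm (sgn w), sgn w) \<in> T" "\<Psi> (P (Xm (sgn w), sgn w)) = q w" "norm (sgn w) = 1" if "w \<in> W" for w
    proof -
      have w: "sgn w \<in> A'" "dist (sgn w) z0 < r" "w \<noteq> 0" using that by (auto simp: W_def dist_commute)
      show n: "norm (sgn w) = 1" using w(3) by (simp add: norm_sgn)
      have XA: "Xm (sgn w) \<in> A" using r(2)[OF n w(2)] .
      then show "P (Xm (sgn w), sgn w) \<in> T" using A(5) w(1) by blast
      have XU: "Xm (sgn w) \<in> U" using A(5) w(1) XA by blast
      show "\<Psi> (P (Xm (sgn w), sgn w)) = q w"
        unfolding q_def by (rule \<Psi>P[OF XU Xm(2)[OF n] n Xm(4)[OF n c(1) XU]])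
    qed
    have qV: "q w \<in> V" and \<Theta>q: "fst (\<Theta> (q w)) = Xm (sgn w)" if "w \<in> W" for w
    proof -
      show "q w \<in> V" using W[OF that] hom unfolding homeomorphism_def by (metis imageI)
      have "\<Theta> (q w) = P (Xm (sgn w), sgn w)" using W[OF that] hom unfolding homeomorphism_def by metis
      then show "fst (\<Theta> (q w)) = Xm (sgn w)" by (simp add: P_def)
    qed
    have ssgn: "smoothv_on W sgn" by (rule smoothv_on_subset[OF smoothv_on_sgn]) (simp add: W_def)
    have "smoothv_on W (\<lambda>w. (- 1) *\<^sub>R (sgn w, 1 :: real))"
      by (intro smoothv_on_scaleR smoothv_on_Pair ssgn oW smooth_on_const smoothv_on_const)
    then have sq: "smoothv_on W q" unfolding q_def
      by (intro smoothv_on_Pair smoothv_on_const oW) simp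
    have sX: "smoothv_on W (\<lambda>w. fst (\<Theta> (q w)))"
      by (rule smoothv_on_fst[OF smoothv_on_compose[OF oW T(4) s\<Theta> sq]]) (use qV in auto)
    have "smooth_on W (\<lambda>w. snd (fst (\<Theta> (q w))) - fst (fst (\<Theta> (q w))) \<bullet> sgn w)"
      by (intro smooth_on_diff smooth_on_inner smoothv_on_fst[OF sX] ssgn oW
          smoothv_on_real[OF oW, THEN iffD1] smoothv_on_snd[OF sX])
    then have "smooth_on W (\<lambda>w. ph (sgn w))"
      by (rule smooth_on_cong[OF oW]) (simp add: ph W \<Theta>q horo_def)
    then show "\<exists>V. open V \<and> w0 \<in> V \<and> smooth_on V (\<lambda>w. ph (sgn w))" using oW wW by blast
  qed
  then show "smooth_sphere (\<lambda>z. exp (horo_support K z))" by (simp add: smooth_sphere_def ph_def)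
qed

section \<open>Gradients and contact points\<close>

lemma sgn_unit: "norm z = 1 \<Longrightarrow> sgn z = (z :: 'a::real_normed_vector)"
  by (simp add: sgn_div_norm)

text \<open>For smooth \<phi>, the Euclidean gradient of the extension constant along rays. At unit
  vectors it is therefore tangential and coincides with the spherical gradient.\<close>

definition sgrad :: "(real ^ 'm::finite \<Rightarrow> real) \<Rightarrow> real ^ 'm \<Rightarrow> real ^ 'm" where
  "sgrad \<phi> w = (\<Sum>b\<in>Basis. frechet_derivative (\<lambda>w. \<phi> (sgn w)) (at w) b *\<^sub>R b)"

lemma smooth_sphere_derivative:
  assumes "smooth_sphere \<phi>" "w \<noteq> 0"
  shows "((\<lambda>w. \<phi> (sgn w)) has_derivative (\<lambda>h. sgrad \<phi> w \<bullet> h)) (at w)"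
proof -
  have d: "((\<lambda>w. \<phi> (sgn w)) has_derivative frechet_derivative (\<lambda>w. \<phi> (sgn w)) (at w)) (at w)"
    using smooth_on_has_derivative assms unfolding smooth_sphere_def by blast
  have "frechet_derivative (\<lambda>w. \<phi> (sgn w)) (at w) h = sgrad \<phi> w \<bullet> h" for h
    using has_derivative_linear_expand[OF has_derivative_linear[OF d], of h]
    unfolding sgrad_def inner_sum_left by (simp add: inner_commute[of _ h] mult.commute)
  then show ?thesis using d by presburger
qed

lemma smoothv_on_sgrad: "smooth_sphere \<phi> \<Longrightarrow> smoothv_on (- {0}) (sgrad \<phi>)"
  unfolding sgrad_def smooth_sphere_def
  by (rule smoothv_onI_Basis) (auto simp: inner_sum_left intro!: smooth_on_sum smooth_on_mult smooth_on_const smooth_on_frechet_derivative)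

lemma sphere_gradient:
  assumes "smooth_sphere \<phi>" "norm z = 1"
  shows "has_sphere_gradient \<phi> (sgrad \<phi> z) z"
  unfolding has_sphere_gradient_def
proof
  have z0: "z \<noteq> 0" using assms by auto
  note d = smooth_sphere_derivative[OF assms(1) z0]
  show "(\<phi> has_derivative (\<lambda>h. sgrad \<phi> z \<bullet> h)) (at z within sphere 0 1)"
    by (rule has_derivative_transform_within[OF has_derivative_at_withinI[OF d] zero_less_one])
       (use assms in \<open>auto simp: sgn_unit\<close>)
  have "((\<lambda>t::real. z + t *\<^sub>R z) has_derivative (\<lambda>t. t *\<^sub>R z)) (at 0)" by (auto intro!: derivative_eq_intros)
  from diff_chain_at[OF this, of "\<lambda>w. \<phi> (sgn w)" "\<lambda>h. sgrad \<phi> z \<bullet> h"] d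
  have "((\<lambda>t::real. \<phi> (sgn (z + t *\<^sub>R z))) has_derivative (\<lambda>t. sgrad \<phi> z \<bullet> (t *\<^sub>R z))) (at 0)" by (simp add: o_def)
  moreover have "((\<lambda>t::real. \<phi> (sgn (z + t *\<^sub>R z))) has_derivative (\<lambda>t. 0)) (at 0)"
  proof (rule has_derivative_transform_within_open[OF has_derivative_const[of "\<phi> z"], where s = "{-1<..}"])
    fix t :: real assume t: "t \<in> {-1<..}"
    have "sgn (z + t *\<^sub>R z) = sgn ((1 + t) *\<^sub>R z)" by (simp add: algebra_simps)
    also have "\<dots> = z" using t assms(2) by (simp add: sgn_scaleR sgn_unit)
    finally show "\<phi> z = \<phi> (sgn (z + t *\<^sub>R z))" by simp
  qed auto
  ultimately have "(\<lambda>t. sgrad \<phi> z \<bullet> (t *\<^sub>R z)) = (\<lambda>t. 0)" by (rule has_derivative_unique)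
  then show "sgrad \<phi> z \<bullet> z = 0" by (metis scaleR_one)
qed

lemma smooth_sphere_horo: "smooth_sphere (horo X)"
  unfolding smooth_sphere_def horo_def
  by (intro smooth_on_diff smooth_on_inner smooth_on_const smoothv_on_const smoothv_on_sgn) auto

lemma sphere_gradient_unique:
  fixes \<phi> :: "real ^ 'm::finite \<Rightarrow> real"
  assumes z: "norm z = 1" and g: "has_sphere_gradient \<phi> g z" and \<phi>: "smooth_sphere \<phi>"
  shows "g = sgrad \<phi> z"
proof -
  have z0: "z \<noteq> 0" using z by auto
  have ds: "(sgn has_derivative frechet_derivative sgn (at z)) (at z)"
    using smoothv_on_has_derivative[OF smoothv_on_sgn] z0 by blast
  have "(sgn has_derivative frechet_derivative sgn (at z)) (at z within - {0})"
    using ds has_derivative_at_withinI by blast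
  moreover have "sgn ` (- {0}) \<subseteq> sphere (0 :: real ^ 'm) 1" by (auto simp: norm_sgn split: if_splits)
  then have "(\<phi> has_derivative (\<lambda>h. g \<bullet> h)) (at (sgn z) within sgn ` (- {0}))"
    using has_derivative_subset[OF conjunct2[OF g[unfolded has_sphere_gradient_def]]] sgn_unit[OF z] by simp
  ultimately have dw: "((\<lambda>w. \<phi> (sgn w)) has_derivative (\<lambda>h. g \<bullet> frechet_derivative sgn (at z) h)) (at z within - {0})"
    using diff_chain_within[of sgn _ z "- {0}" \<phi>] by (simp add: o_def)
  then have "((\<lambda>w. \<phi> (sgn w)) has_derivative (\<lambda>h. g \<bullet> frechet_derivative sgn (at z) h)) (at z)"
  proof -
    have "at z within - {0} = at z" using z0 by (intro at_within_open) auto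
    then show ?thesis using dw by simp
  qed
  then have 1: "(\<lambda>h. g \<bullet> frechet_derivative sgn (at z) h) = (\<lambda>h. sgrad \<phi> z \<bullet> h)"
    using smooth_sphere_derivative[OF \<phi> z0] has_derivative_unique by blast
  have dsgn: "frechet_derivative sgn (at z) h = h - (z \<bullet> h) *\<^sub>R z" for h
  proof -
    have dn: "(norm has_derivative (\<lambda>h. z \<bullet> h)) (at z)"
      using has_derivative_norm[OF z0] by (simp add: sgn_unit[OF z] inner_commute)
    have "norm z \<noteq> 0" using z by simp
    from has_derivative_scaleR[OF Deriv.has_derivative_inverse[OF this dn] has_derivative_ident]
    have "(sgn has_derivative (\<lambda>h. h - (z \<bullet> h) *\<^sub>R z)) (at z)"
      using z by (simp add: sgn_div_norm[abs_def])
    then show ?thesis using frechet_derivative_at by metis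
  qed
  have "g \<bullet> h = sgrad \<phi> z \<bullet> h" for h
  proof -
    have "g \<bullet> z = 0" using g by (simp add: has_sphere_gradient_def)
    then have "g \<bullet> frechet_derivative sgn (at z) h = g \<bullet> h" by (simp add: dsgn inner_diff_right)
    then show ?thesis using 1 by metis
  qed
  then show ?thesis by (metis vector_eq_rdot)
qed

text \<open>The parametrisation in the boundary formula, extended off the sphere so that it can be
  differentiated on an open set.\<close>

definition contact_point :: "(real ^ 'm::finite \<Rightarrow> real) \<Rightarrow> real ^ 'm \<Rightarrow> 'm minkowski" where
  "contact_point \<phi> w = (\<phi> (sgn w) / 2) *\<^sub>R (- sgn w, 1)
     + (((norm (sgrad \<phi> w))\<^sup>2 / \<phi> (sgn w) + 1 / \<phi> (sgn w)) / 2) *\<^sub>R (sgn w, 1) - (sgrad \<phi> w, 0)"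

lemma sgrad_horo:
  assumes z: "norm z = 1"
  shows "sgrad (horo X) z = (fst X \<bullet> z) *\<^sub>R z - fst X"
proof -
  have "z \<bullet> z = 1" using z by (simp add: dot_square_norm)
  then have o: "((fst X \<bullet> z) *\<^sub>R z - fst X) \<bullet> z = 0" by (simp add: inner_diff_left)
  have "(horo X has_derivative (\<lambda>h. ((fst X \<bullet> z) *\<^sub>R z - fst X) \<bullet> h)) (at z within sphere 0 1)"
  proof -
    \<comment> \<open>The added multiple of \<open>1 - w \<bullet> w\<close> vanishes on the sphere
      and removes the radial part of the derivative.\<close>
    have "((\<lambda>w. horo X w - (fst X \<bullet> z) / 2 * (1 - w \<bullet> w)) has_derivative
        (\<lambda>h. - (fst X \<bullet> h) - (fst X \<bullet> z) / 2 * (0 - (z \<bullet> h + h \<bullet> z)))) (at z within sphere 0 1)"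
      unfolding horo_def[abs_def] by (rule derivative_eq_intros refl | simp)+
    moreover have "(\<lambda>h. - (fst X \<bullet> h) - (fst X \<bullet> z) / 2 * (0 - (z \<bullet> h + h \<bullet> z))) = (\<lambda>h. ((fst X \<bullet> z) *\<^sub>R z - fst X) \<bullet> h)"
      by (auto simp: fun_eq_iff inner_diff_left inner_commute[of _ z])
    ultimately have "((\<lambda>w. horo X w - (fst X \<bullet> z) / 2 * (1 - w \<bullet> w)) has_derivative (\<lambda>h. ((fst X \<bullet> z) *\<^sub>R z - fst X) \<bullet> h)) (at z within sphere 0 1)"
      by simp
    then show ?thesis
      by (rule has_derivative_transform_within[OF _ zero_less_one]) (use z in \<open>auto simp: dot_square_norm\<close>)
  qed
  with o have "has_sphere_gradient (horo X) ((fst X \<bullet> z) *\<^sub>R z - fst X) z"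
    unfolding has_sphere_gradient_def by (rule conjI)
  then show ?thesis using sphere_gradient_unique[OF z _ smooth_sphere_horo] by metis
qed

text \<open>The formula inverts the passage from a point to its horospherical function. As it uses
  only value and gradient at \<open>z\<close>, every smooth \<phi> that touches
  \<open>horo X\<close> from above at \<open>z\<close> gives the same point; this is the boundary
  formula.\<close>

lemma contact_point_horo:
  assumes X: "X \<in> hyp_space" and z: "norm z = 1"
  shows "contact_point (horo X) z = X"
proof -
  define d where "d = fst X \<bullet> z"
  define f where "f = horo X z"
  have f: "f > 0" unfolding f_def using horo_pos X z by blast
  have fd: "f = snd X - d" by (simp add: f_def d_def horo_def)
  have zz: "z \<bullet> z = 1" using z by (simp add: dot_square_norm)
  have xx: "fst X \<bullet> fst X = (snd X)\<^sup>2 - 1"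
    using hyp_spaceD(1)[OF X] by (simp add: mink_eq power2_eq_square)
  have "(norm (sgrad (horo X) z))\<^sup>2 = fst X \<bullet> fst X - d\<^sup>2"
    unfolding sgrad_horo[OF z] power2_norm_eq_inner
    by (simp add: inner_diff_left inner_diff_right zz inner_commute d_def power2_eq_square)
  then have "(norm (sgrad (horo X) z))\<^sup>2 + 1 = (snd X - d) * (snd X + d)"
    unfolding xx by (simp add: power2_eq_square algebra_simps)
  then have c: "(norm (sgrad (horo X) z))\<^sup>2 / f + 1 / f = snd X + d"
    using f by (simp add: fd field_simps)
  have "contact_point (horo X) z = (f / 2) *\<^sub>R (- z, 1) + ((snd X + d) / 2) *\<^sub>R (z, 1) - (d *\<^sub>R z - fst X, 0)"
    unfolding contact_point_def sgn_unit[OF z] f_def[symmetric] c unfolding sgrad_horo[OF z] d_def ..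
  also have "\<dots> = (((snd X + d) / 2 - f / 2 - d) *\<^sub>R z + fst X, f / 2 + (snd X + d) / 2)"
    by (simp add: algebra_simps)
  also have "\<dots> = X" by (simp add: fd field_simps)
  finally show ?thesis .
qed

lemma smoothv_on_contact_point:
  assumes "smooth_sphere \<phi>" "\<And>z. norm z = 1 \<Longrightarrow> \<phi> z > 0"
  shows "smoothv_on (- {0}) (contact_point \<phi>)"
proof -
  have \<phi>: "smooth_on (- {0}) (\<lambda>w. \<phi> (sgn w))" using assms(1) by (simp add: smooth_sphere_def)
  have pos: "\<phi> (sgn w) > 0" if "w \<in> - {0}" for w using assms(2) that by (simp add: norm_sgn)
  have inv: "smooth_on (- {0}) (\<lambda>w. 1 / \<phi> (sgn w))" by (intro smooth_on_inverse \<phi>) (use pos in auto)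
  note g = smoothv_on_sgrad[OF assms(1)]
  have "smoothv_on (- {0}) (\<lambda>w. (1 / 2 * \<phi> (sgn w)) *\<^sub>R ((- 1) *\<^sub>R sgn w, 1 :: real)
     + (1 / 2 * ((sgrad \<phi> w \<bullet> sgrad \<phi> w) * (1 / \<phi> (sgn w)) + 1 / \<phi> (sgn w))) *\<^sub>R (sgn w, 1) - (sgrad \<phi> w, 0 :: real))"
    by (intro smoothv_on_diff smoothv_on_add smoothv_on_scaleR smoothv_on_Pair smooth_on_mult smooth_on_add
        smooth_on_inner smooth_on_const smoothv_on_const smoothv_on_sgn \<phi> inv g) auto
  then show ?thesis
    unfolding contact_point_def[abs_def] power2_norm_eq_inner by simp
qed

lemma contact_gradient:
  assumes z: "norm z = 1" and \<phi>: "smooth_sphere \<phi>" and \<psi>: "smooth_sphere \<psi>"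
    and le: "\<And>z. norm z = 1 \<Longrightarrow> \<psi> z \<le> \<phi> z" and eq: "\<psi> z = \<phi> z"
  shows "sgrad \<psi> z = sgrad \<phi> z"
proof -
  have z0: "z \<noteq> 0" using z by auto
  have d: "((\<lambda>w. \<phi> (sgn w) - \<psi> (sgn w)) has_derivative (\<lambda>h. sgrad \<phi> z \<bullet> h - sgrad \<psi> z \<bullet> h)) (at z)"
    by (intro has_derivative_diff smooth_sphere_derivative \<phi> \<psi> z0)
  have "(\<lambda>h. sgrad \<phi> z \<bullet> h - sgrad \<psi> z \<bullet> h) = (\<lambda>h. 0)"
  proof (rule differential_zero_maxmin[OF _ _ d])
    show "z \<in> - {0}" using z0 by simp
    show "(\<forall>y\<in>- {0}. \<phi> (sgn y) - \<psi> (sgn y) \<le> \<phi> (sgn z) - \<psi> (sgn z)) \<or> (\<forall>y\<in>- {0}. \<phi> (sgn z) - \<psi> (sgn z) \<le> \<phi> (sgn y) - \<psi> (sgn y))"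
      using le eq by (auto simp: sgn_unit[OF z] norm_sgn)
  qed auto
  then have "sgrad \<phi> z \<bullet> h = sgrad \<psi> z \<bullet> h" for h by (metis eq_iff_diff_eq_0)
  then show ?thesis by (metis vector_eq_rdot)
qed

lemma contact_point_eq:
  assumes z: "norm z = 1" and \<phi>: "smooth_sphere \<phi>" and X: "X \<in> horo_hull \<phi>" and eq: "horo X z = \<phi> z"
  shows "X = contact_point \<phi> z"
proof -
  have Xh: "X \<in> hyp_space" "\<And>z. norm z = 1 \<Longrightarrow> horo X z \<le> \<phi> z" using X by (auto simp: horo_hull_def)
  have "sgrad (horo X) z = sgrad \<phi> z"
    by (rule contact_gradient[OF z \<phi> smooth_sphere_horo Xh(2) eq])
  then have "contact_point (horo X) z = contact_point \<phi> z"
    unfolding contact_point_def sgn_unit[OF z] eq by simp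
  then show ?thesis using contact_point_horo[OF Xh(1) z] by simp
qed

lemma continuous_on_smooth_sphere:
  assumes "smooth_sphere \<phi>"
  shows "continuous_on (sphere 0 1) \<phi>"
proof -
  have "continuous_on (sphere 0 1) (\<lambda>w. \<phi> (sgn w))"
    by (rule continuous_on_subset[OF smooth_on_imp_continuous_on]) (use assms in \<open>auto simp: smooth_sphere_def\<close>)
  then show ?thesis by (rule continuous_on_cong[THEN iffD1, rotated -1]) (auto simp: sgn_unit)
qed

lemma horo_norm_le: "norm z = 1 \<Longrightarrow> \<bar>horo v z\<bar> \<le> 2 * norm v"
proof -
  assume z: "norm z = 1"
  have "norm (fst v) \<le> norm v" "norm (snd v) \<le> norm v"
    by (metis norm_fst_le prod.collapse, metis norm_snd_le prod.collapse)
  then show ?thesis using inner_le_norm_unit[OF z, of "fst v"] by (simp add: horo_def)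
qed

section \<open>Interior, boundary and connectedness of the horospherical hull\<close>

lemma horo_hull_interior:
  assumes "X \<in> hyp_space" "\<epsilon> > 0" "\<And>z. norm z = 1 \<Longrightarrow> horo X z + \<epsilon> \<le> \<phi> z"
  shows "ball X (\<epsilon> / 2) \<inter> hyp_space \<subseteq> horo_hull \<phi>"
proof
  fix Y assume Y: "Y \<in> ball X (\<epsilon> / 2) \<inter> hyp_space"
  have "horo Y z \<le> \<phi> z" if z: "norm z = 1" for z
  proof -
    have "horo Y z = horo X z + horo (Y - X) z" by simp
    also have "\<dots> \<le> horo X z + 2 * norm (Y - X)" using horo_norm_le[OF z, of "Y - X"] by (simp del: horo_simps)
    also have "\<dots> \<le> horo X z + \<epsilon>" using Y by (simp add: dist_norm norm_minus_commute)
    finally show ?thesis using assms(3)[OF z] by simp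
  qed
  then show "Y \<in> horo_hull \<phi>" using Y by (simp add: horo_hull_def)
qed

text \<open>Without contact, compactness of the sphere would leave a positive margin below \<phi>,
  and a neighbourhood of \<open>X\<close> would lie in the hull.\<close>

lemma boundary_contact:
  fixes \<phi> :: "real ^ 'm::finite \<Rightarrow> real"
  assumes \<phi>: "continuous_on (sphere 0 1) \<phi>" and X: "X \<in> hyp_boundary (horo_hull \<phi>)"
  obtains z where "norm z = 1" "X \<in> horo_hull \<phi>" "horo X z = \<phi> z"
proof -
  have Xh: "X \<in> hyp_space" using X by (simp add: hyp_boundary_iff)
  have XO: "X \<in> horo_hull \<phi>"
  proof (rule ccontr)
    assume "X \<notin> horo_hull \<phi>"
    then have "X \<in> - horo_hull \<phi>" "open (- horo_hull \<phi>)" using closed_horo_hull by auto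
    then show False using X unfolding hyp_boundary_iff by blast
  qed
  obtain u :: "real ^ 'm" where u: "norm u = 1" using vector_choose_size[of 1] by auto
  have "\<exists>z\<in>sphere 0 1. \<forall>y\<in>sphere 0 1. \<phi> z - horo X z \<le> \<phi> y - horo X y"
    using u by (intro continuous_attains_inf continuous_intros \<phi>) auto
  then obtain z where z: "norm z = 1" "\<And>y. norm y = 1 \<Longrightarrow> \<phi> z - horo X z \<le> \<phi> y - horo X y" by auto
  have "\<not> \<phi> z - horo X z > 0"
  proof
    assume p: "\<phi> z - horo X z > 0"
    have "ball X ((\<phi> z - horo X z) / 2) \<inter> hyp_space \<subseteq> horo_hull \<phi>"
      by (rule horo_hull_interior[OF Xh p]) (use z in force)
    moreover have "open (ball X ((\<phi> z - horo X z) / 2)) \<and> X \<in> ball X ((\<phi> z - horo X z) / 2)" using p by simp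
    then obtain Y where "Y \<in> ball X ((\<phi> z - horo X z) / 2) \<inter> hyp_space" "Y \<notin> horo_hull \<phi>"
      using X unfolding hyp_boundary_iff by blast
    ultimately show False by blast
  qed
  moreover have "horo X z \<le> \<phi> z" using XO z(1) by (simp add: horo_hull_def)
  ultimately show ?thesis using that z(1) XO by simp
qed

text \<open>The renormalised chord runs along a geodesic. Since \<open>mink W W \<le> -1\<close>,
  renormalising can only decrease the values of \<open>horo\<close>; hence hulls are geodesically
  convex.\<close>

lemma hyp_segment:
  assumes X: "X \<in> hyp_space" "Y \<in> hyp_space" and t: "0 \<le> t" "t \<le> 1"
  defines "W \<equiv> (1 - t) *\<^sub>R X + t *\<^sub>R Y"
  shows "mink W W \<le> -1" "(1 / sqrt (- mink W W)) *\<^sub>R W \<in> hyp_space"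
    "norm z = 1 \<Longrightarrow> horo ((1 / sqrt (- mink W W)) *\<^sub>R W) z \<le> (1 - t) * horo X z + t * horo Y z"
proof -
  have "mink W W = - (1 - t)\<^sup>2 - t\<^sup>2 + 2 * t * (1 - t) * mink X Y"
    unfolding W_def using hyp_spaceD(1)[OF X(1)] hyp_spaceD(1)[OF X(2)]
    by (simp add: mink_commute[of Y X] power2_eq_square algebra_simps)
  moreover have "2 * t * (1 - t) * mink X Y \<le> 2 * t * (1 - t) * (-1)"
    using hyp_mink_le[OF X] t by (intro mult_left_mono) auto
  moreover have "- (1 - t)\<^sup>2 - t\<^sup>2 + 2 * t * (1 - t) * (-1) = -1" by (simp add: power2_eq_square algebra_simps)
  ultimately show 1: "mink W W \<le> -1" by linarith
  have "snd W > 0"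
  proof -
    have "snd W = (1 - t) * snd X + t * snd Y" by (simp add: W_def)
    then show ?thesis using hyp_spaceD(2)[OF X(1)] hyp_spaceD(2)[OF X(2)] t
      by (cases "t = 0") (auto intro: add_nonneg_pos)
  qed
  then show "(1 / sqrt (- mink W W)) *\<^sub>R W \<in> hyp_space" using timelike_normalise[of W] 1 by simp
  show "horo ((1 / sqrt (- mink W W)) *\<^sub>R W) z \<le> (1 - t) * horo X z + t * horo Y z" if z: "norm z = 1"
  proof -
    have "horo W z \<ge> 0" unfolding W_def using horo_pos[OF X(1) z] horo_pos[OF X(2) z] t by simp
    moreover have "sqrt (- mink W W) \<ge> 1" using 1 by simp
    ultimately have "horo W z / sqrt (- mink W W) \<le> horo W z" by (simp add: divide_le_eq mult_le_cancel_left1)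
    then show ?thesis by (simp add: W_def)
  qed
qed

lemma connected_horo_hull: "connected (horo_hull \<phi>)"
  unfolding connected_iff_connected_component
proof (intro ballI)
  fix X Y assume XY: "X \<in> horo_hull \<phi>" "Y \<in> horo_hull \<phi>"
  then have h: "X \<in> hyp_space" "Y \<in> hyp_space" "\<And>z. norm z = 1 \<Longrightarrow> horo X z \<le> \<phi> z" "\<And>z. norm z = 1 \<Longrightarrow> horo Y z \<le> \<phi> z"
    by (auto simp: horo_hull_def)
  define W where "W t = (1 - t) *\<^sub>R X + t *\<^sub>R Y" for t
  define \<gamma> where "\<gamma> t = (1 / sqrt (- mink (W t) (W t))) *\<^sub>R W t" for t
  note seg = hyp_segment[OF h(1,2), folded W_def, folded \<gamma>_def]
  have "continuous_on {0..1} \<gamma>"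
  proof -
    have "- mink (W t) (W t) \<noteq> 0" if "t \<in> {0..1}" for t using seg(1)[of t] that by auto
    then show ?thesis unfolding \<gamma>_def W_def by (intro continuous_intros) auto
  qed
  then have "connected (\<gamma> ` {0..1})" by (intro connected_continuous_image) auto
  moreover have "\<gamma> t \<in> horo_hull \<phi>" if t: "t \<in> {0..1}" for t
  proof -
    have "horo (\<gamma> t) z \<le> \<phi> z" if z: "norm z = 1" for z
    proof -
      have "horo (\<gamma> t) z \<le> (1 - t) * horo X z + t * horo Y z" using seg(3)[of t z] t z by simp
      also have "\<dots> \<le> (1 - t) * \<phi> z + t * \<phi> z" using t h(3,4)[OF z] by (intro add_mono mult_left_mono) auto
      finally show ?thesis by (simp add: algebra_simps)
    qed
    then show ?thesis using seg(2)[of t] t by (simp add: horo_hull_def)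
  qed
  moreover have "\<gamma> 0 = X" "\<gamma> 1 = Y"
    using hyp_spaceD(1)[OF h(1)] hyp_spaceD(1)[OF h(2)] by (simp_all add: \<gamma>_def W_def)
  ultimately show "connected_component (horo_hull \<phi>) X Y"
    unfolding connected_component_def by (intro exI[of _ "\<gamma> ` {0..1}"]) (auto simp: image_iff intro: bexI[of _ 0] bexI[of _ 1])
qed

text \<open>The normalised midpoint of the contact points for opposite directions \<open>u\<close>
  and \<open>- u\<close> inherits half of each gap. The squared distances of \<open>z\<close> from
  \<open>u\<close> and \<open>- u\<close> add up to 4, so the midpoint has the margin
  \<open>2 * c\<close> for every \<open>z\<close>.\<close>

lemma supported_interior:
  fixes \<phi> :: "real ^ 'm::finite \<Rightarrow> real"
  assumes "supported c \<phi>" "c > 0"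
  shows "hyp_interior (horo_hull \<phi>) \<noteq> {}" "\<not> is_point (horo_hull \<phi>)"
proof -
  obtain u :: "real ^ 'm" where u: "norm u = 1" using vector_choose_size[of 1] by auto
  have u': "norm (- u) = 1" using u by simp
  obtain X1 where X1: "X1 \<in> horo_hull \<phi>" "horo X1 u = \<phi> u" "\<And>z. norm z = 1 \<Longrightarrow> \<phi> z \<ge> horo X1 z + c * (norm (z - u))\<^sup>2"
    using supportedE[OF assms(1) less_imp_le[OF assms(2)] u] by blast
  obtain X2 where X2: "X2 \<in> horo_hull \<phi>" "\<And>z. norm z = 1 \<Longrightarrow> \<phi> z \<ge> horo X2 z + c * (norm (z - - u))\<^sup>2"
    using supportedE[OF assms(1) less_imp_le[OF assms(2)] u'] by blast
  have h: "X1 \<in> hyp_space" "X2 \<in> hyp_space" using X1 X2 by (auto simp: horo_hull_def)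
  define W where "W = (1 - 1 / 2) *\<^sub>R X1 + (1 / 2 :: real) *\<^sub>R X2"
  define M where "M = (1 / sqrt (- mink W W)) *\<^sub>R W"
  have M: "M \<in> hyp_space" "\<And>z. norm z = 1 \<Longrightarrow> horo M z \<le> (1 - 1 / 2) * horo X1 z + 1 / 2 * horo X2 z"
    using hyp_segment(2,3)[OF h, of "1 / 2"] unfolding M_def W_def by auto
  have gap: "horo M z + 2 * c \<le> \<phi> z" if z: "norm z = 1" for z
  proof -
    have "(norm (z - u))\<^sup>2 + (norm (z - - u))\<^sup>2 = 4"
      using unit_inner_diff[OF z u] unit_inner_diff[OF z u'] by simp
    then have "c * (norm (z - u))\<^sup>2 + c * (norm (z - - u))\<^sup>2 = 4 * c" by (simp flip: distrib_left)
    then show ?thesis using M(2)[OF z] X1(3)[OF z] X2(2)[OF z] by simp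
  qed
  have sub: "ball M ((2 * c) / 2) \<inter> hyp_space \<subseteq> horo_hull \<phi>"
    by (rule horo_hull_interior[OF M(1) _ gap]) (use assms in simp)
  have "openin (top_of_set hyp_space) (hyp_space \<inter> ball M c)" by (simp add: openin_open_Int)
  then have "M \<in> hyp_interior (horo_hull \<phi>)"
    unfolding hyp_interior_def interior_of_def mem_Collect_eq
    using sub M(1) assms(2) by (intro exI[of _ "hyp_space \<inter> ball M c"]) auto
  then show "hyp_interior (horo_hull \<phi>) \<noteq> {}" by blast
  have MO: "M \<in> horo_hull \<phi>" using sub M(1) assms(2) by auto
  have "M \<noteq> X1" using gap[OF u] X1(2) assms(2) by auto
  then show "\<not> is_point (horo_hull \<phi>)" using MO X1(1) by (auto simp: is_point_def)
qed

section \<open>Regularity of the domain with a given support function\<close>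

text \<open>The value at a nondegenerate maximum in \<open>y\<close> depends smoothly on the
  parameter \<open>x\<close>: the map to \<open>x\<close> and the partial gradient in
  \<open>y\<close> is locally invertible. The conclusion speaks of critical points in
  \<open>T\<close>, so that it applies to maximisers once they are known to be close to
  \<open>y0\<close>.\<close>

lemma smooth_max_value:
  fixes f :: "'a::euclidean_space \<times> 'b::euclidean_space \<Rightarrow> real"
  assumes W: "open W" and f: "smooth_on (UNIV \<times> W) f" and y0: "y0 \<in> W" and c: "c > 0"
    and max: "\<And>y. y \<in> W \<Longrightarrow> f (x0, y) \<le> f (x0, y0) - c * (norm (y - y0))\<^sup>2"
  obtains T V g where "open T" "(x0, y0) \<in> T" "T \<subseteq> UNIV \<times> W" "open V" "x0 \<in> V" "smooth_on V g"
    "\<And>x y. (x, y) \<in> T \<Longrightarrow> (\<And>v. frechet_derivative f (at (x, y)) (0, v) = 0) \<Longrightarrow> x \<in> V \<and> g x = f (x, y)"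
proof -
  let ?D = "\<lambda>p. frechet_derivative f (at p)"
  define G where "G p = (\<Sum>b\<in>Basis. ?D p (0, b) *\<^sub>R b)" for p
  define \<Psi> where "\<Psi> p = (fst p, G p)" for p
  define p0 where "p0 = (x0, y0)"
  have U: "open (UNIV \<times> W)" "p0 \<in> UNIV \<times> W" using W y0 by (auto simp: p0_def intro: open_Times)
  have Ginner: "G p \<bullet> b = ?D p (0, b)" if "b \<in> Basis" for p b
    unfolding G_def inner_sum_left using that by (simp add: inner_Basis if_distrib sum.delta cong: if_cong)
  have sG: "smoothv_on (UNIV \<times> W) G"
    by (rule smoothv_onI_Basis[OF U(1)]) (use Ginner smooth_on_frechet_derivative[OF f] in simp)
  have s\<Psi>: "smoothv_on (UNIV \<times> W) \<Psi>"
    unfolding \<Psi>_def by (intro smoothv_on_Pair smoothv_on_fst smoothv_on_id U(1) sG)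
  have crit: "?D p0 (0, v) = 0" and neg: "v \<noteq> 0 \<Longrightarrow> hess f p0 (0, v) (0, v) < 0" for v
  proof -
    define w where "w = (0 :: 'a, v)"
    \<comment> \<open>With the gap added back, \<open>h\<close> still has a maximum at 0; hence the
      Hessian of \<open>f\<close> in the direction \<open>v\<close> is at most -2c times the square
      of its length.\<close>
    define h where "h t = f (p0 + t *\<^sub>R w) + c * (t\<^sup>2 * (norm v)\<^sup>2)" for t
    obtain r where r: "r > 0" "ball p0 r \<subseteq> UNIV \<times> W" using U openE by blast
    define \<rho> where "\<rho> = r / (norm v + 1)"
    have \<rho>: "\<rho> > 0" using r(1) by (simp add: \<rho>_def add_nonneg_pos)
    have inW: "p0 + t *\<^sub>R w \<in> UNIV \<times> W" if "\<bar>t\<bar> < \<rho>" for t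
    proof -
      have "norm (t *\<^sub>R w) = \<bar>t\<bar> * norm v" by (simp add: w_def norm_Pair)
      also have "\<dots> \<le> \<bar>t\<bar> * (norm v + 1)" by (intro mult_left_mono) auto
      also have "\<dots> < r" using that by (simp add: \<rho>_def pos_less_divide_eq add_nonneg_pos)
      finally have "p0 + t *\<^sub>R w \<in> ball p0 r" by (simp add: dist_norm)
      then show ?thesis using r(2) by blast
    qed
    have dh: "(h has_real_derivative ?D (p0 + t *\<^sub>R w) w + c * (2 * t * (norm v)\<^sup>2)) (at t)" if "\<bar>t\<bar> < \<rho>" for t
      unfolding h_def by (rule derivative_eq_intros smooth_on_line_derivative[OF f inW[OF that]] refl | simp)+
    have hmax: "h t \<le> h 0" if "\<bar>t\<bar> < \<rho>" for t
    proof -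
      have "p0 + t *\<^sub>R w = (x0, y0 + t *\<^sub>R v)" by (simp add: p0_def w_def)
      moreover from this have "y0 + t *\<^sub>R v \<in> W" using inW[OF that] by simp
      from max[OF this] have "f (x0, y0 + t *\<^sub>R v) + c * (t\<^sup>2 * (norm v)\<^sup>2) \<le> f (x0, y0)"
        by (simp add: power_mult_distrib)
      ultimately show ?thesis by (simp add: h_def p0_def)
    qed
    have "?D (p0 + 0 *\<^sub>R w) w + c * (2 * 0 * (norm v)\<^sup>2) = 0"
      by (rule DERIV_local_max[OF dh \<rho>]) (use \<rho> hmax in auto)
    then show cr: "?D p0 (0, v) = 0" by (simp add: w_def flip: zero_prod_def)
    show "hess f p0 (0, v) (0, v) < 0" if v: "v \<noteq> 0"
    proof (rule ccontr)
      assume "\<not> hess f p0 (0, v) (0, v) < 0"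
      then have hs: "hess f p0 w w \<ge> 0" by (simp add: w_def)
      have "((\<lambda>t. ?D (p0 + t *\<^sub>R w) w + c * (2 * t * (norm v)\<^sup>2)) has_real_derivative
          hess f (p0 + 0 *\<^sub>R w) w w + c * (2 * (norm v)\<^sup>2)) (at 0)"
        unfolding hess_def
        by (rule derivative_eq_intros smooth_on_line_derivative[OF smooth_on_frechet_derivative[OF f] inW] refl | use \<rho> in simp)+
      moreover have "hess f (p0 + 0 *\<^sub>R w) w w + c * (2 * (norm v)\<^sup>2) > 0" using hs c v by (simp add: add_nonneg_pos)
      ultimately obtain d where d: "d > 0" "\<And>t. t > 0 \<Longrightarrow> t < d \<Longrightarrow>
          ?D (p0 + 0 *\<^sub>R w) w + c * (2 * 0 * (norm v)\<^sup>2) < ?D (p0 + t *\<^sub>R w) w + c * (2 * t * (norm v)\<^sup>2)"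
        using DERIV_pos_inc_right by (metis (no_types, lifting) add_0)
      define t where "t = min d \<rho> / 2"
      have t: "0 < t" "t < d" "t < \<rho>" using d(1) \<rho> by (auto simp: t_def)
      have "\<exists>\<xi>. 0 < \<xi> \<and> \<xi> < t \<and> h t - h 0 = (t - 0) * (?D (p0 + \<xi> *\<^sub>R w) w + c * (2 * \<xi> * (norm v)\<^sup>2))"
        by (rule MVT2[OF t(1)]) (use dh t(3) in auto)
      then obtain \<xi> where \<xi>: "0 < \<xi>" "\<xi> < t" "h t - h 0 = t * (?D (p0 + \<xi> *\<^sub>R w) w + c * (2 * \<xi> * (norm v)\<^sup>2))" by auto
      have "?D (p0 + \<xi> *\<^sub>R w) w + c * (2 * \<xi> * (norm v)\<^sup>2) > 0"
        using d(2)[of \<xi>] \<xi>(1,2) t(2) cr by (simp add: w_def flip: zero_prod_def)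
      then have "h t - h 0 > 0" unfolding \<xi>(3) using t(1) by simp
      then show False using hmax[of t] t by simp
    qed
  qed
  \<comment> \<open>The derivative is block triangular, with the identity and the negative definite
    Hessian in \<open>y\<close> on the diagonal.\<close>
  have inj: "q = 0" if q: "frechet_derivative \<Psi> (at p0) q = 0" for q
  proof -
    have d: "(\<Psi> has_derivative frechet_derivative \<Psi> (at p0)) (at p0)" using smoothv_on_has_derivative[OF s\<Psi> U(2)] .
    have "(fst has_derivative (\<lambda>h. fst (frechet_derivative \<Psi> (at p0) h))) (at p0)"
      using has_derivative_fst[OF d] by (simp add: \<Psi>_def)
    then have "(\<lambda>h. fst (frechet_derivative \<Psi> (at p0) h)) = fst"
      using has_derivative_unique bounded_linear_imp_has_derivative[OF bounded_linear_fst] by blast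
    then have "fst q = fst (frechet_derivative \<Psi> (at p0) q)" by (rule fun_cong[symmetric])
    then have q1: "fst q = 0" using q by simp
    have hb: "hess f p0 (0, b) q = 0" if b: "b \<in> Basis" for b
    proof -
      have "((\<lambda>p. snd (\<Psi> p) \<bullet> b) has_derivative (\<lambda>h. snd (frechet_derivative \<Psi> (at p0) h) \<bullet> b)) (at p0)"
        by (intro has_derivative_inner_left has_derivative_snd d)
      then have "((\<lambda>p. ?D p (0, b)) has_derivative (\<lambda>h. snd (frechet_derivative \<Psi> (at p0) h) \<bullet> b)) (at p0)"
        by (simp add: \<Psi>_def Ginner[OF b])
      from frechet_derivative_at[OF this] show ?thesis unfolding hess_def using q by (metis inner_zero_left snd_zero)
    qed
    define v where "v = snd q"
    have qv: "q = (0, v)" using q1 by (simp add: v_def prod_eq_iff)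
    have lin: "linear (hess f p0 (0, v))"
      unfolding hess_def using smooth_on_has_derivative[OF smooth_on_frechet_derivative[OF f] U(2)] has_derivative_linear by blast
    have "hess f p0 (0, v) (0, v) = hess f p0 (0, v) (\<Sum>b\<in>Basis. (v \<bullet> b) *\<^sub>R (0, b))"
    proof -
      have "(\<Sum>b\<in>Basis. (v \<bullet> b) *\<^sub>R (0 :: 'a, b)) = (0, v)"
        by (simp add: prod_eq_iff fst_sum snd_sum euclidean_representation)
      then show ?thesis by simp
    qed
    also have "\<dots> = (\<Sum>b\<in>Basis. (v \<bullet> b) * hess f p0 (0, v) (0, b))"
      by (simp only: linear_sum[OF lin] linear_scale[OF lin] real_scaleR_def)
    also have "\<dots> = 0" using hb hess_commute[OF U(1) f U(2)] qv by (intro sum.neutral) auto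
    finally have "v = 0" using neg[of v] by fastforce
    then show ?thesis using qv by (simp add: zero_prod_def)
  qed
  obtain T V \<Theta> where T: "open T" "T \<subseteq> UNIV \<times> W" "p0 \<in> T" and V: "open V" "\<Psi> p0 \<in> V"
    and hom: "homeomorphism T V \<Psi> \<Theta>" and s\<Theta>: "smoothv_on V \<Theta>"
    by (rule smooth_inverse_function[OF U(1) s\<Psi> U(2)], erule inj) (rule that; assumption)
  have G0: "G p = 0" if "\<And>v. ?D p (0, v) = 0" for p unfolding G_def using that by simp
  define V' where "V' = (\<lambda>x. (x, 0 :: 'b)) -` V"
  define g where "g x = f (\<Theta> (x, 0))" for x
  have V': "open V'" unfolding V'_def by (rule open_vimage[OF V(1)]) (intro continuous_intros)
  have "smooth_on V' g"
    unfolding g_def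
  proof (rule smooth_on_compose[OF V' U(1) f])
    show "smoothv_on V' (\<lambda>x. \<Theta> (x, 0))"
      by (rule smoothv_on_compose[OF V' V(1) s\<Theta>])
         (intro smoothv_on_Pair smoothv_on_id smoothv_on_const V', auto simp: V'_def)
    show "(\<lambda>x. \<Theta> (x, 0)) ` V' \<subseteq> UNIV \<times> W"
      using homeomorphism_image2[OF hom] T(2) by (auto simp: V'_def)
  qed
  moreover have "x \<in> V' \<and> g x = f (x, y)" if "(x, y) \<in> T" "\<And>v. ?D (x, y) (0, v) = 0" for x y
  proof -
    have "\<Psi> (x, y) = (x, 0)" using G0[OF that(2)] by (simp add: \<Psi>_def)
    moreover from this have "\<Theta> (x, 0) = (x, y)" using homeomorphism_apply1[OF hom that(1)] by simp
    moreover have "\<Psi> (x, y) \<in> V" using homeomorphism_image1[OF hom] that(1) by blast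
    ultimately show ?thesis by (simp add: V'_def g_def)
  qed
  moreover have "x0 \<in> V'" using calculation(2)[of x0 y0] T(3) crit by (simp add: p0_def)
  ultimately show ?thesis using that T V' unfolding p0_def by blast
qed

text \<open>Composition with \<open>sgn\<close> is constant along rays, so a gap on the sphere
  leaves the radial direction degenerate; the term \<open>(w \<bullet> w - 1)\<^sup>2\<close>
  supplies the missing control.\<close>

lemma quadratic_gap_sgn:
  fixes w z0 :: "'a::real_inner"
  assumes "norm z0 = 1" "w \<noteq> 0" "c > 0"
  shows "min c 1 / 2 * (norm (w - z0))\<^sup>2 \<le> c * (norm (sgn w - z0))\<^sup>2 + (w \<bullet> w - 1)\<^sup>2"
proof -
  have "w = norm w *\<^sub>R sgn w" using assms(2) by (simp add: sgn_div_norm)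
  then have "w - sgn w = (norm w - 1) *\<^sub>R sgn w" by (metis scaleR_left_diff_distrib scaleR_one)
  then have n: "norm (w - sgn w) = \<bar>norm w - 1\<bar>" using assms(2) by (simp add: norm_sgn)
  have "norm (w - z0) \<le> norm (w - sgn w) + norm (sgn w - z0)"
    using norm_triangle_ineq[of "w - sgn w" "sgn w - z0"] by simp
  then have "(norm (w - z0))\<^sup>2 \<le> (norm (w - sgn w) + norm (sgn w - z0))\<^sup>2" by (intro power_mono) auto
  also have "\<dots> \<le> 2 * (norm (w - sgn w))\<^sup>2 + 2 * (norm (sgn w - z0))\<^sup>2"
    using sum_squares_bound[of "norm (w - sgn w)" "norm (sgn w - z0)"] by (simp add: power2_sum)
  finally have 1: "(norm (w - z0))\<^sup>2 / 2 \<le> (norm w - 1)\<^sup>2 + (norm (sgn w - z0))\<^sup>2" unfolding n by simp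
  have "(w \<bullet> w - 1)\<^sup>2 = (norm w - 1)\<^sup>2 * (norm w + 1)\<^sup>2"
    by (simp add: dot_square_norm power2_eq_square algebra_simps)
  moreover have "(norm w + 1)\<^sup>2 \<ge> 1" by simp
  ultimately have 2: "(norm w - 1)\<^sup>2 \<le> (w \<bullet> w - 1)\<^sup>2" by (simp add: mult_le_cancel_left1)
  have "min c 1 / 2 * (norm (w - z0))\<^sup>2 \<le> min c 1 * ((norm w - 1)\<^sup>2 + (norm (sgn w - z0))\<^sup>2)"
    using mult_left_mono[OF 1, of "min c 1"] assms(3) by simp
  also have "\<dots> \<le> 1 * (norm w - 1)\<^sup>2 + c * (norm (sgn w - z0))\<^sup>2"
    unfolding distrib_left by (intro add_mono mult_right_mono) auto
  finally show ?thesis using 2 by simp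
qed

text \<open>\<open>supported\<close> only asserts that some contact point has the gap; for smooth
  \<phi> the contact point is determined, so each one has it.\<close>

lemma supported_contact:
  assumes \<phi>: "smooth_sphere \<phi>" and c: "supported c \<phi>" "c \<ge> 0"
    and z0: "norm z0 = 1" and X: "X \<in> horo_hull \<phi>" "horo X z0 = \<phi> z0" and z: "norm z = 1"
  shows "horo X z + c * (norm (z - z0))\<^sup>2 \<le> \<phi> z"
proof -
  obtain X' where X': "X' \<in> horo_hull \<phi>" "horo X' z0 = \<phi> z0" "\<And>z. norm z = 1 \<Longrightarrow> \<phi> z \<ge> horo X' z + c * (norm (z - z0))\<^sup>2"
    using supportedE[OF c z0] by blast
  have "X' = X" using contact_point_eq[OF z0 \<phi> X] contact_point_eq[OF z0 \<phi> X'(1,2)] by simp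
  then show ?thesis using X'(3)[OF z] by simp
qed

text \<open>Near a boundary point the hull is the sublevel set of the maximum over unit
  \<open>z\<close> of \<open>horo Y z - \<phi> z\<close>. The gap makes this maximum nondegenerate
  at the contact direction and keeps the maximisers of nearby points close to it. The squared
  penalty in \<open>f\<close> handles the radial direction and vanishes on the sphere.\<close>

lemma smooth_boundary_horo_hull:
  fixes \<phi> :: "real ^ 'm::finite \<Rightarrow> real"
  assumes \<phi>: "smooth_sphere \<phi>" and c: "supported c \<phi>" "c > 0"
  shows "smooth_boundary (horo_hull \<phi>)"
  unfolding smooth_boundary_def
proof
  fix X0 assume b: "X0 \<in> hyp_boundary (horo_hull \<phi>)"
  note cont = continuous_on_smooth_sphere[OF \<phi>]
  obtain z0 where z0: "norm z0 = 1" and X0: "X0 \<in> horo_hull \<phi>" "horo X0 z0 = \<phi> z0" by (rule boundary_contact[OF cont b])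
  have X0h: "X0 \<in> hyp_space" using X0 by (simp add: horo_hull_def)
  note gap = supported_contact[OF \<phi> c(1) less_imp_le[OF c(2)] z0 X0]
  let ?W = "- {0} :: (real ^ 'm) set"
  define f where "f p = horo (fst p) (sgn (snd p)) - \<phi> (sgn (snd p)) - (snd p \<bullet> snd p - 1) * (snd p \<bullet> snd p - 1)"
    for p :: "'m minkowski \<times> (real ^ 'm)"
  have W: "open ?W" "open (UNIV \<times> ?W)" by (auto intro: open_Times)
  have z0W: "z0 \<in> ?W" using z0 by auto
  have s: "smoothv_on (UNIV \<times> ?W) (\<lambda>p. snd p)" "smoothv_on (UNIV \<times> ?W) (\<lambda>p. fst p)"
    by (intro smoothv_on_snd smoothv_on_fst smoothv_on_id W)+
  have sg: "smoothv_on (UNIV \<times> ?W) (\<lambda>p. sgn (snd p))"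
    by (rule smoothv_on_compose[OF W(2,1) smoothv_on_sgn s(1)]) auto
  have sf: "smooth_on (UNIV \<times> ?W) f"
    unfolding f_def horo_def
  proof (intro smooth_on_diff smooth_on_mult smooth_on_inner smooth_on_const W s sg smoothv_on_fst)
    show "smooth_on (UNIV \<times> ?W) (\<lambda>p. snd (fst p))"
      using smoothv_on_snd[OF s(2)] smoothv_on_real[OF W(2)] by blast
    show "smooth_on (UNIV \<times> ?W) (\<lambda>p. \<phi> (sgn (snd p)))"
      by (rule smooth_on_compose[OF W(2,1) \<phi>[unfolded smooth_sphere_def] s(1)]) auto
  qed
  have f_unit: "f (Y, z) = horo Y z - \<phi> z" if "norm z = 1" for Y z
    using that by (simp add: f_def sgn_unit dot_square_norm)
  have f_le: "f (Y, w) \<le> horo Y (sgn w) - \<phi> (sgn w)" for Y w by (simp add: f_def)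
  have "f (X0, w) \<le> f (X0, z0) - min c 1 / 2 * (norm (w - z0))\<^sup>2" if "w \<in> ?W" for w
  proof -
    have w: "w \<noteq> 0" "norm (sgn w) = 1" using that by (auto simp: norm_sgn)
    have "f (X0, z0) = 0" using f_unit[OF z0] X0(2) by simp
    then show ?thesis
      using gap[OF w(2)] quadratic_gap_sgn[OF z0 w(1) c(2)] by (simp add: f_def power2_eq_square)
  qed
  from smooth_max_value[OF W(1) sf z0W _ this] c(2)
  obtain T V g where T: "open T" "(X0, z0) \<in> T" "T \<subseteq> UNIV \<times> ?W" and V: "open V" "X0 \<in> V" "smooth_on V g"
    and g: "\<And>Y z. (Y, z) \<in> T \<Longrightarrow> (\<And>v. frechet_derivative f (at (Y, z)) (0, v) = 0) \<Longrightarrow> Y \<in> V \<and> g Y = f (Y, z)"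
    by (metis (no_types, lifting) half_gt_zero min_less_iff_conj zero_less_one)
  obtain A B where AB: "open A" "open B" "X0 \<in> A" "z0 \<in> B" "A \<times> B \<subseteq> T"
    using T(1,2) by (rule open_prod_elim) (auto simp: mem_Sigma_iff)
  have crit: "frechet_derivative f (at (Y, z)) (0, v) = 0"
    if z: "norm z = 1" and m: "\<And>z'. norm z' = 1 \<Longrightarrow> horo Y z' - \<phi> z' \<le> horo Y z - \<phi> z" for Y z v
  proof -
    have zW: "z \<in> ?W" using z by auto
    have d: "(f has_derivative frechet_derivative f (at (Y, z))) (at (Y, z))"
      using smooth_on_has_derivative[OF sf] zW by blast
    have "((\<lambda>w. (Y, w)) has_derivative (\<lambda>v. (0, v))) (at z)"
      by (intro has_derivative_Pair has_derivative_const has_derivative_ident)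
    from diff_chain_at[OF this d]
    have d': "((\<lambda>w. f (Y, w)) has_derivative (\<lambda>v. frechet_derivative f (at (Y, z)) (0, v))) (at z)" by (simp add: o_def)
    have "(\<lambda>v. frechet_derivative f (at (Y, z)) (0, v)) = (\<lambda>v. 0)"
    proof (rule differential_zero_maxmin[OF zW W(1) d'], rule disjI1, rule ballI)
      fix w assume "w \<in> ?W"
      then have "norm (sgn w) = 1" by (auto simp: norm_sgn)
      then show "f (Y, w) \<le> f (Y, z)" using f_le[of Y w] m[of "sgn w"] f_unit[OF z, of Y] by linarith
    qed
    then show ?thesis by metis
  qed
  have "continuous_on (UNIV \<times> sphere 0 1) (\<lambda>(Y, z). horo Y z - \<phi> z)"
    unfolding split_def by (intro continuous_intros continuous_on_compose2[OF cont]) auto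
  moreover have "horo X0 z - \<phi> z < horo X0 z0 - \<phi> z0" if "z \<in> sphere 0 1" "z \<noteq> z0" for z
  proof -
    have "c * (norm (z - z0))\<^sup>2 > 0" using c(2) that by simp
    then show ?thesis using gap[of z] that(1) X0(2) by auto
  qed
  ultimately obtain r where r: "r > 0" "\<And>Y z. dist Y X0 < r \<Longrightarrow> z \<in> sphere 0 1 \<Longrightarrow>
      (\<forall>z'\<in>sphere 0 1. horo Y z' - \<phi> z' \<le> horo Y z - \<phi> z) \<Longrightarrow> z \<in> B"
    using argmax_neighbourhood[of "sphere 0 1" "\<lambda>Y z. horo Y z - \<phi> z" z0 X0 B] AB(2,4) z0 by auto
  define U where "U = ball X0 r \<inter> A \<inter> V"
  have U: "open U" "X0 \<in> U" using AB V r(1) by (auto simp: U_def)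
  have gmax: "\<exists>z. norm z = 1 \<and> g Y = horo Y z - \<phi> z \<and> (\<forall>z'. norm z' = 1 \<longrightarrow> horo Y z' - \<phi> z' \<le> g Y)" if Y: "Y \<in> U" for Y
  proof -
    have "\<exists>z\<in>sphere 0 1. \<forall>y\<in>sphere 0 1. horo Y y - \<phi> y \<le> horo Y z - \<phi> z"
      using z0 by (intro continuous_attains_sup continuous_intros cont) auto
    then obtain z where z: "z \<in> sphere 0 1" "\<forall>y\<in>sphere 0 1. horo Y y - \<phi> y \<le> horo Y z - \<phi> z" by blast
    have n: "norm z = 1" using z(1) by simp
    have "z \<in> B" using r(2)[of Y z] Y z by (simp add: U_def dist_commute)
    then have "(Y, z) \<in> T" using Y AB(5) by (auto simp: U_def)
    then have "g Y = f (Y, z)" using g crit[OF n] z(2) by simp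
    then show ?thesis using f_unit[OF n] n z(2) by auto
  qed
  have OU: "horo_hull \<phi> \<inter> U = {Y \<in> hyp_space \<inter> U. g Y \<le> 0}"
  proof -
    have "Y \<in> horo_hull \<phi> \<longleftrightarrow> g Y \<le> 0" if Y: "Y \<in> U" "Y \<in> hyp_space" for Y
    proof -
      obtain z where z: "norm z = 1" "g Y = horo Y z - \<phi> z" "\<And>z'. norm z' = 1 \<Longrightarrow> horo Y z' - \<phi> z' \<le> g Y"
        using gmax[OF Y(1)] by blast
      show ?thesis
      proof
        assume "Y \<in> horo_hull \<phi>"
        then show "g Y \<le> 0" using z(1,2) by (simp add: horo_hull_def)
      next
        assume "g Y \<le> 0"
        then have "horo Y z' \<le> \<phi> z'" if "norm z' = 1" for z' using z(3)[OF that] by simp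
        then show "Y \<in> horo_hull \<phi>" using Y by (simp add: horo_hull_def)
      qed
    qed
    then show ?thesis by (auto simp: horo_hull_def)
  qed
  have g0: "g X0 = 0"
  proof -
    obtain z where z: "norm z = 1" "g X0 = horo X0 z - \<phi> z" "\<And>z'. norm z' = 1 \<Longrightarrow> horo X0 z' - \<phi> z' \<le> g X0"
      using gmax[OF U(2)] by blast
    have "horo X0 z \<le> \<phi> z" using X0(1) z(1) by (simp add: horo_hull_def)
    then show ?thesis using z(2) z(3)[OF z0] X0(2) by simp
  qed
  \<comment> \<open>\<open>g Y\<close> dominates \<open>horo Y z0 - \<phi> z0\<close> with equality
    at \<open>X0\<close>, so both have the same derivative there.\<close>
  have dg: "frechet_derivative g (at X0) v = horo v z0" for v
  proof -
    have d1: "(g has_derivative frechet_derivative g (at X0)) (at X0)" using smooth_on_has_derivative[OF V(3,2)] .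
    have d2: "((\<lambda>Y. horo Y z0 - \<phi> z0) has_derivative (\<lambda>v. horo v z0)) (at X0)"
      unfolding horo_def by (auto intro!: derivative_eq_intros)
    have "(\<lambda>v. frechet_derivative g (at X0) v - horo v z0) = (\<lambda>v. 0)"
    proof (rule differential_zero_maxmin[OF U(2,1) has_derivative_diff[OF d1 d2]], rule disjI2, rule ballI)
      fix Y assume "Y \<in> U"
      from gmax[OF this] have "horo Y z0 - \<phi> z0 \<le> g Y" using z0 by blast
      then show "g X0 - (horo X0 z0 - \<phi> z0) \<le> g Y - (horo Y z0 - \<phi> z0)" using g0 X0(2) by simp
    qed
    then show ?thesis by (metis eq_iff_diff_eq_0)
  qed
  have "horo (horo_normal X0 z0) z0 > 0"
    unfolding horo_normal(3)[OF X0h z0, of "horo_normal X0 z0"] mink_commute[of X0 "horo_normal X0 z0"]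
    using horo_normal(1,2)[OF X0h z0] horo_pos[OF X0h z0] by simp
  then have "mink (horo_normal X0 z0) X0 = 0 \<and> frechet_derivative g (at X0) (horo_normal X0 z0) \<noteq> 0"
    using horo_normal(1)[OF X0h z0] dg by simp
  moreover have "smooth_on U g" by (rule smooth_on_subset[OF V(3)]) (auto simp: U_def)
  ultimately show "\<exists>U f. open U \<and> X0 \<in> U \<and> smooth_on U f \<and>
        horo_hull \<phi> \<inter> U = {Y \<in> hyp_space \<inter> U. f Y \<le> 0} \<and> f X0 = 0 \<and>
        (\<exists>v. mink v X0 = 0 \<and> frechet_derivative f (at X0) v \<noteq> 0)"
    using U OU g0 by blast
qed

lemma smooth_bounded_domain_horo_hull:
  fixes \<phi> :: "real ^ 'm::finite \<Rightarrow> real"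
  assumes \<phi>: "smooth_sphere \<phi>" and c: "supported c \<phi>" "c > 0"
  shows "smooth_bounded_domain (horo_hull \<phi>)"
  unfolding smooth_bounded_domain_def
proof (intro conjI)
  show "horo_hull \<phi> \<subseteq> hyp_space" by (auto simp: horo_hull_def)
  have "compact (\<phi> ` sphere 0 1)" by (intro compact_continuous_image continuous_on_smooth_sphere \<phi>) auto
  then obtain B where B: "\<And>y. y \<in> \<phi> ` sphere 0 1 \<Longrightarrow> norm y \<le> B" using compact_imp_bounded bounded_iff by metis
  have "\<phi> z \<le> B" if "norm z = 1" for z using B[of "\<phi> z"] that by force
  then show "compact (horo_hull \<phi>)" using bounded_horo_hull closed_horo_hull compact_eq_bounded_closed by metis
  show "connected (horo_hull \<phi>)" by (rule connected_horo_hull)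
  show "hyp_interior (horo_hull \<phi>) \<noteq> {}" by (rule supported_interior[OF c])
  show "smooth_boundary (horo_hull \<phi>)" by (rule smooth_boundary_horo_hull[OF assms])
qed

section \<open>Principal curvatures of the horospherical hull\<close>

lemma has_vector_derivative_quotient:
  fixes f :: "real \<Rightarrow> 'a::real_normed_vector"
  assumes "(f has_vector_derivative v) (at 0)"
  shows "((\<lambda>t. (1 / t) *\<^sub>R (f t - f 0)) \<longlongrightarrow> v) (at 0)"
proof -
  have "((\<lambda>t. norm ((f t - f 0) - t *\<^sub>R v) / norm t) \<longlongrightarrow> 0) (at 0)"
    using assms unfolding has_vector_derivative_def has_derivative_iff_norm by simp
  moreover have "\<forall>\<^sub>F t in at 0. norm ((f t - f 0) - t *\<^sub>R v) / norm t = norm ((1 / t) *\<^sub>R (f t - f 0) - v)"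
    unfolding eventually_at_filter
  proof (intro always_eventually allI impI)
    fix t :: real assume t: "t \<noteq> 0"
    then have "(1 / t) *\<^sub>R (f t - f 0) - v = (1 / t) *\<^sub>R ((f t - f 0) - t *\<^sub>R v)"
      by (simp add: scaleR_diff_right[of _ "f t - f 0"] del: scaleR_diff_right)
    then show "norm ((f t - f 0) - t *\<^sub>R v) / norm t = norm ((1 / t) *\<^sub>R (f t - f 0) - v)"
      by (simp only: norm_scaleR) simp
  qed
  ultimately have "((\<lambda>t. norm ((1 / t) *\<^sub>R (f t - f 0) - v)) \<longlongrightarrow> 0) (at 0)" by (rule Lim_transform_eventually)
  then show ?thesis by (rule LIM_zero_cancel[OF tendsto_norm_zero_cancel])
qed

lemma smoothv_on_derivative_bound:
  fixes s :: "'a::euclidean_space \<Rightarrow> 'b::euclidean_space"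
  assumes s: "smoothv_on U s" and S: "compact S" "S \<subseteq> U"
  obtains M where "M > 0" "\<And>x h. x \<in> S \<Longrightarrow> norm (frechet_derivative s (at x) h) \<le> M * norm h"
proof -
  have bound: "\<exists>M. \<forall>x\<in>S. norm (frechet_derivative s (at x) b) \<le> M" for b
  proof -
    have "continuous_on U (\<lambda>x. frechet_derivative s (at x) b)"
    proof (rule continuous_on_componentwise[THEN iffD2], rule ballI)
      fix c :: 'b
      have "continuous_on U (\<lambda>x. frechet_derivative (\<lambda>x. s x \<bullet> c) (at x) b)"
        by (intro smooth_on_imp_continuous_on smooth_on_frechet_derivative smoothv_onD s)
      then show "continuous_on U (\<lambda>x. frechet_derivative s (at x) b \<bullet> c)"
        by (rule continuous_on_cong[THEN iffD1, rotated -1])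
           (use Ckv_on_SucD(2)[OF smoothv_on_imp_Ckv_on[OF s]] in auto)
    qed
    then have "compact ((\<lambda>x. frechet_derivative s (at x) b) ` S)"
      using S continuous_on_subset compact_continuous_image by blast
    then show ?thesis using compact_imp_bounded bounded_iff by (metis (no_types, lifting) imageI)
  qed
  then obtain m where m: "\<And>b x. x \<in> S \<Longrightarrow> norm (frechet_derivative s (at x) b) \<le> m b" by metis
  define M where "M = 1 + (\<Sum>b\<in>Basis. \<bar>m b\<bar>)"
  have "M > 0" unfolding M_def by (intro add_pos_nonneg sum_nonneg) auto
  moreover have "norm (frechet_derivative s (at x) h) \<le> M * norm h" if x: "x \<in> S" for x h
  proof -
    have lin: "linear (frechet_derivative s (at x))"
      using smoothv_on_has_derivative[OF s] x S(2) has_derivative_linear by blast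
    have "frechet_derivative s (at x) h = frechet_derivative s (at x) (\<Sum>b\<in>Basis. (h \<bullet> b) *\<^sub>R b)"
      by (simp only: euclidean_representation)
    also have "\<dots> = (\<Sum>b\<in>Basis. (h \<bullet> b) *\<^sub>R frechet_derivative s (at x) b)"
      by (simp only: linear_sum[OF lin] linear_scale[OF lin])
    also have "norm \<dots> \<le> (\<Sum>b\<in>Basis. norm h * \<bar>m b\<bar>)"
    proof (rule sum_norm_le)
      fix b :: 'a assume b: "b \<in> Basis"
      have "norm (frechet_derivative s (at x) b) \<le> \<bar>m b\<bar>" using m[OF x, of b] by simp
      then show "norm ((h \<bullet> b) *\<^sub>R frechet_derivative s (at x) b) \<le> norm h * \<bar>m b\<bar>"
        unfolding norm_scaleR by (intro mult_mono) (auto simp: Basis_le_norm[OF b])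
    qed
    also have "\<dots> \<le> M * norm h" by (simp add: M_def sum_distrib_left[symmetric] algebra_simps)
    finally show ?thesis .
  qed
  ultimately show ?thesis using that by blast
qed

text \<open>Otherwise \<open>X\<close> could be pushed inside the domain to a point with a larger value of \<open>horo _ z\<close>.\<close>

lemma outward_normal_horo_hull:
  assumes sb: "smooth_boundary (horo_hull \<phi>)" and X: "X \<in> hyp_boundary (horo_hull \<phi>)"
    and z: "norm z = 1" "X \<in> horo_hull \<phi>" "horo X z = \<phi> z"
  shows "outward_normal (horo_hull \<phi>) X = horo_normal X z"
proof -
  obtain U F where chart: "boundary_chart (horo_hull \<phi>) U F" and XU: "X \<in> U"
    by (rule smooth_boundary_chart[OF sb X])
  have "unit_normal F X = horo_normal X z"
  proof (rule ccontr)
    assume "unit_normal F X \<noteq> horo_normal X z"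
    moreover have "horo_hull \<phi> \<subseteq> hyp_space" by (auto simp: horo_hull_def)
    ultimately have "pushable (horo_hull \<phi>) z X"
      using boundary_chart.pushable_boundary[OF chart _ XU X z(1)] by blast
    then obtain Y where "Y \<in> horo_hull \<phi>" "horo X z < horo Y z" using pushable_not_maximal z(2) by blast
    moreover from this have "horo Y z \<le> \<phi> z" using z(1) by (simp add: horo_hull_def)
    ultimately show False using z(3) by simp
  qed
  then show ?thesis using boundary_chart.outward_normal_eq[OF chart XU X] by simp
qed

text \<open>Move along the boundary in a principal direction \<open>v\<close>. The contact direction
  then changes with a speed proportional to \<open>1 - \<kappa>\<close>, while smoothness of
  \<open>contact_point\<close> bounds \<open>v\<close> by \<open>M\<close> times that speed; so
  \<kappa> stays away from 1. Monotonicity of the contact directions excludes values below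
  1.\<close>

lemma principal_curvature_horo_hull:
  fixes \<phi> :: "real ^ 'm::finite \<Rightarrow> real"
  assumes \<phi>: "smooth_sphere \<phi>" and sb: "smooth_boundary (horo_hull \<phi>)" and X: "X \<in> hyp_boundary (horo_hull \<phi>)"
    and pos: "\<And>z. norm z = 1 \<Longrightarrow> \<phi> z > 0" and B: "\<And>z. norm z = 1 \<Longrightarrow> \<phi> z \<le> B"
    and M: "M > 0" "\<And>z h. norm z = 1 \<Longrightarrow> norm (frechet_derivative (contact_point \<phi>) (at z) h) \<le> M * norm h"
    and \<kappa>: "principal_curvature (horo_hull \<phi>) X \<kappa>"
  shows "\<kappa> \<ge> 1 + 1 / (2 * M * B)"
proof -
  let ?O = "horo_hull \<phi>" and ?b = "hyp_boundary (horo_hull \<phi>)"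
  let ?N = "outward_normal ?O"
  obtain A v where A: "(?N has_derivative A) (at X within ?b)"
    and v: "v \<in> tangent_space ?b X" "v \<noteq> 0" "A v = \<kappa> *\<^sub>R v"
    using \<kappa> unfolding principal_curvature_def by blast
  obtain \<gamma> \<epsilon> where \<epsilon>: "\<epsilon> > 0" and \<gamma>: "\<gamma> 0 = X" "\<And>t. \<bar>t\<bar> < \<epsilon> \<Longrightarrow> \<gamma> t \<in> ?b"
    and d\<gamma>: "(\<gamma> has_vector_derivative v) (at 0)"
    using v(1) unfolding tangent_space_def by blast
  note cont = continuous_on_smooth_sphere[OF \<phi>]
  have "\<exists>z. norm z = 1 \<and> Y \<in> ?O \<and> horo Y z = \<phi> z" if "Y \<in> ?b" for Y
    using boundary_contact[OF cont that] by metis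
  then obtain z where z: "\<And>Y. Y \<in> ?b \<Longrightarrow> norm (z Y) = 1 \<and> Y \<in> ?O \<and> horo Y (z Y) = \<phi> (z Y)" by metis
  define I where "I = {-\<epsilon><..<\<epsilon>}"
  have I: "open I" "0 \<in> I" and \<gamma>I: "\<And>t. t \<in> I \<Longrightarrow> \<gamma> t \<in> ?b" using \<epsilon> \<gamma>(2) by (auto simp: I_def)
  have Xh: "X \<in> hyp_space" using X by (simp add: hyp_boundary_iff)
  define z0 where "z0 = z X"
  have z0: "norm z0 = 1" "X \<in> ?O" "horo X z0 = \<phi> z0" using z[OF X] by (auto simp: z0_def)
  define N0 where "N0 = horo_normal X z0"
  have N0: "?N X = N0" unfolding N0_def by (rule outward_normal_horo_hull[OF sb X z0])
  obtain U F where chart: "boundary_chart ?O U F" and XU: "X \<in> U"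
    by (rule smooth_boundary_chart[OF sb X])
  have tan: "mink v X = 0" "frechet_derivative F (at X) v = 0"
    using boundary_chart.boundary_tangent_sub[OF chart XU X v(1)] by auto
  have "mink N0 v = 0"
    using boundary_chart.normal_properties(3)[OF chart XU tan(1)] tan(2)
      boundary_chart.outward_normal_eq[OF chart XU X] N0 by simp
  then have hv: "horo v z0 = 0"
    using horo_normal(3)[OF Xh z0(1), of v] tan(1) by (simp add: N0_def mink_commute)
  \<comment> \<open>Position minus normal is the null vector of the contact direction divided by
    \<phi>. The directions were merely chosen, so their differentiability along the curve is
    obtained from \<open>e\<close>, whose derivative is \<open>1 - \<kappa>\<close> times
    \<open>v\<close>.\<close>
  define e where "e t = \<gamma> t - ?N (\<gamma> t)" for t
  have e: "e t = (1 / \<phi> (z (\<gamma> t))) *\<^sub>R (z (\<gamma> t), 1)" if "t \<in> I" for t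
    using outward_normal_horo_hull[OF sb \<gamma>I[OF that], of "z (\<gamma> t)"] z[OF \<gamma>I[OF that]] by (simp add: e_def horo_normal_def)
  have de: "(e has_vector_derivative (1 - \<kappa>) *\<^sub>R v) (at 0)"
  proof -
    have w: "at 0 within I = at (0 :: real)" using I by (rule at_within_open[rotated])
    have "(?N has_derivative A) (at (\<gamma> 0) within \<gamma> ` I)"
      unfolding \<gamma>(1) by (rule has_derivative_subset[OF A]) (use \<gamma>I in blast)
    moreover have "(\<gamma> has_derivative (\<lambda>t. t *\<^sub>R v)) (at 0 within I)"
      using d\<gamma> unfolding w has_vector_derivative_def .
    ultimately have "((\<lambda>t. ?N (\<gamma> t)) has_derivative (\<lambda>t. A (t *\<^sub>R v))) (at 0)"
      using diff_chain_within[of \<gamma> _ 0 I ?N A] w by (simp add: o_def)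
    moreover have "A (t *\<^sub>R v) = t *\<^sub>R (\<kappa> *\<^sub>R v)" for t
      using linear_scale[OF has_derivative_linear[OF A]] v(3) by simp
    ultimately have "((\<lambda>t. ?N (\<gamma> t)) has_vector_derivative \<kappa> *\<^sub>R v) (at 0)"
      unfolding has_vector_derivative_def by simp
    from has_vector_derivative_diff[OF d\<gamma> this] show ?thesis
      unfolding e_def[abs_def] by (simp add: scaleR_left_diff_distrib)
  qed
  define \<zeta> where "\<zeta> t = (1 / snd (e t)) *\<^sub>R fst (e t)" for t
  have \<zeta>: "\<zeta> t = z (\<gamma> t)" if "t \<in> I" for t
    using pos[of "z (\<gamma> t)"] z[OF \<gamma>I[OF that]] by (simp add: \<zeta>_def e[OF that])
  have e0: "fst (e 0) = (1 / \<phi> z0) *\<^sub>R z0" "snd (e 0) = 1 / \<phi> z0"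
    using e[OF I(2)] by (simp_all add: \<gamma>(1) z0_def)
  have p0: "\<phi> z0 > 0" using pos z0(1) by blast
  \<comment> \<open>The derivative of the quotient of the components of \<open>e\<close>, using that
    \<open>e 0\<close> is \<open>(z0, 1)\<close> divided by \<open>\<phi> z0\<close>.\<close>
  define \<zeta>' where "\<zeta>' = (\<phi> z0 * (1 - \<kappa>)) *\<^sub>R (fst v - snd v *\<^sub>R z0)"
  have d\<zeta>: "(\<zeta> has_vector_derivative \<zeta>') (at 0)"
  proof -
    have dd: "(e has_derivative (\<lambda>t. t *\<^sub>R ((1 - \<kappa>) *\<^sub>R v))) (at 0)" using de unfolding has_vector_derivative_def .
    have s0: "snd (e 0) \<noteq> 0" using e0(2) p0 by simp
    have "((\<lambda>t. inverse (snd (e t)) *\<^sub>R fst (e t)) has_derivative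
        (\<lambda>t. inverse (snd (e 0)) *\<^sub>R fst (t *\<^sub>R ((1 - \<kappa>) *\<^sub>R v)) +
          - (inverse (snd (e 0)) * snd (t *\<^sub>R ((1 - \<kappa>) *\<^sub>R v)) * inverse (snd (e 0))) *\<^sub>R fst (e 0))) (at 0)"
      by (rule has_derivative_scaleR[OF Deriv.has_derivative_inverse[OF s0 has_derivative_snd[OF dd]] has_derivative_fst[OF dd]])
    moreover have "inverse (snd (e 0)) *\<^sub>R fst (t *\<^sub>R ((1 - \<kappa>) *\<^sub>R v)) +
          - (inverse (snd (e 0)) * snd (t *\<^sub>R ((1 - \<kappa>) *\<^sub>R v)) * inverse (snd (e 0))) *\<^sub>R fst (e 0) = t *\<^sub>R \<zeta>'" for t
      using p0 by (simp add: e0 \<zeta>'_def scaleR_diff_right mult_ac)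
    ultimately show ?thesis unfolding has_vector_derivative_def \<zeta>_def[abs_def] inverse_eq_divide by simp
  qed
  have \<zeta>0: "\<zeta> 0 = z0" using \<zeta>[OF I(2)] by (simp add: \<gamma>(1) z0_def)
  have cp: "\<gamma> t = contact_point \<phi> (\<zeta> t)" if "t \<in> I" for t
    using contact_point_eq[OF _ \<phi>] z[OF \<gamma>I[OF that]] \<zeta>[OF that] by simp
  let ?C = "frechet_derivative (contact_point \<phi>) (at z0)"
  have "v = ?C \<zeta>'"
  proof -
    have z0n: "z0 \<in> - {0}" using z0(1) by auto
    have dC: "(contact_point \<phi> has_derivative ?C) (at (\<zeta> 0))"
      unfolding \<zeta>0 using smoothv_on_has_derivative[OF smoothv_on_contact_point[OF \<phi> pos] z0n] .
    have "((\<lambda>t. contact_point \<phi> (\<zeta> t)) has_derivative (\<lambda>t. ?C (t *\<^sub>R \<zeta>'))) (at 0)"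
      using diff_chain_at[OF d\<zeta>[unfolded has_vector_derivative_def] dC] by (simp add: o_def)
    then have "(\<gamma> has_derivative (\<lambda>t. ?C (t *\<^sub>R \<zeta>'))) (at 0)"
      by (rule has_derivative_transform_within_open[OF _ I]) (simp add: cp)
    moreover have "(\<gamma> has_derivative (\<lambda>t. t *\<^sub>R v)) (at 0)" using d\<gamma> unfolding has_vector_derivative_def .
    ultimately have "(\<lambda>t. ?C (t *\<^sub>R \<zeta>')) = (\<lambda>t. t *\<^sub>R v)" by (rule has_derivative_unique)
    then show ?thesis by (metis scaleR_one)
  qed
  then have "norm v \<le> M * norm \<zeta>'" using M(2)[OF z0(1), of \<zeta>'] by simp
  also have "norm \<zeta>' \<le> (B * \<bar>1 - \<kappa>\<bar>) * (2 * norm v)"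
  proof -
    have "norm (fst v - snd v *\<^sub>R z0) \<le> norm (fst v) + norm (snd v)"
      using norm_triangle_ineq4[of "fst v" "snd v *\<^sub>R z0"] z0(1) by simp
    also have "\<dots> \<le> 2 * norm v"
      using norm_fst_le[of "fst v" "snd v"] norm_snd_le[of "snd v" "fst v"] by simp
    finally have "norm (fst v - snd v *\<^sub>R z0) \<le> 2 * norm v" .
    then show ?thesis
      unfolding \<zeta>'_def norm_scaleR real_norm_def abs_mult
      using B[OF z0(1)] p0 by (intro mult_mono) auto
  qed
  finally have "norm v \<le> M * ((B * \<bar>1 - \<kappa>\<bar>) * (2 * norm v))" using M(1) by simp
  then have "norm v * 1 \<le> norm v * (2 * M * B * \<bar>1 - \<kappa>\<bar>)" by (simp add: mult_ac)
  then have big: "1 \<le> 2 * M * B * \<bar>1 - \<kappa>\<bar>" by (rule mult_left_le_imp_le) (use v(2) in simp)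
  have Bp: "B > 0" using B[OF z0(1)] p0 by linarith
  have lim: "((\<lambda>t. fst ((1 / t) *\<^sub>R (\<gamma> t - \<gamma> 0)) \<bullet> ((1 / t) *\<^sub>R (\<zeta> t - \<zeta> 0))) \<longlongrightarrow> fst v \<bullet> \<zeta>') (at 0)"
    by (rule tendsto_inner[OF tendsto_fst[OF has_vector_derivative_quotient[OF d\<gamma>]] has_vector_derivative_quotient[OF d\<zeta>]])
  \<comment> \<open>Adding the two support inequalities of a pair of contact points gives the
    monotonicity \<open>fst (\<gamma> t - \<gamma> 0) \<bullet> (\<zeta> t - \<zeta> 0) \<le>
    0\<close>; this is its infinitesimal form, and it fixes the sign of
    \<open>1 - \<kappa>\<close>.\<close>
  have "fst v \<bullet> \<zeta>' \<le> 0"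
  proof (rule tendsto_upperbound[OF lim])
    have "fst ((1 / t) *\<^sub>R (\<gamma> t - \<gamma> 0)) \<bullet> ((1 / t) *\<^sub>R (\<zeta> t - \<zeta> 0)) \<le> 0" if t: "t \<in> I" for t
    proof -
      have zt: "norm (\<zeta> t) = 1" "\<gamma> t \<in> ?O" "horo (\<gamma> t) (\<zeta> t) = \<phi> (\<zeta> t)" using z[OF \<gamma>I[OF t]] \<zeta>[OF t] by auto
      have "horo (\<gamma> t) z0 \<le> horo X z0" "horo X (\<zeta> t) \<le> horo (\<gamma> t) (\<zeta> t)"
        using zt z0 by (auto simp: horo_hull_def)
      then have "fst (\<gamma> t - \<gamma> 0) \<bullet> (\<zeta> t - \<zeta> 0) \<le> 0"
        unfolding \<gamma>(1) \<zeta>0 by (simp add: horo_def inner_diff_left inner_diff_right)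
      then have "(1 / t)\<^sup>2 * (fst (\<gamma> t - \<gamma> 0) \<bullet> (\<zeta> t - \<zeta> 0)) \<le> 0" by (simp add: mult_nonneg_nonpos)
      then show ?thesis by (simp add: power2_eq_square mult.assoc)
    qed
    then show "\<forall>\<^sub>F t in at 0. fst ((1 / t) *\<^sub>R (\<gamma> t - \<gamma> 0)) \<bullet> ((1 / t) *\<^sub>R (\<zeta> t - \<zeta> 0)) \<le> 0"
      using eventually_at_topological I by blast
  qed simp
  moreover have "fst v \<bullet> \<zeta>' = \<phi> z0 * (1 - \<kappa>) * mink v v"
  proof -
    have "snd v = fst v \<bullet> z0" using hv by (simp add: horo_def)
    then show ?thesis by (simp add: \<zeta>'_def mink_eq inner_diff_right)
  qed
  moreover have "mink v v > 0" by (rule mink_orthogonal_pos[OF Xh tan(1) v(2)])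
  ultimately have "\<kappa> \<ge> 1" using p0 by (simp add: mult_le_0_iff)
  then have "1 \<le> 2 * M * B * (\<kappa> - 1)" using big by simp
  then show ?thesis using M(1) Bp by (simp add: field_simps)
qed

theorem smooth_uniformly_hconvex_horo_hull:
  fixes \<phi> :: "real ^ 'm::finite \<Rightarrow> real"
  assumes \<phi>: "smooth_sphere \<phi>" and c: "supported c \<phi>" "c > 0" and pos: "\<And>z. norm z = 1 \<Longrightarrow> \<phi> z > 0"
  shows "smooth_uniformly_hconvex (horo_hull \<phi>)"
proof -
  note sb = smooth_bounded_domain_horo_hull[OF \<phi> c]
  have "compact (\<phi> ` sphere 0 1)" by (intro compact_continuous_image continuous_on_smooth_sphere \<phi>) auto
  then obtain B where B: "\<And>y. y \<in> \<phi> ` sphere 0 1 \<Longrightarrow> norm y \<le> B" using compact_imp_bounded bounded_iff by metis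
  have B: "\<phi> z \<le> B" if "norm z = 1" for z using B[of "\<phi> z"] that by force
  obtain u :: "real ^ 'm" where u: "norm u = 1" using vector_choose_size[of 1] by auto
  have Bp: "B > 0" using B[OF u] pos[OF u] by linarith
  obtain M where M: "M > 0"
    "\<And>z h. z \<in> sphere 0 1 \<Longrightarrow> norm (frechet_derivative (contact_point \<phi>) (at z) h) \<le> M * norm h"
    by (rule smoothv_on_derivative_bound[OF smoothv_on_contact_point[OF \<phi> pos], of "sphere 0 1"]) auto
  have "\<kappa> \<ge> 1 + 1 / (2 * M * B)"
    if "X \<in> hyp_boundary (horo_hull \<phi>)" "principal_curvature (horo_hull \<phi>) X \<kappa>" for X \<kappa>
    by (rule principal_curvature_horo_hull[OF \<phi> _ that(1) pos B M(1) _ that(2)])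
       (use sb M(2) in \<open>auto simp: smooth_bounded_domain_def\<close>)
  moreover define \<delta> where "\<delta> = 1 / (2 * M * B)"
  have "\<delta> > 0" using M(1) Bp by (simp add: \<delta>_def)
  \<comment> \<open>Halving \<delta> turns the weak bound on \<kappa> into a strict one.\<close>
  ultimately have "\<delta> / 2 > 0 \<and> (\<forall>X\<in>hyp_boundary (horo_hull \<phi>). \<forall>\<kappa>.
      principal_curvature (horo_hull \<phi>) X \<kappa> \<longrightarrow> \<kappa> > 1 + \<delta> / 2)"
    unfolding \<delta>_def[symmetric] by fastforce
  then show ?thesis unfolding smooth_uniformly_hconvex_def using sb by blast
qed

section \<open>The hyperbolic p-sum\<close>

lemma smooth_sphere_cong:
  assumes "smooth_sphere f" "\<And>z. norm z = 1 \<Longrightarrow> f z = g z"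
  shows "smooth_sphere g"
  unfolding smooth_sphere_def
  by (rule smooth_on_cong[OF _ assms(1)[unfolded smooth_sphere_def]]) (use assms(2) in \<open>auto simp: norm_sgn\<close>)

lemma supported_cong:
  assumes "supported c f" "\<And>z. norm z = 1 \<Longrightarrow> f z = g z"
  shows "supported c g"
  using assms unfolding supported_def by metis

lemma horo_hull_cong: "(\<And>z. norm z = 1 \<Longrightarrow> f z = g z) \<Longrightarrow> horo_hull f = horo_hull g"
  by (auto simp: horo_hull_def)

lemma smooth_sphere_bounds:
  fixes \<phi> :: "real ^ 'm::finite \<Rightarrow> real"
  assumes \<phi>: "smooth_sphere \<phi>" and pos: "\<And>z. norm z = 1 \<Longrightarrow> \<phi> z > 0"
  obtains m B where "m > 0" "B > 0" "\<And>z. norm z = 1 \<Longrightarrow> m \<le> \<phi> z" "\<And>z. norm z = 1 \<Longrightarrow> \<phi> z \<le> B"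
proof -
  obtain u :: "real ^ 'm" where u: "norm u = 1" using vector_choose_size[of 1] by auto
  then have ne: "sphere (0 :: real ^ 'm) 1 \<noteq> {}" by auto
  note cont = continuous_on_smooth_sphere[OF \<phi>]
  obtain z1 where "norm z1 = 1" "\<And>z. norm z = 1 \<Longrightarrow> \<phi> z1 \<le> \<phi> z"
    using continuous_attains_inf[OF compact_sphere ne cont] by auto
  moreover obtain z2 where "norm z2 = 1" "\<And>z. norm z = 1 \<Longrightarrow> \<phi> z \<le> \<phi> z2"
    using continuous_attains_sup[OF compact_sphere ne cont] by auto
  ultimately show ?thesis using that[of "\<phi> z1" "\<phi> z2"] pos by blast
qed

lemma smooth_sphere_psum:
  fixes f g :: "real ^ 'm::finite \<Rightarrow> real"
  assumes f: "smooth_sphere f" "\<And>z. f z > 0" and g: "smooth_sphere g" "\<And>z. g z > 0"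
    and ab: "a \<ge> 0" "b \<ge> 0" "a + b > 0"
  shows "smooth_sphere (psum p a b f g)" "psum p a b f g z > 0"
proof -
  have pos: "a * f z powr p + b * g z powr p > 0" for z
  proof (cases "a = 0")
    case False
    then show ?thesis using ab f(2)[of z] by (intro add_pos_nonneg) auto
  qed (use ab g(2)[of z] in auto)
  then show "psum p a b f g z > 0" by (simp add: psum_def less_imp_neq[THEN not_sym])
  show "smooth_sphere (psum p a b f g)"
    using f g pos unfolding smooth_sphere_def psum_def
    by (intro smooth_on_powr smooth_on_add smooth_on_mult smooth_on_const) auto
qed

lemma horo_support_point:
  assumes "X \<in> hyp_space" "norm z = 1"
  shows "exp (horo_support {X} z) = horo X z"
  using horo_support_max[of "{X}" X z] assms by auto

lemma domain_support:
  fixes K :: "'m::finite minkowski set"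
  assumes "smooth_uniformly_hconvex K \<or> is_point K"
  shows "smooth_sphere (\<lambda>z. exp (horo_support K z))"
    and "\<exists>c\<ge>0. supported c (\<lambda>z. exp (horo_support K z)) \<and> (c > 0 \<or> is_point K)"
proof -
  have "smooth_sphere (\<lambda>z. exp (horo_support K z)) \<and>
    (\<exists>c\<ge>0. supported c (\<lambda>z. exp (horo_support K z)) \<and> (c > 0 \<or> is_point K))"
  proof (cases "smooth_uniformly_hconvex K")
    case True
    then show ?thesis using smooth_domain_support less_imp_le by blast
  next
    case False
    then have pt: "is_point K" using assms by blast
    then obtain X where X: "X \<in> hyp_space" "K = {X}" unfolding is_point_def by blast
    have eq: "horo X z = exp (horo_support K z)" if "norm z = 1" for z
      using horo_support_point[OF X(1) that] X(2) by simp
    have "supported 0 (horo X)" unfolding supported_def using X(1) by auto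
    then have "supported 0 (\<lambda>z. exp (horo_support K z))" using eq by (rule supported_cong)
    moreover have "smooth_sphere (\<lambda>z. exp (horo_support K z))" using smooth_sphere_horo eq by (rule smooth_sphere_cong)
    ultimately show ?thesis using pt by (intro conjI exI[of _ 0]) auto
  qed
  then show "smooth_sphere (\<lambda>z. exp (horo_support K z))"
    and "\<exists>c\<ge>0. supported c (\<lambda>z. exp (horo_support K z)) \<and> (c > 0 \<or> is_point K)" by auto
qed

text \<open>The last excluded case is a genuine degeneration: if \<open>K = L\<close> is a point and
  \<open>a + b = 1\<close>, then \<phi> is the horospherical function of that point, so the p-sum is
  the point itself for every \<open>p\<close>.\<close>

theorem theorem4p1:
  fixes n :: nat and p a b :: real and K L :: "'m::finite minkowski set"
  assumes "n \<ge> 1" and "CARD('m) = n + 1"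
    and "1/2 \<le> p" and "p \<le> 2" and "a \<ge> 0" and "b \<ge> 0" and "a + b \<ge> 1"
    and "smooth_uniformly_hconvex K \<or> is_point K"
    and "smooth_uniformly_hconvex L \<or> is_point L"
  shows "(\<exists>!\<Omega>. hconvex_bounded_domain \<Omega> \<and>
            (\<forall>z\<in>sphere 0 1. horo_support \<Omega> z =
               (1 / p) * ln (a * exp (p * horo_support K z) + b * exp (p * horo_support L z))))
    \<and> (let \<Omega> = hyp_psum p a K b L;
           \<phi> = (\<lambda>z. (a * exp (p * horo_support K z) + b * exp (p * horo_support L z)) powr (1 / p))
       in hconvex_bounded_domain \<Omega>
        \<and> (\<forall>z\<in>sphere 0 1. horo_support \<Omega> z = psum_support p a K b L z)
        \<and> (\<forall>z\<in>sphere 0 1. \<phi> z = exp (psum_support p a K b L z))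
        \<and> (\<forall>X\<in>hyp_boundary \<Omega>. \<exists>z\<in>sphere 0 1. \<exists>D\<phi>. has_sphere_gradient \<phi> D\<phi> z \<and>
              X = (\<phi> z / 2) *\<^sub>R (- z, 1)
                  + (((norm D\<phi>)\<^sup>2 / \<phi> z + 1 / \<phi> z) / 2) *\<^sub>R (z, 1)
                  - (D\<phi>, 0))
        \<and> (\<not> (a = 1 \<and> b = 0 \<and> is_point K) \<and>
           \<not> (a = 0 \<and> b = 1 \<and> is_point L) \<and>
           \<not> (p \<in> {1/2, 2} \<and> a > 0 \<and> b > 0 \<and> a + b = 1 \<and> is_point K \<and> is_point L) \<and>
           \<not> (a > 0 \<and> b > 0 \<and> a + b = 1 \<and> is_point K \<and> K = L)
           \<longrightarrow> smooth_uniformly_hconvex \<Omega> \<and> \<not> is_point \<Omega>))"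
proof -
  define f where "f z = exp (horo_support K z)" for z
  define g where "g z = exp (horo_support L z)" for z
  define \<phi> where "\<phi> = psum p a b f g"
  have sf: "smooth_sphere f" and sg: "smooth_sphere g"
    using domain_support(1)[OF assms(8)] domain_support(1)[OF assms(9)] unfolding f_def g_def by auto
  obtain c1 c2 where c: "c1 \<ge> 0" "supported c1 f" "c1 > 0 \<or> is_point K" "c2 \<ge> 0" "supported c2 g" "c2 > 0 \<or> is_point L"
    using domain_support(2)[OF assms(8)] domain_support(2)[OF assms(9)] unfolding f_def g_def by blast
  have fg: "f z > 0" "g z > 0" for z by (simp_all add: f_def g_def)
  have ab: "a + b > 0" using assms(7) by simp
  have s\<phi>: "smooth_sphere \<phi>" and pos: "\<phi> z > 0" for z
    using smooth_sphere_psum[OF sf fg(1) sg fg(2) assms(5,6) ab] unfolding \<phi>_def by auto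
  have \<phi>: "\<phi> = (\<lambda>z. (a * exp (p * horo_support K z) + b * exp (p * horo_support L z)) powr (1 / p))"
    by (simp add: \<phi>_def psum_def f_def g_def exp_powr_real mult.commute fun_eq_iff)
  have \<phi>_exp: "\<phi> z = exp (psum_support p a K b L z)" for z
  proof -
    have "a * exp (p * horo_support K z) + b * exp (p * horo_support L z) \<noteq> 0"
    proof
      assume "a * exp (p * horo_support K z) + b * exp (p * horo_support L z) = 0"
      then have "\<phi> z = 0" unfolding \<phi> by simp
      then show False using pos[of z] by simp
    qed
    then show ?thesis unfolding \<phi> psum_support_def powr_def by simp
  qed
  obtain m1 B1 where m1: "m1 > 0" "\<And>z. norm z = 1 \<Longrightarrow> m1 \<le> f z" using smooth_sphere_bounds[OF sf fg(1)] by metis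
  obtain m2 B2 where m2: "m2 > 0" "\<And>z. norm z = 1 \<Longrightarrow> m2 \<le> g z" using smooth_sphere_bounds[OF sg fg(2)] by metis
  obtain m B where B: "B > 0" "\<And>z. norm z = 1 \<Longrightarrow> \<phi> z \<le> B" using smooth_sphere_bounds[OF s\<phi> pos] by metis
  have m: "min m1 m2 > 0" using m1 m2 by simp
  have fm: "f z \<ge> min m1 m2" and gm: "g z \<ge> min m1 m2" if "norm z = 1" for z
    using m1(2)[OF that] m2(2)[OF that] by auto
  obtain c0 where c0: "c0 \<ge> 0" "supported c0 \<phi>" "a + b > 1 \<or> (a > 0 \<and> c1 > 0) \<or> (b > 0 \<and> c2 > 0) \<Longrightarrow> c0 > 0"
    by (rule supported_psum[OF assms(3-7) c(2,1,5,4) m fm gm, folded \<phi>_def, OF _ _ B]) (assumption | rule that)+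
  let ?O = "horo_hull \<phi>"
  let ?P = "\<lambda>\<Omega>. hconvex_bounded_domain \<Omega> \<and> (\<forall>z\<in>sphere 0 1. horo_support \<Omega> z = psum_support p a K b L z)"
  have PO: "?P ?O"
  proof (intro conjI ballI)
    show "hconvex_bounded_domain ?O" by (rule horo_hull_supported(1)[OF c0(2,1) B(2)])
    fix z :: "real ^ 'm" assume "z \<in> sphere 0 1"
    then have "norm z = 1" by simp
    with c0(2,1) B(2) have "exp (horo_support ?O z) = \<phi> z" by (rule horo_hull_supported(2))
    then show "horo_support ?O z = psum_support p a K b L z" unfolding \<phi>_exp by simp
  qed
  have uniq: "\<Omega> = ?O" if "?P \<Omega>" for \<Omega>
  proof -
    have "\<Omega> = horo_hull (\<lambda>z. exp (horo_support \<Omega> z))" using that by (intro hconvex_eq_horo_hull) auto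
    also have "\<dots> = ?O" by (rule horo_hull_cong) (use that \<phi>_exp in auto)
    finally show ?thesis .
  qed
  have O: "hyp_psum p a K b L = ?O" unfolding hyp_psum_def using PO uniq by (rule the_equality)
  have bdry: "\<exists>z\<in>sphere 0 1. \<exists>D\<phi>. has_sphere_gradient \<phi> D\<phi> z \<and>
      X = (\<phi> z / 2) *\<^sub>R (- z, 1) + (((norm D\<phi>)\<^sup>2 / \<phi> z + 1 / \<phi> z) / 2) *\<^sub>R (z, 1) - (D\<phi>, 0)"
    if X: "X \<in> hyp_boundary ?O" for X
  proof -
    obtain z where z: "norm z = 1" "X \<in> ?O" "horo X z = \<phi> z"
      by (rule boundary_contact[OF continuous_on_smooth_sphere[OF s\<phi>] X])
    have "X = contact_point \<phi> z" by (rule contact_point_eq[OF z(1) s\<phi> z(2,3)])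
    then show ?thesis
      using z(1) sphere_gradient[OF s\<phi> z(1)] unfolding contact_point_def sgn_unit[OF z(1)]
      by (intro bexI[of _ z] exI[of _ "sgrad \<phi> z"] conjI) auto
  qed
  have smooth: "smooth_uniformly_hconvex ?O \<and> \<not> is_point ?O"
    if ex: "\<not> (a = 1 \<and> b = 0 \<and> is_point K)" "\<not> (a = 0 \<and> b = 1 \<and> is_point L)"
      "\<not> (p \<in> {1/2, 2} \<and> a > 0 \<and> b > 0 \<and> a + b = 1 \<and> is_point K \<and> is_point L)"
      "\<not> (a > 0 \<and> b > 0 \<and> a + b = 1 \<and> is_point K \<and> K = L)"
  proof -
    \<comment> \<open>A gap is inherited if the weights exceed 1 in total or a domain of positive
      weight has one. Otherwise the exclusions leave two distinct points with positive weights and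
      \<open>p\<close> strictly between 1/2 and 2, where the strict power mean inequalities
      apply.\<close>
    have "\<exists>c>0. supported c \<phi>"
    proof (cases "a + b > 1 \<or> (a > 0 \<and> c1 > 0) \<or> (b > 0 \<and> c2 > 0)")
      case True
      then show ?thesis using c0 by blast
    next
      case False
      then have ab1: "a + b = 1" and pts: "a > 0 \<Longrightarrow> is_point K" "b > 0 \<Longrightarrow> is_point L"
        using assms(7) c(3,6) by auto
      have a: "a > 0" using ex(2) pts(2) ab1 assms(5,6) by (cases "a = 0") auto
      have b: "b > 0" using ex(1) pts(1) ab1 assms(5,6) by (cases "b = 0") auto
      obtain X1 X2 where X: "X1 \<in> hyp_space" "X2 \<in> hyp_space" "K = {X1}" "L = {X2}"
        using pts a b unfolding is_point_def by blast
      have ne: "X1 \<noteq> X2" using ex(4) a b ab1 pts(1) X by auto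
      have p: "1 / 2 < p" "p < 2" using ex(3) a b ab1 pts assms(3,4) by auto
      obtain c where "c > 0" "supported c (psum p a b (horo X1) (horo X2))"
        by (rule supported_psum_points[OF X(1,2) ne p a b assms(7)])
      moreover have "psum p a b (horo X1) (horo X2) z = \<phi> z" if "norm z = 1" for z
        using horo_support_point[OF X(1) that] horo_support_point[OF X(2) that]
        by (simp add: \<phi>_def psum_def f_def g_def X(3,4))
      ultimately show ?thesis using supported_cong by blast
    qed
    then obtain c where c: "supported c \<phi>" "c > 0" by blast
    show ?thesis using smooth_uniformly_hconvex_horo_hull[OF s\<phi> c pos] supported_interior(2)[OF c] by blast
  qed
  have ex1: "\<exists>!\<Omega>. ?P \<Omega>" using PO uniq by (rule ex1I)
  show ?thesis
    unfolding Let_def O \<phi>[symmetric]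
  proof (intro conjI)
    show "\<exists>!\<Omega>. hconvex_bounded_domain \<Omega> \<and> (\<forall>z\<in>sphere 0 1. horo_support \<Omega> z =
        1 / p * ln (a * exp (p * horo_support K z) + b * exp (p * horo_support L z)))"
      using ex1 unfolding psum_support_def .
    show "hconvex_bounded_domain ?O" "\<forall>z\<in>sphere 0 1. horo_support ?O z = psum_support p a K b L z"
      using PO by auto
    show "\<forall>z\<in>sphere 0 1. \<phi> z = exp (psum_support p a K b L z)" using \<phi>_exp by blast
  qed (use bdry smooth in blast)+
qed

end
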